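(* Let $M$ be a compact Riemannian manifold (not necessarily orientable), let $\mathcal{Q}$ be a compact quantum group, and let $\alpha$ be a smooth action of $\mathcal{Q}$ on $M$. Assume: (I) There is a Fréchet-dense unital $*$-subalgebra $\mathcal{A}\subset C^\infty(M)$ on which the action is algebraic, i.e. $\alpha(\mathcal{A})\subset\mathcal{A}\otimes\mathcal{Q}_0$, and such that $\langle\langle d\alpha(df),d\alpha(dg)\rangle\rangle\in\mathcal{A}\otimes\mathcal{Q}_0$ for all $f,g\in\mathcal{A}$, where $\langle\langle\cdot,\cdot\rangle\rangle$ is the inner product coming from the given Riemannian structure. (II) There is a well-defined representation $\Gamma$ on $\Omega^1(M)$ (with respect to $\alpha$) such that $\Gamma(df)=(d\otimes\mathrm{id})(\alpha(f))$ for all $f\in C^\infty(M)$; this $\Gamma$ is denoted $d\alpha$. Then $M$ has a Riemannian structure with respect to which $\alpha$ is inner product preserving; that is, if $\langle\langle\cdot,\cdot\rangle\rangle^{\mathrm{new}}$ denotes the inner product on one-forms coming from this Riemannian structure, then $$\langle\langle d\alpha(df),d\alpha(dg)\rangle\rangle^{\mathrm{new}}=\alpha\big(\langle\langle df,dg\rangle\rangle^{\mathrm{new}}\big)\qquad\text{for all } f,g\in C^\infty(M).$$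
   Context: $\hat\otimes$ is the minimal $C^*$-tensor product and $\otimes$ the algebraic tensor product. A compact quantum group (CQG) is a unital $C^*$-algebra $\mathcal{Q}$ with a coassociative coproduct $\Delta:\mathcal{Q}\to\mathcal{Q}\hat\otimes\mathcal{Q}$ (a unital $*$-homomorphism) such that the linear spans of $\Delta(\mathcal{Q})(\mathcal{Q}\otimes 1)$ and $\Delta(\mathcal{Q})(1\otimes\mathcal{Q})$ are norm-dense in $\mathcal{Q}\hat\otimes\mathcal{Q}$. $\mathcal{Q}_0\subset\mathcal{Q}$ is the dense unital Hopf $*$-algebra spanned by matrix coefficients of irreducible unitary representations of $\mathcal{Q}$. An action of $\mathcal{Q}$ on a unital $C^*$-algebra $\mathcal{C}$ is a unital $*$-homomorphism $\alpha:\mathcal{C}\to\mathcal{C}\hat\otimes\mathcal{Q}$ with $(\alpha\otimes\mathrm{id})\alpha=(\mathrm{id}\otimes\Delta)\alpha$ and such that the span of $\alpha(\mathcal{C})(1\otimes\mathcal{Q})$ is dense in $\mathcal{C}\hat\otimes\mathcal{Q}$. A smooth action of $\mathcal{Q}$ on a compact smooth manifold $M$ is an action $\alpha$ of $\mathcal{Q}$ on $C(M)$ that maps $C^\infty(M)$ into $C^\infty(M,\mathcal{Q})$ (smooth $\mathcal{Q}$-valued functions, inside $C(M,\mathcal{Q})=C(M)\hat\otimes\mathcal{Q}$) and such that the span of $\alpha(C^\infty(M))(1\otimes\mathcal{Q})$ is dense in $C^\infty(M,\mathcal{Q})$ in the natural Fréchet topology. For a $C^*$-algebra $\mathcal{C}$,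 $\Omega^1(M,\mathcal{C})$ is the space of smooth $\mathcal{C}$-valued one-forms with its natural Fréchet topology and $C^\infty(M,\mathcal{C})$-bimodule structure; $\Omega^1(M)=\Omega^1(M,\mathbb{C})$. $d\otimes\mathrm{id}:C^\infty(M,\mathcal{Q})\to\Omega^1(M,\mathcal{Q})$ is the de Rham differential acting on $\mathcal{Q}$-valued functions. Given a smooth action $\alpha$, a representation on $\Omega^1(M)$ is a continuous $\mathbb{C}$-linear map $\Gamma:\Omega^1(M)\to\Omega^1(M,\mathcal{Q})$ that is coassociative, i.e. $(\Gamma\otimes\mathrm{id})\Gamma=(\mathrm{id}\otimes\Delta)\Gamma$, and satisfies $\Gamma(\xi f)=\Gamma(\xi)\alpha(f)=\alpha(f)\Gamma(\xi)$ for $\xi\in\Omega^1(M)$, $f\in C^\infty(M)$. A Riemannian structure on $M$ gives a $C^\infty(M)$-valued inner product $\langle\langle\cdot,\cdot\rangle\rangle$ on $\Omega^1(M)$ (conjugate-linear in the first variable), which extends to a $C^\infty(M,\mathcal{Q})$-valued inner product on $\Omega^1(M,\mathcal{Q})$ determined by $\langle\langle\omega\otimes q,\eta\otimes q'\rangle\rangle=\langle\langle\omega,\eta\rangle\rangle\otimes q^*q'$. *)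

theory Defs
  imports "HOL-Analysis.Analysis" "HOL-Library.Function_Algebras"
begin

section \<open>Unital \<open>C\<^sup>*\<close>-algebras\<close>

class scaleC =
  fixes scaleC :: "complex \<Rightarrow> 'a \<Rightarrow> 'a" (infixr "*\<^sub>C" 75)

class star =
  fixes star :: "'a \<Rightarrow> 'a"

text \<open>The class \<^class>\<open>real_normed_algebra_1\<close> includes \<open>1 \<noteq> 0\<close>, so the zero algebra is excluded.\<close>

class cstar_algebra = real_normed_algebra_1 + banach + scaleC + star +
  assumes scaleC_add_right: "c *\<^sub>C (x + y) = c *\<^sub>C x + c *\<^sub>C y"
    and scaleC_add_left: "(c + d) *\<^sub>C x = c *\<^sub>C x + d *\<^sub>C x"
    and scaleC_scaleC: "c *\<^sub>C d *\<^sub>C x = (c * d) *\<^sub>C x"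
    and scaleC_of_real: "complex_of_real r *\<^sub>C x = r *\<^sub>R x"
    and mult_scaleC_left: "(c *\<^sub>C x) * y = c *\<^sub>C (x * y)"
    and mult_scaleC_right: "x * (c *\<^sub>C y) = c *\<^sub>C (x * y)"
    and norm_scaleC: "norm (c *\<^sub>C x) = cmod c * norm x"
    and star_add: "star (x + y) = star x + star y"
    and star_scaleC: "star (c *\<^sub>C x) = cnj c *\<^sub>C star x"
    and star_mult: "star (x * y) = star y * star x"
    and star_star: "star (star x) = x"
    and norm_star_mult: "norm (star x * x) = (norm x)\<^sup>2"

instantiation complex :: cstar_algebra
begin
definition scaleC_complex :: "complex \<Rightarrow> complex \<Rightarrow> complex" where
  "scaleC_complex c z = c * z"
definition star_complex :: "complex \<Rightarrow> complex" where
  "star_complex = cnj"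
instance
  by standard
    (simp_all add: scaleC_complex_def star_complex_def algebra_simps norm_mult power2_eq_square
      scaleR_conv_of_real)
end

text \<open>Function spaces carry the pointwise operations; together with the theory
  \<open>Function_Algebras\<close> this covers \<open>C(M,\<C>)\<close> and, by iteration, spaces of forms.\<close>

instantiation "fun" :: (type, scaleC) scaleC
begin
definition scaleC_fun :: "complex \<Rightarrow> ('a \<Rightarrow> 'b) \<Rightarrow> 'a \<Rightarrow> 'b" where
  "scaleC_fun c F = (\<lambda>x. c *\<^sub>C F x)"
instance ..
end

instantiation "fun" :: (type, star) star
begin
definition star_fun :: "('a \<Rightarrow> 'b) \<Rightarrow> 'a \<Rightarrow> 'b" where
  "star_fun F = (\<lambda>x. star (F x))"
instance ..
end

abbreviation cspan :: "'a::{ab_group_add,scaleC} set \<Rightarrow> 'a set" where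
  "cspan \<equiv> module.span scaleC"

definition clinear_on :: "'a::{plus,scaleC} set \<Rightarrow> ('a \<Rightarrow> 'b::{plus,scaleC}) \<Rightarrow> bool" where
  "clinear_on V T \<longleftrightarrow> (\<forall>x\<in>V. \<forall>y\<in>V. T (x + y) = T x + T y) \<and> (\<forall>c. \<forall>x\<in>V. T (c *\<^sub>C x) = c *\<^sub>C T x)"

definition unital_star_hom_on ::
  "'a::{plus,times,one,scaleC,star} set \<Rightarrow> 'b::{plus,times,one,scaleC,star} set \<Rightarrow> ('a \<Rightarrow> 'b) \<Rightarrow> bool"
  where
  "unital_star_hom_on V W T \<longleftrightarrow>
     T \<in> V \<rightarrow> W \<and> clinear_on V T \<and> T 1 = 1 \<and>
     (\<forall>x\<in>V. \<forall>y\<in>V. T (x * y) = T x * T y) \<and> (\<forall>x\<in>V. T (star x) = star (T x))"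

definition unital_star_subalgebra :: "'a::{plus,times,one,scaleC,star} set \<Rightarrow> bool" where
  "unital_star_subalgebra A \<longleftrightarrow>
     1 \<in> A \<and> (\<forall>x\<in>A. \<forall>y\<in>A. x + y \<in> A \<and> x * y \<in> A) \<and> (\<forall>x\<in>A. star x \<in> A \<and> (\<forall>c. c *\<^sub>C x \<in> A))"


section \<open>The minimal tensor product\<close>

definition cstar_state :: "('a::cstar_algebra \<Rightarrow> complex) \<Rightarrow> bool" where
  "cstar_state \<phi> \<longleftrightarrow> clinear_on UNIV \<phi> \<and> \<phi> 1 = 1 \<and>
     (\<forall>a. Im (\<phi> (star a * a)) = 0 \<and> Re (\<phi> (star a * a)) \<ge> 0)"

text \<open>A list \<open>[(a\<^sub>1,b\<^sub>1),\<dots>,(a\<^sub>n,b\<^sub>n)]\<close> represents the element \<open>\<Sum>\<^sub>i a\<^sub>i \<otimes> b\<^sub>i\<close> of the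
  algebraic tensor product.\<close>

definition tensor_eval :: "('a \<Rightarrow> 'b \<Rightarrow> 'c::monoid_add) \<Rightarrow> ('a \<times> 'b) list \<Rightarrow> 'c" where
  "tensor_eval t xs = (\<Sum>(a, b)\<leftarrow>xs. t a b)"

definition tensor_mult :: "('a::times \<times> 'b::times) list \<Rightarrow> ('a \<times> 'b) list \<Rightarrow> ('a \<times> 'b) list" where
  "tensor_mult xs ys = [(a * c, b * d). (a, b) \<leftarrow> xs, (c, d) \<leftarrow> ys]"

definition tensor_star :: "('a::star \<times> 'b::star) list \<Rightarrow> ('a \<times> 'b) list" where
  "tensor_star xs = [(star a, star b). (a, b) \<leftarrow> xs]"

definition product_functional ::
  "('a \<Rightarrow> complex) \<Rightarrow> ('b \<Rightarrow> complex) \<Rightarrow> ('a \<times> 'b) list \<Rightarrow> complex" where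
  "product_functional \<phi> \<psi> = tensor_eval (\<lambda>a b. \<phi> a * \<psi> b)"

text \<open>The spatial norm of \<open>x\<close>, computed in the tensor product of the universal (hence faithful)
  representations of the two factors, is the supremum of \<open>\<parallel>(\<pi>\<^sub>\<phi> \<otimes> \<pi>\<^sub>\<psi>)(x)\<parallel>\<close> over all pairs of
  states, \<open>\<pi>\<^sub>\<phi>\<close> being the GNS representation. The vectors \<open>(\<pi>\<^sub>\<phi> \<otimes> \<pi>\<^sub>\<psi>)(y)(\<xi>\<^sub>\<phi> \<otimes> \<xi>\<^sub>\<psi>)\<close> with
  \<open>y\<close> in the algebraic tensor product are dense in the Hilbert space, and the squared norm of
  such a vector is \<open>(\<phi> \<otimes> \<psi>)(y\<^sup>* y)\<close>.\<close>

definition spatial_norm :: "('a::cstar_algebra \<times> 'b::cstar_algebra) list \<Rightarrow> real" where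
  "spatial_norm x = Sup {sqrt (Re (product_functional \<phi> \<psi>
        (tensor_mult (tensor_star (tensor_mult x y)) (tensor_mult x y)))) | \<phi> \<psi> y.
      cstar_state \<phi> \<and> cstar_state \<psi> \<and>
      product_functional \<phi> \<psi> (tensor_mult (tensor_star y) y) = 1}"

text \<open>\<open>minimal_tensor t\<close>: the \<open>C\<^sup>*\<close>-algebra \<open>'c\<close> is the minimal tensor product of \<open>'a\<close> and \<open>'b\<close>,
  with \<open>t a b\<close> in the role of \<open>a \<otimes> b\<close>; that is, \<open>'c\<close> is the completion of the algebraic tensor
  product in the spatial norm. This determines \<open>('c, t)\<close> up to a unique isomorphism.\<close>

definition minimal_tensor ::
  "('a::cstar_algebra \<Rightarrow> 'b::cstar_algebra \<Rightarrow> 'c::cstar_algebra) \<Rightarrow> bool" where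
  "minimal_tensor t \<longleftrightarrow>
     (\<forall>a. clinear_on UNIV (t a)) \<and> (\<forall>b. clinear_on UNIV (\<lambda>a. t a b)) \<and>
     (\<forall>a b c d. t a b * t c d = t (a * c) (b * d)) \<and>
     (\<forall>a b. star (t a b) = t (star a) (star b)) \<and> t 1 1 = 1 \<and>
     (\<forall>x. norm (tensor_eval t x) = spatial_norm x) \<and>
     closure (range (tensor_eval t)) = UNIV"


section \<open>Compact quantum groups\<close>

text \<open>Here \<open>t\<close> presents \<open>'qq\<close> as \<open>\<Q> \<otimes> \<Q>\<close>, and \<open>tL\<close>, \<open>tR\<close> present \<open>'qqq\<close> as
  \<open>(\<Q> \<otimes> \<Q>) \<otimes> \<Q>\<close> and as \<open>\<Q> \<otimes> (\<Q> \<otimes> \<Q>)\<close>, identified in the usual way. The homomorphisms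
  \<open>L\<close> and \<open>R\<close> are \<open>\<Delta> \<otimes> id\<close> and \<open>id \<otimes> \<Delta>\<close>; they exist and are determined by their values on
  elementary tensors.\<close>

definition compact_quantum_group ::
  "('q::cstar_algebra \<Rightarrow> 'q \<Rightarrow> 'qq::cstar_algebra) \<Rightarrow> ('qq \<Rightarrow> 'q \<Rightarrow> 'qqq::cstar_algebra) \<Rightarrow>
   ('q \<Rightarrow> 'qq \<Rightarrow> 'qqq) \<Rightarrow> ('q \<Rightarrow> 'qq) \<Rightarrow> bool" where
  "compact_quantum_group t tL tR \<Delta> \<longleftrightarrow>
     minimal_tensor t \<and> minimal_tensor tL \<and> minimal_tensor tR \<and>
     (\<forall>a b c. tL (t a b) c = tR a (t b c)) \<and>
     unital_star_hom_on UNIV UNIV \<Delta> \<and>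
     (\<exists>L R. unital_star_hom_on UNIV UNIV L \<and> (\<forall>a b. L (t a b) = tL (\<Delta> a) b) \<and>
            unital_star_hom_on UNIV UNIV R \<and> (\<forall>a b. R (t a b) = tR a (\<Delta> b)) \<and>
            (\<forall>a. L (\<Delta> a) = R (\<Delta> a))) \<and>
     closure (cspan {\<Delta> a * t b 1 | a b. True}) = UNIV \<and>
     closure (cspan {\<Delta> a * t 1 b | a b. True}) = UNIV"

text \<open>Finite-dimensional representations are matrices \<open>u\<close> with indices below \<open>n\<close>. (Irreducible
  unitary representations of a compact quantum group are finite-dimensional.) A projection \<open>p\<close>
  has invariant range if \<open>u (p \<otimes> 1) = (p \<otimes> 1) u (p \<otimes> 1)\<close>.\<close>

definition unitary_rep ::
  "('q::cstar_algebra \<Rightarrow> 'q \<Rightarrow> 'qq::cstar_algebra) \<Rightarrow> ('q \<Rightarrow> 'qq) \<Rightarrow> nat \<Rightarrow> (nat \<Rightarrow> nat \<Rightarrow> 'q) \<Rightarrow> bool"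
  where
  "unitary_rep t \<Delta> n u \<longleftrightarrow>
     (\<forall>i<n. \<forall>j<n. (\<Sum>k<n. star (u k i) * u k j) = (if i = j then 1 else 0)) \<and>
     (\<forall>i<n. \<forall>j<n. (\<Sum>k<n. u i k * star (u j k)) = (if i = j then 1 else 0)) \<and>
     (\<forall>i<n. \<forall>j<n. \<Delta> (u i j) = (\<Sum>k<n. t (u i k) (u k j)))"

definition projection_matrix :: "nat \<Rightarrow> (nat \<Rightarrow> nat \<Rightarrow> complex) \<Rightarrow> bool" where
  "projection_matrix n p \<longleftrightarrow>
     (\<forall>i<n. \<forall>j<n. (\<Sum>k<n. p i k * p k j) = p i j \<and> cnj (p j i) = p i j)"

definition irreducible_unitary_rep ::
  "('q::cstar_algebra \<Rightarrow> 'q \<Rightarrow> 'qq::cstar_algebra) \<Rightarrow> ('q \<Rightarrow> 'qq) \<Rightarrow> nat \<Rightarrow> (nat \<Rightarrow> nat \<Rightarrow> 'q) \<Rightarrow> bool"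
  where
  "irreducible_unitary_rep t \<Delta> n u \<longleftrightarrow>
     n \<ge> 1 \<and> unitary_rep t \<Delta> n u \<and>
     (\<forall>p. projection_matrix n p \<and>
          (\<forall>i<n. \<forall>j<n. (\<Sum>k<n. p k j *\<^sub>C u i k) = (\<Sum>k<n. \<Sum>l<n. (p i k * p l j) *\<^sub>C u k l)) \<longrightarrow>
          (\<forall>i<n. \<forall>j<n. p i j = 0) \<or> (\<forall>i<n. \<forall>j<n. p i j = (if i = j then 1 else 0)))"

definition hopf_core ::
  "('q::cstar_algebra \<Rightarrow> 'q \<Rightarrow> 'qq::cstar_algebra) \<Rightarrow> ('q \<Rightarrow> 'qq) \<Rightarrow> 'q set" where
  "hopf_core t \<Delta> = cspan {u i j | n u i j. irreducible_unitary_rep t \<Delta> n u \<and> i < n \<and> j < n}"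


section \<open>Smooth manifolds, functions and one-forms\<close>

primrec dir_deriv ::
  "'e::real_normed_vector list \<Rightarrow> ('e \<Rightarrow> 'b::real_normed_vector) \<Rightarrow> 'e \<Rightarrow> 'b" where
  "dir_deriv [] f = f"
| "dir_deriv (v # vs) f = (\<lambda>y. frechet_derivative (dir_deriv vs f) (at y) v)"

text \<open>Intended for open \<open>S\<close>.\<close>

definition smooth_on :: "'e::real_normed_vector set \<Rightarrow> ('e \<Rightarrow> 'b::real_normed_vector) \<Rightarrow> bool" where
  "smooth_on S f \<longleftrightarrow> (\<forall>vs. \<forall>y\<in>S. dir_deriv vs f differentiable (at y))"

text \<open>A chart consists of its domain and the coordinate map, whose values outside the domain are
  irrelevant.\<close>

type_synonym ('m, 'e) chart = "'m set \<times> ('m \<Rightarrow> 'e)"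

definition chart_inv :: "('m, 'e) chart \<Rightarrow> 'e \<Rightarrow> 'm" where
  "chart_inv c = inv_into (fst c) (snd c)"

definition chart_image :: "('m, 'e) chart \<Rightarrow> 'e set" where
  "chart_image c = snd c ` fst c"

definition smooth_atlas :: "('m::t2_space, 'e::euclidean_space) chart set \<Rightarrow> bool" where
  "smooth_atlas A \<longleftrightarrow>
     (\<forall>c\<in>A. open (fst c) \<and> open (chart_image c) \<and>
        homeomorphism (fst c) (chart_image c) (snd c) (chart_inv c)) \<and>
     (\<Union>c\<in>A. fst c) = UNIV \<and>
     (\<forall>c\<in>A. \<forall>c'\<in>A. smooth_on (snd c ` (fst c \<inter> fst c')) (snd c' \<circ> chart_inv c))"

text \<open>The compact manifold is the whole type \<open>'m\<close>, without boundary; second countability follows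
  from compactness.\<close>

definition compact_manifold :: "('m::t2_space, 'e::euclidean_space) chart set \<Rightarrow> bool" where
  "compact_manifold A \<longleftrightarrow> smooth_atlas A \<and> compact (UNIV :: 'm set)"

definition transition_deriv ::
  "('m, 'e::euclidean_space) chart \<Rightarrow> ('m, 'e) chart \<Rightarrow> 'm \<Rightarrow> 'e \<Rightarrow> 'e" where
  "transition_deriv c c' x = frechet_derivative (snd c' \<circ> chart_inv c) (at (snd c x))"

definition cts :: "('m::topological_space \<Rightarrow> 'q::topological_space) set" where
  "cts = {F. continuous_on UNIV F}"

definition smooth_functions ::
  "('m, 'e::euclidean_space) chart set \<Rightarrow> ('m \<Rightarrow> 'q::real_normed_vector) set" where
  "smooth_functions A = {F. \<forall>c\<in>A. smooth_on (chart_image c) (F \<circ> chart_inv c)}"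

text \<open>A one-form is the family of its coordinate expressions: \<open>\<omega> c x v\<close> is the value of \<open>\<omega>\<close> at the
  tangent vector at \<open>x\<close> whose coordinates in the chart \<open>c\<close> are \<open>v\<close>. By convention \<open>\<omega> c x = 0\<close> unless
  \<open>c\<close> is a chart of the atlas around \<open>x\<close>.\<close>

type_synonym ('m, 'e, 'q) form = "('m, 'e) chart \<Rightarrow> 'm \<Rightarrow> 'e \<Rightarrow> 'q"

definition one_forms ::
  "('m, 'e::euclidean_space) chart set \<Rightarrow> ('m, 'e, 'q::real_normed_vector) form set" where
  "one_forms A = {\<omega>.
     (\<forall>c x. c \<notin> A \<or> x \<notin> fst c \<longrightarrow> \<omega> c x = (\<lambda>v. 0)) \<and>
     (\<forall>c\<in>A. \<forall>x\<in>fst c. linear (\<omega> c x)) \<and>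
     (\<forall>c\<in>A. \<forall>v. smooth_on (chart_image c) (\<lambda>y. \<omega> c (chart_inv c y) v)) \<and>
     (\<forall>c\<in>A. \<forall>c'\<in>A. \<forall>x\<in>fst c \<inter> fst c'. \<forall>v. \<omega> c x v = \<omega> c' x (transition_deriv c c' x v))}"

text \<open>The de Rham differential of vector-valued functions, \<open>d \<otimes> id\<close>.\<close>

definition de_rham ::
  "('m, 'e::euclidean_space) chart set \<Rightarrow> ('m \<Rightarrow> 'q::real_normed_vector) \<Rightarrow> ('m, 'e, 'q) form" where
  "de_rham A F = (\<lambda>c x v. if c \<in> A \<and> x \<in> fst c
     then frechet_derivative (F \<circ> chart_inv c) (at (snd c x)) v else 0)"

definition form_times :: "('m, 'e, 'q::times) form \<Rightarrow> ('m \<Rightarrow> 'q) \<Rightarrow> ('m, 'e, 'q) form" where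
  "form_times \<omega> F = (\<lambda>c x v. \<omega> c x v * F x)"

definition times_form :: "('m \<Rightarrow> 'q::times) \<Rightarrow> ('m, 'e, 'q) form \<Rightarrow> ('m, 'e, 'q) form" where
  "times_form F \<omega> = (\<lambda>c x v. F x * \<omega> c x v)"

text \<open>Elementary tensors \<open>f \<otimes> q\<close> and \<open>\<omega> \<otimes> q\<close> for complex-valued \<open>f\<close> and \<open>\<omega>\<close>.\<close>

definition fun_tensor :: "('m \<Rightarrow> complex) \<Rightarrow> 'q::scaleC \<Rightarrow> 'm \<Rightarrow> 'q" where
  "fun_tensor f q = (\<lambda>x. f x *\<^sub>C q)"

definition form_tensor :: "('m, 'e, complex) form \<Rightarrow> 'q::scaleC \<Rightarrow> ('m, 'e, 'q) form" where
  "form_tensor \<omega> q = (\<lambda>c x v. \<omega> c x v *\<^sub>C q)"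


section \<open>Natural topologies\<close>

definition seminorm_topology :: "'v::minus set \<Rightarrow> ('v \<Rightarrow> real) set \<Rightarrow> 'v topology" where
  "seminorm_topology V P =
     topology_generated_by (insert V {{G\<in>V. p (G - F) < e} | p F e. p \<in> P \<and> F \<in> V \<and> e > 0})"

definition uniform_topology :: "('m::topological_space \<Rightarrow> 'q::real_normed_vector) topology" where
  "uniform_topology = seminorm_topology cts {\<lambda>F. SUP x. norm (F x)}"

definition smooth_topology ::
  "('m::topological_space, 'e::euclidean_space) chart set \<Rightarrow> ('m \<Rightarrow> 'q::real_normed_vector) topology"
  where
  "smooth_topology A = seminorm_topology (smooth_functions A)
     {\<lambda>F. SUP x\<in>K. norm (dir_deriv vs (F \<circ> chart_inv c) (snd c x)) | c K vs.
        c \<in> A \<and> compact K \<and> K \<noteq> {} \<and> K \<subseteq> fst c}"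

definition form_topology ::
  "('m::topological_space, 'e::euclidean_space) chart set \<Rightarrow>
   ('m, 'e, 'q::real_normed_vector) form topology" where
  "form_topology A = seminorm_topology (one_forms A)
     {\<lambda>\<omega>. SUP x\<in>K. norm (dir_deriv vs (\<lambda>y. \<omega> c (chart_inv c y) v) (snd c x)) | c K vs v.
        c \<in> A \<and> compact K \<and> K \<noteq> {} \<and> K \<subseteq> fst c}"

definition dense_in :: "'v topology \<Rightarrow> 'v set \<Rightarrow> bool" where
  "dense_in X S \<longleftrightarrow> S \<subseteq> topspace X \<and> X closure_of S = topspace X"


section \<open>Smooth actions and representations on one-forms\<close>

text \<open>\<open>C(M) \<otimes> \<Q>\<close> and \<open>C(M) \<otimes> \<Q> \<otimes> \<Q>\<close> are the algebras of continuous functions on \<open>M\<close> with values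
  in \<open>\<Q>\<close> and \<open>\<Q> \<otimes> \<Q>\<close>. So \<open>id \<otimes> \<Delta>\<close> is composition with \<open>\<Delta>\<close>, while \<open>\<alpha> \<otimes> id\<close> is the homomorphism \<open>E\<close>
  determined by its values on elementary tensors.\<close>

definition cqg_action ::
  "('q::cstar_algebra \<Rightarrow> 'q \<Rightarrow> 'qq::cstar_algebra) \<Rightarrow> ('q \<Rightarrow> 'qq) \<Rightarrow>
   (('m::topological_space \<Rightarrow> complex) \<Rightarrow> ('m \<Rightarrow> 'q)) \<Rightarrow> bool" where
  "cqg_action t \<Delta> \<alpha> \<longleftrightarrow>
     unital_star_hom_on cts cts \<alpha> \<and>
     (\<exists>E :: ('m \<Rightarrow> 'q) \<Rightarrow> ('m \<Rightarrow> 'qq). unital_star_hom_on cts cts E \<and>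
        (\<forall>f\<in>cts. \<forall>q. E (fun_tensor f q) = (\<lambda>x. t (\<alpha> f x) q)) \<and>
        (\<forall>f\<in>cts. E (\<alpha> f) = \<Delta> \<circ> \<alpha> f)) \<and>
     dense_in uniform_topology (cspan {\<alpha> f * (\<lambda>_. q) | f q. f \<in> cts})"

definition smooth_action ::
  "('q::cstar_algebra \<Rightarrow> 'q \<Rightarrow> 'qq::cstar_algebra) \<Rightarrow> ('q \<Rightarrow> 'qq) \<Rightarrow>
   ('m::topological_space, 'e::euclidean_space) chart set \<Rightarrow>
   (('m \<Rightarrow> complex) \<Rightarrow> ('m \<Rightarrow> 'q)) \<Rightarrow> bool" where
  "smooth_action t \<Delta> A \<alpha> \<longleftrightarrow>
     cqg_action t \<Delta> \<alpha> \<and> \<alpha> \<in> smooth_functions A \<rightarrow> smooth_functions A \<and>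
     dense_in (smooth_topology A) (cspan {\<alpha> f * (\<lambda>_. q) | f q. f \<in> smooth_functions A})"

text \<open>As for functions, \<open>E\<close> is the continuous extension \<open>\<Gamma> \<otimes> id\<close>. It exists because the Frechet
  space of one-forms is nuclear, and it is unique because finite sums of elementary tensors
  are dense.\<close>

definition form_representation ::
  "('q::cstar_algebra \<Rightarrow> 'q \<Rightarrow> 'qq::cstar_algebra) \<Rightarrow> ('q \<Rightarrow> 'qq) \<Rightarrow>
   ('m::topological_space, 'e::euclidean_space) chart set \<Rightarrow>
   (('m \<Rightarrow> complex) \<Rightarrow> ('m \<Rightarrow> 'q)) \<Rightarrow>
   (('m, 'e, complex) form \<Rightarrow> ('m, 'e, 'q) form) \<Rightarrow> bool" where
  "form_representation t \<Delta> A \<alpha> \<Gamma> \<longleftrightarrow>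
     \<Gamma> \<in> one_forms A \<rightarrow> one_forms A \<and> clinear_on (one_forms A) \<Gamma> \<and>
     continuous_map (form_topology A) (form_topology A) \<Gamma> \<and>
     (\<exists>E :: ('m, 'e, 'q) form \<Rightarrow> ('m, 'e, 'qq) form.
        E \<in> one_forms A \<rightarrow> one_forms A \<and> clinear_on (one_forms A) E \<and>
        continuous_map (form_topology A) (form_topology A) E \<and>
        (\<forall>\<omega>\<in>one_forms A. \<forall>q. E (form_tensor \<omega> q) = (\<lambda>c x v. t (\<Gamma> \<omega> c x v) q)) \<and>
        (\<forall>\<omega>\<in>one_forms A. E (\<Gamma> \<omega>) = (\<lambda>c x v. \<Delta> (\<Gamma> \<omega> c x v)))) \<and>
     (\<forall>\<omega>\<in>one_forms A. \<forall>f\<in>smooth_functions A.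
        \<Gamma> (form_times \<omega> f) = form_times (\<Gamma> \<omega>) (\<alpha> f) \<and>
        \<Gamma> (form_times \<omega> f) = times_form (\<alpha> f) (\<Gamma> \<omega>))"


section \<open>Riemannian structures\<close>

text \<open>As with one-forms, \<open>g c x v w\<close> is the metric at \<open>x\<close> evaluated on the tangent vectors with
  coordinates \<open>v\<close> and \<open>w\<close> in the chart \<open>c\<close>.\<close>

type_synonym ('m, 'e) metric_field = "('m, 'e) chart \<Rightarrow> 'm \<Rightarrow> 'e \<Rightarrow> 'e \<Rightarrow> real"

definition riemannian_metric ::
  "('m, 'e::euclidean_space) chart set \<Rightarrow> ('m, 'e) metric_field \<Rightarrow> bool" where
  "riemannian_metric A g \<longleftrightarrow>
     (\<forall>c\<in>A. \<forall>x\<in>fst c. bilinear (g c x) \<and> (\<forall>v w. g c x v w = g c x w v) \<and>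
        (\<forall>v. v \<noteq> 0 \<longrightarrow> g c x v v > 0)) \<and>
     (\<forall>c\<in>A. \<forall>v w. smooth_on (chart_image c) (\<lambda>y. g c (chart_inv c y) v w)) \<and>
     (\<forall>c\<in>A. \<forall>c'\<in>A. \<forall>x\<in>fst c \<inter> fst c'. \<forall>v w.
        g c x v w = g c' x (transition_deriv c c' x v) (transition_deriv c c' x w))"

text \<open>The musical isomorphism of a positive definite form \<open>h\<close>: \<open>sharp h b\<close> is the vector dual to the
  functional \<open>v \<mapsto> b \<bullet> v\<close>. For basis vectors, \<open>sharp h b\<^sub>j = \<Sum>\<^sub>i h\<^sup>i\<^sup>j b\<^sub>i\<close> with \<open>(h\<^sup>i\<^sup>j)\<close> the inverse of
  the matrix of \<open>h\<close>.\<close>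

definition sharp :: "('e::euclidean_space \<Rightarrow> 'e \<Rightarrow> real) \<Rightarrow> 'e \<Rightarrow> 'e" where
  "sharp h b = (THE w. \<forall>v. h w v = b \<bullet> v)"

text \<open>In any chart \<open>c\<close> around \<open>x\<close> this is \<open>\<Sum>\<^sub>i\<^sub>j g\<^sup>i\<^sup>j \<omega>\<^sub>i\<^sup>* \<eta>\<^sub>j\<close>; by the transformation laws the value does
  not depend on the chart.\<close>

definition form_inner ::
  "('m, 'e::euclidean_space) chart set \<Rightarrow> ('m, 'e) metric_field \<Rightarrow>
   ('m, 'e, 'q::cstar_algebra) form \<Rightarrow> ('m, 'e, 'q) form \<Rightarrow> 'm \<Rightarrow> 'q" where
  "form_inner A g \<omega> \<eta> = (\<lambda>x. let c = (SOME c. c \<in> A \<and> x \<in> fst c) in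
     \<Sum>b\<in>Basis. star (\<omega> c x (sharp (g c x) b)) * \<eta> c x b)"

lemma form_inner_form_tensor:
  fixes A :: "('m, 'e::euclidean_space) chart set" and q q' :: "'q::cstar_algebra"
  shows "form_inner A g (form_tensor \<omega> q) (form_tensor \<eta> q') =
    fun_tensor (form_inner A g \<omega> \<eta>) (star q * q')"
proof -
  have scaleC_zero: "0 *\<^sub>C y = 0" for y :: 'q
    using scaleC_of_real[of 0 y] by simp
  have "(\<Sum>b\<in>B. r b) *\<^sub>C y = (\<Sum>b\<in>B. r b *\<^sub>C y)" for B :: "'e set" and r and y :: 'q
    by (induction B rule: infinite_finite_induct) (simp_all add: scaleC_add_left scaleC_zero)
  then show ?thesis
    by (simp add: form_inner_def form_tensor_def fun_tensor_def Let_def star_scaleC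
        mult_scaleC_left mult_scaleC_right scaleC_scaleC star_complex_def mult.commute)
qed

end

theory Submission
  imports Defs
begin

text \<open>The dense algebra \<open>\<A>\<close> is a union of finite-dimensional spaces on which the action is a unitary
  matrix with entries in \<open>\<Q>\<close>. On such a space (and on the products of its elements) an invariant
  functional of the form \<open>\<Sum>\<^sub>y c\<^sub>y \<delta>\<^sub>y\<close> with real \<open>c\<^sub>y\<close> and finitely many points \<open>y\<close> replaces the Haar
  state; orthonormalising with respect to it gives finitely many real functions \<open>f\<^sub>i\<close> with
  \<open>\<alpha>(f\<^sub>j) = \<Sum>\<^sub>i f\<^sub>i \<otimes> q\<^sub>i\<^sub>j\<close>, where \<open>(q\<^sub>i\<^sub>j)\<close> is an orthogonal matrix of selfadjoint elements. The density
  condition in the definition of a smooth action, the continuity of \<open>\<Gamma>\<close> and compactness allow us to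
  choose the \<open>f\<^sub>i\<close> such that the \<open>df\<^sub>i\<close> span every cotangent space. The new metric is
  \<open>\<Sum>\<^sub>i df\<^sub>i \<otimes> df\<^sub>i\<close>.

  In this metric \<open>P\<^sub>i\<^sub>j = \<langle>df\<^sub>i, df\<^sub>j\<rangle>\<close> is a symmetric projection of trace \<open>dim M\<close> with
  \<open>\<Sum>\<^sub>j P\<^sub>i\<^sub>j df\<^sub>j = df\<^sub>i\<close>. The matrices \<open>\<alpha>(P\<^sub>i\<^sub>j)\<close> and \<open>\<langle>\<Gamma>(df\<^sub>i), \<Gamma>(df\<^sub>j)\<rangle> = \<Sum>\<^sub>k\<^sub>l P\<^sub>k\<^sub>l q\<^sub>k\<^sub>i q\<^sub>l\<^sub>j\<close> are projections
  with this trace, and the first dominates the second because \<open>\<Gamma>\<close> respects multiplication by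
  functions on both sides. Hence their difference \<open>Z\<close> is a projection with \<open>\<Sum>\<^sub>i\<^sub>j Z\<^sub>i\<^sub>j\<^sup>* Z\<^sub>i\<^sub>j = 0\<close>, so \<open>Z = 0\<close>.
  This is the invariance for the \<open>df\<^sub>i\<close>; they generate all differentials over the smooth functions.\<close>

section \<open>Positive elements of \<open>C\<^sup>*\<close>-algebras\<close>

text \<open>Values in \<open>'q\<close> do not commute, so the invariance is not obtained by
  rearranging products but by comparing two projection matrices. From \<Sum>_j df_j P_ji = df_i the
  right module rule gives \<Sum>_j \<Gamma>(df_j) \<alpha>(P_ji) = \<Gamma>(df_i); together with its
  adjoint this shows that \<alpha>(P) acts as the identity on the second matrix from either side.
  The trace of a matrix over \<open>'q\<close> is not cyclic, but for a selfadjoint idempotent Z the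
  sum of all star Z_ij * Z_ij is itself the trace of Z. To conclude that each entry vanishes, star y
  * y must be positive in an abstract algebra; this is derived from norm estimates alone. The f_i
  are taken real so that the q_ij become selfadjoint and the adjoint of \<Gamma>(df_i) has
  coefficients q_ki again. The weights c_y are real but may be negative: positivity is only claimed
  for squared moduli of functions in the chosen span. It comes from agreement on invariant functions
  with the plain sum over a finite set of points that determines the functions of the span.\<close>

lemma scaleC_one [simp]: "1 *\<^sub>C x = (x :: 'a::cstar_algebra)"
  using scaleC_of_real[of 1 x] by simp

interpretation cstar: vector_space "scaleC :: complex \<Rightarrow> 'a \<Rightarrow> 'a::cstar_algebra"
  by unfold_locales (simp_all add: scaleC_add_right scaleC_add_left scaleC_scaleC)

interpretation cstar_fun: vector_space "scaleC :: complex \<Rightarrow> ('m \<Rightarrow> 'a) \<Rightarrow> 'm \<Rightarrow> 'a::cstar_algebra"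
  by unfold_locales
    (simp_all add: scaleC_fun_def scaleC_add_right scaleC_add_left scaleC_scaleC fun_eq_iff)

lemma star_zero [simp]: "star (0 :: 'a::cstar_algebra) = 0"
  using star_add[of "0::'a" 0] by simp

lemma star_minus: "star (- x) = - star (x :: 'a::cstar_algebra)"
  using star_add[of x "- x"] by (simp add: eq_neg_iff_add_eq_0 add.commute)

lemma star_diff: "star (x - y) = star x - star (y :: 'a::cstar_algebra)"
  using star_add[of x "- y"] by (simp add: star_minus)

lemma star_one [simp]: "star (1 :: 'a::cstar_algebra) = 1"
  using star_mult[of "star (1::'a)" 1] by (simp add: star_star)

lemma star_scaleR: "star (r *\<^sub>R x) = r *\<^sub>R star (x :: 'a::cstar_algebra)"
  using star_scaleC[of "complex_of_real r" x] by (simp add: scaleC_of_real)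

lemma star_sum: "star (sum f I) = (\<Sum>i\<in>I. star (f i :: 'a::cstar_algebra))"
  by (induction I rule: infinite_finite_induct) (simp_all add: star_add)

lemma star_power: "star (x ^ n) = star (x :: 'a::cstar_algebra) ^ n"
  by (induction n) (simp_all add: star_mult power_commutes)

lemma norm_star [simp]: "norm (star x) = norm (x :: 'a::cstar_algebra)"
proof -
  have le: "norm z \<le> norm (star z)" for z :: 'a
  proof (cases "z = 0")
    case False
    have "norm z * norm z \<le> norm (star z) * norm z"
      using norm_star_mult[of z] norm_mult_ineq[of "star z" z] by (simp add: power2_eq_square)
    then show ?thesis using False by simp
  qed simp
  show ?thesis using le[of x] le[of "star x"] by (simp add: star_star)
qed

lemma bounded_linear_star: "bounded_linear (star :: 'a::cstar_algebra \<Rightarrow> 'a)"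
  by (rule bounded_linear_intro[of _ 1]) (simp_all add: star_add star_scaleR)

lemma bounded_linear_scaleC_left: "bounded_linear (\<lambda>c. c *\<^sub>C (x :: 'a::cstar_algebra))"
proof (rule bounded_linear_intro[of _ "norm x"])
  show "(r *\<^sub>R c) *\<^sub>C x = r *\<^sub>R c *\<^sub>C x" for r c
    by (metis scaleC_of_real scaleC_scaleC scaleR_conv_of_real)
qed (simp_all add: scaleC_add_left norm_scaleC)

lemma bounded_linear_scaleC_right: "bounded_linear (\<lambda>x. c *\<^sub>C (x :: 'a::cstar_algebra))"
proof (rule bounded_linear_intro[of _ "norm c"])
  show "c *\<^sub>C r *\<^sub>R x = r *\<^sub>R c *\<^sub>C x" for r and x :: 'a
    by (metis scaleC_of_real scaleC_scaleC mult.commute)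
qed (simp_all add: scaleC_add_right norm_scaleC mult.commute)

section \<open>Growth of powers of selfadjoint elements, and square roots\<close>

lemma norm_selfadjoint_power:
  assumes "star a = (a :: 'a::cstar_algebra)"
  shows "norm (a ^ 2 ^ k) = norm a ^ 2 ^ k"
proof (induction k)
  case (Suc k)
  have "norm (a ^ 2 ^ Suc k) = norm (star (a ^ 2 ^ k) * a ^ 2 ^ k)"
    by (simp add: star_power assms power_add[symmetric] mult_2)
  also have "\<dots> = (norm a ^ 2 ^ k)\<^sup>2" by (simp add: norm_star_mult Suc)
  finally show ?case by (simp add: power_mult[symmetric] mult.commute)
qed simp

text \<open>Bernoulli bounds t ^ N below only linearly in N; squaring that bound at exponent 2 N
  makes it quadratic, which no linear upper bound survives. Applied to norms of powers with
  exponents 2 ^ k, this replaces the spectral radius formula.\<close>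

lemma le_one_if_powers_bounded_linearly:
  fixes t :: real
  assumes "t \<ge> 0" and bound: "\<And>k. t ^ 2 ^ k \<le> A + B * 2 ^ k"
  shows "t \<le> 1"
proof (rule ccontr)
  assume "\<not> t \<le> 1"
  then have t: "t > 1" by simp
  define C where "C = \<bar>A\<bar> + 2 * \<bar>B\<bar> + 1"
  obtain k where k: "C / (t - 1)\<^sup>2 < 2 ^ k" using real_arch_pow[of 2] by auto
  define N :: real where "N = 2 ^ k"
  have N: "N \<ge> 1" by (simp add: N_def)
  have "C < (t - 1)\<^sup>2 * N" using k t by (simp add: N_def field_simps)
  then have "C * N \<le> (t - 1)\<^sup>2 * N * N" using N by (intro mult_right_mono) auto
  also have "\<dots> = ((t - 1) * N)\<^sup>2" by (simp add: power2_eq_square)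
  also have "\<dots> \<le> (1 + (t - 1) * N)\<^sup>2" using t N by (intro power_mono) auto
  also have "1 + (t - 1) * N \<le> t ^ 2 ^ k"
    using Bernoulli_inequality[of "t - 1" "2 ^ k"] t by (simp add: N_def mult.commute)
  then have "(1 + (t - 1) * N)\<^sup>2 \<le> (t ^ 2 ^ k)\<^sup>2" using t N by (intro power_mono) auto
  also have "\<dots> = t ^ 2 ^ Suc k" by (simp add: power_mult[symmetric] mult.commute)
  also have "\<dots> \<le> A + B * 2 ^ Suc k" by (rule bound)
  also have "\<dots> \<le> \<bar>A\<bar> * N + 2 * \<bar>B\<bar> * N"
  proof -
    have "\<bar>A\<bar> * 1 \<le> \<bar>A\<bar> * N" using N by (intro mult_left_mono) auto
    moreover have "B * (2 * N) \<le> \<bar>B\<bar> * (2 * N)" using N by (intro mult_right_mono) auto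
    ultimately show ?thesis unfolding N_def power_Suc by linarith
  qed
  finally have "C * N \<le> \<bar>A\<bar> * N + 2 * \<bar>B\<bar> * N" .
  then show False using N by (simp add: C_def algebra_simps)
qed

text \<open>The square root is the binomial series for exponent \<open>1/2\<close>.\<close>

lemma selfadjoint_sqrt_one_minus:
  fixes x :: "'a::cstar_algebra"
  assumes "star x = x" and x: "norm x < 1"
  obtains s where "star s = s" "s * s = 1 - x" "\<And>y. x * y = y * x \<Longrightarrow> s * y = y * s"
proof -
  define a :: "nat \<Rightarrow> real" where "a k = (-1) ^ k * ((1 / 2) gchoose k)" for k
  \<comment> \<open>Consecutive coefficients have a ratio of modulus |1/2 - k| / (k + 1) \<le> 1, so
    the series converges absolutely as soon as norm x < 1.\<close>
  have gbin: "\<bar>(1 / 2 :: real) gchoose k\<bar> \<le> 1" for k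
  proof (induction k)
    case (Suc k)
    have "\<bar>(1 / 2 :: real) gchoose Suc k\<bar> = \<bar>(1/2 :: real) gchoose k\<bar> * (\<bar>1/2 - real k\<bar> / (real k + 1))"
      by (simp add: gbinomial_prod_rev atLeast0_lessThan_Suc divide_simps abs_mult)
    also have "\<dots> \<le> 1 * 1" by (intro mult_mono Suc) auto
    finally show ?case by simp
  qed simp
  have a_le: "\<bar>a k\<bar> \<le> 1" for k using gbin[of k] by (simp add: a_def abs_mult)
  \<comment> \<open>Vandermonde: convolving the coefficients for exponent 1/2 gives those for
    exponent 1, so the squared series stops after 1 - x.\<close>
  have conv: "(\<Sum>i\<le>k. a i * a (k - i)) = (if k = 0 then 1 else if k = 1 then - 1 else 0)" for k
  proof -
    have "(\<Sum>i\<le>k. a i * a (k - i)) =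
        (\<Sum>i\<le>k. (-1) ^ k * (((1 / 2) gchoose i) * ((1 / 2) gchoose (k - i))))"
      by (intro sum.cong) (auto simp: a_def power_add[symmetric])
    also have "\<dots> = (-1) ^ k * (of_nat 1 gchoose k)"
      using gbinomial_Vandermonde[of "1/2::real" "1/2" k]
      by (simp add: sum_distrib_left[symmetric] atLeast0AtMost)
    also have "\<dots> = (if k = 0 then 1 else if k = 1 then - 1 else 0)"
      unfolding binomial_gbinomial[symmetric] by (cases k; cases "k - 1") auto
    finally show ?thesis .
  qed
  have sm: "summable (\<lambda>k. norm (a k *\<^sub>R x ^ k))"
  proof (rule summable_comparison_test'[of "\<lambda>k. norm x ^ k" 0])
    show "summable ((^) (norm x))" using x by (intro summable_geometric) simp
    show "norm (norm (a n *\<^sub>R x ^ n)) \<le> norm x ^ n" for n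
      using mult_mono[OF a_le[of n] norm_power_ineq[of x n]] by simp
  qed
  note sm' = summable_norm_cancel[OF sm]
  define s where "s = (\<Sum>k. a k *\<^sub>R x ^ k)"
  have "star s = (\<Sum>k. star (a k *\<^sub>R x ^ k))"
    unfolding s_def by (rule bounded_linear.suminf[OF bounded_linear_star sm'])
  then have 1: "star s = s" by (simp add: star_scaleR star_power assms(1) s_def)
  have "(\<lambda>k. \<Sum>i\<le>k. (a i *\<^sub>R x ^ i) * (a (k - i) *\<^sub>R x ^ (k - i))) sums (s * s)"
    unfolding s_def by (rule Cauchy_product_sums[OF sm sm])
  moreover have "(\<Sum>i\<le>k. (a i *\<^sub>R x ^ i) * (a (k - i) *\<^sub>R x ^ (k - i))) =
      (if k = 0 then 1 else if k = 1 then - x else 0)" for k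
  proof -
    have "(\<Sum>i\<le>k. (a i *\<^sub>R x ^ i) * (a (k - i) *\<^sub>R x ^ (k - i))) = (\<Sum>i\<le>k. a i * a (k - i)) *\<^sub>R x ^ k"
      unfolding scaleR_sum_left by (intro sum.cong) (auto simp: power_add[symmetric])
    then show ?thesis by (simp add: conv)
  qed
  moreover have "(\<lambda>k. if k = 0 then 1 else if k = 1 then - x else 0) sums
      (\<Sum>k\<in>{0, 1::nat}. if k = 0 then 1 else if k = 1 then - x else 0)"
    by (rule sums_finite) auto
  ultimately have 2: "s * s = 1 - x" using sums_unique2 by fastforce
  have 3: "s * y = y * s" if "x * y = y * x" for y
    using suminf_mult[OF sm', of y] suminf_mult2[OF sm', of y]
      power_commuting_commutes[OF that] by (simp add: s_def)
  show ?thesis using that[OF 1 2 3] by blast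
qed

text \<open>For selfadjoint \<open>a\<close> the norm condition says that the spectrum lies in
  [0, 2 r]. Positivity is thus expressed without spectra, and closure under sums becomes the
  triangle inequality.\<close>

definition pos_elem :: "'a::cstar_algebra \<Rightarrow> bool" where
  "pos_elem a \<longleftrightarrow> star a = a \<and> (\<exists>r\<ge>0. norm (of_real r - a) \<le> r)"

lemma star_of_real [simp]: "star (of_real r) = (of_real r :: 'a::cstar_algebra)"
  by (simp add: of_real_def star_scaleR)

text \<open>Enlarging r by d moves the centre by d and costs at most d in norm, so the radius can be
  taken as large as a later estimate wants.\<close>

lemma pos_elemE:
  assumes "pos_elem a"
  obtains r0 where "r0 \<ge> 0" "\<And>r. r \<ge> r0 \<Longrightarrow> norm (of_real r - a) \<le> r"
proof -
  obtain r0 where r0: "r0 \<ge> 0" "norm (of_real r0 - a) \<le> r0" using assms by (auto simp: pos_elem_def)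
  have "norm (of_real r - a) \<le> r" if "r \<ge> r0" for r
  proof -
    have "norm (of_real (r - r0) + (of_real r0 - a)) \<le> \<bar>r - r0\<bar> + r0"
      using norm_triangle_le[of "of_real (r - r0) :: 'a" "of_real r0 - a"] r0(2)
      by (metis add_left_mono norm_of_real norm_triangle_mono order_refl)
    then show ?thesis using that by simp
  qed
  then show ?thesis using that r0(1) by blast
qed

lemma pos_elem_add:
  assumes "pos_elem a" "pos_elem b"
  shows "pos_elem (a + b)"
proof -
  obtain r s where r: "r \<ge> 0" "norm (of_real r - a) \<le> r" and s: "s \<ge> 0" "norm (of_real s - b) \<le> s"
    using assms by (auto simp: pos_elem_def)
  have "norm (of_real (r + s) - (a + b)) \<le> r + s"
    using norm_triangle_mono[OF r(2) s(2)] by (simp add: algebra_simps)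
  then show ?thesis using assms r s by (auto simp: pos_elem_def star_add intro!: exI[of _ "r + s"])
qed

lemma pos_elem_scaleR:
  assumes "pos_elem a" "k \<ge> 0"
  shows "pos_elem (k *\<^sub>R a)"
proof -
  obtain r where r: "r \<ge> 0" "norm (of_real r - a) \<le> r" using assms by (auto simp: pos_elem_def)
  have "norm (of_real (k * r) - k *\<^sub>R a) = k * norm (of_real r - a)"
    using assms(2) norm_scaleR[of k "of_real r - a"] by (simp add: of_real_def algebra_simps)
  then show ?thesis using assms r by (auto simp: pos_elem_def star_scaleR mult_left_mono intro!: exI[of _ "k * r"])
qed

lemma pos_elem_zero [simp]: "pos_elem 0"
  by (auto simp: pos_elem_def)

lemma pos_elem_sum: "(\<And>i. i \<in> I \<Longrightarrow> pos_elem (f i)) \<Longrightarrow> pos_elem (sum f I)"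
  by (induction I rule: infinite_finite_induct) (auto intro: pos_elem_add)

text \<open>Here \<open>a + \<i> s\<close> is a multiple of a unitary, and \<open>a\<close> is the average of it and its adjoint.\<close>

lemma norm_le_if_squares_sum:
  fixes a s :: "'a::cstar_algebra"
  assumes sa: "star a = a" "star s = s" and comm: "a * s = s * a"
    and sq: "a * a + s * s = of_real (\<rho>\<^sup>2)" and "\<rho> \<ge> 0"
  shows "norm a \<le> \<rho>"
proof -
  define u where "u = a + \<i> *\<^sub>C s"
  have "star u = a - \<i> *\<^sub>C s" by (simp add: u_def star_add star_scaleC sa)
  then have "star u * u = of_real (\<rho>\<^sup>2)"
    using sq comm by (simp add: \<open>star u = _\<close>) (simp add: u_def algebra_simps mult_scaleC_left mult_scaleC_right scaleC_scaleC)
  then have "(norm u)\<^sup>2 = \<rho>\<^sup>2" using norm_star_mult[of u] by (metis norm_of_real abs_power2)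
  then have u: "norm u = \<rho>" using \<open>\<rho> \<ge> 0\<close> by simp
  have "a = (1 / 2) *\<^sub>R (u + star u)"
    using \<open>star u = _\<close> by (simp add: u_def scaleR_2[symmetric])
  then have "norm a \<le> (1 / 2) * (norm u + norm (star u))"
    by (metis abs_of_pos half_gt_zero_iff norm_scaleR norm_triangle_ineq mult_le_cancel_left_pos zero_less_one)
  then show ?thesis by (simp add: u)
qed

text \<open>After scaling to norm x < 1, the root s of 1 - x * x commutes with x and the two squares
  add up to 1. Hence norm s \<le> 1, so norm (1 - x * x) \<le> 1, and radius 1 witnesses
  positivity.\<close>

lemma pos_elem_square:
  assumes "star b = b"
  shows "pos_elem (b * b)"
proof -
  define r where "r = norm b + 1"
  have r: "r > 0" by (simp add: r_def add_nonneg_pos)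
  define x where "x = (1 / r) *\<^sub>R b"
  have x: "star x = x" "norm x < 1" using r by (simp_all add: x_def star_scaleR assms r_def)
  have xx: "star (x * x) = x * x" "norm (x * x) < 1"
    using x norm_star_mult[of x] by (simp_all add: star_mult power_less_one_iff)
  obtain s where s: "star s = s" "s * s = 1 - x * x" "\<And>y. x * x * y = y * (x * x) \<Longrightarrow> s * y = y * s"
    using selfadjoint_sqrt_one_minus[OF xx] by metis
  have "norm s \<le> 1"
    by (rule norm_le_if_squares_sum[OF s(1) x(1)]) (use s(3)[of x] in \<open>simp_all add: s(2) mult.assoc\<close>)
  then have "norm (1 - x * x) \<le> 1" using norm_star_mult[of s] by (simp add: s(1,2) abs_square_le_1)
  then have "pos_elem (x * x)" using xx(1) by (auto simp: pos_elem_def intro!: exI[of _ 1])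
  from pos_elem_scaleR[OF this, of "r\<^sup>2"] show ?thesis
    using r by (simp add: x_def power2_eq_square)
qed

text \<open>The roots p and q of e + \<delta> + a and e + \<delta> - a commute with each other and
  with a, and (p q)^2 = (e + \<delta>)^2 - a^2, so a and p q are the two legs of a circle of radius
  e + \<delta>. The summand \<delta> brings the argument of the root series down to norm at most r /
  (r + \<delta>) < 1.\<close>

lemma pos_elem_norm_le:
  assumes "star a = a" "pos_elem (of_real e + a)" "pos_elem (of_real e - a)" "\<delta> > 0" "e \<ge> 0"
  shows "norm a \<le> e + \<delta>"
proof -
  have sqrt: "\<exists>p. star p = p \<and> p * p = of_real (e + \<delta>) + b \<and> (\<forall>y. b * y = y * b \<longrightarrow> p * y = y * p)"
    if sb: "star b = b" and pb: "pos_elem (of_real e + b)" for b :: 'a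
  proof -
    obtain r where r: "r \<ge> 0" "norm (of_real r - (of_real e + b)) \<le> r"
      using pb by (auto simp: pos_elem_def)
    define x where "x = (1 / (r + \<delta>)) *\<^sub>R (of_real r - (of_real e + b))"
    have x: "star x = x" by (simp add: x_def star_scaleR star_diff star_add sb)
    have "norm x \<le> r / (r + \<delta>)"
      unfolding x_def norm_scaleR using r \<open>\<delta> > 0\<close> by (simp add: divide_right_mono)
    also have "\<dots> < 1" using r \<open>\<delta> > 0\<close> by simp
    finally obtain s where s: "star s = s" "s * s = 1 - x" "\<And>y. x * y = y * x \<Longrightarrow> s * y = y * s"
      using selfadjoint_sqrt_one_minus[OF x] by metis
    define p where "p = sqrt (r + \<delta>) *\<^sub>R s"
    have "p * p = (r + \<delta>) *\<^sub>R (1 - x)" using r \<open>\<delta> > 0\<close> by (simp add: p_def s(2))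
    also have "\<dots> = (r + \<delta>) *\<^sub>R 1 - (of_real r - (of_real e + b))" using r \<open>\<delta> > 0\<close>
      by (simp add: x_def scaleR_diff_right)
    also have "\<dots> = of_real (e + \<delta>) + b" by (simp add: of_real_def scaleR_add_left)
    finally have "p * p = of_real (e + \<delta>) + b" .
    moreover have "p * y = y * p" if "b * y = y * b" for y
    proof -
      have "x * y = y * x" using that by (simp add: x_def algebra_simps of_real_def)
      then show ?thesis using s(3) by (simp add: p_def)
    qed
    moreover have "star p = p" by (simp add: p_def star_scaleR s(1))
    ultimately show ?thesis by blast
  qed
  obtain p where p: "star p = p" "p * p = of_real (e + \<delta>) + a" "\<And>y. a * y = y * a \<Longrightarrow> p * y = y * p"
    using sqrt[of a] assms by metis
  have "star (- a) = - a" "pos_elem (of_real e + - a)" using assms by (simp_all add: star_minus)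
  from sqrt[OF this] obtain q where q: "star q = q" "q * q = of_real (e + \<delta>) - a"
    "\<And>y. a * y = y * a \<Longrightarrow> q * y = y * q" by (metis minus_mult_left mult_minus_right uminus_add_conv_diff add.commute)
  have pq: "p * q = q * p" using p(3)[of q] q(3)[of a] by simp
  have "(p * q) * (p * q) = (p * p) * (q * q)" by (metis mult.assoc pq)
  also have "\<dots> = of_real ((e + \<delta>)\<^sup>2) - a * a"
  proof -
    have "of_real (e + \<delta>) * a = a * (of_real (e + \<delta>) :: 'a)" by (simp add: of_real_def)
    then show ?thesis unfolding p(2) q(2)
      by (simp add: distrib_right right_diff_distrib power2_eq_square)
  qed
  finally have *: "a * a + (p * q) * (p * q) = of_real ((e + \<delta>)\<^sup>2)" by simp
  have "a * (p * q) = (p * q) * a" using p(3)[of a] q(3)[of a] by (metis mult.assoc)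
  then show ?thesis
    using norm_le_if_squares_sum[OF assms(1) _ _ *] assms(4,5) p(1) q(1) pq by (simp add: star_mult)
qed

lemma pos_elem_antisym:
  assumes "pos_elem a" "pos_elem (- a)"
  shows "a = 0"
proof -
  have "norm a \<le> 0 + \<delta>" if "\<delta> > 0" for \<delta>
    by (rule pos_elem_norm_le) (use assms that in \<open>auto simp: pos_elem_def\<close>)
  then show ?thesis using field_le_epsilon[of "norm a" 0] by simp
qed

text \<open>The powers of \<open>R + z z\<^sup>*\<close> and of \<open>R + z\<^sup>* z\<close> are related by
  \<open>(R + z z\<^sup>*)\<^sup>n = R\<^sup>n + z (\<Sum>\<^sub>j R\<^sup>n\<^sup>-\<^sup>1\<^sup>-\<^sup>j (R + z\<^sup>* z)\<^sup>j) z\<^sup>*\<close>.\<close>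

lemma pos_elem_one_minus_star_commute:
  fixes z :: "'a::cstar_algebra"
  assumes "pos_elem (1 - star z * z)"
  shows "pos_elem (1 - z * star z)"
proof -
  obtain r0 where r0: "r0 \<ge> 0" "\<And>r. r \<ge> r0 \<Longrightarrow> norm (of_real r - (1 - star z * z)) \<le> r"
    using pos_elemE[OF assms] by metis
  \<comment> \<open>R \<ge> 1 makes the powers monotone in the exponent. With r = R + 1 the element
    \<open>b\<close> is exactly r - (1 - star z * z), whose norm the hypothesis bounds by r, and
    \<open>w\<close> is its counterpart for z * star z.\<close>
  define R where "R = r0 + 1"
  define r where "r = R + 1"
  define b where "b = of_real R + star z * z"
  define w where "w = of_real R + z * star z"
  have R: "R \<ge> 1" and r: "r > 0" "R \<le> r" using r0 by (simp_all add: R_def r_def)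
  have "of_real r - (1 - star z * z) = b" by (simp add: b_def r_def)
  then have b: "norm b \<le> r" using r0(2)[of r] by (simp add: r_def R_def)
  have pw: "w ^ n = of_real (R ^ n) + z * (\<Sum>j<n. of_real (R ^ (n - Suc j)) * b ^ j) * star z" for n
  proof (induction n)
    case (Suc n)
    have zb: "star z * w = b * star z" by (simp add: w_def b_def algebra_simps of_real_def)
    have bz: "w * z = z * b" by (simp add: w_def b_def algebra_simps of_real_def)
    have "w ^ Suc n = w * of_real (R ^ n) + z * (b * (\<Sum>j<n. of_real (R ^ (n - Suc j)) * b ^ j)) * star z"
      by (simp add: Suc distrib_left mult.assoc[symmetric] bz)
    also have "w * of_real (R ^ n) = of_real (R ^ Suc n) + z * of_real (R ^ n) * star z"
      by (simp add: w_def algebra_simps of_real_def)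
    also have "b * (\<Sum>j<n. of_real (R ^ (n - Suc j)) * b ^ j) =
        (\<Sum>j<n. of_real (R ^ (Suc n - Suc (Suc j))) * b ^ Suc j)"
      by (simp add: sum_distrib_left of_real_def)
    also have "of_real (R ^ Suc n) + z * of_real (R ^ n) * star z +
        z * (\<Sum>j<n. of_real (R ^ (Suc n - Suc (Suc j))) * b ^ Suc j) * star z =
        of_real (R ^ Suc n) + z * (\<Sum>j<Suc n. of_real (R ^ (Suc n - Suc j)) * b ^ j) * star z"
      unfolding sum.lessThan_Suc_shift by (simp add: algebra_simps)
    finally show ?case .
  qed simp
  \<comment> \<open>Each of the n summands has norm at most r ^ n, so the powers of w / r grow at
    most linearly; at exponents 2 ^ k this forces norm w \<le> r, which is the claim with radius
    r.\<close>
  have "norm (w ^ n) \<le> r ^ n * (1 + (norm z)\<^sup>2 * n)" for n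
  proof -
    have summand: "norm (of_real (R ^ (n - Suc j)) * b ^ j) \<le> r ^ n" if "j < n" for j
    proof -
      have "norm (of_real (R ^ (n - Suc j)) * b ^ j) \<le> R ^ (n - Suc j) * norm b ^ j"
        by (rule order_trans[OF norm_mult_ineq]) (use R in \<open>simp add: norm_power norm_power_ineq mult_left_mono flip: of_real_power\<close>)
      also have "\<dots> \<le> r ^ (n - Suc j) * r ^ j"
        using R r b by (intro mult_mono power_mono) auto
      also have "\<dots> = r ^ (n - 1)" using that by (simp add: power_add[symmetric])
      also have "\<dots> \<le> r ^ n" using R r that by (intro power_increasing) auto
      finally show ?thesis .
    qed
    have "norm (w ^ n) \<le> R ^ n + norm (z * (\<Sum>j<n. of_real (R ^ (n - Suc j)) * b ^ j) * star z)"
      unfolding pw[of n] by (rule order_trans[OF norm_triangle_ineq]) (use R in \<open>simp flip: of_real_power\<close>)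
    also have "norm (z * (\<Sum>j<n. of_real (R ^ (n - Suc j)) * b ^ j) * star z) \<le>
        norm z * norm (\<Sum>j<n. of_real (R ^ (n - Suc j)) * b ^ j) * norm z"
      using norm_mult_ineq[of "z * (\<Sum>j<n. of_real (R ^ (n - Suc j)) * b ^ j)" "star z"]
        mult_right_mono[OF norm_mult_ineq[of z "\<Sum>j<n. of_real (R ^ (n - Suc j)) * b ^ j"], of "norm z"]
      by simp
    also have "norm (\<Sum>j<n. of_real (R ^ (n - Suc j)) * b ^ j) \<le> (\<Sum>j<n. r ^ n)"
      by (rule sum_norm_le) (use summand in auto)
    finally have "norm (w ^ n) \<le> R ^ n + norm z * (\<Sum>j<n. r ^ n) * norm z"
      by (simp add: mult_left_mono mult_right_mono)
    also have "R ^ n \<le> r ^ n" using R r by (intro power_mono) auto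
    finally show ?thesis by (simp add: algebra_simps power2_eq_square)
  qed
  moreover have "star w = w" by (simp add: w_def star_add star_mult star_star)
  ultimately have "norm w ^ 2 ^ k \<le> r ^ 2 ^ k * (1 + (norm z)\<^sup>2 * 2 ^ k)" for k
    using norm_selfadjoint_power[of w k] by (metis of_nat_numeral of_nat_power)
  then have "(norm w / r) ^ 2 ^ k \<le> 1 + (norm z)\<^sup>2 * 2 ^ k" for k
    using r unfolding power_divide by (subst pos_divide_le_eq) (simp_all add: mult.commute)
  then have "norm w / r \<le> 1"
    using r by (intro le_one_if_powers_bounded_linearly) auto
  moreover have "of_real r - (1 - z * star z) = w" by (simp add: w_def r_def)
  ultimately have "norm (of_real r - (1 - z * star z)) \<le> r" using r by simp
  then show ?thesis using r by (auto simp: pos_elem_def star_diff star_mult star_star intro!: exI[of _ r])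
qed

text \<open>With \<open>c = y\<^sup>* y\<close> and \<open>z = y (1 - c)\<^sup>m\<close> the element \<open>z\<^sup>* z = c (1 - c)\<^sup>2\<^sup>m\<close> is bounded above
  independently of \<open>m\<close>, hence so is \<open>z z\<^sup>*\<close>; as \<open>z\<^sup>* z + z z\<^sup>*\<close> is a sum of squares, \<open>z\<^sup>* z\<close> is bounded
  below as well. So the powers of \<open>1 - c\<close> grow at most linearly.\<close>

lemma pos_elem_star_mult: "pos_elem (star y * y)"
proof -
  have main: "pos_elem (star y * y)" if y: "norm y < 1" for y :: 'a
  proof -
    define c where "c = star y * y"
    have sc: "star c = c" by (simp add: c_def star_mult star_star)
    have nc: "norm c < 1" using y by (simp add: c_def norm_star_mult power_less_one_iff)
    obtain s where s: "star s = s" "s * s = 1 - c" "\<And>y. c * y = y * c \<Longrightarrow> s * y = y * s"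
      using selfadjoint_sqrt_one_minus[OF sc nc] by metis
    define w where "w = 1 - c"
    have sw: "star w = w" by (simp add: w_def star_diff sc)
    have w: "w = s * s" by (simp add: w_def s)
    have nw: "norm w \<le> 2" unfolding w_def
      using norm_triangle_ineq4[of 1 c] nc by simp
    have cw: "c * w ^ n = w ^ n * c" for n
      by (rule power_commuting_commutes[symmetric]) (simp add: w_def algebra_simps)
    have even: "norm (c * w ^ (2 * m)) \<le> 2" for m
    proof -
      define z where "z = y * w ^ m"
      define d where "d = star z * z"
      have d: "d = c * w ^ (2 * m)"
      proof -
        have "d = w ^ m * c * w ^ m" by (simp add: d_def z_def star_mult star_power sw c_def mult.assoc)
        also have "\<dots> = c * (w ^ m * w ^ m)" by (simp add: cw[symmetric] mult.assoc)
        finally show ?thesis by (simp add: power_add[symmetric] mult_2)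
      qed
      have sd: "star d = d" by (simp add: d_def star_mult star_star)
      \<comment> \<open>With c = 1 - w the geometric sum turns the sum of the squares of
        \<open>v k\<close>, k < 2 m, into 1 - d - w, and w = s * s. So 1 - d is a sum of squares of
        selfadjoint elements.\<close>
      define v where "v k = (1 - w) * s ^ k" for k
      have sk: "(1 - w) * s ^ k = s ^ k * (1 - w)" for k
        by (rule power_commuting_commutes[symmetric]) (simp add: w algebra_simps)
      have geom: "(1 - w) * (\<Sum>k<n. w ^ k) = 1 - w ^ n" for n
      proof (induction n)
        case (Suc n)
        have "(1 - w) * (\<Sum>k<Suc n. w ^ k) = (1 - w) * (\<Sum>k<n. w ^ k) + (1 - w) * w ^ n"
          by (simp add: distrib_left)
        then show ?case unfolding Suc by (simp add: left_diff_distrib)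
      qed simp
      have "(\<Sum>k<2 * m. v k * v k) = (\<Sum>k<2 * m. (1 - w) * ((1 - w) * w ^ k))"
      proof (intro sum.cong refl)
        fix k
        have "v k * v k = (1 - w) * (s ^ k * (1 - w)) * s ^ k" by (simp add: v_def mult.assoc)
        also have "\<dots> = (1 - w) * ((1 - w) * (s ^ k * s ^ k))" by (simp only: sk[symmetric] mult.assoc)
        also have "s ^ k * s ^ k = w ^ k"
          unfolding w by (metis mult_2 power2_eq_square power_add power_mult)
        finally show "v k * v k = (1 - w) * ((1 - w) * w ^ k)" .
      qed
      also have "\<dots> = (1 - w) * ((1 - w) * (\<Sum>k<2 * m. w ^ k))" by (simp add: sum_distrib_left)
      also have "\<dots> = 1 - d - w" unfolding geom d using cw[of "2 * m"] by (simp add: w_def algebra_simps)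
      finally have "1 - d = s * s + (\<Sum>k<2 * m. v k * v k)" by (simp add: w)
      moreover have "star (v k) = v k" for k
        using sk[of k] by (simp add: v_def star_mult star_power star_diff sw s)
      ultimately have "pos_elem (1 - d)"
        using s(1) by (auto intro!: pos_elem_add pos_elem_sum pos_elem_square)
      then have p1: "pos_elem (1 - z * star z)" unfolding d_def by (rule pos_elem_one_minus_star_commute)
      \<comment> \<open>Up to sign these are the real and imaginary parts of z, and star z * z + z *
        star z = 2 (a a + b b). Adding 1 - z * star z leaves 1 + d, which gives the lower bound for
        d.\<close>
      define a b where "a = (1 / 2) *\<^sub>R (z + star z)" and "b = ((1 / 2) * \<i>) *\<^sub>C (z - star z)"
      have sab: "star a = a" "star b = b"
        by (simp_all add: a_def b_def star_scaleR star_scaleC star_add star_diff star_star add.commute algebra_simps)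
      have "pos_elem (2 *\<^sub>R (a * a + b * b))"
        by (intro pos_elem_scaleR pos_elem_add pos_elem_square sab) simp
      also have "2 *\<^sub>R (a * a + b * b) = star z * z + z * star z"
      proof -
        have b2: "b * b = - ((1 / 4) *\<^sub>R ((z - star z) * (z - star z)))"
          by (simp add: b_def mult_scaleC_left mult_scaleC_right scaleC_of_real[symmetric])
        have "4 *\<^sub>R (a * a + b * b) = (z + star z) * (z + star z) - (z - star z) * (z - star z)"
          by (simp add: a_def b2 scaleR_diff_right)
        also have "\<dots> = 2 *\<^sub>R (star z * z + z * star z)"
          by (simp add: algebra_simps scaleR_2)
        finally have "2 *\<^sub>R (2 *\<^sub>R (a * a + b * b)) = 2 *\<^sub>R (star z * z + z * star z)" by simp
        then show ?thesis by (simp only: scaleR_cancel_left) simp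
      qed
      finally have "pos_elem ((star z * z + z * star z) + (1 - z * star z))" using p1 by (rule pos_elem_add)
      then have "pos_elem (of_real 1 + d)" by (simp add: d_def add.commute)
      then show ?thesis
        using pos_elem_norm_le[OF sd _ _ zero_less_one, of 1] \<open>pos_elem (1 - d)\<close> by (simp add: d)
    qed
    have bound: "norm (c * w ^ n) \<le> 4" for n
    proof (cases "even n")
      case True
      then show ?thesis using even[of "n div 2"] by simp
    next
      case False
      then have "c * w ^ n = c * w ^ (2 * (n div 2)) * w"
        by (simp add: mult.assoc power_Suc2[symmetric])
      then have "norm (c * w ^ n) \<le> norm (c * w ^ (2 * (n div 2))) * norm w"
        by (simp add: norm_mult_ineq)
      also have "\<dots> \<le> 2 * 2" using even[of "n div 2"] nw by (intro mult_mono) auto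
      finally show ?thesis by simp
    qed
    have "norm (w ^ n) \<le> 1 + 4 * real n" for n
    proof (induction n)
      case (Suc n)
      have "w ^ Suc n = w ^ n - c * w ^ n" by (simp add: w_def algebra_simps)
      then show ?case using norm_triangle_ineq4[of "w ^ n" "c * w ^ n"] Suc bound[of n] by simp
    qed simp
    from this[of "2 ^ k" for k] have "norm w ^ 2 ^ k \<le> 1 + 4 * 2 ^ k" for k
      by (simp add: norm_selfadjoint_power[OF sw])
    then have "norm w \<le> 1" by (intro le_one_if_powers_bounded_linearly) auto
    then show ?thesis using sc unfolding pos_elem_def c_def[symmetric] w_def by (auto intro!: exI[of _ 1])
  qed
  define k where "k = norm y + 1"
  have k: "k > 0" by (simp add: k_def add_nonneg_pos)
  have "pos_elem (star ((1 / k) *\<^sub>R y) * ((1 / k) *\<^sub>R y))"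
    by (rule main) (use k in \<open>simp add: k_def\<close>)
  from pos_elem_scaleR[OF this, of "k\<^sup>2"] show ?thesis
    using k by (simp add: star_scaleR power2_eq_square)
qed

text \<open>The negative of a summand is the sum of the others, hence positive like the summand
  itself; antisymmetry makes it 0 and the norm identity makes \<open>y j\<close> vanish. Both the
  invariance of the finite functional and the comparison of projections end here.\<close>

lemma sum_star_mult_eq_0D:
  assumes "finite I" "(\<Sum>i\<in>I. star (y i) * y i) = (0 :: 'a::cstar_algebra)" "j \<in> I"
  shows "y j = 0"
proof -
  have "- (star (y j) * y j) = (\<Sum>i\<in>I - {j}. star (y i) * y i)"
    using assms by (intro minus_unique) (simp add: sum.remove[of I j])
  then have "pos_elem (- (star (y j) * y j))" by (simp add: pos_elem_sum pos_elem_star_mult)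
  then have "star (y j) * y j = 0" using pos_elem_antisym pos_elem_star_mult by blast
  then show ?thesis using norm_star_mult[of "y j"] by simp
qed

section \<open>States\<close>

definition sublinear :: "('a::real_vector \<Rightarrow> real) \<Rightarrow> bool" where
  "sublinear p \<longleftrightarrow> (\<forall>x y. p (x + y) \<le> p x + p y) \<and> (\<forall>r\<ge>0. \<forall>x. p (r *\<^sub>R x) = r * p x)"

lemma sublinear_zero: "sublinear p \<Longrightarrow> p 0 = 0"
  unfolding sublinear_def by (metis mult_zero_left order_refl scaleR_zero_left)

lemma sublinear_lower:
  assumes "sublinear p"
  shows "- p (- x) \<le> p x"
proof -
  have "p (x + - x) \<le> p x + p (- x)" using assms unfolding sublinear_def by blast
  then show ?thesis using sublinear_zero[OF assms] by simp
qed

text \<open>The infimum of p (x + t a) - t p a over t \<ge> 0 lowers p while keeping it sublinear.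
  As p' (- a) \<le> - p a, every linear functional below p' takes at least the value p a at a. This
  serves both the additivity of a minimal functional and the attainment of p at a given
  point.\<close>

lemma sublinear_shift:
  assumes p: "sublinear p"
  obtains p' where "sublinear p'" "\<And>x. p' x \<le> p x" "\<And>x. p' x \<le> p (x + a) - p a"
proof -
  define D where "D x = (\<lambda>t. p (x + t *\<^sub>R a) - t * p a) ` {0..}" for x
  define p' where "p' x = Inf (D x)" for x
  have sub: "p (x + y) \<le> p x + p y" for x y using p by (simp add: sublinear_def)
  have hom: "p (r *\<^sub>R x) = r * p x" if "r \<ge> 0" for r x using p that by (simp add: sublinear_def)
  have bdd: "bdd_below (D x)" for x
  proof (rule bdd_belowI)
    fix d assume "d \<in> D x"
    then obtain t where t: "t \<ge> 0" "d = p (x + t *\<^sub>R a) - t * p a" by (auto simp: D_def)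
    show "- p (- x) \<le> d"
      using sub[of "x + t *\<^sub>R a" "- x"] hom[OF t(1), of a] t by simp
  qed
  have le: "p' x \<le> p (x + t *\<^sub>R a) - t * p a" if "t \<ge> 0" for x t
    unfolding p'_def by (rule cInf_lower[OF _ bdd]) (use that in \<open>auto simp: D_def\<close>)
  have ge: "c \<le> p' x" if "\<And>t. t \<ge> 0 \<Longrightarrow> c \<le> p (x + t *\<^sub>R a) - t * p a" for x c
    unfolding p'_def by (rule cInf_greatest) (use that in \<open>auto simp: D_def\<close>)
  have "p' (x + y) \<le> p' x + p' y" for x y
  proof -
    have "p' (x + y) - (p (x + t *\<^sub>R a) - t * p a) \<le> p' y" if "t \<ge> 0" for t
    proof (rule ge)
      fix u :: real assume "u \<ge> 0"
      have "p' (x + y) \<le> p ((x + t *\<^sub>R a) + (y + u *\<^sub>R a)) - (t + u) * p a"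
        using le[of "t + u" "x + y"] \<open>t \<ge> 0\<close> \<open>u \<ge> 0\<close> by (simp add: algebra_simps)
      also have "\<dots> \<le> p (x + t *\<^sub>R a) + p (y + u *\<^sub>R a) - (t + u) * p a" using sub by simp
      finally show "p' (x + y) - (p (x + t *\<^sub>R a) - t * p a) \<le> p (y + u *\<^sub>R a) - u * p a"
        by (simp add: algebra_simps)
    qed
    then have "p' (x + y) - p' y \<le> p' x" by (intro ge) (simp add: algebra_simps)
    then show ?thesis by simp
  qed
  moreover have "p' (r *\<^sub>R x) = r * p' x" if "r \<ge> 0" for r x
  proof (cases "r = 0")
    case True
    have "p' 0 = 0"
      using le[of 0 0] hom[of 0 0] by (intro antisym ge) (simp_all add: hom)
    then show ?thesis using True by simp
  next
    case False
    with that have r: "r > 0" by simp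
    have eq: "p (r *\<^sub>R x + (r * t) *\<^sub>R a) - (r * t) * p a = r * (p (x + t *\<^sub>R a) - t * p a)" for t x
      using hom[of r "x + t *\<^sub>R a"] r by (simp add: algebra_simps)
    show ?thesis
    proof (rule antisym)
      have "p' (r *\<^sub>R x) / r \<le> p' x"
      proof (rule ge)
        fix t :: real assume "t \<ge> 0"
        then have "p' (r *\<^sub>R x) \<le> r * (p (x + t *\<^sub>R a) - t * p a)"
          unfolding eq[symmetric] using r by (intro le) simp
        then show "p' (r *\<^sub>R x) / r \<le> p (x + t *\<^sub>R a) - t * p a" using r by (simp add: field_simps)
      qed
      then show "p' (r *\<^sub>R x) \<le> r * p' x" using r by (simp add: field_simps)
      show "r * p' x \<le> p' (r *\<^sub>R x)"
      proof (rule ge)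
        fix t :: real assume "t \<ge> 0"
        have "r * p' x \<le> r * (p (x + (t / r) *\<^sub>R a) - (t / r) * p a)"
          using r \<open>t \<ge> 0\<close> by (intro mult_left_mono le) auto
        also have "\<dots> = p (r *\<^sub>R x + t *\<^sub>R a) - t * p a" using eq[of x "t / r"] r by simp
        finally show "r * p' x \<le> p (r *\<^sub>R x + t *\<^sub>R a) - t * p a" .
      qed
    qed
  qed
  ultimately have "sublinear p'" by (simp add: sublinear_def)
  then show ?thesis using that[of p'] le[of 0] le[of 1] by simp
qed

text \<open>The Hahn--Banach theorem: a minimal sublinear functional is linear.\<close>

lemma sublinear_dominates_linear:
  fixes p :: "'a::real_vector \<Rightarrow> real"
  assumes p: "sublinear p"
  obtains f where "linear f" "\<And>x. f x \<le> p x"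
proof -
  define S where "S = {q. sublinear q \<and> (\<forall>x. q x \<le> p x)}"
  \<comment> \<open>The order is reversed, so that maximal elements for Zorn's lemma are the
    pointwise minimal sublinear functionals and chains are bounded by pointwise infima.\<close>
  define below where "below = (\<lambda>q q' :: 'a \<Rightarrow> real. \<forall>x. q' x \<le> q x)"
  have "\<exists>m\<in>S. \<forall>q\<in>S. below m q \<longrightarrow> q = m"
  proof (rule predicate_Zorn)
    show "partial_order_on S (relation_of below S)"
      by (rule partial_order_on_relation_ofI)
        (auto simp: below_def fun_eq_iff intro: order_trans antisym)
    fix C assume C: "C \<in> Chains (relation_of below S)"
    show "\<exists>u\<in>S. \<forall>q\<in>C. below q u"
    proof (cases "C = {}")
      case True
      then show ?thesis using p by (auto simp: S_def)
    next
      case False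
      have CS: "C \<subseteq> S" and tot: "\<And>q q'. q \<in> C \<Longrightarrow> q' \<in> C \<Longrightarrow> below q q' \<or> below q' q"
        using C by (auto simp: Chains_def relation_of_def)
      define u where "u x = (INF q\<in>C. q x)" for x
      have "- p (- x) \<le> q x" if "q \<in> C" for q x
        using sublinear_lower[of q x] that CS by (force simp: S_def intro: order_trans[of _ "- q (- x)"])
      then have bdd: "bdd_below ((\<lambda>q. q x) ` C)" for x by (auto intro!: bdd_belowI)
      have le: "u x \<le> q x" if "q \<in> C" for q x
        unfolding u_def by (rule cINF_lower[OF bdd that])
      have ge: "c \<le> u x" if "\<And>q. q \<in> C \<Longrightarrow> c \<le> q x" for c x
        unfolding u_def using False that by (rule cINF_greatest)
      have "u (x + y) \<le> u x + u y" for x y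
      proof -
        have "u (x + y) - q y \<le> q' x" if q: "q \<in> C" "q' \<in> C" for q q'
        proof -
          obtain q0 where "q0 \<in> C" "q0 x \<le> q' x" "q0 y \<le> q y"
            using tot[OF q] q by (auto simp: below_def)
          moreover have "q0 (x + y) \<le> q0 x + q0 y"
            using \<open>q0 \<in> C\<close> CS by (auto simp: S_def sublinear_def)
          ultimately show ?thesis using le[of q0 "x + y"] by linarith
        qed
        then have "u (x + y) - q y \<le> u x" if "q \<in> C" for q using that by (intro ge)
        then have "u (x + y) - u x \<le> q y" if "q \<in> C" for q using that by force
        then have "u (x + y) - u x \<le> u y" by (intro ge)
        then show ?thesis by simp
      qed
      moreover have "u (r *\<^sub>R x) = r * u x" if "r \<ge> 0" for r x
      proof -
        have hom: "q (r *\<^sub>R x) = r * q x" if "q \<in> C" for q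
          using CS that \<open>r \<ge> 0\<close> by (auto simp: S_def sublinear_def)
        have "u (r *\<^sub>R x) = (INF q\<in>C. r * q x)" unfolding u_def by (rule INF_cong) (auto simp: hom)
        also have "\<dots> = r * u x"
        proof (cases "r = 0")
          case True
          then show ?thesis using False by simp
        next
          case r: False
          show ?thesis
          proof (rule antisym)
            have "(INF q\<in>C. r * q x) / r \<le> u x"
            proof (rule ge)
              fix q assume "q \<in> C"
              then have "(INF q\<in>C. r * q x) \<le> r * q x"
                using bdd[of "r *\<^sub>R x"] hom by (intro cINF_lower) (auto simp: image_def cong: rev_conj_cong)
              then show "(INF q\<in>C. r * q x) / r \<le> q x" using r that by (simp add: field_simps)
            qed
            then show "(INF q\<in>C. r * q x) \<le> r * u x" using r that by (simp add: field_simps)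
            show "r * u x \<le> (INF q\<in>C. r * q x)"
              using False le that by (intro cINF_greatest mult_left_mono) auto
          qed
        qed
        finally show ?thesis .
      qed
      ultimately have "sublinear u" by (simp add: sublinear_def)
      moreover have "u x \<le> p x" for x
      proof -
        obtain q where "q \<in> C" using False by blast
        then show ?thesis using le[of q x] CS by (force simp: S_def intro: order_trans)
      qed
      ultimately show ?thesis using le by (auto simp: S_def below_def)
    qed
  qed
  then obtain m where m: "m \<in> S" and min: "\<And>q. q \<in> S \<Longrightarrow> (\<And>x. q x \<le> m x) \<Longrightarrow> q = m"
    by (auto simp: below_def)
  have sm: "sublinear m" using m by (simp add: S_def)
  \<comment> \<open>By minimality the functional lowered along y is m itself, and its defining bound
    is exactly the missing inequality m x + m y \<le> m (x + y).\<close>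
  have add: "m (x + y) = m x + m y" for x y
  proof -
    obtain q where q: "sublinear q" "\<And>x. q x \<le> m x" "\<And>x. q x \<le> m (x + y) - m y"
      using sublinear_shift[OF sm, of y] by blast
    then have "q \<in> S" using m by (auto simp: S_def intro: order_trans)
    then have "q = m" using min q(2) by blast
    then show ?thesis using q(3)[of x] sm by (simp add: sublinear_def antisym)
  qed
  have hom: "m (r *\<^sub>R x) = r * m x" if "r \<ge> 0" for r x
    using sm that by (simp add: sublinear_def)
  have neg: "m (- x) = - m x" for x using add[of x "- x"] hom[of 0 0] by simp
  have "linear m"
  proof (rule linearI)
    show "m (r *\<^sub>R x) = r *\<^sub>R m x" for r x
      using hom[of r x] hom[of "- r" x] neg[of "r *\<^sub>R x"] by (cases "r \<ge> 0") auto
  qed (rule add)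
  then show ?thesis using that m by (auto simp: S_def)
qed

lemma sublinear_attained_by_linear:
  assumes "sublinear p"
  obtains f where "linear f" "\<And>x. f x \<le> p x" "f a = p a"
proof -
  obtain p' where p': "sublinear p'" "\<And>x. p' x \<le> p x" "\<And>x. p' x \<le> p (x + a) - p a"
    using sublinear_shift[OF assms, of a] by blast
  obtain f where f: "linear f" "\<And>x. f x \<le> p' x" using sublinear_dominates_linear[OF p'(1)] by blast
  have "p 0 = 0" by (rule sublinear_zero[OF assms])
  then have "f (- a) \<le> - p a" using f(2)[of "- a"] p'(3)[of "- a"] by simp
  then have "f a \<ge> p a" using linear_neg[OF f(1), of a] by simp
  moreover have "f x \<le> p x" for x using f(2) p'(2) order_trans by blast
  ultimately show ?thesis using that f(1) antisym by metis
qed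

text \<open>The largest real part in the numerical range.\<close>

definition numerical_sup :: "'a::cstar_algebra \<Rightarrow> real" where
  "numerical_sup x = (INF s\<in>{0..}. norm (of_real s + x) - s)"

lemma numerical_sup_le: "s \<ge> 0 \<Longrightarrow> numerical_sup x \<le> norm (of_real s + x) - s"
  unfolding numerical_sup_def
proof (rule cINF_lower)
  show "bdd_below ((\<lambda>s. norm (of_real s + x) - s) ` {0..})"
  proof (rule bdd_belowI2)
    fix s :: real assume "s \<in> {0..}"
    then show "- norm x \<le> norm (of_real s + x) - s"
      using norm_triangle_ineq4[of "of_real s + x" x] by simp
  qed
qed simp

lemma numerical_sup_ge:
  "(\<And>s. s \<ge> 0 \<Longrightarrow> c \<le> norm (of_real s + x) - s) \<Longrightarrow> c \<le> numerical_sup x"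
  unfolding numerical_sup_def by (rule cINF_greatest) auto

lemma sublinear_numerical_sup: "sublinear (numerical_sup :: 'a::cstar_algebra \<Rightarrow> real)"
  unfolding sublinear_def
proof (intro conjI allI impI)
  fix x y :: 'a
  have "numerical_sup (x + y) - (norm (of_real s + x) - s) \<le> numerical_sup y" if "s \<ge> 0" for s
  proof (rule numerical_sup_ge)
    fix u :: real assume "u \<ge> 0"
    have "of_real (s + u) + (x + y) = (of_real s + x) + (of_real u + y)" by (simp add: algebra_simps)
    then have "norm (of_real (s + u) + (x + y)) \<le> norm (of_real s + x) + norm (of_real u + y)"
      by (metis norm_triangle_ineq)
    then show "numerical_sup (x + y) - (norm (of_real s + x) - s) \<le> norm (of_real u + y) - u"
      using numerical_sup_le[of "s + u" "x + y"] \<open>s \<ge> 0\<close> \<open>u \<ge> 0\<close> by simp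
  qed
  then have "numerical_sup (x + y) - numerical_sup y \<le> numerical_sup x"
    by (intro numerical_sup_ge) (simp add: algebra_simps)
  then show "numerical_sup (x + y) \<le> numerical_sup x + numerical_sup y" by simp
next
  fix r :: real and x :: 'a assume "r \<ge> 0"
  show "numerical_sup (r *\<^sub>R x) = r * numerical_sup x"
  proof (cases "r = 0")
    case True
    have "numerical_sup (0::'a) = 0"
      using numerical_sup_le[of 0 "0::'a"] by (intro antisym numerical_sup_ge) auto
    then show ?thesis using True by simp
  next
    case False
    with \<open>r \<ge> 0\<close> have r: "r > 0" by simp
    have eq: "norm (of_real (r * s) + r *\<^sub>R x) - r * s = r * (norm (of_real s + x) - s)" for s
      using r norm_scaleR[of r "of_real s + x"] by (simp add: algebra_simps of_real_def)
    show ?thesis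
    proof (rule antisym)
      have "numerical_sup (r *\<^sub>R x) / r \<le> numerical_sup x"
      proof (rule numerical_sup_ge)
        fix s :: real assume "s \<ge> 0"
        then show "numerical_sup (r *\<^sub>R x) / r \<le> norm (of_real s + x) - s"
          using numerical_sup_le[of "r * s" "r *\<^sub>R x"] r unfolding eq by (simp add: field_simps)
      qed
      then show "numerical_sup (r *\<^sub>R x) \<le> r * numerical_sup x" using r by (simp add: field_simps)
      show "r * numerical_sup x \<le> numerical_sup (r *\<^sub>R x)"
      proof (rule numerical_sup_ge)
        fix s :: real assume "s \<ge> 0"
        then have "r * numerical_sup x \<le> r * (norm (of_real (s / r) + x) - s / r)"
          using r by (intro mult_left_mono numerical_sup_le) auto
        also have "\<dots> = norm (of_real s + r *\<^sub>R x) - s" using eq[of "s / r"] r by simp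
        finally show "r * numerical_sup x \<le> norm (of_real s + r *\<^sub>R x) - s" .
      qed
    qed
  qed
qed

lemma numerical_sup_pos_elem:
  assumes "pos_elem a"
  shows "numerical_sup (- a) \<le> 0"
proof -
  obtain r where "r \<ge> 0" "norm (of_real r - a) \<le> r" using assms by (auto simp: pos_elem_def)
  then show ?thesis using numerical_sup_le[of r "- a"] by simp
qed

text \<open>By the norm identity, norm (s + \<i> a) ^ 2 \<le> s ^ 2 + norm a ^ 2, and the root of
  the right side exceeds s by an amount that tends to 0 as s grows. The choice s = norm a ^ 2 / e
  makes the excess at most e.\<close>

lemma numerical_sup_skew:
  fixes a :: "'a::cstar_algebra"
  assumes "star a = a"
  shows "numerical_sup (\<i> *\<^sub>C a) \<le> 0"
proof (rule field_le_epsilon)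
  fix e :: real assume e: "e > 0"
  define s where "s = (norm a)\<^sup>2 / e"
  have s: "s \<ge> 0" using e by (simp add: s_def)
  define u where "u = of_real s + \<i> *\<^sub>C a"
  have "star u = of_real s - \<i> *\<^sub>C a" by (simp add: u_def star_add star_scaleC assms)
  moreover have "of_real s * a = a * of_real s" by (simp add: of_real_def)
  ultimately have "star u * u = of_real (s\<^sup>2) + a * a"
    by (simp only:) (simp add: u_def algebra_simps mult_scaleC_left mult_scaleC_right scaleC_scaleC power2_eq_square)
  then have "(norm u)\<^sup>2 = norm (of_real (s\<^sup>2) + a * a)" using norm_star_mult[of u] by simp
  also have "\<dots> \<le> s\<^sup>2 + (norm a)\<^sup>2"
  proof -
    have "norm (of_real (s\<^sup>2) + a * a) \<le> norm (of_real (s\<^sup>2) :: 'a) + norm (a * a)" by (rule norm_triangle_ineq)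
    also have "norm (of_real (s\<^sup>2) :: 'a) = s\<^sup>2" by (metis norm_of_real abs_power2)
    also have "norm (a * a) = (norm a)\<^sup>2" using norm_star_mult[of a] by (simp add: assms)
    finally show ?thesis .
  qed
  also have "\<dots> \<le> (s + e)\<^sup>2" using e by (simp add: s_def power2_sum)
  finally have "norm u \<le> s + e" by (rule power2_le_imp_le) (use s e in simp)
  then show "numerical_sup (\<i> *\<^sub>C a) \<le> 0 + e" using numerical_sup_le[OF s, of "\<i> *\<^sub>C a"] by (simp add: u_def)
qed

text \<open>A real functional dominated by \<open>numerical_sup\<close> already is the real part of
  a state: domination at 1 and - 1 normalises it, at - star x * x it gives positivity, and at \<i> x
  and - \<i> x with x selfadjoint it makes the complexified functional real on selfadjoint
  elements.\<close>

lemma cstar_state_attaining: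
  fixes a :: "'a::cstar_algebra"
  obtains \<phi> where "cstar_state \<phi>" "Re (\<phi> a) = numerical_sup a"
proof -
  obtain f :: "'a \<Rightarrow> real" where f: "linear f" "\<And>x. f x \<le> numerical_sup x" "f a = numerical_sup a"
    using sublinear_attained_by_linear[OF sublinear_numerical_sup] by blast
  define \<phi> where "\<phi> x = Complex (f x) (- f (\<i> *\<^sub>C x))" for x
  have add: "f (x + y) = f x + f y" for x y by (rule linear_add[OF f(1)])
  have scale: "f (r *\<^sub>R x) = r * f x" for r x using linear_scale[OF f(1)] by simp
  have fc: "f (c *\<^sub>C x) = Re c * f x + Im c * f (\<i> *\<^sub>C x)" for c x
  proof -
    have "c *\<^sub>C x = complex_of_real (Re c) *\<^sub>C x + complex_of_real (Im c) *\<^sub>C \<i> *\<^sub>C x"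
      by (simp add: complex_eq[of c, symmetric] scaleC_scaleC scaleC_add_left[symmetric] mult.commute)
    then show ?thesis by (simp only: scaleC_of_real add scale)
  qed
  have "clinear_on UNIV \<phi>"
    unfolding clinear_on_def
  proof (intro conjI ballI allI)
    show "\<phi> (x + y) = \<phi> x + \<phi> y" for x y by (simp add: \<phi>_def add scaleC_add_right complex_eq_iff)
    show "\<phi> (c *\<^sub>C x) = c *\<^sub>C \<phi> x" for c x
      using fc[of c x] fc[of "\<i> * c" x] by (simp add: \<phi>_def complex_eq_iff scaleC_complex_def scaleC_scaleC)
  qed
  moreover have sa: "f (\<i> *\<^sub>C x) = 0" if "star x = x" for x
  proof -
    have "f (\<i> *\<^sub>C x) \<le> 0" using f(2)[of "\<i> *\<^sub>C x"] numerical_sup_skew[OF that] by simp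
    moreover have "f (\<i> *\<^sub>C (- x)) \<le> 0"
      using f(2)[of "\<i> *\<^sub>C (- x)"] numerical_sup_skew[of "- x"] that by (simp add: star_minus)
    moreover have "f (\<i> *\<^sub>C (- x)) = - f (\<i> *\<^sub>C x)"
      using linear_neg[OF f(1), of "\<i> *\<^sub>C x"] by simp
    ultimately show ?thesis by simp
  qed
  moreover have "\<phi> 1 = 1"
  proof -
    have "f 1 \<le> 1" using f(2)[of 1] numerical_sup_le[of 0 "1::'a"] by simp
    moreover have "f (- 1) \<le> - 1" using f(2)[of "- 1"] numerical_sup_le[of 1 "- 1::'a"] by simp
    ultimately have "f 1 = 1" using linear_neg[OF f(1), of 1] by simp
    then show ?thesis using sa[of 1] by (simp add: \<phi>_def complex_eq_iff)
  qed
  moreover have "Re (\<phi> (star x * x)) \<ge> 0" for x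
    using f(2)[of "- (star x * x)"] numerical_sup_pos_elem[OF pos_elem_star_mult, of x]
      linear_neg[OF f(1), of "star x * x"] by (simp add: \<phi>_def)
  moreover have "Im (\<phi> (star x * x)) = 0" for x
    using sa[of "star x * x"] by (simp add: \<phi>_def star_mult star_star)
  ultimately have "cstar_state \<phi>" by (simp add: cstar_state_def)
  then show ?thesis using that f(3) by (simp add: \<phi>_def)
qed

section \<open>Elementary properties of states\<close>

lemma cstar_state_add: "cstar_state \<phi> \<Longrightarrow> \<phi> (x + y) = \<phi> x + \<phi> y"
  and cstar_state_scaleC: "cstar_state \<phi> \<Longrightarrow> \<phi> (c *\<^sub>C x) = c * \<phi> x"
  by (simp_all add: cstar_state_def clinear_on_def scaleC_complex_def)

lemma cstar_state_zero: "cstar_state \<phi> \<Longrightarrow> \<phi> 0 = 0"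
  using cstar_state_scaleC[of \<phi> 0 0] by simp

lemma cstar_state_sum: "cstar_state \<phi> \<Longrightarrow> \<phi> (sum f I) = (\<Sum>i\<in>I. \<phi> (f i))"
  by (induction I rule: infinite_finite_induct) (simp_all add: cstar_state_add cstar_state_zero)

lemma cstar_state_minus: "cstar_state \<phi> \<Longrightarrow> \<phi> (- x) = - \<phi> x"
  using cstar_state_scaleC[of \<phi> "-1" x] by simp

lemma cstar_state_diff: "cstar_state \<phi> \<Longrightarrow> \<phi> (x - y) = \<phi> x - \<phi> y"
  using cstar_state_add[of \<phi> x "- y"] by (simp add: cstar_state_minus)

text \<open>Positivity at 1 + x makes the value at x + star x real; the same for \<i> x determines
  the other component.\<close>

lemma cstar_state_star:
  assumes \<phi>: "cstar_state \<phi>"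
  shows "\<phi> (star x) = cnj (\<phi> x)"
proof -
  have "Im (\<phi> x + \<phi> (star x)) = 0" for x
  proof -
    have "star (1 + x) * (1 + x) = 1 + (x + star x) + star x * x" by (simp add: star_add algebra_simps)
    then have "Im (\<phi> (star (1 + x) * (1 + x))) = Im (\<phi> 1) + Im (\<phi> x + \<phi> (star x)) + Im (\<phi> (star x * x))"
      by (simp add: cstar_state_add[OF \<phi>])
    then show ?thesis using \<phi> unfolding cstar_state_def by simp
  qed
  from this[of x] this[of "\<i> *\<^sub>C x"] show ?thesis
    by (simp add: star_scaleC cstar_state_minus[OF \<phi>] cstar_state_scaleC[OF \<phi>] complex_eq_iff)
qed

text \<open>For selfadjoint a the states attaining \<open>numerical_sup\<close> at a and at - a show
  that both suprema are 0. Hence e + a and e - a are positive for every e > 0, which bounds norm a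
  by e. Identities in the algebra can from here on be tested on scalars.\<close>

lemma cstar_states_separate:
  fixes y :: "'a::cstar_algebra"
  assumes "\<And>\<phi>. cstar_state \<phi> \<Longrightarrow> \<phi> y = 0"
  shows "y = 0"
proof -
  have sa: "a = 0" if a: "star a = a" "\<And>\<phi>. cstar_state \<phi> \<Longrightarrow> \<phi> a = 0" for a :: 'a
  proof -
    have pos: "pos_elem (of_real e - b)" if e: "e > 0" and b: "b = a \<or> b = - a" for b e
    proof -
      obtain \<phi> where \<phi>: "cstar_state \<phi>" "Re (\<phi> b) = numerical_sup b" by (rule cstar_state_attaining)
      have "\<phi> b = 0" using a(2)[OF \<phi>(1)] b by (auto simp: cstar_state_minus[OF \<phi>(1)])
      then have "numerical_sup b = 0" using \<phi>(2) by simp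
      have "\<exists>s\<ge>0. norm (of_real s + b) - s < e"
      proof (rule ccontr)
        assume "\<not> ?thesis"
        then have "e \<le> numerical_sup b" by (intro numerical_sup_ge) force
        then show False using e \<open>numerical_sup b = 0\<close> by simp
      qed
      then obtain s where s: "s \<ge> 0" "norm (of_real s + b) - s < e" by blast
      moreover have "of_real (s + e) - (of_real e - b) = of_real s + b" by simp
      ultimately have "norm (of_real (s + e) - (of_real e - b)) \<le> s + e" by simp
      then show ?thesis unfolding pos_elem_def
        using s e a(1) b by (auto simp: star_diff star_add star_minus intro!: exI[of _ "s + e"])
    qed
    have "norm a \<le> 0 + e" if "e > 0" for e
    proof -
      have "norm a \<le> e / 2 + e / 2"
        by (rule pos_elem_norm_le) (use pos[of "e / 2" a] pos[of "e / 2" "- a"] that a(1) in auto)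
      then show ?thesis by simp
    qed
    then show "a = 0" using field_le_epsilon[of "norm a" 0] by simp
  qed
  have 1: "y + star y = 0"
    by (rule sa) (simp_all add: star_add star_star add.commute cstar_state_add cstar_state_star assms)
  have 2: "\<i> *\<^sub>C (y - star y) = 0"
    by (rule sa) (simp_all add: star_scaleC star_diff star_star cstar_state_scaleC
        cstar_state_diff cstar_state_star assms cstar.scale_right_diff_distrib)
  have "y - star y = 0" using 2 by simp
  then have "2 *\<^sub>R y = 0" using 1 by (simp add: scaleR_2)
  then show ?thesis by simp
qed

section \<open>Slices of the minimal tensor product\<close>

definition psd_on :: "'i set \<Rightarrow> ('i \<Rightarrow> 'i \<Rightarrow> complex) \<Rightarrow> bool" where
  "psd_on I A \<longleftrightarrow> (\<forall>i\<in>I. \<forall>j\<in>I. A j i = cnj (A i j)) \<and>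
     (\<forall>\<xi>. (\<Sum>i\<in>I. \<Sum>j\<in>I. cnj (\<xi> i) * A i j * \<xi> j) \<in> \<real>\<^sub>\<ge>\<^sub>0)"

text \<open>The Schur product theorem, by splitting off rank-one summands as in the Cholesky decomposition.\<close>

lemma sum_mult_psd_nonneg:
  assumes "finite I" "psd_on I A" "psd_on I B"
  shows "(\<Sum>i\<in>I. \<Sum>j\<in>I. A i j * B i j) \<in> \<real>\<^sub>\<ge>\<^sub>0"
  using assms
proof (induction I arbitrary: A rule: finite_induct)
  case (insert k I)
  let ?K = "insert k I"
  have quad: "(\<Sum>i\<in>?K. \<Sum>j\<in>?K. cnj (\<xi> i) * A i j * \<xi> j) \<in> \<real>\<^sub>\<ge>\<^sub>0"
    and quadB: "(\<Sum>i\<in>?K. \<Sum>j\<in>?K. cnj (\<xi> i) * B i j * \<xi> j) \<in> \<real>\<^sub>\<ge>\<^sub>0" for \<xi>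
    using insert.prems by (auto simp: psd_on_def)
  have herm: "A j i = cnj (A i j)" if "i \<in> ?K" "j \<in> ?K" for i j
    using insert.prems(1) that unfolding psd_on_def by blast
  have hk: "A i k = cnj (A k i)" if "i \<in> I" for i using herm[of k i] that by simp
  have BI: "psd_on I B"
    unfolding psd_on_def
  proof (intro conjI ballI allI)
    fix \<xi> :: "'a \<Rightarrow> complex"
    show "(\<Sum>i\<in>I. \<Sum>j\<in>I. cnj (\<xi> i) * B i j * \<xi> j) \<in> \<real>\<^sub>\<ge>\<^sub>0"
    proof -
      have ne: "i \<noteq> k" if "i \<in> I" for i using that insert.hyps by blast
      show ?thesis using quadB[of "\<xi>(k := 0)"] insert.hyps by (simp add: ne cong: sum.cong)
    qed
  next
    fix i j assume "i \<in> I" "j \<in> I"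
    then show "B j i = cnj (B i j)" using insert.prems(2) unfolding psd_on_def by blast
  qed
  have split: "(\<Sum>i\<in>?K. \<Sum>j\<in>?K. f i j) =
      f k k + (\<Sum>j\<in>I. f k j) + (\<Sum>i\<in>I. f i k) + (\<Sum>i\<in>I. \<Sum>j\<in>I. f i j)" for f :: "'a \<Rightarrow> 'a \<Rightarrow> complex"
    using insert.hyps by (simp add: sum.distrib)
  define d where "d = A k k"
  have d: "d \<in> \<real>\<^sub>\<ge>\<^sub>0"
    using quad[of "\<lambda>i. if i = k then 1 else 0"] insert.hyps
    by (subst (asm) split) (simp add: d_def sum.neutral cong: sum.cong if_cong)
  define v where "v j = (\<Sum>i\<in>I. A k i * j i)" for j :: "'a \<Rightarrow> complex"
  have ext: "(\<Sum>i\<in>?K. \<Sum>j\<in>?K. cnj ((\<xi>(k := c)) i) * A i j * (\<xi>(k := c)) j) =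
      cnj c * d * c + cnj c * v \<xi> + c * cnj (v \<xi>) + (\<Sum>i\<in>I. \<Sum>j\<in>I. cnj (\<xi> i) * A i j * \<xi> j)" for \<xi> c
  proof -
    have ne: "i \<noteq> k" if "i \<in> I" for i using that insert.hyps by blast
    show ?thesis
      unfolding split v_def d_def
      by (simp add: ne sum_distrib_left sum_distrib_right mult_ac hk cong: sum.cong)
  qed
  show ?case
  proof (cases "d = 0")
    case True
    have "A k i = 0" if i: "i \<in> I" for i
    proof (rule ccontr)
      assume nz: "A k i \<noteq> 0"
      define \<xi> where "\<xi> j = (if j = i then 1 else 0 :: complex)" for j
      define S where "S = (\<Sum>i\<in>I. \<Sum>j\<in>I. cnj (\<xi> i) * A i j * \<xi> j)"
      have v: "v \<xi> = A k i" using i insert.hyps by (simp add: v_def \<xi>_def if_distrib sum.delta cong: if_cong)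
      \<comment> \<open>This c makes each of the two cross terms equal to - (|Re S| + 1), so the
        quadratic form of A would be negative: a zero on the diagonal forces its row to
        vanish.\<close>
      define c where "c = - of_real (\<bar>Re S\<bar> + 1) / (A k i * cnj (A k i)) * A k i"
      have "cnj c * A k i + c * cnj (A k i) + S \<in> \<real>\<^sub>\<ge>\<^sub>0"
        using quad[of "\<xi>(k := c)"] unfolding ext v S_def True by simp
      moreover have "cnj c * A k i = - of_real (\<bar>Re S\<bar> + 1)" "c * cnj (A k i) = - of_real (\<bar>Re S\<bar> + 1)"
        using nz by (simp_all add: c_def)
      ultimately have "0 \<le> - (2 * \<bar>Re S\<bar>) - 2 + Re S" by (simp add: complex_nonneg_Reals_iff)
      then show False by linarith
    qed
    then have "A i k = 0" "A k i = 0" if "i \<in> I" for i using that herm[of k i] by auto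
    then have "(\<Sum>i\<in>?K. \<Sum>j\<in>?K. A i j * B i j) = (\<Sum>i\<in>I. \<Sum>j\<in>I. A i j * B i j)"
      unfolding split using True by (simp add: d_def)
    moreover have "psd_on I A"
      unfolding psd_on_def
    proof (intro conjI ballI allI)
      fix \<xi> :: "'a \<Rightarrow> complex"
      show "(\<Sum>i\<in>I. \<Sum>j\<in>I. cnj (\<xi> i) * A i j * \<xi> j) \<in> \<real>\<^sub>\<ge>\<^sub>0"
        using quad[of "\<xi>(k := 0)"] unfolding ext by simp
    next
      fix i j assume "i \<in> I" "j \<in> I"
      then show "A j i = cnj (A i j)" by (intro herm) auto
    qed
    ultimately show ?thesis using insert.IH BI by simp
  next
    case False
    have cd: "cnj d = d" using herm[of k k] by (simp add: d_def)
    \<comment> \<open>The Schur complement of the entry (k, k). Completing the square with c = - v /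
      d identifies its form with a value of the form of A, and the rank-one part split off
      contributes the value of the form of B at the row \<open>A k\<close>, divided by d.\<close>
    define A' where "A' i j = A i j - A i k * A k j / d" for i j
    have "psd_on I A'"
      unfolding psd_on_def
    proof (intro conjI ballI allI)
      fix i j assume ij: "i \<in> I" "j \<in> I"
      have "A j i = cnj (A i j)" "A j k = cnj (A k j)" "A k i = cnj (A i k)"
        using ij herm[of i j] herm[of k j] herm[of i k] by auto
      then show "A' j i = cnj (A' i j)" unfolding A'_def by (simp add: cd)
    next
      fix \<xi> :: "'a \<Rightarrow> complex"
      define c where "c = - v \<xi> / d"
      have "(\<Sum>i\<in>I. \<Sum>j\<in>I. cnj (\<xi> i) * A' i j * \<xi> j) =
          (\<Sum>i\<in>I. \<Sum>j\<in>I. cnj (\<xi> i) * A i j * \<xi> j) - (\<Sum>i\<in>I. \<Sum>j\<in>I. cnj (\<xi> i) * A i k * (A k j * \<xi> j)) / d"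
        by (simp add: A'_def sum_subtractf sum_divide_distrib algebra_simps diff_divide_distrib)
      also have "(\<Sum>i\<in>I. \<Sum>j\<in>I. cnj (\<xi> i) * A i k * (A k j * \<xi> j)) = cnj (v \<xi>) * v \<xi>"
        by (simp add: v_def sum_product hk cong: sum.cong) (simp add: mult_ac)
      also have "(\<Sum>i\<in>I. \<Sum>j\<in>I. cnj (\<xi> i) * A i j * \<xi> j) - cnj (v \<xi>) * v \<xi> / d =
          cnj c * d * c + cnj c * v \<xi> + c * cnj (v \<xi>) + (\<Sum>i\<in>I. \<Sum>j\<in>I. cnj (\<xi> i) * A i j * \<xi> j)"
        using False by (simp add: c_def cd)
      finally show "(\<Sum>i\<in>I. \<Sum>j\<in>I. cnj (\<xi> i) * A' i j * \<xi> j) \<in> \<real>\<^sub>\<ge>\<^sub>0"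
        using quad[of "\<xi>(k := c)"] unfolding ext by simp
    qed
    then have n1: "(\<Sum>i\<in>I. \<Sum>j\<in>I. A' i j * B i j) \<in> \<real>\<^sub>\<ge>\<^sub>0" by (intro insert.IH BI)
    have n2: "(\<Sum>i\<in>?K. \<Sum>j\<in>?K. cnj (A k i) * B i j * A k j) / d \<in> \<real>\<^sub>\<ge>\<^sub>0"
      using quadB[of "A k"] d by simp
    have e1: "(\<Sum>i\<in>?K. \<Sum>j\<in>?K. cnj (A k i) * B i j * A k j) / d =
        (\<Sum>i\<in>?K. \<Sum>j\<in>?K. A i k * A k j / d * B i j)"
      unfolding sum_divide_distrib by (intro sum.cong refl) (use herm[of k] in auto)
    have e2: "(\<Sum>i\<in>I. \<Sum>j\<in>I. A' i j * B i j) + (\<Sum>i\<in>?K. \<Sum>j\<in>?K. A i k * A k j / d * B i j) =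
        (\<Sum>i\<in>?K. \<Sum>j\<in>?K. A i j * B i j)"
    proof -
      have "(\<Sum>i\<in>I. \<Sum>j\<in>I. A' i j * B i j) + (\<Sum>i\<in>I. \<Sum>j\<in>I. A i k * A k j / d * B i j) = (\<Sum>i\<in>I. \<Sum>j\<in>I. A i j * B i j)"
        by (simp add: A'_def sum.distrib[symmetric] algebra_simps)
      then show ?thesis unfolding split using False
        by (simp add: d_def[symmetric] algebra_simps)
    qed
    show ?thesis using nonneg_Reals_add_I[OF n1 n2] unfolding e1 e2 .
  qed
qed simp

text \<open>The GNS sesquilinear form of the product functional on the algebraic tensor product,
  conjugate-linear in the left list. Its additivity and scaling rules replace a Hilbert
  space.\<close>

definition product_form ::
  "('a::cstar_algebra \<Rightarrow> complex) \<Rightarrow> ('b::cstar_algebra \<Rightarrow> complex) \<Rightarrow> ('a \<times> 'b) list \<Rightarrow> ('a \<times> 'b) list \<Rightarrow> complex"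
  where "product_form \<phi> \<psi> v w = (\<Sum>(a, b)\<leftarrow>v. \<Sum>(c, d)\<leftarrow>w. \<phi> (star a * c) * \<psi> (star b * d))"

lemma product_functional_eq_product_form:
  "product_functional \<phi> \<psi> (tensor_mult (tensor_star v) w) = product_form \<phi> \<psi> v w"
  unfolding product_functional_def tensor_eval_def tensor_mult_def tensor_star_def product_form_def
  by (induction v) (auto simp: o_def case_prod_beta)

lemma product_form_append:
  "product_form \<phi> \<psi> (v @ v') w = product_form \<phi> \<psi> v w + product_form \<phi> \<psi> v' w"
  "product_form \<phi> \<psi> v (w @ w') = product_form \<phi> \<psi> v w + product_form \<phi> \<psi> v w'"
  unfolding product_form_def by (induction v) (auto simp: case_prod_beta sum_list_addf)

lemma product_form_scale_left:
  assumes "cstar_state \<phi>"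
  shows "product_form \<phi> \<psi> (map (\<lambda>(a, b). (k *\<^sub>C a, b)) v) w = cnj k * product_form \<phi> \<psi> v w"
  unfolding product_form_def
  by (induction v) (auto simp: case_prod_beta o_def star_scaleC mult_scaleC_left mult.assoc
      cstar_state_scaleC[OF assms] sum_list_const_mult distrib_left)

lemma product_form_scale_right:
  assumes "cstar_state \<phi>"
  shows "product_form \<phi> \<psi> v (map (\<lambda>(a, b). (k *\<^sub>C a, b)) w) = k * product_form \<phi> \<psi> v w"
  unfolding product_form_def
  by (induction v) (auto simp: case_prod_beta o_def mult_scaleC_right mult.assoc
      cstar_state_scaleC[OF assms] sum_list_const_mult distrib_left)

lemma psd_on_state:
  fixes a :: "'i \<Rightarrow> 'a::cstar_algebra"
  assumes \<phi>: "cstar_state \<phi>"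
  shows "psd_on I (\<lambda>i j. \<phi> (star (a i) * a j))"
  unfolding psd_on_def
proof (intro conjI ballI allI)
  show "\<phi> (star (a j) * a i) = cnj (\<phi> (star (a i) * a j))" for i j
    using cstar_state_star[OF \<phi>, of "star (a i) * a j"] by (simp add: star_mult star_star)
  fix \<xi>
  have "(\<Sum>i\<in>I. \<Sum>j\<in>I. cnj (\<xi> i) * \<phi> (star (a i) * a j) * \<xi> j) =
      \<phi> (star (\<Sum>i\<in>I. \<xi> i *\<^sub>C a i) * (\<Sum>j\<in>I. \<xi> j *\<^sub>C a j))"
    by (simp add: star_sum star_scaleC sum_product cstar_state_sum[OF \<phi>] mult_scaleC_left
        mult_scaleC_right cstar_state_scaleC[OF \<phi>] mult_ac)
  then show "(\<Sum>i\<in>I. \<Sum>j\<in>I. cnj (\<xi> i) * \<phi> (star (a i) * a j) * \<xi> j) \<in> \<real>\<^sub>\<ge>\<^sub>0"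
    using \<phi> by (simp add: complex_nonneg_Reals_iff cstar_state_def)
qed

text \<open>The two legs of w give two Gram matrices, and the form is the sum of the entries of
  their Schur product.\<close>

lemma product_form_nonneg:
  assumes "cstar_state \<phi>" "cstar_state \<psi>"
  shows "product_form \<phi> \<psi> w w \<in> \<real>\<^sub>\<ge>\<^sub>0"
proof -
  have "product_form \<phi> \<psi> w w = (\<Sum>i<length w. \<Sum>j<length w.
      \<phi> (star (fst (w ! i)) * fst (w ! j)) * \<psi> (star (snd (w ! i)) * snd (w ! j)))"
    by (simp add: product_form_def sum_list_sum_nth case_prod_beta atLeast0LessThan)
  then show ?thesis
    using sum_mult_psd_nonneg[OF finite_lessThan[of "length w"]
        psd_on_state[OF assms(1), of _ "\<lambda>i. fst (w ! i)"] psd_on_state[OF assms(2), of _ "\<lambda>i. snd (w ! i)"]]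
    by simp
qed

section \<open>Boundedness of left multiplication and vanishing of product functionals\<close>

lemma tensor_mult_Cons:
  "tensor_mult ((a, b) # x) w = map (\<lambda>(c, d). (a * c, b * d)) w @ tensor_mult x w"
  by (simp add: tensor_mult_def)

lemma product_form_map_map:
  "product_form \<phi> \<psi> (map f v) (map g w) =
   (\<Sum>p\<leftarrow>v. \<Sum>q\<leftarrow>w. \<phi> (star (fst (f p)) * fst (g q)) * \<psi> (star (snd (f p)) * snd (g q)))"
  by (simp add: product_form_def o_def case_prod_beta)

text \<open>Nonnegativity of a form on vectors multiplied by this s is the same as a bound for
  multiplication by a. The summand 1 in the constant keeps the argument of the root series strictly
  below norm 1.\<close>

lemma exists_sqrt_complement:
  fixes a :: "'a::cstar_algebra"
  obtains s where "star s * s = 1 - (1 / (norm a + 1)\<^sup>2) *\<^sub>R (star a * a)"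
proof -
  define x where "x = (1 / (norm a + 1)\<^sup>2) *\<^sub>R (star a * a)"
  have "norm x = (norm a)\<^sup>2 / (norm a + 1)\<^sup>2" by (simp add: x_def norm_star_mult)
  also have "\<dots> < 1"
  proof -
    have "(norm a)\<^sup>2 < (norm a + 1)\<^sup>2" by (intro power_strict_mono) auto
    then show ?thesis by (subst divide_less_eq_1_pos) (auto intro: zero_less_power add_nonneg_pos)
  qed
  finally have "norm x < 1" .
  moreover have "star x = x" by (simp add: x_def star_scaleR star_mult star_star)
  ultimately show ?thesis using selfadjoint_sqrt_one_minus[of x] that by (metis x_def)
qed

text \<open>One leg at a time: the form at the vector multiplied by the complementary root is
  nonnegative and equals the difference of the two sides, up to the scaling factor.\<close>

lemma product_form_mult_left_le:
  assumes "cstar_state \<phi>" "cstar_state \<psi>"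
  shows "Re (product_form \<phi> \<psi> (map (\<lambda>(c, d). (a * c, b * d)) w) (map (\<lambda>(c, d). (a * c, b * d)) w))
    \<le> (norm a + 1)\<^sup>2 * ((norm b + 1)\<^sup>2 * Re (product_form \<phi> \<psi> w w))"
proof -
  have sR: "\<theta> (r *\<^sub>R x) = of_real r * \<theta> x" if "cstar_state \<theta>" for \<theta> :: "'z::cstar_algebra \<Rightarrow> complex" and r x
    using cstar_state_scaleC[OF that, of "of_real r" x] by (simp add: scaleC_of_real)
  have left: "Re (product_form \<phi> \<psi> (map (\<lambda>(c, d). (a * c, d)) v) (map (\<lambda>(c, d). (a * c, d)) v))
      \<le> (norm a + 1)\<^sup>2 * Re (product_form \<phi> \<psi> v v)" for v :: "('a \<times> 'b) list"
  proof -
    define r where "r = 1 / (norm a + 1)\<^sup>2"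
    obtain s where s: "star s * s = 1 - r *\<^sub>R (star a * a)"
      unfolding r_def by (rule exists_sqrt_complement)
    have "\<phi> (star (s * x) * (s * y)) = \<phi> (star x * y) - of_real r * \<phi> (star (a * x) * (a * y))" for x y
    proof -
      have "star (s * x) * (s * y) = star x * (star s * s) * y" by (simp add: star_mult mult.assoc)
      also have "\<dots> = star x * y - r *\<^sub>R (star (a * x) * (a * y))"
        unfolding s by (simp add: star_mult mult.assoc algebra_simps)
      finally show ?thesis by (simp only: cstar_state_diff[OF assms(1)] sR[OF assms(1)])
    qed
    then have "product_form \<phi> \<psi> (map (\<lambda>(c, d). (s * c, d)) v) (map (\<lambda>(c, d). (s * c, d)) v) =
        product_form \<phi> \<psi> v v - of_real r *
          product_form \<phi> \<psi> (map (\<lambda>(c, d). (a * c, d)) v) (map (\<lambda>(c, d). (a * c, d)) v)"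
      unfolding product_form_map_map
      by (simp add: product_form_def case_prod_unfold left_diff_distrib sum_list_subtractf
          sum_list_const_mult mult.assoc)
    moreover have "Re (product_form \<phi> \<psi> (map (\<lambda>(c, d). (s * c, d)) v) (map (\<lambda>(c, d). (s * c, d)) v)) \<ge> 0"
      using product_form_nonneg[OF assms] by (simp add: complex_nonneg_Reals_iff)
    ultimately have "r * Re (product_form \<phi> \<psi> (map (\<lambda>(c, d). (a * c, d)) v) (map (\<lambda>(c, d). (a * c, d)) v)) \<le> Re (product_form \<phi> \<psi> v v)"
      by simp
    moreover have "(norm a + 1)\<^sup>2 > 0" by (intro zero_less_power) (simp add: add_nonneg_pos)
    ultimately show ?thesis by (simp add: r_def divide_le_eq mult.commute)
  qed
  have right: "Re (product_form \<phi> \<psi> (map (\<lambda>(c, d). (c, b * d)) v) (map (\<lambda>(c, d). (c, b * d)) v))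
      \<le> (norm b + 1)\<^sup>2 * Re (product_form \<phi> \<psi> v v)" for v :: "('a \<times> 'b) list"
  proof -
    define r where "r = 1 / (norm b + 1)\<^sup>2"
    obtain s where s: "star s * s = 1 - r *\<^sub>R (star b * b)"
      unfolding r_def by (rule exists_sqrt_complement)
    have "\<psi> (star (s * x) * (s * y)) = \<psi> (star x * y) - of_real r * \<psi> (star (b * x) * (b * y))" for x y
    proof -
      have "star (s * x) * (s * y) = star x * (star s * s) * y" by (simp add: star_mult mult.assoc)
      also have "\<dots> = star x * y - r *\<^sub>R (star (b * x) * (b * y))"
        unfolding s by (simp add: star_mult mult.assoc algebra_simps)
      finally show ?thesis by (simp only: cstar_state_diff[OF assms(2)] sR[OF assms(2)])
    qed
    then have "product_form \<phi> \<psi> (map (\<lambda>(c, d). (c, s * d)) v) (map (\<lambda>(c, d). (c, s * d)) v) =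
        product_form \<phi> \<psi> v v - of_real r *
          product_form \<phi> \<psi> (map (\<lambda>(c, d). (c, b * d)) v) (map (\<lambda>(c, d). (c, b * d)) v)"
      unfolding product_form_map_map
      by (simp add: product_form_def case_prod_unfold right_diff_distrib sum_list_subtractf
          sum_list_const_mult mult.left_commute)
    moreover have "Re (product_form \<phi> \<psi> (map (\<lambda>(c, d). (c, s * d)) v) (map (\<lambda>(c, d). (c, s * d)) v)) \<ge> 0"
      using product_form_nonneg[OF assms] by (simp add: complex_nonneg_Reals_iff)
    ultimately have "r * Re (product_form \<phi> \<psi> (map (\<lambda>(c, d). (c, b * d)) v) (map (\<lambda>(c, d). (c, b * d)) v)) \<le> Re (product_form \<phi> \<psi> v v)"
      by simp
    moreover have "(norm b + 1)\<^sup>2 > 0" by (intro zero_less_power) (simp add: add_nonneg_pos)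
    ultimately show ?thesis by (simp add: r_def divide_le_eq mult.commute)
  qed
  have eq: "map (\<lambda>(c, d). (a * c, b * d)) w = map (\<lambda>(c, d). (a * c, d)) (map (\<lambda>(c, d). (c, b * d)) w)"
    by (simp add: case_prod_beta)
  show ?thesis
    unfolding eq by (rule order_trans[OF left mult_left_mono[OF right]]) simp
qed

lemma product_form_parallelogram_le:
  assumes "cstar_state \<phi>" "cstar_state \<psi>"
  shows "Re (product_form \<phi> \<psi> (v @ w) (v @ w)) \<le>
    2 * Re (product_form \<phi> \<psi> v v) + 2 * Re (product_form \<phi> \<psi> w w)"
proof -
  define w' where "w' = map (\<lambda>(a, b). ((- 1) *\<^sub>C a, b)) w"
  have "Re (product_form \<phi> \<psi> (v @ w') (v @ w')) \<ge> 0"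
    using product_form_nonneg[OF assms] by (simp add: complex_nonneg_Reals_iff)
  then show ?thesis
    unfolding product_form_append w'_def product_form_scale_left[OF assms(1)] product_form_scale_right[OF assms(1)]
    by simp
qed

text \<open>The constant depends on x alone, uniformly over all states. This bounds the set whose
  supremum is the spatial norm; only for a bounded set does a supremum of 0 carry
  information.\<close>

lemma product_form_tensor_mult_bounded:
  fixes x :: "('a::cstar_algebra \<times> 'b::cstar_algebra) list"
  shows "\<exists>K\<ge>0. \<forall>\<phi> \<psi> w. cstar_state \<phi> \<and> cstar_state \<psi> \<longrightarrow>
    Re (product_form \<phi> \<psi> (tensor_mult x w) (tensor_mult x w)) \<le> K * Re (product_form \<phi> \<psi> w w)"
proof (induction x)
  case Nil
  then show ?case by (auto simp: tensor_mult_def product_form_def)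
next
  case (Cons p x)
  obtain a b where p: "p = (a, b)" by (cases p)
  obtain K where K: "K \<ge> 0" "\<And>\<phi> \<psi> w. cstar_state \<phi> \<Longrightarrow> cstar_state \<psi> \<Longrightarrow>
    Re (product_form \<phi> \<psi> (tensor_mult x w) (tensor_mult x w)) \<le> K * Re (product_form \<phi> \<psi> w w)"
    using Cons.IH by blast
  define L where "L = 2 * ((norm a + 1)\<^sup>2 * (norm b + 1)\<^sup>2) + 2 * K"
  have "Re (product_form \<phi> \<psi> (tensor_mult (p # x) w) (tensor_mult (p # x) w)) \<le> L * Re (product_form \<phi> \<psi> w w)"
    if "cstar_state \<phi>" "cstar_state \<psi>" for \<phi> \<psi> w
    using product_form_parallelogram_le[OF that, of "map (\<lambda>(c, d). (a * c, b * d)) w" "tensor_mult x w"]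
      product_form_mult_left_le[OF that, of a b w] K(2)[OF that, of w]
    by (simp add: p tensor_mult_Cons L_def algebra_simps)
  moreover have "L \<ge> 0" using K(1) by (simp add: L_def)
  ultimately show ?case by blast
qed

text \<open>The vector 1 \<otimes> 1 competes in the supremum, so x has length 0 in the GNS form,
  and Cauchy-Schwarz against 1 \<otimes> 1 gives the value of the functional.\<close>

lemma product_functional_eq_0:
  assumes \<phi>: "cstar_state \<phi>" and \<psi>: "cstar_state \<psi>" and x: "spatial_norm x = 0"
  shows "product_functional \<phi> \<psi> x = 0"
proof -
  define V where "V = {sqrt (Re (product_functional \<phi> \<psi>
        (tensor_mult (tensor_star (tensor_mult x y)) (tensor_mult x y)))) | \<phi> \<psi> y.
      cstar_state \<phi> \<and> cstar_state \<psi> \<and> product_functional \<phi> \<psi> (tensor_mult (tensor_star y) y) = 1}"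
  obtain K where K: "K \<ge> 0" "\<And>\<phi> \<psi> w. cstar_state \<phi> \<Longrightarrow> cstar_state \<psi> \<Longrightarrow>
    Re (product_form \<phi> \<psi> (tensor_mult x w) (tensor_mult x w)) \<le> K * Re (product_form \<phi> \<psi> w w)"
    using product_form_tensor_mult_bounded[of x] by blast
  have "bdd_above V"
  proof (rule bdd_aboveI)
    fix r assume "r \<in> V"
    then obtain \<phi> \<psi> y where "cstar_state \<phi>" "cstar_state \<psi>" "product_form \<phi> \<psi> y y = 1"
      and r: "r = sqrt (Re (product_form \<phi> \<psi> (tensor_mult x y) (tensor_mult x y)))"
      by (auto simp: V_def product_functional_eq_product_form)
    then have "Re (product_form \<phi> \<psi> (tensor_mult x y) (tensor_mult x y)) \<le> K" using K(2)[of \<phi> \<psi> y] by simp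
    then show "r \<le> sqrt K" using r by simp
  qed
  moreover have one: "\<phi> 1 = 1" "\<psi> 1 = 1" using \<phi> \<psi> by (simp_all add: cstar_state_def)
  have x1: "tensor_mult x [(1, 1)] = x" by (induction x) (auto simp: tensor_mult_def)
  have "sqrt (Re (product_form \<phi> \<psi> x x)) \<in> V"
    unfolding V_def mem_Collect_eq product_functional_eq_product_form using \<phi> \<psi> x1 one
    by (intro exI[of _ \<phi>] exI[of _ \<psi>] exI[of _ "[(1, 1)]"]) (auto simp: product_form_def)
  ultimately have "sqrt (Re (product_form \<phi> \<psi> x x)) \<le> Sup V" by (rule cSup_upper[rotated])
  also have "Sup V = 0" using x by (simp add: spatial_norm_def V_def)
  finally have N: "Re (product_form \<phi> \<psi> x x) \<le> 0" by simp
  define c where "c = product_form \<phi> \<psi> [(1, 1)] x"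
  have c: "c = product_functional \<phi> \<psi> x"
    by (simp add: c_def product_form_def product_functional_def tensor_eval_def)
  have c': "product_form \<phi> \<psi> x [(1, 1)] = cnj c"
    unfolding c product_form_def product_functional_def tensor_eval_def
    by (induction x) (auto simp: cstar_state_star[OF \<phi>] cstar_state_star[OF \<psi>])
  define k where "k = cnj c"
  \<comment> \<open>The vector x - c (1 \<otimes> 1): its squared length is that of x minus |c| ^
    2.\<close>
  have "Re (product_form \<phi> \<psi> (x @ map (\<lambda>(a, b). ((- c) *\<^sub>C a, b)) [(1, 1)] ) (x @ map (\<lambda>(a, b). ((- c) *\<^sub>C a, b)) [(1, 1)])) \<ge> 0"
    using product_form_nonneg[OF \<phi> \<psi>] by (simp add: complex_nonneg_Reals_iff)
  then have "Re (product_form \<phi> \<psi> x x) - (cmod c)\<^sup>2 \<ge> 0"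
    unfolding product_form_append product_form_scale_left[OF \<phi>] product_form_scale_right[OF \<phi>] c' c_def[symmetric]
    using one by (simp only: cmod_power2) (simp add: product_form_def power2_eq_square algebra_simps)
  then have "(cmod c)\<^sup>2 \<le> 0" using N by linarith
  then show ?thesis using c by simp
qed

text \<open>The slice map \<phi> \<otimes> id on elementary sums, obtained without constructing it:
  any state \<psi> of the second factor sees the slice through \<phi> \<otimes> \<psi>, which kills
  tensors of norm 0, and states separate. It is the means of comparing coefficients in
  coassociativity.\<close>

lemma minimal_tensor_sum_eq_0D:
  fixes t :: "'a::cstar_algebra \<Rightarrow> 'b::cstar_algebra \<Rightarrow> 'c::cstar_algebra"
  assumes t: "minimal_tensor t" and "finite J" and sum: "(\<Sum>j\<in>J. t (z j) (y j)) = 0" and \<phi>: "cstar_state \<phi>"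
  shows "(\<Sum>j\<in>J. \<phi> (z j) *\<^sub>C y j) = 0"
proof (rule cstar_states_separate)
  fix \<psi> :: "'b \<Rightarrow> complex" assume \<psi>: "cstar_state \<psi>"
  obtain js where js: "distinct js" "set js = J" using finite_distinct_list[OF \<open>finite J\<close>] by blast
  define x where "x = map (\<lambda>j. (z j, y j)) js"
  have "tensor_eval t x = 0"
    using sum js by (simp add: tensor_eval_def x_def o_def sum_list_distinct_conv_sum_set)
  then have "spatial_norm x = 0" using t unfolding minimal_tensor_def by (metis norm_zero)
  then have "product_functional \<phi> \<psi> x = 0" by (rule product_functional_eq_0[OF \<phi> \<psi>])
  then show "\<psi> (\<Sum>j\<in>J. \<phi> (z j) *\<^sub>C y j) = 0"
    using js by (simp add: product_functional_def tensor_eval_def x_def o_def sum_list_distinct_conv_sum_set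
        cstar_state_sum[OF \<psi>] cstar_state_scaleC[OF \<psi>])
qed

section \<open>Invariant functionals of finite support\<close>

lemma scaleC_fun_apply [simp]: "(c *\<^sub>C f) x = c *\<^sub>C f x"
  by (simp add: scaleC_fun_def)

lemma scaleC_complex [simp]: "c *\<^sub>C (z :: complex) = c * z"
  by (simp add: scaleC_complex_def)

lemma scaleC_sum_left: "(\<Sum>i\<in>I. c i) *\<^sub>C (x :: 'a::cstar_algebra) = (\<Sum>i\<in>I. c i *\<^sub>C x)"
  by (rule cstar.scale_sum_left)

lemma scaleC_sum_right: "c *\<^sub>C (\<Sum>i\<in>I. x i) = (\<Sum>i\<in>I. c *\<^sub>C (x i :: 'a::cstar_algebra))"
  by (rule cstar.scale_sum_right)

abbreviation csubspace :: "('i \<Rightarrow> complex) set \<Rightarrow> bool" where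
  "csubspace \<equiv> cstar_fun.subspace"

lemma csubspaceI:
  assumes "(\<lambda>i. 0) \<in> N" "\<And>f g. f \<in> N \<Longrightarrow> g \<in> N \<Longrightarrow> (\<lambda>i. f i + g i) \<in> N"
    "\<And>c f. f \<in> N \<Longrightarrow> (\<lambda>i. c * f i) \<in> N"
  shows "csubspace N"
  unfolding cstar_fun.subspace_def using assms
  by (auto simp: zero_fun_def plus_fun_def scaleC_fun_def)

lemma csubspaceD:
  assumes "csubspace N"
  shows "(\<lambda>i. 0) \<in> N" "f \<in> N \<Longrightarrow> g \<in> N \<Longrightarrow> (\<lambda>i. f i + g i) \<in> N"
    "f \<in> N \<Longrightarrow> (\<lambda>i. c * f i) \<in> N"
  using assms unfolding cstar_fun.subspace_def
  by (auto simp: zero_fun_def plus_fun_def scaleC_fun_def dest: spec)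

lemma csubspace_combine:
  assumes "csubspace N" "f \<in> N" "g \<in> N"
  shows "(\<lambda>i. f i + c * g i) \<in> N"
  using csubspaceD(2)[OF assms(1,2) csubspaceD(3)[OF assms(1,3), of c]] .

lemma csubspace_sum:
  assumes "csubspace N" "\<And>k. k \<in> K \<Longrightarrow> f k \<in> N"
  shows "(\<lambda>i. \<Sum>k\<in>K. c k * f k i) \<in> N"
  using assms(2)
proof (induction K rule: infinite_finite_induct)
  case (insert k K)
  then show ?case
    using csubspaceD(2)[OF assms(1) csubspaceD(3)[OF assms(1), of "f k" "c k"]] by simp
qed (use csubspaceD(1)[OF assms(1)] in auto)

section \<open>Orthogonal projections in finitely many coordinates\<close>

definition cinner :: "'i set \<Rightarrow> ('i \<Rightarrow> complex) \<Rightarrow> ('i \<Rightarrow> complex) \<Rightarrow> complex" where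
  "cinner I f g = (\<Sum>i\<in>I. f i * cnj (g i))"

lemma cinner_left: "cinner I (\<lambda>i. f i + c * g i) h = cinner I f h + c * cinner I g h"
  by (simp add: cinner_def sum.distrib sum_distrib_left algebra_simps)

lemma cinner_right: "cinner I h (\<lambda>i. f i + c * g i) = cinner I h f + cnj c * cinner I h g"
  by (simp add: cinner_def sum.distrib sum_distrib_left algebra_simps)

lemma cinner_commute: "cinner I f g = cnj (cinner I g f)"
  by (simp add: cinner_def mult.commute)

lemma cinner_self: "cinner I f f = of_real (\<Sum>i\<in>I. (cmod (f i))\<^sup>2)"
  unfolding cinner_def of_real_sum by (simp add: complex_norm_square del: of_real_power)

text \<open>Induction on the index set replaces a count of dimensions: the vectors of N that vanish
  at the new index are handled by the induction hypothesis, and at most one further direction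
  remains. Coordinates outside I are invisible to \<open>cinner\<close>.\<close>

lemma orthogonal_projection_exists:
  assumes "finite I" "csubspace N"
  shows "\<exists>\<eta>\<in>N. \<forall>\<zeta>\<in>N. cinner I (\<lambda>i. \<xi> i - \<eta> i) \<zeta> = 0"
  using assms
proof (induction I arbitrary: N \<xi> rule: finite_induct)
  case empty
  then show ?case using csubspaceD(1)[OF empty] by (auto simp: cinner_def)
next
  case (insert k I)
  have ins: "cinner (insert k I) f g = f k * cnj (g k) + cinner I f g" for f g
    using insert.hyps by (simp add: cinner_def)
  define N0 where "N0 = {\<zeta>\<in>N. \<zeta> k = 0}"
  have N0: "csubspace N0"
    by (rule csubspaceI) (use csubspaceD[OF insert.prems] in \<open>auto simp: N0_def\<close>)
  show ?case
  proof (cases "N0 = N")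
    case True
    obtain \<eta> where "\<eta> \<in> N" "\<forall>\<zeta>\<in>N. cinner I (\<lambda>i. \<xi> i - \<eta> i) \<zeta> = 0"
      using insert.IH[OF insert.prems] by blast
    moreover have "\<zeta> k = 0" if "\<zeta> \<in> N" for \<zeta> using that True by (auto simp: N0_def)
    ultimately show ?thesis by (intro bexI[of _ \<eta>]) (auto simp: ins)
  next
    case False
    then obtain \<zeta>1 where z1: "\<zeta>1 \<in> N" "\<zeta>1 k \<noteq> 0" by (auto simp: N0_def)
    define \<zeta>0 where "\<zeta>0 i = (1 / \<zeta>1 k) * \<zeta>1 i" for i
    have z0: "\<zeta>0 \<in> N" "\<zeta>0 k = 1"
      using z1 csubspaceD(3)[OF insert.prems z1(1), of "1 / \<zeta>1 k"] by (auto simp: \<zeta>0_def[abs_def])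
    obtain \<eta>0 where e0: "\<eta>0 \<in> N0" "\<And>\<zeta>. \<zeta> \<in> N0 \<Longrightarrow> cinner I (\<lambda>i. \<zeta>0 i - \<eta>0 i) \<zeta> = 0"
      using insert.IH[OF N0] by blast
    \<comment> \<open>The part of \<zeta>0 orthogonal to N0. It spans the remaining direction of N,
      and its entry 1 at k makes s at least 1.\<close>
    define \<tau> where "\<tau> i = \<zeta>0 i + (- 1) * \<eta>0 i" for i
    have \<tau>N: "\<tau> \<in> N"
      using csubspace_combine[OF insert.prems z0(1), of \<eta>0 "- 1"] e0(1) by (auto simp: \<tau>_def[abs_def] N0_def)
    have \<tau>k: "\<tau> k = 1" using e0(1) z0(2) by (simp add: \<tau>_def N0_def)
    have \<tau>0: "cinner I \<tau> \<zeta> = 0" if "\<zeta> \<in> N0" for \<zeta> using e0(2)[OF that] by (simp add: \<tau>_def[abs_def])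
    define s where "s = cinner (insert k I) \<tau> \<tau>"
    have "s = 1 + cinner I \<tau> \<tau>" by (simp add: s_def ins \<tau>k)
    then have "s = 1 + of_real (\<Sum>i\<in>I. (cmod (\<tau> i))\<^sup>2)" unfolding cinner_self .
    then have "Re s = 1 + (\<Sum>i\<in>I. (cmod (\<tau> i))\<^sup>2)" by simp
    moreover have "(\<Sum>i\<in>I. (cmod (\<tau> i))\<^sup>2) \<ge> 0" by (intro sum_nonneg) auto
    ultimately have s: "s \<noteq> 0" by auto
    obtain \<eta>1 where e1: "\<eta>1 \<in> N0" "\<And>\<zeta>. \<zeta> \<in> N0 \<Longrightarrow> cinner I (\<lambda>i. \<xi> i - \<eta>1 i) \<zeta> = 0"
      using insert.IH[OF N0] by blast
    define c where "c = cinner (insert k I) \<xi> \<tau> / s"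
    define \<eta> where "\<eta> i = \<eta>1 i + c * \<tau> i" for i
    have "\<eta> \<in> N"
      using csubspace_combine[OF insert.prems _ \<tau>N, of \<eta>1 c] e1(1) by (auto simp: \<eta>_def[abs_def] N0_def)
    moreover have "cinner (insert k I) (\<lambda>i. \<xi> i - \<eta> i) \<zeta> = 0" if "\<zeta> \<in> N" for \<zeta>
    proof -
      define \<zeta>' where "\<zeta>' i = \<zeta> i + (- \<zeta> k) * \<tau> i" for i
      have z': "\<zeta>' \<in> N0"
        using csubspace_combine[OF insert.prems that \<tau>N, of "- \<zeta> k"] by (simp add: N0_def \<zeta>'_def[abs_def] \<tau>k)
      have "cinner (insert k I) (\<lambda>i. \<xi> i - \<eta> i) \<zeta>' = cinner I (\<lambda>i. (\<xi> i - \<eta>1 i) + (- c) * \<tau> i) \<zeta>'"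
        using z' by (simp add: ins N0_def \<eta>_def algebra_simps)
      also have "\<dots> = 0" unfolding cinner_left using e1(2)[OF z'] \<tau>0[OF z'] by simp
      finally have 1: "cinner (insert k I) (\<lambda>i. \<xi> i - \<eta> i) \<zeta>' = 0" .
      have "cinner (insert k I) (\<lambda>i. \<xi> i - \<eta> i) \<tau> =
          cinner (insert k I) (\<lambda>i. (\<xi> i + (- 1) * \<eta>1 i) + (- c) * \<tau> i) \<tau>"
        by (simp add: \<eta>_def algebra_simps)
      also have "\<dots> = cinner (insert k I) \<xi> \<tau> - cinner (insert k I) \<eta>1 \<tau> - c * s"
        unfolding cinner_left s_def by simp
      also have "cinner (insert k I) \<eta>1 \<tau> = 0"
        using \<tau>0[OF e1(1)] e1(1) cinner_commute[of I \<eta>1 \<tau>] by (simp add: ins N0_def)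
      finally have 2: "cinner (insert k I) (\<lambda>i. \<xi> i - \<eta> i) \<tau> = 0" using s by (simp add: c_def)
      have "cinner (insert k I) (\<lambda>i. \<xi> i - \<eta> i) (\<lambda>i. \<zeta>' i + \<zeta> k * \<tau> i) = 0"
        unfolding cinner_right 1 2 by simp
      then show ?thesis by (simp add: \<zeta>'_def)
    qed
    ultimately show ?thesis by blast
  qed
qed

text \<open>The columns are the projections of the unit vectors onto N; reproducing N and being
  hermitian follow by pairing them with elements of N.\<close>

lemma orthogonal_projection_matrix:
  assumes I: "finite I" and N: "csubspace N"
  shows "\<exists>p. (\<forall>j\<in>I. (\<lambda>i. p i j) \<in> N) \<and> (\<forall>i\<in>I. \<forall>j\<in>I. p j i = cnj (p i j)) \<and>
    (\<forall>\<zeta>\<in>N. \<forall>i\<in>I. (\<Sum>j\<in>I. p i j * \<zeta> j) = \<zeta> i)"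
proof -
  have "\<forall>j. \<exists>\<eta>\<in>N. \<forall>\<zeta>\<in>N. cinner I (\<lambda>i. (if i = j then 1 else 0) - \<eta> i) \<zeta> = 0"
    by (intro allI orthogonal_projection_exists[OF I N])
  then obtain E where E: "\<And>j. E j \<in> N"
    "\<And>j \<zeta>. \<zeta> \<in> N \<Longrightarrow> cinner I (\<lambda>i. (if i = j then 1 else 0) - E j i) \<zeta> = 0" by metis
  define p where "p i j = E j i" for i j
  have rep: "\<zeta> j = (\<Sum>i\<in>I. cnj (p i j) * \<zeta> i)" if "\<zeta> \<in> N" "j \<in> I" for \<zeta> j
  proof -
    have "cinner I (\<lambda>i. (if i = j then 1 else 0) + (- 1) * E j i) \<zeta> = 0" using E(2)[OF that(1), of j] by simp
    moreover have "cinner I (\<lambda>i. if i = j then 1 else 0) \<zeta> = cnj (\<zeta> j)"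
      using I that(2) by (simp add: cinner_def if_distrib[of "\<lambda>x. x * _"] cong: if_cong)
    ultimately have "cnj (\<zeta> j) = cinner I (E j) \<zeta>" unfolding cinner_left by simp
    then have "\<zeta> j = cnj (cinner I (E j) \<zeta>)" by (metis complex_cnj_cnj)
    then show ?thesis by (simp add: cinner_def p_def)
  qed
  have herm: "p j k = cnj (p k j)" if "k \<in> I" "j \<in> I" for k j
  proof -
    have *: "p j k = (\<Sum>i\<in>I. cnj (p i j) * p i k)" if "j \<in> I" for j k
      using rep[OF E(1)[of k] that] by (simp add: p_def)
    show ?thesis using *[of j k] *[of k j] that by (simp add: mult.commute)
  qed
  show ?thesis
  proof (intro exI[of _ p] conjI ballI)
    show "(\<lambda>i. p i j) \<in> N" for j using E(1)[of j] by (simp add: p_def[abs_def])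
    show "p j i = cnj (p i j)" if "i \<in> I" "j \<in> I" for i j by (rule herm[OF that])
    fix \<zeta> j assume "\<zeta> \<in> N" "j \<in> I"
    then have "\<zeta> j = (\<Sum>i\<in>I. cnj (p i j) * \<zeta> i)" by (rule rep)
    also have "\<dots> = (\<Sum>i\<in>I. p j i * \<zeta> i)" using \<open>j \<in> I\<close>
      by (intro sum.cong refl arg_cong2[where f = "(*)"] herm[symmetric])
    finally show "(\<Sum>i\<in>I. p j i * \<zeta> i) = \<zeta> j" by simp
  qed
qed

section \<open>Functionals given by finitely many points\<close>

lemma csubspace_evaluation_combinations:
  "csubspace {l. \<exists>Y c. finite Y \<and> (\<forall>i\<in>I. l i = (\<Sum>y\<in>Y. c y * e i y))}"
proof (rule csubspaceI)
  show "(\<lambda>i. 0) \<in> {l. \<exists>Y c. finite Y \<and> (\<forall>i\<in>I. l i = (\<Sum>y\<in>Y. c y * e i y))}"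
    by (intro CollectI exI[of _ "{}"]) auto
next
  fix f g assume "f \<in> {l. \<exists>Y c. finite Y \<and> (\<forall>i\<in>I. l i = (\<Sum>y\<in>Y. c y * e i y))}"
    "g \<in> {l. \<exists>Y c. finite Y \<and> (\<forall>i\<in>I. l i = (\<Sum>y\<in>Y. c y * e i y))}"
  then obtain Y c Y' c' where Y: "finite Y" "\<forall>i\<in>I. f i = (\<Sum>y\<in>Y. c y * e i y)"
    and Y': "finite Y'" "\<forall>i\<in>I. g i = (\<Sum>y\<in>Y'. c' y * e i y)" by auto
  define d where "d y = (if y \<in> Y then c y else 0) + (if y \<in> Y' then c' y else 0)" for y
  have "(\<Sum>y\<in>Y \<union> Y'. d y * e i y) = (\<Sum>y\<in>Y. c y * e i y) + (\<Sum>y\<in>Y'. c' y * e i y)" for i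
  proof -
    have "(\<Sum>y\<in>Y \<union> Y'. d y * e i y) =
        (\<Sum>y\<in>Y \<union> Y'. if y \<in> Y then c y * e i y else 0) + (\<Sum>y\<in>Y \<union> Y'. if y \<in> Y' then c' y * e i y else 0)"
      unfolding sum.distrib[symmetric] by (intro sum.cong) (auto simp: d_def algebra_simps)
    then show ?thesis
      using Y(1) Y'(1) by (simp add: sum.If_cases Int_absorb1 inf_commute Int_Un_distrib)
  qed
  then show "(\<lambda>i. f i + g i) \<in> {l. \<exists>Y c. finite Y \<and> (\<forall>i\<in>I. l i = (\<Sum>y\<in>Y. c y * e i y))}"
    using Y Y' by (intro CollectI exI[of _ "Y \<union> Y'"] exI[of _ d]) auto
next
  fix k f assume "f \<in> {l. \<exists>Y c. finite Y \<and> (\<forall>i\<in>I. l i = (\<Sum>y\<in>Y. c y * e i y))}"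
  then obtain Y c where "finite Y" "\<forall>i\<in>I. f i = (\<Sum>y\<in>Y. c y * e i y)" by auto
  then show "(\<lambda>i. k * f i) \<in> {l. \<exists>Y c. finite Y \<and> (\<forall>i\<in>I. l i = (\<Sum>y\<in>Y. c y * e i y))}"
    by (intro CollectI exI[of _ Y] exI[of _ "\<lambda>y. k * c y"]) (auto simp: sum_distrib_left mult.assoc)
qed

text \<open>The bipolar theorem in finite dimension. The component of l orthogonal to all evaluation
  vectors is, after conjugation, a linear relation between the functions; l kills it by hypothesis
  and the projection of l kills it by construction, so it is orthogonal to itself.\<close>

lemma annihilator_is_evaluation_combination:
  fixes e :: "'i \<Rightarrow> 'm \<Rightarrow> complex"
  assumes I: "finite I"
    and l: "\<And>\<xi>. (\<And>y. (\<Sum>i\<in>I. \<xi> i * e i y) = 0) \<Longrightarrow> (\<Sum>i\<in>I. l i * \<xi> i) = 0"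
  shows "\<exists>Y c. finite Y \<and> (\<forall>i\<in>I. l i = (\<Sum>y\<in>Y. c y * e i y))"
proof -
  define N where "N = {l. \<exists>Y c. finite Y \<and> (\<forall>i\<in>I. l i = (\<Sum>y\<in>Y. c y * e i y))}"
  have N: "csubspace N" unfolding N_def by (rule csubspace_evaluation_combinations)
  obtain \<eta> where \<eta>: "\<eta> \<in> N" "\<And>\<zeta>. \<zeta> \<in> N \<Longrightarrow> cinner I (\<lambda>i. l i - \<eta> i) \<zeta> = 0"
    using orthogonal_projection_exists[OF I N] by blast
  define \<xi> where "\<xi> i = cnj (l i - \<eta> i)" for i
  have \<xi>N: "(\<Sum>i\<in>I. \<zeta> i * \<xi> i) = 0" if "\<zeta> \<in> N" for \<zeta>
  proof -
    have "(\<Sum>i\<in>I. \<zeta> i * \<xi> i) = cnj (cinner I (\<lambda>i. l i - \<eta> i) \<zeta>)"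
      by (simp add: cinner_def \<xi>_def mult.commute)
    then show ?thesis using \<eta>(2)[OF that] by simp
  qed
  have "(\<Sum>i\<in>I. \<xi> i * e i y) = 0" for y
  proof -
    have "(\<lambda>i. e i y) \<in> N" unfolding N_def by (intro CollectI exI[of _ "{y}"] exI[of _ "\<lambda>_. 1"]) auto
    then show ?thesis using \<xi>N[of "\<lambda>i. e i y"] by (simp add: mult.commute)
  qed
  then have "(\<Sum>i\<in>I. l i * \<xi> i) = 0" by (rule l)
  with \<xi>N[OF \<eta>(1)] have "(\<Sum>i\<in>I. (l i - \<eta> i) * \<xi> i) = 0" by (simp add: left_diff_distrib sum_subtractf)
  then have "cinner I (\<lambda>i. l i - \<eta> i) (\<lambda>i. l i - \<eta> i) = 0" by (simp add: cinner_def \<xi>_def)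
  then have "(\<Sum>i\<in>I. (cmod (l i - \<eta> i))\<^sup>2) = 0" unfolding cinner_self by (metis of_real_eq_0_iff)
  then have "l i = \<eta> i" if "i \<in> I" for i using I that by (simp add: sum_nonneg_eq_0_iff)
  then show ?thesis using \<eta>(1) by (simp add: N_def)
qed

text \<open>The finitely many columns of the projection onto the evaluation vectors involve finitely
  many points. A combination vanishing there is killed by the projection, which reproduces the
  evaluation at every x.\<close>

lemma finite_determining_set:
  fixes e :: "'i \<Rightarrow> 'm \<Rightarrow> complex"
  assumes I: "finite I"
  obtains Y0 where "finite Y0"
    "\<And>\<xi> x. (\<And>y. y \<in> Y0 \<Longrightarrow> (\<Sum>i\<in>I. \<xi> i * e i y) = 0) \<Longrightarrow> (\<Sum>i\<in>I. \<xi> i * e i x) = 0"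
proof -
  define N where "N = {l. \<exists>Y c. finite Y \<and> (\<forall>i\<in>I. l i = (\<Sum>y\<in>Y. c y * e i y))}"
  have N: "csubspace N" unfolding N_def by (rule csubspace_evaluation_combinations)
  obtain p where p: "\<And>j. j \<in> I \<Longrightarrow> (\<lambda>i. p i j) \<in> N"
    "\<And>\<zeta> i. \<zeta> \<in> N \<Longrightarrow> i \<in> I \<Longrightarrow> (\<Sum>j\<in>I. p i j * \<zeta> j) = \<zeta> i"
    using orthogonal_projection_matrix[OF I N] by blast
  have "\<forall>j\<in>I. \<exists>Y c. finite Y \<and> (\<forall>i\<in>I. p i j = (\<Sum>y\<in>Y. c y * e i y))"
    using p(1) by (auto simp: N_def)
  then obtain Y c where Y: "\<And>j. j \<in> I \<Longrightarrow> finite (Y j)"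
    "\<And>i j. i \<in> I \<Longrightarrow> j \<in> I \<Longrightarrow> p i j = (\<Sum>y\<in>Y j. c j y * e i y)" by metis
  define Y0 where "Y0 = (\<Union>j\<in>I. Y j)"
  show ?thesis
  proof (rule that)
    show "finite Y0" using I Y(1) by (simp add: Y0_def)
    fix \<xi> x assume zero: "\<And>y. y \<in> Y0 \<Longrightarrow> (\<Sum>i\<in>I. \<xi> i * e i y) = 0"
    have col: "(\<Sum>i\<in>I. \<xi> i * p i j) = 0" if j: "j \<in> I" for j
    proof -
      have "(\<Sum>i\<in>I. \<xi> i * p i j) = (\<Sum>i\<in>I. \<Sum>y\<in>Y j. c j y * (\<xi> i * e i y))"
        using Y(2) j by (intro sum.cong) (auto simp: sum_distrib_left mult.left_commute)
      also have "\<dots> = (\<Sum>y\<in>Y j. c j y * (\<Sum>i\<in>I. \<xi> i * e i y))"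
        by (subst sum.swap) (simp add: sum_distrib_left)
      also have "\<dots> = 0" using j zero by (intro sum.neutral) (auto simp: Y0_def)
      finally show ?thesis .
    qed
    have "(\<lambda>i. e i x) \<in> N" unfolding N_def by (intro CollectI exI[of _ "{x}"] exI[of _ "\<lambda>_. 1"]) auto
    then have "(\<Sum>i\<in>I. \<xi> i * e i x) = (\<Sum>i\<in>I. \<xi> i * (\<Sum>j\<in>I. p i j * e j x))"
      using p(2) by (intro sum.cong) auto
    also have "\<dots> = (\<Sum>j\<in>I. (\<Sum>i\<in>I. \<xi> i * p i j) * e j x)"
      unfolding sum_distrib_left sum_distrib_right by (subst sum.swap) (simp add: mult.assoc)
    also have "\<dots> = 0" using col by simp
    finally show "(\<Sum>i\<in>I. \<xi> i * e i x) = 0" .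
  qed
qed

text \<open>The functional of smallest norm among those which agree with \<open>\<Sum>\<^sub>y\<^sub>\<in>\<^sub>Y\<^sub>0 \<delta>\<^sub>y\<close> on the invariant
  vectors is itself invariant, because the coaction matrix is unitary.\<close>

lemma invariant_measure_exists:
  fixes m :: "'i \<Rightarrow> 'm \<Rightarrow> complex" and U :: "'i \<Rightarrow> 'i \<Rightarrow> 'q::cstar_algebra"
  assumes I: "finite I"
    and UU: "\<And>i k. i \<in> I \<Longrightarrow> k \<in> I \<Longrightarrow> (\<Sum>j\<in>I. U i j * star (U k j)) = (if i = k then 1 else 0)"
    and well_defined: "\<And>\<xi> x. (\<And>y. (\<Sum>j\<in>I. \<xi> j * m j y) = 0) \<Longrightarrow>
      (\<Sum>j\<in>I. \<xi> j *\<^sub>C (\<Sum>i\<in>I. m i x *\<^sub>C U i j)) = 0"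
  obtains Y c where "finite Y"
    "\<And>j. j \<in> I \<Longrightarrow> (\<Sum>y\<in>Y. c y *\<^sub>C (\<Sum>i\<in>I. m i y *\<^sub>C U i j)) = (\<Sum>y\<in>Y. c y * m j y) *\<^sub>C 1"
    "\<And>\<zeta>. (\<And>x. (\<Sum>j\<in>I. \<zeta> j *\<^sub>C (\<Sum>i\<in>I. m i x *\<^sub>C U i j)) = (\<Sum>j\<in>I. \<zeta> j * m j x) *\<^sub>C 1) \<Longrightarrow>
      (\<Sum>y\<in>Y. c y * (\<Sum>j\<in>I. \<zeta> j * m j y)) = (\<Sum>y\<in>Y0. \<Sum>j\<in>I. \<zeta> j * m j y)"
proof -
  define A where "A x j = (\<Sum>i\<in>I. m i x *\<^sub>C U i j)" for x j
  \<comment> \<open>Coefficient vectors rather than functions: the \<open>m j\<close> may be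
    linearly dependent, so several vectors can represent one invariant function.\<close>
  define Inv where "Inv = {\<zeta>. \<forall>x. (\<Sum>j\<in>I. \<zeta> j *\<^sub>C A x j) = (\<Sum>j\<in>I. \<zeta> j * m j x) *\<^sub>C 1}"
  have scale: "(\<Sum>j\<in>I. (k * f j) *\<^sub>C A x j) = k *\<^sub>C (\<Sum>j\<in>I. f j *\<^sub>C A x j)"
    "(\<Sum>j\<in>I. k * f j * m j x) = k * (\<Sum>j\<in>I. f j * m j x)" for k f x
    by (simp_all add: scaleC_sum_right sum_distrib_left mult.assoc)
  have Inv: "csubspace Inv"
  proof (rule csubspaceI)
    show "(\<lambda>i. c * f i) \<in> Inv" if "f \<in> Inv" for c f
      using that unfolding Inv_def mem_Collect_eq scale by simp
  qed (simp_all add: Inv_def scaleC_add_left sum.distrib distrib_right)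
  define l0 where "l0 j = (\<Sum>y\<in>Y0. m j y)" for j
  obtain \<zeta>0 where z0: "\<zeta>0 \<in> Inv" "\<And>\<zeta>. \<zeta> \<in> Inv \<Longrightarrow> cinner I (\<lambda>i. cnj (l0 i) - \<zeta>0 i) \<zeta> = 0"
    using orthogonal_projection_exists[OF I Inv, of "\<lambda>i. cnj (l0 i)"] by blast
  define l where "l j = cnj (\<zeta>0 j)" for j
  have agree: "(\<Sum>j\<in>I. l j * \<zeta> j) = (\<Sum>y\<in>Y0. \<Sum>j\<in>I. \<zeta> j * m j y)" if "\<zeta> \<in> Inv" for \<zeta>
  proof -
    have "cnj (cinner I (\<lambda>i. cnj (l0 i) - \<zeta>0 i) \<zeta>) = 0" using z0(2)[OF that] by simp
    then have "(\<Sum>j\<in>I. l j * \<zeta> j) = (\<Sum>j\<in>I. l0 j * \<zeta> j)"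
      by (simp add: cinner_def l_def left_diff_distrib sum_subtractf)
    also have "\<dots> = (\<Sum>y\<in>Y0. \<Sum>j\<in>I. \<zeta> j * m j y)"
      unfolding l0_def sum_distrib_right by (subst sum.swap) (simp add: mult.commute)
    finally show ?thesis .
  qed
  \<comment> \<open>A linear relation between the \<open>m j\<close> represents the invariant
    function 0, hence lies in \<open>Inv\<close> and is annihilated by l. Therefore l depends on the
    function only and is a combination of evaluations.\<close>
  have kernel: "(\<Sum>i\<in>I. l i * \<xi> i) = 0" if ker: "\<And>y. (\<Sum>i\<in>I. \<xi> i * m i y) = 0" for \<xi>
  proof -
    have "\<xi> \<in> Inv" using well_defined[OF ker] ker by (simp add: Inv_def A_def)
    then show ?thesis using agree[of \<xi>] ker by simp
  qed
  obtain Y c where Y: "finite Y" "\<And>i. i \<in> I \<Longrightarrow> l i = (\<Sum>y\<in>Y. c y * m i y)"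
    using annihilator_is_evaluation_combination[of I m l, OF I kernel] by blast
  define a where "a j = (\<Sum>i\<in>I. l i *\<^sub>C U i j)" for j
  have a: "a j = (\<Sum>y\<in>Y. c y *\<^sub>C A y j)" for j
  proof -
    have "a j = (\<Sum>i\<in>I. \<Sum>y\<in>Y. c y *\<^sub>C m i y *\<^sub>C U i j)"
      unfolding a_def by (intro sum.cong refl) (simp add: Y(2) scaleC_sum_left scaleC_scaleC)
    then show ?thesis by (subst (asm) sum.swap) (simp add: A_def scaleC_sum_right)
  qed
  define s where "s = cinner I l l"
  have sr: "cnj s = s" by (simp add: s_def cinner_self)
  have b: "(\<Sum>j\<in>I. \<zeta>0 j *\<^sub>C a j) = s *\<^sub>C 1"
  proof -
    have "(\<Sum>j\<in>I. \<zeta>0 j *\<^sub>C a j) = (\<Sum>y\<in>Y. c y *\<^sub>C (\<Sum>j\<in>I. \<zeta>0 j *\<^sub>C A y j))"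
      unfolding a scaleC_sum_right by (subst sum.swap) (simp add: scaleC_scaleC mult.commute)
    also have "\<dots> = (\<Sum>y\<in>Y. c y *\<^sub>C (\<Sum>j\<in>I. \<zeta>0 j * m j y) *\<^sub>C 1)"
      using z0(1) by (simp add: Inv_def)
    also have "\<dots> = (\<Sum>y\<in>Y. \<Sum>j\<in>I. c y * (\<zeta>0 j * m j y)) *\<^sub>C 1"
      by (simp add: scaleC_scaleC scaleC_sum_left scaleC_sum_right sum_distrib_left)
    also have "(\<Sum>y\<in>Y. \<Sum>j\<in>I. c y * (\<zeta>0 j * m j y)) = (\<Sum>j\<in>I. \<zeta>0 j * l j)"
      by (subst sum.swap) (simp add: Y(2) sum_distrib_left mult.left_commute)
    also have "\<dots> = s" by (simp add: s_def cinner_def l_def mult.commute)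
    finally show ?thesis .
  qed
  have aa: "(\<Sum>j\<in>I. a j * star (a j)) = s *\<^sub>C 1"
  proof -
    have "(\<Sum>j\<in>I. a j * star (a j)) = (\<Sum>j\<in>I. \<Sum>i\<in>I. \<Sum>k\<in>I. (l i * cnj (l k)) *\<^sub>C (U i j * star (U k j)))"
      by (simp add: a_def star_sum star_scaleC sum_product mult_scaleC_left mult_scaleC_right scaleC_scaleC mult.commute)
    also have "\<dots> = (\<Sum>i\<in>I. \<Sum>k\<in>I. \<Sum>j\<in>I. (l i * cnj (l k)) *\<^sub>C (U i j * star (U k j)))"
      by (subst sum.swap, rule sum.cong, rule refl, rule sum.swap)
    also have "\<dots> = (\<Sum>i\<in>I. \<Sum>k\<in>I. (l i * cnj (l k)) *\<^sub>C (if i = k then 1 else 0))"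
      by (intro sum.cong refl) (simp add: UU scaleC_sum_right[symmetric])
    also have "\<dots> = s *\<^sub>C 1"
      using I by (simp add: if_distrib[of "\<lambda>x. _ *\<^sub>C x"] s_def cinner_def scaleC_sum_left cong: if_cong)
    finally show ?thesis .
  qed
  \<comment> \<open>Unitarity gives \<Sum>_j a_j star a_j = s and invariance of \<zeta>0 gives
    \<Sum>_j \<zeta>0_j a_j = s, so the expanded square of a - l is s - s - s + s. Taking the
    adjoint brings it into the form star y * y.\<close>
  define y where "y j = star (a j - l j *\<^sub>C 1)" for j
  have "star (y j) * y j = a j * star (a j) - \<zeta>0 j *\<^sub>C a j - star (\<zeta>0 j *\<^sub>C a j) + (l j * cnj (l j)) *\<^sub>C 1" for j
    by (simp add: y_def star_diff star_star star_scaleC l_def algebra_simps mult_scaleC_left mult_scaleC_right scaleC_scaleC)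
  then have "(\<Sum>j\<in>I. star (y j) * y j) = (\<Sum>j\<in>I. a j * star (a j)) - (\<Sum>j\<in>I. \<zeta>0 j *\<^sub>C a j)
      - star (\<Sum>j\<in>I. \<zeta>0 j *\<^sub>C a j) + (\<Sum>j\<in>I. l j * cnj (l j)) *\<^sub>C 1"
    by (simp add: sum.distrib sum_subtractf star_sum scaleC_sum_left)
  also have "\<dots> = 0" unfolding aa b by (simp add: star_scaleC sr) (simp add: s_def cinner_def)
  finally have "y j = 0" if "j \<in> I" for j using sum_star_mult_eq_0D[OF I _ that] by blast
  then have "star (y j) = 0" if "j \<in> I" for j using that by simp
  then have inv: "a j = l j *\<^sub>C 1" if "j \<in> I" for j using that by (simp add: y_def star_star)
  show ?thesis
  proof (rule that[OF Y(1)])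
    show "(\<Sum>y\<in>Y. c y *\<^sub>C (\<Sum>i\<in>I. m i y *\<^sub>C U i j)) = (\<Sum>y\<in>Y. c y * m j y) *\<^sub>C 1" if "j \<in> I" for j
      using inv[OF that] unfolding a Y(2)[OF that] by (simp add: A_def)
  next
    fix \<zeta> assume "\<And>x. (\<Sum>j\<in>I. \<zeta> j *\<^sub>C (\<Sum>i\<in>I. m i x *\<^sub>C U i j)) = (\<Sum>j\<in>I. \<zeta> j * m j x) *\<^sub>C 1"
    then have "(\<Sum>y\<in>Y0. \<Sum>j\<in>I. \<zeta> j * m j y) = (\<Sum>j\<in>I. l j * \<zeta> j)"
      using agree[of \<zeta>] by (simp add: Inv_def A_def)
    also have "\<dots> = (\<Sum>j\<in>I. \<Sum>y\<in>Y. c y * (\<zeta> j * m j y))"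
      by (intro sum.cong refl) (simp add: Y(2) sum_distrib_left mult_ac)
    also have "\<dots> = (\<Sum>y\<in>Y. c y * (\<Sum>j\<in>I. \<zeta> j * m j y))" by (subst sum.swap) (simp add: sum_distrib_left)
    finally show "(\<Sum>y\<in>Y. c y * (\<Sum>j\<in>I. \<zeta> j * m j y)) = (\<Sum>y\<in>Y0. \<Sum>j\<in>I. \<zeta> j * m j y)" by simp
  qed
qed

section \<open>Hermitian forms and their lowest eigenvalue\<close>

definition quad_form :: "'i set \<Rightarrow> ('i \<Rightarrow> 'i \<Rightarrow> complex) \<Rightarrow> ('i \<Rightarrow> complex) \<Rightarrow> real" where
  "quad_form I H \<zeta> = Re (\<Sum>i\<in>I. \<Sum>j\<in>I. cnj (\<zeta> i) * H i j * \<zeta> j)"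

lemma quad_form_add:
  assumes herm: "\<And>i j. i \<in> I \<Longrightarrow> j \<in> I \<Longrightarrow> H j i = cnj (H i j)"
  shows "quad_form I H (\<lambda>i. \<xi> i + of_real s * \<eta> i) =
    quad_form I H \<xi> + 2 * s * Re (\<Sum>i\<in>I. cnj (\<eta> i) * (\<Sum>j\<in>I. H i j * \<xi> j)) + s\<^sup>2 * quad_form I H \<eta>"
proof -
  define B where "B f g = (\<Sum>i\<in>I. \<Sum>j\<in>I. cnj (f i) * H i j * g j)" for f g
  have q: "quad_form I H f = Re (B f f)" for f by (simp add: quad_form_def B_def)
  have "B (\<lambda>i. \<xi> i + of_real s * \<eta> i) (\<lambda>i. \<xi> i + of_real s * \<eta> i) =
      B \<xi> \<xi> + of_real s * B \<xi> \<eta> + of_real s * B \<eta> \<xi> + of_real (s\<^sup>2) * B \<eta> \<eta>"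
    by (simp add: B_def algebra_simps sum.distrib sum_distrib_left power2_eq_square)
  moreover have "B \<xi> \<eta> = cnj (B \<eta> \<xi>)"
  proof -
    have "cnj (B \<eta> \<xi>) = (\<Sum>i\<in>I. \<Sum>j\<in>I. cnj (\<xi> j) * cnj (H i j) * \<eta> i)" by (simp add: B_def mult_ac)
    also have "\<dots> = (\<Sum>i\<in>I. \<Sum>j\<in>I. cnj (\<xi> j) * H j i * \<eta> i)"
      by (intro sum.cong refl arg_cong2[where f = "(*)"] herm[symmetric])
    also have "\<dots> = B \<xi> \<eta>" unfolding B_def by (rule sum.swap)
    finally show ?thesis by simp
  qed
  ultimately have "quad_form I H (\<lambda>i. \<xi> i + of_real s * \<eta> i) =
      quad_form I H \<xi> + 2 * s * Re (B \<eta> \<xi>) + s\<^sup>2 * quad_form I H \<eta>"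
    unfolding q by (simp flip: of_real_power)
  moreover have "B \<eta> \<xi> = (\<Sum>i\<in>I. cnj (\<eta> i) * (\<Sum>j\<in>I. H i j * \<xi> j))"
    by (simp add: B_def sum_distrib_left mult.assoc)
  ultimately show ?thesis by (simp only:)
qed

text \<open>Moving from \<xi> in the direction of - H \<xi> by a small s changes the form by - 2 s
  |H \<xi>| ^ 2 plus a term of order s ^ 2, which would be negative unless H \<xi> = 0.\<close>

lemma quad_form_zero_imp_kernel:
  assumes I: "finite I" and herm: "\<And>i j. i \<in> I \<Longrightarrow> j \<in> I \<Longrightarrow> H j i = cnj (H i j)"
    and nonneg: "\<And>\<zeta>. quad_form I H \<zeta> \<ge> 0" and zero: "quad_form I H \<xi> = 0" and "i \<in> I"
  shows "(\<Sum>j\<in>I. H i j * \<xi> j) = 0"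
proof -
  define \<eta> where "\<eta> i = (\<Sum>j\<in>I. H i j * \<xi> j)" for i
  define n where "n = (\<Sum>i\<in>I. (cmod (\<eta> i))\<^sup>2)"
  define Q where "Q = quad_form I H \<eta>"
  have "(\<Sum>i\<in>I. cnj (\<eta> i) * \<eta> i) = of_real n"
    using cinner_self[of I \<eta>] unfolding n_def by (simp only: cinner_def mult.commute)
  then have n: "Re (\<Sum>i\<in>I. cnj (\<eta> i) * \<eta> i) = n" by simp
  have "2 * n \<le> s * Q" if "s > 0" for s
  proof -
    have "0 \<le> quad_form I H (\<lambda>i. \<xi> i + of_real (- s) * \<eta> i)" by (rule nonneg)
    also have "\<dots> = quad_form I H \<xi> + 2 * (- s) * Re (\<Sum>i\<in>I. cnj (\<eta> i) * (\<Sum>j\<in>I. H i j * \<xi> j)) + (- s)\<^sup>2 * Q"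
      unfolding Q_def by (rule quad_form_add) (rule herm)
    finally have "0 \<le> 2 * (- s) * n + (- s)\<^sup>2 * Q" by (simp only: zero \<eta>_def[symmetric] n)
    then have "s * (2 * n) \<le> s * (s * Q)" by (simp add: power2_eq_square)
    then show ?thesis using that by simp
  qed
  moreover have "Q \<ge> 0" using nonneg by (simp add: Q_def)
  ultimately have "2 * n \<le> 0 + e" if "e > 0" for e
  proof -
    have "2 * n \<le> (e / (Q + 1)) * Q" using \<open>Q \<ge> 0\<close> that \<open>\<And>s. s > 0 \<Longrightarrow> 2 * n \<le> s * Q\<close>[of "e / (Q + 1)"] by simp
    also have "\<dots> \<le> e" using \<open>Q \<ge> 0\<close> that by (simp add: field_simps)
    finally show ?thesis by simp
  qed
  then have "2 * n \<le> 0" by (rule field_le_epsilon)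
  moreover have "n \<ge> 0" unfolding n_def by (intro sum_nonneg) auto
  ultimately have "n = 0" by simp
  then show ?thesis using I \<open>i \<in> I\<close> by (simp add: n_def sum_nonneg_eq_0_iff \<eta>_def)
qed

text \<open>The index type may be infinite, so the coordinates outside I are frozen at 0; the sphere
  is then a closed subset of a product of discs and points.\<close>

lemma compact_unit_sphere_fun:
  assumes "finite I"
  shows "compact {\<xi> :: 'i \<Rightarrow> complex. (\<forall>i. i \<notin> I \<longrightarrow> \<xi> i = 0) \<and> (\<Sum>i\<in>I. (cmod (\<xi> i))\<^sup>2) = 1}" (is "compact ?S")
proof -
  define B where "B = (PiE UNIV (\<lambda>i. if i \<in> I then cball 0 1 else {0}) :: ('i \<Rightarrow> complex) set)"
  have "compactin (product_topology (\<lambda>i. euclidean) UNIV) B"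
    unfolding B_def compactin_PiE by auto
  then have "compact B" by (simp add: euclidean_product_topology)
  moreover have "closed {\<xi> :: 'i \<Rightarrow> complex. (\<Sum>i\<in>I. (cmod (\<xi> i))\<^sup>2) = 1}"
    by (intro closed_Collect_eq continuous_intros continuous_on_product_coordinates)
  moreover have "?S = B \<inter> {\<xi>. (\<Sum>i\<in>I. (cmod (\<xi> i))\<^sup>2) = 1}"
  proof -
    have "cmod (\<xi> i) \<le> 1" if "(\<Sum>i\<in>I. (cmod (\<xi> i))\<^sup>2) = 1" "i \<in> I" for \<xi> :: "'i \<Rightarrow> complex" and i
    proof -
      have "(cmod (\<xi> i))\<^sup>2 \<le> 1"
        unfolding that(1)[symmetric] using assms that(2) by (intro member_le_sum) auto
      then show ?thesis by (simp add: abs_square_le_1)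
    qed
    then show ?thesis by (auto simp: B_def PiE_iff split: if_splits)
  qed
  ultimately show ?thesis by (simp only: compact_Int_closed)
qed

text \<open>The minimiser of the form on the unit sphere is the eigenvector: H - \<theta> is
  nonnegative and vanishes at it, so the kernel lemma applies.\<close>

lemma minimal_eigenvalue:
  assumes I: "finite I" "I \<noteq> {}" and herm: "\<And>i j. i \<in> I \<Longrightarrow> j \<in> I \<Longrightarrow> H j i = cnj (H i j)"
  shows "\<exists>\<theta> \<xi>. (\<exists>i\<in>I. \<xi> i \<noteq> 0) \<and> (\<forall>i\<in>I. (\<Sum>j\<in>I. H i j * \<xi> j) = of_real \<theta> * \<xi> i) \<and>
    (\<forall>\<zeta>. quad_form I H \<zeta> \<ge> \<theta> * (\<Sum>i\<in>I. (cmod (\<zeta> i))\<^sup>2))"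
proof -
  define S where "S = {\<xi> :: 'a \<Rightarrow> complex. (\<forall>i. i \<notin> I \<longrightarrow> \<xi> i = 0) \<and> (\<Sum>i\<in>I. (cmod (\<xi> i))\<^sup>2) = 1}"
  obtain k where k: "k \<in> I" using I(2) by blast
  have "(\<lambda>i. if i = k then 1 else 0) \<in> S"
    using k I(1) by (auto simp: S_def if_distrib[of "\<lambda>x. (cmod x)\<^sup>2"] cong: if_cong)
  then have ne: "S \<noteq> {}" by blast
  have cont: "continuous_on S (quad_form I H)"
    unfolding quad_form_def
    by (intro continuous_intros continuous_on_subset[OF continuous_on_product_coordinates]) auto
  obtain \<xi> where \<xi>: "\<xi> \<in> S" "\<And>\<zeta>. \<zeta> \<in> S \<Longrightarrow> quad_form I H \<xi> \<le> quad_form I H \<zeta>"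
    using continuous_attains_inf[OF compact_unit_sphere_fun[OF I(1), folded S_def] ne cont] by blast
  define \<theta> where "\<theta> = quad_form I H \<xi>"
  have q0: "quad_form I H \<zeta> = quad_form I H (\<lambda>i. if i \<in> I then \<zeta> i else 0)" for \<zeta>
    by (simp add: quad_form_def cong: sum.cong)
  have scale: "quad_form I H (\<lambda>i. of_real r * \<zeta> i) = r\<^sup>2 * quad_form I H \<zeta>" for r \<zeta>
  proof -
    have "quad_form I H (\<lambda>i. 0 + of_real r * \<zeta> i) = quad_form I H (\<lambda>i. 0) +
        2 * r * Re (\<Sum>i\<in>I. cnj (\<zeta> i) * (\<Sum>j\<in>I. H i j * 0)) + r\<^sup>2 * quad_form I H \<zeta>"
      by (rule quad_form_add) (rule herm)
    then show ?thesis by (simp add: quad_form_def[of _ _ "\<lambda>i. 0"])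
  qed
  have min: "quad_form I H \<zeta> \<ge> \<theta> * (\<Sum>i\<in>I. (cmod (\<zeta> i))\<^sup>2)" for \<zeta>
  proof -
    define n where "n = (\<Sum>i\<in>I. (cmod (\<zeta> i))\<^sup>2)"
    have n0: "n \<ge> 0" unfolding n_def by (intro sum_nonneg) auto
    show ?thesis
    proof (cases "n = 0")
      case True
      then have "\<zeta> i = 0" if "i \<in> I" for i using I that by (simp add: n_def sum_nonneg_eq_0_iff)
      then have "quad_form I H \<zeta> = 0" by (simp add: quad_form_def)
      then show ?thesis using True by (simp add: n_def)
    next
      case False
      with n0 have n: "n > 0" by simp
      define \<zeta>' where "\<zeta>' i = of_real (1 / sqrt n) * (if i \<in> I then \<zeta> i else 0)" for i
      have "(\<Sum>i\<in>I. (cmod (\<zeta>' i))\<^sup>2) = (\<Sum>i\<in>I. (cmod (\<zeta> i))\<^sup>2 / n)"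
        using n by (intro sum.cong) (auto simp: \<zeta>'_def norm_mult norm_divide power_divide)
      also have "\<dots> = 1" using n by (simp add: sum_divide_distrib[symmetric] n_def)
      finally have "\<zeta>' \<in> S" by (auto simp: S_def \<zeta>'_def)
      then have "\<theta> \<le> quad_form I H \<zeta>'" unfolding \<theta>_def by (rule \<xi>(2))
      also have "\<dots> = quad_form I H \<zeta> / n"
        unfolding \<zeta>'_def scale q0[symmetric] using n by (simp add: power_divide)
      finally show ?thesis using n by (simp add: n_def field_simps)
    qed
  qed
  define H' where "H' i j = H i j - (if i = j then of_real \<theta> else 0)" for i j
  have inner: "(\<Sum>j\<in>I. H' i j * \<zeta> j) = (\<Sum>j\<in>I. H i j * \<zeta> j) - of_real \<theta> * \<zeta> i" if "i \<in> I" for i \<zeta>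
    using I that by (simp add: H'_def left_diff_distrib sum_subtractf if_distrib[of "\<lambda>x. x * _"] cong: if_cong)
  have q': "quad_form I H' \<zeta> = quad_form I H \<zeta> - \<theta> * (\<Sum>i\<in>I. (cmod (\<zeta> i))\<^sup>2)" for \<zeta>
  proof -
    have "(\<Sum>i\<in>I. \<Sum>j\<in>I. cnj (\<zeta> i) * H' i j * \<zeta> j) = (\<Sum>i\<in>I. cnj (\<zeta> i) * (\<Sum>j\<in>I. H' i j * \<zeta> j))"
      by (simp add: sum_distrib_left mult.assoc)
    also have "\<dots> = (\<Sum>i\<in>I. cnj (\<zeta> i) * ((\<Sum>j\<in>I. H i j * \<zeta> j) - of_real \<theta> * \<zeta> i))"
      by (intro sum.cong) (auto simp: inner)
    also have "\<dots> = (\<Sum>i\<in>I. \<Sum>j\<in>I. cnj (\<zeta> i) * H i j * \<zeta> j) - of_real \<theta> * cinner I \<zeta> \<zeta>"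
      by (simp add: right_diff_distrib sum_subtractf sum_distrib_left mult_ac cinner_def)
    finally show ?thesis unfolding quad_form_def cinner_self by simp
  qed
  have "(\<Sum>j\<in>I. H' i j * \<xi> j) = 0" if "i \<in> I" for i
  proof (rule quad_form_zero_imp_kernel[OF I(1) _ _ _ that])
    show "H' j i = cnj (H' i j)" if "i \<in> I" "j \<in> I" for i j
      using herm[OF that] by (simp add: H'_def)
    show "0 \<le> quad_form I H' \<zeta>" for \<zeta> using min[of \<zeta>] by (simp add: q')
    show "quad_form I H' \<xi> = 0" using \<xi>(1) unfolding q' \<theta>_def by (simp add: S_def)
  qed
  then have "(\<Sum>j\<in>I. H i j * \<xi> j) = of_real \<theta> * \<xi> i" if "i \<in> I" for i
    using inner[OF that, of \<xi>] that by simp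
  moreover have "\<exists>i\<in>I. \<xi> i \<noteq> 0"
  proof (rule ccontr)
    assume "\<not> ?thesis"
    then show False using \<xi>(1) by (simp add: S_def)
  qed
  ultimately show ?thesis using min by blast
qed

text \<open>The eigenprojections of \<open>H\<close> commute with \<open>u\<close>, which reduces positivity of \<open>H\<close> to that of its
  traces against the commutant of \<open>u\<close>.\<close>

lemma positive_if_traces_positive:
  fixes u :: "'i \<Rightarrow> 'i \<Rightarrow> 'q::cstar_algebra" and e :: "'i \<Rightarrow> 'm \<Rightarrow> complex"
  assumes I: "finite I" and herm: "\<And>i j. i \<in> I \<Longrightarrow> j \<in> I \<Longrightarrow> H j i = cnj (H i j)"
    and comm: "\<And>i j. i \<in> I \<Longrightarrow> j \<in> I \<Longrightarrow> (\<Sum>k\<in>I. H i k *\<^sub>C u k j) = (\<Sum>k\<in>I. H k j *\<^sub>C u i k)"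
    and trace: "\<And>T. (\<And>i j. i \<in> I \<Longrightarrow> j \<in> I \<Longrightarrow> (\<Sum>k\<in>I. T i k *\<^sub>C u k j) = (\<Sum>k\<in>I. T k j *\<^sub>C u i k)) \<Longrightarrow>
      (\<Sum>i\<in>I. \<Sum>j\<in>I. T i j * H j i) = (\<Sum>y\<in>Y0. \<Sum>i\<in>I. \<Sum>j\<in>I. T i j * (e i y * cnj (e j y)))"
    and Y0: "finite Y0"
  shows "quad_form I H \<zeta> \<ge> 0"
    and "quad_form I H \<zeta> = 0 \<Longrightarrow> y \<in> Y0 \<Longrightarrow> (\<Sum>i\<in>I. \<zeta> i * e i y) = 0"
proof -
  \<comment> \<open>For p the projection onto the eigenspace of \<theta>, the trace of p H is
    \<theta> times the squared entries of p, while the trace hypothesis evaluates it as a sum of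
    squares over Y0. The hypothesis may be used once p is shown to commute with u.\<close>
  have eig: "\<exists>p. (\<forall>\<zeta>. (\<forall>i\<in>I. (\<Sum>j\<in>I. H i j * \<zeta> j) = of_real \<theta> * \<zeta> i) \<longrightarrow> (\<forall>i\<in>I. (\<Sum>j\<in>I. p i j * \<zeta> j) = \<zeta> i)) \<and>
      \<theta> * (\<Sum>i\<in>I. \<Sum>j\<in>I. (cmod (p i j))\<^sup>2) = (\<Sum>y\<in>Y0. \<Sum>k\<in>I. (cmod (\<Sum>i\<in>I. p i k * e i y))\<^sup>2)" for \<theta>
  proof -
    define N where "N = {\<zeta>. \<forall>i\<in>I. (\<Sum>j\<in>I. H i j * \<zeta> j) = of_real \<theta> * \<zeta> i}"
    have N: "csubspace N"
    proof (rule csubspaceI)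
      show "(\<lambda>i. c * f i) \<in> N" if "f \<in> N" for c f
      proof -
        have "(\<Sum>j\<in>I. H i j * (c * f j)) = c * (\<Sum>j\<in>I. H i j * f j)" for i
          by (simp add: sum_distrib_left mult_ac)
        then show ?thesis using that by (simp add: N_def)
      qed
    qed (auto simp: N_def algebra_simps sum.distrib)
    obtain p where pN: "\<And>j. j \<in> I \<Longrightarrow> (\<lambda>i. p i j) \<in> N"
      and ph: "\<And>i j. i \<in> I \<Longrightarrow> j \<in> I \<Longrightarrow> p j i = cnj (p i j)"
      and pid: "\<And>\<zeta> i. \<zeta> \<in> N \<Longrightarrow> i \<in> I \<Longrightarrow> (\<Sum>j\<in>I. p i j * \<zeta> j) = \<zeta> i"
      using orthogonal_projection_matrix[OF I N] by blast
    have Hp: "(\<Sum>j\<in>I. H i j * p j k) = of_real \<theta> * p i k" if "i \<in> I" "k \<in> I" for i k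
      using pN[OF that(2)] that(1) by (simp add: N_def)
    \<comment> \<open>Eigenvectors with entries in the algebra: states reduce the claim to scalar
      eigenvectors.\<close>
    have pz: "(\<Sum>j\<in>I. p i j *\<^sub>C z j) = z i"
      if z: "\<And>i. i \<in> I \<Longrightarrow> (\<Sum>j\<in>I. H i j *\<^sub>C z j) = of_real \<theta> *\<^sub>C z i" and i: "i \<in> I" for z :: "'i \<Rightarrow> 'q" and i
    proof -
      have "\<phi> ((\<Sum>j\<in>I. p i j *\<^sub>C z j) - z i) = 0" if \<phi>: "cstar_state \<phi>" for \<phi>
      proof -
        have "(\<Sum>j\<in>I. H i j * \<phi> (z j)) = of_real \<theta> * \<phi> (z i)" if "i \<in> I" for i
          using arg_cong[OF z[OF that], of \<phi>] by (simp add: cstar_state_sum[OF \<phi>] cstar_state_scaleC[OF \<phi>])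
        then have "(\<lambda>i. \<phi> (z i)) \<in> N" by (simp add: N_def)
        then show ?thesis using pid[OF _ i]
          by (simp add: cstar_state_diff[OF \<phi>] cstar_state_sum[OF \<phi>] cstar_state_scaleC[OF \<phi>])
      qed
      then show ?thesis using cstar_states_separate by fastforce
    qed
    have half: "(\<Sum>k\<in>I. p k j *\<^sub>C v i k) = (\<Sum>l\<in>I. \<Sum>k\<in>I. (p i l * p k j) *\<^sub>C v l k)"
      if v: "\<And>i j. i \<in> I \<Longrightarrow> j \<in> I \<Longrightarrow> (\<Sum>k\<in>I. H i k *\<^sub>C v k j) = (\<Sum>k\<in>I. H k j *\<^sub>C v i k)"
        and ij: "i \<in> I" "j \<in> I" for v :: "'i \<Rightarrow> 'i \<Rightarrow> 'q" and i j
    proof -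
      have "(\<Sum>l\<in>I. H i l *\<^sub>C (\<Sum>k\<in>I. p k j *\<^sub>C v l k)) = of_real \<theta> *\<^sub>C (\<Sum>k\<in>I. p k j *\<^sub>C v i k)"
        if i: "i \<in> I" for i
      proof -
        have "(\<Sum>l\<in>I. H i l *\<^sub>C (\<Sum>k\<in>I. p k j *\<^sub>C v l k)) = (\<Sum>k\<in>I. p k j *\<^sub>C (\<Sum>l\<in>I. H i l *\<^sub>C v l k))"
          unfolding scaleC_sum_right by (subst sum.swap) (simp add: scaleC_scaleC mult.commute)
        also have "\<dots> = (\<Sum>k\<in>I. p k j *\<^sub>C (\<Sum>l\<in>I. H l k *\<^sub>C v i l))"
          by (intro sum.cong refl) (simp add: v i)
        also have "\<dots> = (\<Sum>l\<in>I. (\<Sum>k\<in>I. H l k * p k j) *\<^sub>C v i l)"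
          unfolding scaleC_sum_right scaleC_sum_left by (subst sum.swap) (simp add: scaleC_scaleC mult.commute)
        also have "\<dots> = (\<Sum>l\<in>I. (of_real \<theta> * p l j) *\<^sub>C v i l)"
          by (intro sum.cong refl) (simp add: Hp ij)
        finally show ?thesis by (simp add: scaleC_sum_right scaleC_scaleC)
      qed
      then have "(\<Sum>l\<in>I. p i l *\<^sub>C (\<Sum>k\<in>I. p k j *\<^sub>C v l k)) = (\<Sum>k\<in>I. p k j *\<^sub>C v i k)"
        using ij(1) by (intro pz) auto
      then show ?thesis by (simp add: scaleC_sum_right scaleC_scaleC)
    qed
    \<comment> \<open>H is hermitian, so the adjoint matrix of u commutes with H as well. The half
      statement reads u p = p u p for u, and for the adjoint, after taking adjoints again, p u = p u
      p.\<close>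
    define v where "v i j = star (u j i)" for i j
    have vcomm: "(\<Sum>k\<in>I. H i k *\<^sub>C v k j) = (\<Sum>k\<in>I. H k j *\<^sub>C v i k)" if "i \<in> I" "j \<in> I" for i j
    proof -
      have "star (\<Sum>k\<in>I. H j k *\<^sub>C u k i) = star (\<Sum>k\<in>I. H k i *\<^sub>C u j k)" using comm[of j i] that by simp
      then have "(\<Sum>k\<in>I. cnj (H j k) *\<^sub>C v i k) = (\<Sum>k\<in>I. cnj (H k i) *\<^sub>C v k j)"
        by (simp add: star_sum star_scaleC v_def)
      moreover have "cnj (H j k) = H k j" "cnj (H k i) = H i k" if "k \<in> I" for k
        using herm that \<open>i \<in> I\<close> \<open>j \<in> I\<close> by metis+
      ultimately show ?thesis by (simp cong: sum.cong)
    qed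
    have pcomm: "(\<Sum>k\<in>I. p i k *\<^sub>C u k j) = (\<Sum>k\<in>I. p k j *\<^sub>C u i k)" if ij: "i \<in> I" "j \<in> I" for i j
    proof -
      have "star (\<Sum>k\<in>I. p k i *\<^sub>C v j k) = star (\<Sum>l\<in>I. \<Sum>k\<in>I. (p j l * p k i) *\<^sub>C v l k)"
        using half[of v j i] vcomm ij by simp
      then have "(\<Sum>k\<in>I. cnj (p k i) *\<^sub>C u k j) = (\<Sum>l\<in>I. \<Sum>k\<in>I. (cnj (p j l) * cnj (p k i)) *\<^sub>C u k l)"
        by (simp add: star_sum star_scaleC v_def star_star)
      moreover have "cnj (p k i) = p i k" "cnj (p j k) = p k j" if "k \<in> I" for k
        using ph that ij by metis+
      ultimately have "(\<Sum>k\<in>I. p i k *\<^sub>C u k j) = (\<Sum>l\<in>I. \<Sum>k\<in>I. (p l j * p i k) *\<^sub>C u k l)"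
        by (simp cong: sum.cong)
      also have "\<dots> = (\<Sum>k\<in>I. \<Sum>l\<in>I. (p i k * p l j) *\<^sub>C u k l)"
        by (subst sum.swap) (simp add: mult.commute)
      also have "\<dots> = (\<Sum>k\<in>I. p k j *\<^sub>C u i k)" using half[of u i j] comm ij by simp
      finally show ?thesis .
    qed
    have sq: "(\<Sum>k\<in>I. p i k * p k j) = p i j" if "i \<in> I" "j \<in> I" for i j
      using pid[OF pN[OF that(2)] that(1)] by simp
    have "(\<Sum>i\<in>I. \<Sum>j\<in>I. p i j * H j i) = of_real (\<theta> * (\<Sum>i\<in>I. \<Sum>j\<in>I. (cmod (p i j))\<^sup>2))"
    proof -
      have "(\<Sum>i\<in>I. \<Sum>j\<in>I. p i j * H j i) = (\<Sum>j\<in>I. \<Sum>i\<in>I. H j i * p i j)"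
        by (subst sum.swap) (simp add: mult.commute)
      also have "\<dots> = (\<Sum>j\<in>I. of_real \<theta> * (\<Sum>k\<in>I. p j k * p k j))"
        by (intro sum.cong refl) (simp add: Hp sq)
      also have "\<dots> = (\<Sum>j\<in>I. of_real \<theta> * (\<Sum>k\<in>I. of_real ((cmod (p j k))\<^sup>2)))"
      proof (intro sum.cong refl arg_cong2[where f = "(*)"])
        fix j k assume "j \<in> I" "k \<in> I"
        then show "p j k * p k j = of_real ((cmod (p j k))\<^sup>2)"
          using ph[of j k] by (simp add: complex_norm_square del: of_real_power)
      qed
      finally show ?thesis by (simp add: sum_distrib_left)
    qed
    moreover have "(\<Sum>i\<in>I. \<Sum>j\<in>I. p i j * (e i y * cnj (e j y))) = of_real (\<Sum>k\<in>I. (cmod (\<Sum>i\<in>I. p i k * e i y))\<^sup>2)" for y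
    proof -
      have "(\<Sum>i\<in>I. \<Sum>j\<in>I. p i j * (e i y * cnj (e j y))) =
          (\<Sum>i\<in>I. \<Sum>j\<in>I. \<Sum>k\<in>I. (p i k * e i y) * cnj (p j k * e j y))"
      proof (intro sum.cong refl)
        fix i j assume ij: "i \<in> I" "j \<in> I"
        have "p i j = (\<Sum>k\<in>I. p i k * cnj (p j k))"
          unfolding sq[OF ij, symmetric] by (intro sum.cong refl arg_cong2[where f = "(*)"] ph ij)
        then show "p i j * (e i y * cnj (e j y)) = (\<Sum>k\<in>I. (p i k * e i y) * cnj (p j k * e j y))"
          by (simp add: sum_distrib_left mult_ac)
      qed
      also have "\<dots> = (\<Sum>k\<in>I. \<Sum>i\<in>I. \<Sum>j\<in>I. (p i k * e i y) * cnj (p j k * e j y))"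
        by (subst (2) sum.swap, subst sum.swap, rule refl)
      also have "\<dots> = (\<Sum>k\<in>I. (\<Sum>i\<in>I. p i k * e i y) * cnj (\<Sum>i\<in>I. p i k * e i y))"
        by (simp add: sum_product)
      finally show ?thesis by (simp add: complex_norm_square del: of_real_power)
    qed
    ultimately have "of_real (\<theta> * (\<Sum>i\<in>I. \<Sum>j\<in>I. (cmod (p i j))\<^sup>2)) =
        complex_of_real (\<Sum>y\<in>Y0. \<Sum>k\<in>I. (cmod (\<Sum>i\<in>I. p i k * e i y))\<^sup>2)"
      using trace[OF pcomm] by (simp only: of_real_sum)
    then show ?thesis using pid by (intro exI[of _ p]) (auto simp: N_def simp del: of_real_mult of_real_sum)
  qed
  have nonneg: "quad_form I H \<zeta> \<ge> 0" for \<zeta>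
  proof (cases "I = {}")
    case False
    obtain \<theta> \<xi> where \<theta>: "\<exists>i\<in>I. \<xi> i \<noteq> 0" "\<forall>i\<in>I. (\<Sum>j\<in>I. H i j * \<xi> j) = of_real \<theta> * \<xi> i"
      "\<And>\<zeta>. quad_form I H \<zeta> \<ge> \<theta> * (\<Sum>i\<in>I. (cmod (\<zeta> i))\<^sup>2)"
      using minimal_eigenvalue[of I H, OF I False herm] by blast
    obtain p where p: "\<forall>i\<in>I. (\<Sum>j\<in>I. p i j * \<xi> j) = \<xi> i"
      "\<theta> * (\<Sum>i\<in>I. \<Sum>j\<in>I. (cmod (p i j))\<^sup>2) = (\<Sum>y\<in>Y0. \<Sum>k\<in>I. (cmod (\<Sum>i\<in>I. p i k * e i y))\<^sup>2)"
      using eig[of \<theta>] \<theta>(2) by blast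
    \<comment> \<open>The eigenspace of the lowest eigenvalue is not trivial, so n > 0, and \<theta>
      n is a sum of squares; hence \<theta> is nonnegative.\<close>
    define n where "n = (\<Sum>i\<in>I. \<Sum>j\<in>I. (cmod (p i j))\<^sup>2)"
    have "n \<ge> 0" unfolding n_def by (intro sum_nonneg) auto
    moreover have "n \<noteq> 0"
    proof
      assume "n = 0"
      then have "p i j = 0" if "i \<in> I" "j \<in> I" for i j
        using I that by (simp add: n_def sum_nonneg_eq_0_iff sum_nonneg)
      then show False using p(1) \<theta>(1) by force
    qed
    moreover have "\<theta> * n \<ge> 0" unfolding n_def p(2) by (intro sum_nonneg) auto
    ultimately have "\<theta> \<ge> 0" by (simp add: zero_le_mult_iff)
    then have "\<theta> * (\<Sum>i\<in>I. (cmod (\<zeta> i))\<^sup>2) \<ge> 0" by (intro mult_nonneg_nonneg sum_nonneg) auto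
    then show ?thesis using \<theta>(3)[of \<zeta>] by simp
  qed (simp add: quad_form_def)
  then show "quad_form I H \<zeta> \<ge> 0" .
  assume zero: "quad_form I H \<zeta> = 0" and y: "y \<in> Y0"
  \<comment> \<open>A null vector is an eigenvector for 0, where the trace identity says that the
    functions built from the columns of the projection all vanish on Y0.\<close>
  have "\<forall>i\<in>I. (\<Sum>j\<in>I. H i j * \<zeta> j) = of_real 0 * \<zeta> i"
    using quad_form_zero_imp_kernel[OF I herm nonneg zero] by simp
  then obtain p where p: "\<forall>i\<in>I. (\<Sum>j\<in>I. p i j * \<zeta> j) = \<zeta> i"
    "0 * (\<Sum>i\<in>I. \<Sum>j\<in>I. (cmod (p i j))\<^sup>2) = (\<Sum>y\<in>Y0. \<Sum>k\<in>I. (cmod (\<Sum>i\<in>I. p i k * e i y))\<^sup>2)"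
    using eig[of 0] by blast
  then have "(\<Sum>k\<in>I. (cmod (\<Sum>i\<in>I. p i k * e i y))\<^sup>2) = 0"
    using Y0 y by (simp add: sum_nonneg_eq_0_iff sum_nonneg)
  then have k: "(\<Sum>i\<in>I. p i k * e i y) = 0" if "k \<in> I" for k
    using I that by (simp add: sum_nonneg_eq_0_iff)
  have "(\<Sum>i\<in>I. \<zeta> i * e i y) = (\<Sum>i\<in>I. (\<Sum>j\<in>I. p i j * \<zeta> j) * e i y)" using p(1) by (intro sum.cong) auto
  also have "\<dots> = (\<Sum>j\<in>I. \<zeta> j * (\<Sum>i\<in>I. p i j * e i y))"
    unfolding sum_distrib_left sum_distrib_right by (subst sum.swap) (simp add: mult_ac)
  also have "\<dots> = 0" using k by simp
  finally show "(\<Sum>i\<in>I. \<zeta> i * e i y) = 0" .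
qed

section \<open>Finite-dimensional invariant subspaces of an algebraic coaction\<close>

lemma cstar_states_separate2:
  assumes "\<And>\<phi>. cstar_state \<phi> \<Longrightarrow> \<phi> x = \<phi> (y :: 'a::cstar_algebra)"
  shows "x = y"
  using cstar_states_separate[of "x - y"] assms by (simp add: cstar_state_diff)

lemma sum_fun_apply: "(\<Sum>k\<in>K. F k) x = (\<Sum>k\<in>K. F k x :: 'a::comm_monoid_add)"
  by (induction K rule: infinite_finite_induct) simp_all

text \<open>Irreducibility is phrased through projections with u p = p u p. Invariance of N under
  all scalar matrices \<phi>(u) says just this for the projection onto N, because states
  separate.\<close>

lemma irreducible_column_dichotomy:
  assumes irr: "irreducible_unitary_rep t \<Delta> n u" and N: "csubspace N"
    and inv: "\<And>\<xi> \<phi>. \<xi> \<in> N \<Longrightarrow> cstar_state \<phi> \<Longrightarrow> \<exists>\<eta>\<in>N. \<forall>a<n. \<eta> a = (\<Sum>c<n. \<phi> (u a c) * \<xi> c)"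
  shows "(\<forall>\<xi>\<in>N. \<forall>i<n. \<xi> i = 0) \<or> (\<forall>\<zeta>. \<exists>\<xi>\<in>N. \<forall>i<n. \<xi> i = \<zeta> i)"
proof -
  obtain p where pN: "\<forall>j\<in>{..<n}. (\<lambda>i. p i j) \<in> N"
    and ph: "\<forall>i\<in>{..<n}. \<forall>j\<in>{..<n}. p j i = cnj (p i j)"
    and pid: "\<forall>\<zeta>\<in>N. \<forall>i\<in>{..<n}. (\<Sum>j<n. p i j * \<zeta> j) = \<zeta> i"
    using orthogonal_projection_matrix[OF finite_lessThan N] by blast
  have "projection_matrix n p"
    unfolding projection_matrix_def using pN ph pid by (metis lessThan_iff)
  moreover have "(\<Sum>k<n. p k j *\<^sub>C u i k) = (\<Sum>k<n. \<Sum>l<n. (p i k * p l j) *\<^sub>C u k l)" if ij: "i < n" "j < n" for i j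
  proof (rule cstar_states_separate2)
    fix \<phi> :: "'a \<Rightarrow> complex" assume \<phi>: "cstar_state \<phi>"
    obtain \<eta> where \<eta>: "\<eta> \<in> N" "\<forall>a<n. \<eta> a = (\<Sum>c<n. \<phi> (u a c) * p c j)"
      using inv[OF _ \<phi>, of "\<lambda>i. p i j"] pN ij by auto
    have "\<phi> (\<Sum>k<n. \<Sum>l<n. (p i k * p l j) *\<^sub>C u k l) = (\<Sum>k<n. p i k * \<eta> k)"
      using \<eta>(2) by (simp add: cstar_state_sum[OF \<phi>] cstar_state_scaleC[OF \<phi>] sum_distrib_left mult_ac)
    also have "\<dots> = \<eta> i" using pid \<eta>(1) ij by simp
    also have "\<dots> = \<phi> (\<Sum>k<n. p k j *\<^sub>C u i k)"
      using \<eta>(2) ij by (simp add: cstar_state_sum[OF \<phi>] cstar_state_scaleC[OF \<phi>] mult_ac)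
    finally show "\<phi> (\<Sum>k<n. p k j *\<^sub>C u i k) = \<phi> (\<Sum>k<n. \<Sum>l<n. (p i k * p l j) *\<^sub>C u k l)" by simp
  qed
  ultimately have "(\<forall>i<n. \<forall>j<n. p i j = 0) \<or> (\<forall>i<n. \<forall>j<n. p i j = (if i = j then 1 else 0))"
    using irr unfolding irreducible_unitary_rep_def by blast
  then show ?thesis
  proof
    assume 0: "\<forall>i<n. \<forall>j<n. p i j = 0"
    have "\<xi> i = 0" if "\<xi> \<in> N" "i < n" for \<xi> i
    proof -
      have "\<xi> i = (\<Sum>j<n. p i j * \<xi> j)" using pid that by simp
      then show ?thesis using 0 that by simp
    qed
    then show ?thesis by blast
  next
    assume 1: "\<forall>i<n. \<forall>j<n. p i j = (if i = j then 1 else 0)"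
    have "\<exists>\<xi>\<in>N. \<forall>i<n. \<xi> i = \<zeta> i" for \<zeta>
    proof
      show "(\<lambda>i. \<Sum>j<n. \<zeta> j * p i j) \<in> N" using pN by (intro csubspace_sum[OF N]) auto
      show "\<forall>i<n. (\<Sum>j<n. \<zeta> j * p i j) = \<zeta> i"
        using 1 by (simp add: if_distrib[of "\<lambda>x. _ * x"] cong: if_cong)
    qed
    then show ?thesis by blast
  qed
qed

text \<open>Invariance under the transposed matrices concerns the other side of u. With p the
  projection onto the conjugate of N it reads p u = p u p, so it is the complement 1 - p whose range
  is invariant in the sense of the definition.\<close>

lemma irreducible_row_dichotomy:
  assumes irr: "irreducible_unitary_rep t \<Delta> n u" and N: "csubspace N"
    and inv: "\<And>\<xi> \<phi>. \<xi> \<in> N \<Longrightarrow> cstar_state \<phi> \<Longrightarrow> \<exists>\<eta>\<in>N. \<forall>c<n. \<eta> c = (\<Sum>a<n. \<xi> a * \<phi> (u a c))"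
  shows "(\<forall>\<xi>\<in>N. \<forall>i<n. \<xi> i = 0) \<or> (\<forall>\<zeta>. \<exists>\<xi>\<in>N. \<forall>i<n. \<xi> i = \<zeta> i)"
proof -
  define N' where "N' = {\<xi>. (\<lambda>i. cnj (\<xi> i)) \<in> N}"
  have N': "csubspace N'"
    by (rule csubspaceI) (use csubspaceD[OF N] in \<open>auto simp: N'_def\<close>)
  obtain p where pN: "\<forall>j\<in>{..<n}. (\<lambda>i. p i j) \<in> N'"
    and ph: "\<forall>i\<in>{..<n}. \<forall>j\<in>{..<n}. p j i = cnj (p i j)"
    and pid: "\<forall>\<zeta>\<in>N'. \<forall>i\<in>{..<n}. (\<Sum>j<n. p i j * \<zeta> j) = \<zeta> i"
    using orthogonal_projection_matrix[OF finite_lessThan N'] by blast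
  have sq: "(\<Sum>k<n. p i k * p k j) = p i j" if "i < n" "j < n" for i j
    using pN pid that by simp
  have row: "(\<Sum>c<n. \<xi> c * p c j) = \<xi> j" if "\<xi> \<in> N" "j < n" for \<xi> j
  proof -
    have "(\<lambda>i. cnj (\<xi> i)) \<in> N'" using that by (simp add: N'_def)
    then have "(\<Sum>c<n. p j c * cnj (\<xi> c)) = cnj (\<xi> j)" using pid that by simp
    then have "cnj (\<Sum>c<n. p j c * cnj (\<xi> c)) = \<xi> j" by simp
    then have "(\<Sum>c<n. cnj (p j c) * \<xi> c) = \<xi> j" by simp
    moreover have "(\<Sum>c<n. \<xi> c * p c j) = (\<Sum>c<n. cnj (p j c) * \<xi> c)"
    proof (intro sum.cong refl)
      fix c assume "c \<in> {..<n}"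
      then have "p c j = cnj (p j c)" using ph that(2) by blast
      then show "\<xi> c * p c j = cnj (p j c) * \<xi> c" by (simp only: mult.commute)
    qed
    ultimately show ?thesis by simp
  qed
  define p' where "p' i j = (if i = j then 1 else 0) - p i j" for i j
  have "projection_matrix n p'"
    unfolding projection_matrix_def
  proof (intro allI impI conjI)
    fix i j assume ij: "i < n" "j < n"
    have "(\<Sum>k<n. p' i k * p' k j) = (\<Sum>k<n. (if i = k then 1 else 0) * p' k j) - (\<Sum>k<n. p i k * p' k j)"
      by (simp add: p'_def[of i] left_diff_distrib sum_subtractf)
    also have "(\<Sum>k<n. (if i = k then 1 else 0) * p' k j) = p' i j"
      using ij by (simp add: if_distrib[of "\<lambda>x. x * _"] cong: if_cong)
    also have "(\<Sum>k<n. p i k * p' k j) = 0"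
      using sq[OF ij] ij by (simp add: p'_def right_diff_distrib sum_subtractf if_distrib[of "\<lambda>x. _ * x"] cong: if_cong)
    finally show "(\<Sum>k<n. p' i k * p' k j) = p' i j" by simp
    have "p j i = cnj (p i j)" using ph ij by blast
    then show "cnj (p' j i) = p' i j" by (simp add: p'_def)
  qed
  moreover have "(\<Sum>k<n. p' k j *\<^sub>C u i k) = (\<Sum>k<n. \<Sum>l<n. (p' i k * p' l j) *\<^sub>C u k l)"
    if ij: "i < n" "j < n" for i j
  proof (rule cstar_states_separate2)
    fix \<phi> :: "'a \<Rightarrow> complex" assume \<phi>: "cstar_state \<phi>"
    have "(\<lambda>a. p a i) \<in> N'" using pN ij by blast
    then have "(\<lambda>a. cnj (p a i)) \<in> N" by (simp add: N'_def)
    then obtain \<eta> where \<eta>: "\<eta> \<in> N" "\<forall>c<n. \<eta> c = (\<Sum>a<n. cnj (p a i) * \<phi> (u a c))"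
      using inv[OF _ \<phi>] by blast
    have \<eta>': "\<eta> c = (\<Sum>a<n. p i a * \<phi> (u a c))" if "c < n" for c
    proof -
      have "cnj (p a i) = p i a" if "a < n" for a using ph ij that by (metis lessThan_iff)
      then show ?thesis using \<eta>(2) that by simp
    qed
    have "(\<Sum>k<n. \<Sum>l<n. p i k * p' l j * \<phi> (u k l)) = (\<Sum>l<n. \<eta> l * p' l j)"
      using \<eta>' by (subst sum.swap) (simp add: sum_distrib_left mult_ac)
    also have "\<dots> = 0"
      using row[OF \<eta>(1) ij(2)] ij by (simp add: p'_def right_diff_distrib sum_subtractf if_distrib[of "\<lambda>x. _ * x"] cong: if_cong)
    finally have "(\<Sum>k<n. \<Sum>l<n. p i k * p' l j * \<phi> (u k l)) = 0" .
    then have "(\<Sum>k<n. \<Sum>l<n. (p' i k * p' l j) * \<phi> (u k l)) =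
        (\<Sum>k<n. \<Sum>l<n. (if i = k then 1 else 0) * (p' l j * \<phi> (u k l)))"
      by (simp add: p'_def[of i] left_diff_distrib sum_subtractf mult.assoc)
    also have "\<dots> = (\<Sum>k<n. (if i = k then 1 else 0) * (\<Sum>l<n. p' l j * \<phi> (u k l)))"
      by (simp add: sum_distrib_left)
    also have "\<dots> = (\<Sum>l<n. p' l j * \<phi> (u i l))"
      using ij by (simp add: if_distrib[of "\<lambda>x. x * _"] cong: if_cong)
    finally show "\<phi> (\<Sum>k<n. p' k j *\<^sub>C u i k) = \<phi> (\<Sum>k<n. \<Sum>l<n. (p' i k * p' l j) *\<^sub>C u k l)"
      by (simp add: cstar_state_sum[OF \<phi>] cstar_state_scaleC[OF \<phi>])
  qed
  ultimately have "(\<forall>i<n. \<forall>j<n. p' i j = 0) \<or> (\<forall>i<n. \<forall>j<n. p' i j = (if i = j then 1 else 0))"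
    using irr unfolding irreducible_unitary_rep_def by blast
  then show ?thesis
  proof
    assume 0: "\<forall>i<n. \<forall>j<n. p' i j = 0"
    have 1: "p i j = (if i = j then 1 else 0)" if "i < n" "j < n" for i j
      using 0 that by (simp add: p'_def)
    have "\<exists>\<xi>\<in>N. \<forall>i<n. \<xi> i = \<zeta> i" for \<zeta>
    proof
      show "(\<lambda>i. \<Sum>j<n. \<zeta> j * cnj (p i j)) \<in> N"
        using pN by (intro csubspace_sum[OF N]) (auto simp: N'_def)
      show "\<forall>i<n. (\<Sum>j<n. \<zeta> j * cnj (p i j)) = \<zeta> i"
        by (simp add: 1 if_distrib[of "\<lambda>x. _ * x"] if_distrib[of cnj] cong: if_cong)
    qed
    then show ?thesis by blast
  next
    assume 1: "\<forall>i<n. \<forall>j<n. p' i j = (if i = j then 1 else 0)"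
    have "p i j = 0" if "i < n" "j < n" for i j using 1 that by (simp add: p'_def)
    then have "\<xi> i = 0" if "\<xi> \<in> N" "i < n" for \<xi> i using row[OF that] that by simp
    then show ?thesis by blast
  qed
qed

locale algebraic_coaction =
  fixes t :: "'q::cstar_algebra \<Rightarrow> 'q \<Rightarrow> 'qq::cstar_algebra"
    and \<Delta> :: "'q \<Rightarrow> 'qq"
    and \<alpha> :: "('m::topological_space \<Rightarrow> complex) \<Rightarrow> ('m \<Rightarrow> 'q)"
    and \<A> :: "('m \<Rightarrow> complex) set"
  assumes tensor: "minimal_tensor t"
    and comult: "clinear_on UNIV \<Delta>"
    and hom: "unital_star_hom_on cts cts \<alpha>"
    and coassociative: "\<exists>E. unital_star_hom_on cts cts E \<and>
        (\<forall>f\<in>cts. \<forall>q. E (fun_tensor f q) = (\<lambda>x. t (\<alpha> f x) q)) \<and> (\<forall>f\<in>cts. E (\<alpha> f) = \<Delta> \<circ> \<alpha> f)"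
    and subalgebra: "unital_star_subalgebra \<A>" and continuous: "\<A> \<subseteq> cts"
    and algebraic: "\<And>f. f \<in> \<A> \<Longrightarrow> \<alpha> f \<in> cspan {fun_tensor a q | a q. a \<in> \<A> \<and> q \<in> hopf_core t \<Delta>}"
begin

lemma subalgebra_closed:
  shows "1 \<in> \<A>" "f \<in> \<A> \<Longrightarrow> g \<in> \<A> \<Longrightarrow> f + g \<in> \<A>" "f \<in> \<A> \<Longrightarrow> g \<in> \<A> \<Longrightarrow> f * g \<in> \<A>"
    "f \<in> \<A> \<Longrightarrow> star f \<in> \<A>" "f \<in> \<A> \<Longrightarrow> c *\<^sub>C f \<in> \<A>"
  using subalgebra by (auto simp: unital_star_subalgebra_def)

lemma csubspace_subalgebra: "csubspace \<A>"
proof -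
  have "0 *\<^sub>C 1 \<in> \<A>" using subalgebra_closed(1,5) by blast
  moreover have "0 *\<^sub>C (1 :: 'm \<Rightarrow> complex) = 0" by (simp add: fun_eq_iff)
  ultimately show ?thesis using subalgebra_closed by (simp add: cstar_fun.subspace_def)
qed

lemma subalgebra_combination: "(\<And>k. k \<in> K \<Longrightarrow> f k \<in> \<A>) \<Longrightarrow> (\<lambda>x. \<Sum>k\<in>K. c k * f k x) \<in> \<A>"
  by (rule csubspace_sum[OF csubspace_subalgebra])

lemma csubspace_cts: "cstar_fun.subspace (cts :: ('m \<Rightarrow> 'a::cstar_algebra) set)"
proof -
  have "continuous_on UNIV (\<lambda>x. c *\<^sub>C f x)" if "continuous_on UNIV f" for c and f :: "'m \<Rightarrow> 'a"
    using bounded_linear.continuous_on[OF bounded_linear_scaleC_right that] .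
  then show ?thesis
    by (auto simp: cstar_fun.subspace_def cts_def zero_fun_def plus_fun_def scaleC_fun_def intro: continuous_intros)
qed

lemma sum_cts: "(\<And>k. k \<in> K \<Longrightarrow> F k \<in> cts) \<Longrightarrow> (\<Sum>k\<in>K. F k) \<in> (cts :: ('m \<Rightarrow> 'a::cstar_algebra) set)"
  by (rule cstar_fun.subspace_sum[OF csubspace_cts])

lemma clinear_on_cts_sum:
  fixes E :: "('m \<Rightarrow> 'a::cstar_algebra) \<Rightarrow> 'm \<Rightarrow> 'b::cstar_algebra"
  assumes E: "clinear_on cts E"
  shows "(\<And>k. k \<in> K \<Longrightarrow> F k \<in> cts) \<Longrightarrow> E (\<Sum>k\<in>K. F k) = (\<Sum>k\<in>K. E (F k))"
proof (induction K rule: infinite_finite_induct)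
  case (insert k K)
  have "F k \<in> cts" "(\<Sum>k\<in>K. F k) \<in> cts" using insert.prems by (auto intro: sum_cts)
  then have "E (F k + (\<Sum>k\<in>K. F k)) = E (F k) + E (\<Sum>k\<in>K. F k)"
    using E unfolding clinear_on_def by blast
  moreover have "E (\<Sum>k\<in>K. F k) = (\<Sum>k\<in>K. E (F k))" using insert by blast
  ultimately show ?case unfolding sum.insert[OF insert.hyps] by (simp only:)
next
  case empty
  have "(0 :: 'm \<Rightarrow> 'a) \<in> cts" using csubspace_cts by (auto simp: cstar_fun.subspace_def)
  then have "E (0 *\<^sub>C 0) = 0 *\<^sub>C E 0" using E unfolding clinear_on_def by blast
  then show ?case by (simp only: sum.empty cstar_fun.scale_zero_left)
next
  case (infinite K)
  have "(0 :: 'm \<Rightarrow> 'a) \<in> cts" using csubspace_cts by (auto simp: cstar_fun.subspace_def)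
  then have "E (0 *\<^sub>C 0) = 0 *\<^sub>C E 0" using E unfolding clinear_on_def by blast
  then show ?case by (simp only: sum.infinite[OF infinite(1)] cstar_fun.scale_zero_left)
qed

lemma action_linear: "clinear_on cts \<alpha>"
  using hom by (simp add: unital_star_hom_on_def)

lemma action_combination:
  assumes "\<And>k. k \<in> K \<Longrightarrow> f k \<in> cts"
  shows "\<alpha> (\<lambda>x. \<Sum>k\<in>K. c k * f k x) x = (\<Sum>k\<in>K. c k *\<^sub>C \<alpha> (f k) x)"
proof -
  have c: "c k *\<^sub>C f k \<in> cts" if "k \<in> K" for k
    by (rule cstar_fun.subspace_scale[OF csubspace_cts assms[OF that]])
  have "(\<lambda>x. \<Sum>k\<in>K. c k * f k x) = (\<Sum>k\<in>K. c k *\<^sub>C f k)" by (simp add: fun_eq_iff sum_fun_apply)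
  then have "\<alpha> (\<lambda>x. \<Sum>k\<in>K. c k * f k x) = (\<Sum>k\<in>K. \<alpha> (c k *\<^sub>C f k))"
    using clinear_on_cts_sum[OF action_linear, of K "\<lambda>k. c k *\<^sub>C f k"] c by simp
  also have "\<dots> = (\<Sum>k\<in>K. c k *\<^sub>C \<alpha> (f k))"
    using action_linear assms by (intro sum.cong) (auto simp: clinear_on_def)
  finally show ?thesis by (simp add: sum_fun_apply)
qed

lemma action_mult: "f \<in> cts \<Longrightarrow> g \<in> cts \<Longrightarrow> \<alpha> (\<lambda>x. f x * g x) x = \<alpha> f x * \<alpha> g x"
proof -
  assume "f \<in> cts" "g \<in> cts"
  then have "\<alpha> (f * g) = \<alpha> f * \<alpha> g" using hom unfolding unital_star_hom_on_def by blast
  then show ?thesis unfolding times_fun_def by (rule fun_cong)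
qed

lemma action_star: "f \<in> cts \<Longrightarrow> \<alpha> (\<lambda>x. cnj (f x)) x = star (\<alpha> f x)"
proof -
  assume "f \<in> cts"
  then have "\<alpha> (star f) = star (\<alpha> f)" using hom by (simp add: unital_star_hom_on_def)
  then show ?thesis by (simp add: star_fun_def star_complex_def)
qed

lemma comult_sum: "\<Delta> (\<Sum>k\<in>K. c k *\<^sub>C q k) = (\<Sum>k\<in>K. c k *\<^sub>C \<Delta> (q k))"
proof -
  have add: "\<Delta> (x + y) = \<Delta> x + \<Delta> y" and sc: "\<Delta> (c *\<^sub>C x) = c *\<^sub>C \<Delta> x" for c x y
    using comult by (auto simp: clinear_on_def)
  have "\<Delta> 0 = 0" using sc[of 0 0] by simp
  then show ?thesis by (induction K rule: infinite_finite_induct) (auto simp: add sc)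
qed

lemma tensor_sum_left: "t (\<Sum>k\<in>K. c k *\<^sub>C z k) y = (\<Sum>k\<in>K. c k *\<^sub>C t (z k) y)"
proof -
  have "clinear_on UNIV (\<lambda>a. t a y)" using tensor by (simp add: minimal_tensor_def)
  then have add: "t (x + x') y = t x y + t x' y" and sc: "t (c *\<^sub>C x) y = c *\<^sub>C t x y" for c x x'
    by (auto simp: clinear_on_def)
  have "t 0 y = 0" using sc[of 0 0] by simp
  then show ?thesis by (induction K rule: infinite_finite_induct) (auto simp: add sc)
qed

text \<open>The extension of \<alpha> \<otimes> id is determined on elementary tensors, so for a
  finite expansion coassociativity becomes an algebraic identity at each point x.\<close>

lemma coassociative_expansion:
  fixes y :: "'k \<Rightarrow> 'q"
  assumes F: "\<And>k. k \<in> K \<Longrightarrow> F k \<in> \<A>" and f: "f \<in> \<A>"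
    and exp: "\<And>x. \<alpha> f x = (\<Sum>k\<in>K. F k x *\<^sub>C y k)"
  shows "(\<Sum>k\<in>K. t (\<alpha> (F k) x) (y k)) = (\<Sum>k\<in>K. F k x *\<^sub>C \<Delta> (y k))"
proof -
  obtain E where E: "unital_star_hom_on cts cts E"
    "\<forall>f\<in>cts. \<forall>q. E (fun_tensor f q) = (\<lambda>x. t (\<alpha> f x) q)" "\<forall>f\<in>cts. E (\<alpha> f) = \<Delta> \<circ> \<alpha> f"
    using coassociative by blast
  have "fun_tensor (F k) (y k) \<in> cts" if "k \<in> K" for k
    using bounded_linear.continuous_on[OF bounded_linear_scaleC_left, of UNIV "F k"] F[OF that] continuous
    by (auto simp: cts_def fun_tensor_def)
  then have "E (\<Sum>k\<in>K. fun_tensor (F k) (y k)) = (\<Sum>k\<in>K. E (fun_tensor (F k) (y k)))"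
    using E(1) by (intro clinear_on_cts_sum) (auto simp: unital_star_hom_on_def)
  moreover have "\<alpha> f = (\<Sum>k\<in>K. fun_tensor (F k) (y k))"
    by (simp add: fun_eq_iff exp sum_fun_apply fun_tensor_def)
  moreover have "E (fun_tensor (F k) (y k)) = (\<lambda>x. t (\<alpha> (F k) x) (y k))" if "k \<in> K" for k
    using E(2) F[OF that] continuous by blast
  moreover have "E (\<alpha> f) = \<Delta> \<circ> \<alpha> f" using E(3) f continuous by blast
  ultimately have "(\<Delta> \<circ> \<alpha> f) x = (\<Sum>k\<in>K. (\<lambda>x. t (\<alpha> (F k) x) (y k))) x" by simp
  then show ?thesis by (simp add: exp comult_sum sum_fun_apply)
qed

end

section \<open>Decomposition of \<alpha> f into columns of irreducible matrices\<close>

context algebraic_coaction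
begin

abbreviation "irrep \<equiv> irreducible_unitary_rep t \<Delta>"

lemma irreducible_comult:
  "irrep n u \<Longrightarrow> a < n \<Longrightarrow> b < n \<Longrightarrow> \<Delta> (u a b) = (\<Sum>c<n. t (u a c) (u c b))"
  by (simp add: irreducible_unitary_rep_def unitary_rep_def)

text \<open>A block (n, u, b, F) stands for \<Sum>_a F_a \<otimes> u_ab, a whole column of u at
  once, since irreducibility says something only about whole columns.\<close>

definition block_list :: "(nat \<times> (nat \<Rightarrow> nat \<Rightarrow> 'q) \<times> nat \<times> (nat \<Rightarrow> 'm \<Rightarrow> complex)) list \<Rightarrow> ('m \<Rightarrow> 'q) \<Rightarrow> bool" where
  "block_list bl G \<longleftrightarrow>
    (\<forall>(n, u, b, F)\<in>set bl. irrep n u \<and> b < n \<and> (\<forall>a<n. F a \<in> \<A>)) \<and>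
    (\<forall>x. G x = (\<Sum>(n, u, b, F)\<leftarrow>bl. \<Sum>a<n. F a x *\<^sub>C u a b))"

lemma block_list_add:
  assumes "block_list bl G" "block_list bl' G'"
  shows "block_list (bl @ bl') (G + G')"
  using assms unfolding block_list_def by auto

lemma block_list_scale:
  assumes "block_list bl G"
  shows "block_list (map (\<lambda>(n, u, b, F). (n, u, b, \<lambda>a. c *\<^sub>C F a)) bl) (c *\<^sub>C G)"
proof -
  have "(\<Sum>(n, u, b, F)\<leftarrow>map (\<lambda>(n, u, b, F). (n, u, b, \<lambda>a. c *\<^sub>C F a)) bl. \<Sum>a<n. F a x *\<^sub>C u a b) =
      c *\<^sub>C (\<Sum>(n, u, b, F)\<leftarrow>bl. \<Sum>a<n. F a x *\<^sub>C u a b)" for x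
    by (induction bl) (auto simp: scaleC_add_right scaleC_sum_right scaleC_scaleC[symmetric] simp del: cstar.scale_scale)
  then show ?thesis using assms subalgebra_closed(5) unfolding block_list_def by (force simp: case_prod_unfold)
qed

lemma subspace_block_list: "cstar_fun.subspace {G. \<exists>bl. block_list bl G}"
proof -
  have "block_list [] 0" by (simp add: block_list_def)
  then show ?thesis
    unfolding cstar_fun.subspace_def using block_list_add block_list_scale by blast
qed

lemma block_list_exists:
  assumes "f \<in> \<A>"
  shows "\<exists>bl. block_list bl (\<alpha> f)"
proof -
  have core: "\<exists>bl. block_list bl (fun_tensor a q)" if a: "a \<in> \<A>" and q: "q \<in> hopf_core t \<Delta>" for a q
  proof -
    have "cspan {u i j | n u i j. irrep n u \<and> i < n \<and> j < n} \<subseteq> {q. \<exists>bl. block_list bl (fun_tensor a q)}"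
    proof (rule cstar.span_minimal)
      show "{u i j | n u i j. irrep n u \<and> i < n \<and> j < n} \<subseteq> {q. \<exists>bl. block_list bl (fun_tensor a q)}"
      proof clarify
        fix n u i j assume u: "irrep n u" "i < n" "j < n"
        have "(0 :: 'm \<Rightarrow> complex) \<in> \<A>" using csubspace_subalgebra by (auto simp: cstar_fun.subspace_def)
        \<comment> \<open>A single matrix coefficient is completed to a full column by zero
          functions.\<close>
        then have "block_list [(n, u, j, \<lambda>k. if k = i then a else 0)] (fun_tensor a (u i j))"
          using u a by (auto simp: block_list_def fun_tensor_def if_distrib[of "\<lambda>f. f _"]
              if_distrib[of "\<lambda>x. x *\<^sub>C _"] cong: if_cong)
        then show "\<exists>bl. block_list bl (fun_tensor a (u i j))" by blast
      qed
      have eq: "fun_tensor a (0 :: 'q) = 0" "fun_tensor a (x + y) = fun_tensor a x + fun_tensor a y"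
        "fun_tensor a (c *\<^sub>C x) = c *\<^sub>C fun_tensor a x" for x y :: 'q and c
        by (auto simp: fun_tensor_def fun_eq_iff scaleC_add_right scaleC_scaleC mult.commute)
      show "cstar.subspace {q. \<exists>bl. block_list bl (fun_tensor a q)}"
        using subspace_block_list unfolding cstar.subspace_def cstar_fun.subspace_def mem_Collect_eq eq by blast
    qed
    then show ?thesis using q by (auto simp: hopf_core_def)
  qed
  have "cspan {fun_tensor a q | a q. a \<in> \<A> \<and> q \<in> hopf_core t \<Delta>} \<subseteq> {G. \<exists>bl. block_list bl G}"
    by (rule cstar_fun.span_minimal[OF _ subspace_block_list]) (use core in auto)
  then show ?thesis using algebraic[OF assms] by blast
qed

text \<open>An expansion with the fewest columns is independent. Slices of the comultiplication move
  a relation between columns, and irreducibility makes it solvable for one entire column, which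
  could then be eliminated. This argument does not have to decide which irreducibles are
  equivalent.\<close>

lemma independent_decomposition:
  assumes f: "f \<in> \<A>"
  shows "\<exists>J n u b F. finite (J :: nat set) \<and>
    (\<forall>i\<in>J. irrep (n i) (u i) \<and> b i < n i \<and> (\<forall>a<n i. F i a \<in> \<A>)) \<and>
    (\<forall>x. \<alpha> f x = (\<Sum>i\<in>J. \<Sum>a<n i. F i a x *\<^sub>C u i a (b i))) \<and>
    (\<forall>r. (\<Sum>i\<in>J. \<Sum>a<n i. r i a *\<^sub>C u i a (b i)) = 0 \<longrightarrow> (\<forall>i\<in>J. \<forall>a<n i. r i a = 0))"
proof -
  obtain bl where bl: "block_list bl (\<alpha> f)" using block_list_exists[OF f] by blast
  define n where "n i = fst (bl ! i)" for i
  define u where "u i = fst (snd (bl ! i))" for i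
  define b where "b i = fst (snd (snd (bl ! i)))" for i
  define F0 where "F0 i = snd (snd (snd (bl ! i)))" for i
  define J0 where "J0 = {..<length bl}"
  have J0: "irrep (n i) (u i) \<and> b i < n i \<and> (\<forall>a<n i. F0 i a \<in> \<A>)" if "i \<in> J0" for i
    using bl nth_mem[of i bl] that by (auto simp: block_list_def n_def u_def b_def F0_def J0_def case_prod_unfold)
  define y where "y i a = u i a (b i)" for i a
  define rep where "rep J F \<longleftrightarrow> (\<forall>i\<in>J. \<forall>a<n i. F i a \<in> \<A>) \<and> (\<forall>x. \<alpha> f x = (\<Sum>i\<in>J. \<Sum>a<n i. F i a x *\<^sub>C y i a))" for J F
  have "rep J0 F0"
    using bl J0 unfolding rep_def block_list_def J0_def n_def u_def b_def F0_def y_def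
    by (auto simp: sum_list_sum_nth atLeast0LessThan case_prod_unfold)
  then have "J0 \<subseteq> J0 \<and> (\<exists>F. rep J0 F)" by blast
  from ex_has_least_nat[of "\<lambda>J. J \<subseteq> J0 \<and> (\<exists>F. rep J F)", OF this, of card]
  obtain J F where J: "J \<subseteq> J0" and F: "rep J F"
    and least: "\<And>J' F'. J' \<subseteq> J0 \<Longrightarrow> rep J' F' \<Longrightarrow> card J \<le> card J'" by blast
  have fin: "finite J" using J finite_subset by (auto simp: J0_def)
  have irr: "irrep (n i) (u i)" and bn: "b i < n i" if "i \<in> J" for i using J0 J that by auto
  define Rel where "Rel = {r. (\<Sum>i\<in>J. \<Sum>a<n i. r (i, a) *\<^sub>C y i a) = 0}"
  \<comment> \<open>Applying \<Delta> to a relation gives the same columns in the second leg with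
    coefficients in the first; slicing the first leg with \<phi> returns a relation whose
    coefficients are transformed by the rows of \<phi>(u).\<close>
  have invariant: "(\<lambda>(i, c). \<Sum>a<n i. r (i, a) * \<phi> (u i a c)) \<in> Rel" if r: "r \<in> Rel" and \<phi>: "cstar_state \<phi>" for r \<phi>
  proof -
    have "(\<Sum>(i, a)\<in>Sigma J (\<lambda>i. {..<n i}). r (i, a) *\<^sub>C y i a) = 0"
      using r fin by (simp add: Rel_def sum.Sigma)
    then have "\<Delta> (\<Sum>k\<in>Sigma J (\<lambda>i. {..<n i}). r k *\<^sub>C (case k of (i, a) \<Rightarrow> y i a)) = \<Delta> (\<Sum>k\<in>{}. 0 *\<^sub>C 0)"
      by (simp add: case_prod_unfold)
    then have "(\<Sum>k\<in>Sigma J (\<lambda>i. {..<n i}). r k *\<^sub>C \<Delta> (case k of (i, a) \<Rightarrow> y i a)) = 0"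
      unfolding comult_sum by simp
    then have "(\<Sum>i\<in>J. \<Sum>a<n i. r (i, a) *\<^sub>C \<Delta> (y i a)) = 0"
      using fin by (simp add: sum.Sigma case_prod_unfold)
    moreover have "(\<Sum>a<n i. r (i, a) *\<^sub>C \<Delta> (y i a)) = (\<Sum>c<n i. t (\<Sum>a<n i. r (i, a) *\<^sub>C u i a c) (y i c))"
      if i: "i \<in> J" for i
    proof -
      have "(\<Sum>a<n i. r (i, a) *\<^sub>C \<Delta> (y i a)) = (\<Sum>a<n i. \<Sum>c<n i. r (i, a) *\<^sub>C t (u i a c) (y i c))"
        using irr[OF i] bn[OF i] by (intro sum.cong) (auto simp: y_def irreducible_comult scaleC_sum_right)
      then show ?thesis unfolding tensor_sum_left by (subst (asm) sum.swap)
    qed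
    ultimately have "(\<Sum>i\<in>J. \<Sum>c<n i. t (\<Sum>a<n i. r (i, a) *\<^sub>C u i a c) (y i c)) = 0" by simp
    then have "(\<Sum>k\<in>Sigma J (\<lambda>i. {..<n i}). t (\<Sum>a<n (fst k). r (fst k, a) *\<^sub>C u (fst k) a (snd k)) (y (fst k) (snd k))) = 0"
      using fin by (simp add: sum.Sigma case_prod_unfold)
    from minimal_tensor_sum_eq_0D[OF tensor _ this \<phi>] show ?thesis
      using fin by (simp add: Rel_def sum.Sigma case_prod_unfold cstar_state_sum[OF \<phi>] cstar_state_scaleC[OF \<phi>])
  qed
  have zero: "r i0 a0 = 0" if r: "(\<Sum>i\<in>J. \<Sum>a<n i. r i a *\<^sub>C y i a) = 0" and i0: "i0 \<in> J" and a0: "a0 < n i0" for r i0 a0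
  proof (rule ccontr)
    assume nz: "r i0 a0 \<noteq> 0"
    \<comment> \<open>The components at i0 of all relations. They are invariant under the rows of
      \<open>u i0\<close> and not all zero, so the dichotomy makes every vector occur.\<close>
    define N where "N = {\<rho>. \<exists>r\<in>Rel. \<forall>a<n i0. \<rho> a = r (i0, a)}"
    have Rel: "csubspace Rel"
    proof (rule csubspaceI)
      show "(\<lambda>i. c * f i) \<in> Rel" if "f \<in> Rel" for c f
      proof -
        have "(\<Sum>i\<in>J. \<Sum>a<n i. (c * f (i, a)) *\<^sub>C y i a) = c *\<^sub>C (\<Sum>i\<in>J. \<Sum>a<n i. f (i, a) *\<^sub>C y i a)"
          by (simp add: scaleC_sum_right)
        then show ?thesis using that by (simp add: Rel_def)
      qed
    qed (auto simp: Rel_def scaleC_add_left sum.distrib)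
    have N: "csubspace N"
    proof (rule csubspaceI)
      show "(\<lambda>i. 0) \<in> N" unfolding N_def using csubspaceD(1)[OF Rel] by (intro CollectI bexI) auto
      fix f g assume "f \<in> N" "g \<in> N"
      then obtain r s where "r \<in> Rel" "\<forall>a<n i0. f a = r (i0, a)" "s \<in> Rel" "\<forall>a<n i0. g a = s (i0, a)"
        by (auto simp: N_def)
      then show "(\<lambda>i. f i + g i) \<in> N"
        unfolding N_def using csubspaceD(2)[OF Rel, of r s]
        by (intro CollectI bexI[of _ "\<lambda>i. r i + s i"]) auto
    next
      fix c f assume "f \<in> N"
      then obtain r where "r \<in> Rel" "\<forall>a<n i0. f a = r (i0, a)" by (auto simp: N_def)
      then show "(\<lambda>i. c * f i) \<in> N"
        unfolding N_def using csubspaceD(3)[OF Rel, of r c]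
        by (intro CollectI bexI[of _ "\<lambda>i. c * r i"]) auto
    qed
    have "\<exists>\<eta>\<in>N. \<forall>c<n i0. \<eta> c = (\<Sum>a<n i0. \<xi> a * \<phi> (u i0 a c))" if \<xi>: "\<xi> \<in> N" "cstar_state \<phi>" for \<xi> \<phi>
    proof -
      obtain r where r: "r \<in> Rel" "\<forall>a<n i0. \<xi> a = r (i0, a)" using \<xi>(1) by (auto simp: N_def)
      show ?thesis
        using invariant[OF r(1) \<xi>(2)] r(2)
        by (intro bexI[of _ "\<lambda>c. \<Sum>a<n i0. r (i0, a) * \<phi> (u i0 a c)"])
          (auto simp: N_def intro!: bexI[of _ "\<lambda>(i, c). \<Sum>a<n i. r (i, a) * \<phi> (u i a c)"])
    qed
    moreover have "(\<lambda>a. r i0 a) \<in> N"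
      unfolding N_def using r by (intro CollectI bexI[of _ "\<lambda>(i, a). r i a"]) (auto simp: Rel_def)
    ultimately have all: "\<forall>\<zeta>. \<exists>\<xi>\<in>N. \<forall>i<n i0. \<xi> i = \<zeta> i"
      using irreducible_row_dichotomy[OF irr[OF i0] N] nz a0 by blast
    have "\<forall>c. \<exists>r\<in>Rel. \<forall>a<n i0. r (i0, a) = (if a = c then 1 else 0)"
    proof
      fix c
      obtain \<xi> where \<xi>: "\<xi> \<in> N" "\<forall>a<n i0. \<xi> a = (if a = c then 1 else 0)"
        using all[rule_format, of "\<lambda>a. if a = c then 1 else 0"] by blast
      obtain r where "r \<in> Rel" "\<forall>a<n i0. \<xi> a = r (i0, a)" using \<xi>(1) by (auto simp: N_def)
      then show "\<exists>r\<in>Rel. \<forall>a<n i0. r (i0, a) = (if a = c then 1 else 0)"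
        using \<xi>(2) by (intro bexI[of _ r]) auto
    qed
    then obtain R where R: "\<And>c. R c \<in> Rel" "\<And>c a. a < n i0 \<Longrightarrow> R c (i0, a) = (if a = c then 1 else 0)"
      by metis
    define J' where "J' = J - {i0}"
    \<comment> \<open>The relation \<open>R c\<close> expresses entry c of column i0 through the
      other columns; substituting it removes column i0 and corrects the remaining functions.\<close>
    define F' where "F' i a = (\<lambda>x. F i a x + (- 1) * (\<Sum>c<n i0. R c (i, a) * F i0 c x))" for i a
    have FA: "F i a \<in> \<A>" if "i \<in> J" "a < n i" for i a using F that by (simp add: rep_def)
    have "F' i a \<in> \<A>" if "i \<in> J'" "a < n i" for i a
      unfolding F'_def using FA i0 that
      by (intro csubspace_combine[OF csubspace_subalgebra] subalgebra_combination) (auto simp: J'_def)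
    moreover have "\<alpha> f x = (\<Sum>i\<in>J'. \<Sum>a<n i. F' i a x *\<^sub>C y i a)" for x
    proof -
      have rest: "(\<Sum>i\<in>J'. \<Sum>a<n i. R c (i, a) *\<^sub>C y i a) = - y i0 c" if "c < n i0" for c
      proof -
        have "(\<Sum>a<n i0. R c (i0, a) *\<^sub>C y i0 a) = y i0 c"
          using that by (simp add: R(2) if_distrib[of "\<lambda>x. x *\<^sub>C _"] cong: if_cong)
        moreover have "(\<Sum>i\<in>J. \<Sum>a<n i. R c (i, a) *\<^sub>C y i a) = 0" using R(1) by (simp add: Rel_def)
        ultimately show ?thesis
          using sum.remove[OF fin i0, of "\<lambda>i. \<Sum>a<n i. R c (i, a) *\<^sub>C y i a"]
          by (simp add: J'_def eq_neg_iff_add_eq_0 add.commute)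
      qed
      have "(\<Sum>i\<in>J'. \<Sum>a<n i. F' i a x *\<^sub>C y i a) =
          (\<Sum>i\<in>J'. \<Sum>a<n i. F i a x *\<^sub>C y i a) - (\<Sum>i\<in>J'. \<Sum>a<n i. \<Sum>c<n i0. F i0 c x *\<^sub>C R c (i, a) *\<^sub>C y i a)"
        by (simp add: F'_def cstar.scale_left_diff_distrib sum_subtractf scaleC_sum_left scaleC_scaleC mult.commute)
      also have "(\<Sum>i\<in>J'. \<Sum>a<n i. \<Sum>c<n i0. F i0 c x *\<^sub>C R c (i, a) *\<^sub>C y i a) =
          (\<Sum>c<n i0. F i0 c x *\<^sub>C (\<Sum>i\<in>J'. \<Sum>a<n i. R c (i, a) *\<^sub>C y i a))"
        unfolding scaleC_sum_right by (subst (2) sum.swap, subst sum.swap, rule refl)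
      also have "\<dots> = - (\<Sum>c<n i0. F i0 c x *\<^sub>C y i0 c)" by (simp add: rest sum_negf)
      finally show ?thesis
        using F sum.remove[OF fin i0, of "\<lambda>i. \<Sum>a<n i. F i a x *\<^sub>C y i a"] by (simp add: rep_def J'_def)
    qed
    ultimately have "rep J' F'" by (simp add: rep_def)
    then have "card J \<le> card J'" using J by (intro least) (auto simp: J'_def)
    moreover have "card J' < card J" unfolding J'_def by (rule card_Diff1_less[OF fin i0])
    ultimately show False by simp
  qed
  show ?thesis
  proof (rule exI[of _ J], rule exI[of _ n], rule exI[of _ u], rule exI[of _ b], rule exI[of _ F], intro conjI allI impI ballI)
    show "finite J" by (rule fin)
    show "irrep (n i) (u i)" "b i < n i" if "i \<in> J" for i using irr bn that by auto
    show "F i a \<in> \<A>" if "i \<in> J" "a < n i" for i a using F that by (simp add: rep_def)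
    show "\<alpha> f x = (\<Sum>i\<in>J. \<Sum>a<n i. F i a x *\<^sub>C u i a (b i))" for x using F by (simp add: rep_def y_def)
    show "r i a = 0" if "(\<Sum>i\<in>J. \<Sum>a<n i. r i a *\<^sub>C u i a (b i)) = 0" "i \<in> J" "a < n i" for r i a
      using that by (intro zero) (simp_all add: y_def)
  qed
qed

definition piece :: "nat \<Rightarrow> (nat \<Rightarrow> nat \<Rightarrow> 'q) \<Rightarrow> (nat \<Rightarrow> 'm \<Rightarrow> complex) \<Rightarrow> bool" where
  "piece n u F \<longleftrightarrow> irrep n u \<and> (\<forall>a<n. F a \<in> \<A>) \<and> (\<forall>c<n. \<forall>x. \<alpha> (F c) x = (\<Sum>a<n. F a x *\<^sub>C u a c))"

text \<open>The last clause says that the functions \<open>F i a\<close> are slices of \<open>\<alpha> f\<close>.\<close>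

definition decomposition ::
  "('m \<Rightarrow> complex) \<Rightarrow> nat set \<Rightarrow> (nat \<Rightarrow> nat) \<Rightarrow> (nat \<Rightarrow> nat \<Rightarrow> nat \<Rightarrow> 'q) \<Rightarrow> (nat \<Rightarrow> nat) \<Rightarrow>
    (nat \<Rightarrow> nat \<Rightarrow> 'm \<Rightarrow> complex) \<Rightarrow> bool" where
  "decomposition f J n u b F \<longleftrightarrow> finite J \<and> (\<forall>i\<in>J. piece (n i) (u i) (F i) \<and> b i < n i) \<and>
    (\<forall>x. \<alpha> f x = (\<Sum>i\<in>J. \<Sum>a<n i. F i a x *\<^sub>C u i a (b i))) \<and>
    (\<forall>L g z. finite (L :: nat set) \<longrightarrow> (\<forall>x. \<alpha> f x = (\<Sum>l\<in>L. g l x *\<^sub>C z l)) \<longrightarrow>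
      (\<forall>i\<in>J. \<forall>a<n i. \<exists>c. \<forall>x. F i a x = (\<Sum>l\<in>L. c l * g l x)))"

text \<open>Independence of the columns allows coefficients to be compared in coassociativity, which
  yields the transformation law of the functions \<open>F i c\<close>.\<close>

lemma piece_decomposition:
  assumes f: "f \<in> \<A>"
  shows "\<exists>J n u b F. decomposition f J n u b F"
proof -
  obtain J n u b F where fin: "finite (J :: nat set)"
    and irr: "\<forall>i\<in>J. irrep (n i) (u i) \<and> b i < n i \<and> (\<forall>a<n i. F i a \<in> \<A>)"
    and rep: "\<forall>x. \<alpha> f x = (\<Sum>i\<in>J. \<Sum>a<n i. F i a x *\<^sub>C u i a (b i))"
    and ind: "\<forall>r. (\<Sum>i\<in>J. \<Sum>a<n i. r i a *\<^sub>C u i a (b i)) = 0 \<longrightarrow> (\<forall>i\<in>J. \<forall>a<n i. r i a = 0)"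
    using independent_decomposition[OF f] by blast
  define K where "K = Sigma J (\<lambda>i. {..<n i})"
  have K: "finite K" using fin by (simp add: K_def)
  define y where "y k = u (fst k) (snd k) (b (fst k))" for k
  define FK where "FK k = F (fst k) (snd k)" for k
  have sumK: "(\<Sum>k\<in>K. g (fst k) (snd k)) = (\<Sum>i\<in>J. \<Sum>a<n i. g i a)" for g :: "nat \<Rightarrow> nat \<Rightarrow> 'z::comm_monoid_add"
    using fin by (simp add: K_def sum.Sigma case_prod_unfold)
  have indK: "r k = 0" if "(\<Sum>k\<in>K. r k *\<^sub>C y k) = 0" "k \<in> K" for r k
    using ind[rule_format, of "\<lambda>i a. r (i, a)" "fst k" "snd k"] that
      sumK[of "\<lambda>i a. r (i, a) *\<^sub>C u i a (b i)"] by (auto simp: y_def K_def)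
  have repK: "\<alpha> f x = (\<Sum>k\<in>K. FK k x *\<^sub>C y k)" for x
    using rep sumK[of "\<lambda>i a. F i a x *\<^sub>C u i a (b i)"] by (simp add: y_def FK_def)
  have FKA: "FK k \<in> \<A>" if "k \<in> K" for k using irr that by (auto simp: FK_def K_def)
  have "\<alpha> (F i c) x = (\<Sum>a<n i. F i a x *\<^sub>C u i a c)" if ic: "i \<in> J" "c < n i" for i c x
  proof (rule cstar_states_separate2)
    fix \<phi> :: "'q \<Rightarrow> complex" assume \<phi>: "cstar_state \<phi>"
    define w where "w k = (\<Sum>a<n (fst k). F (fst k) a x *\<^sub>C u (fst k) a (snd k))" for k
    have "(\<Sum>k\<in>K. t (\<alpha> (FK k) x) (y k)) = (\<Sum>k\<in>K. FK k x *\<^sub>C \<Delta> (y k))"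
      by (rule coassociative_expansion[OF FKA f repK])
    also have "\<dots> = (\<Sum>i\<in>J. \<Sum>a<n i. F i a x *\<^sub>C (\<Sum>c<n i. t (u i a c) (u i c (b i))))"
      using irr unfolding sumK[symmetric]
      by (intro sum.cong) (auto simp: FK_def y_def irreducible_comult K_def)
    also have "\<dots> = (\<Sum>i\<in>J. \<Sum>c<n i. t (w (i, c)) (u i c (b i)))"
      unfolding w_def fst_conv snd_conv tensor_sum_left scaleC_sum_right
      by (intro sum.cong refl sum.swap)
    also have "\<dots> = (\<Sum>k\<in>K. t (w k) (y k))"
      using sumK[of "\<lambda>i c. t (w (i, c)) (u i c (b i))"] by (simp add: y_def)
    finally have "(\<Sum>k\<in>K. t (\<alpha> (FK k) x - w k) (y k)) = 0"
    proof -
      assume eq: "(\<Sum>k\<in>K. t (\<alpha> (FK k) x) (y k)) = (\<Sum>k\<in>K. t (w k) (y k))"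
      have "t (p - q) z = t p z - t q z" for p q z
        using tensor_sum_left[of "\<lambda>k. if k then 1 else - 1" "\<lambda>k. if k then p else q" "{True, False}" z] by simp
      then show ?thesis using eq by (simp add: sum_subtractf)
    qed
    from minimal_tensor_sum_eq_0D[OF tensor K this \<phi>]
    have "\<phi> (\<alpha> (FK (i, c)) x - w (i, c)) = 0"
      using ic by (intro indK[of "\<lambda>k. \<phi> (\<alpha> (FK k) x - w k)"]) (auto simp: K_def)
    then show "\<phi> (\<alpha> (F i c) x) = \<phi> (\<Sum>a<n i. F i a x *\<^sub>C u i a c)"
      by (simp add: FK_def w_def cstar_state_diff[OF \<phi>])
  qed
  then have pieces: "\<forall>i\<in>J. piece (n i) (u i) (F i) \<and> b i < n i" using irr by (auto simp: piece_def)
  have slice: "\<exists>c. \<forall>x. F i a x = (\<Sum>l\<in>L. c l * g l x)"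
    if L: "finite (L :: nat set)" "\<forall>x. \<alpha> f x = (\<Sum>l\<in>L. g l x *\<^sub>C z l)" and ia: "i \<in> J" "a < n i" for L g z i a
  proof -
    \<comment> \<open>Evaluation at states plays the part of evaluation at points, with value 0 off
      the states. Independence makes the unit vector at (i, a) an admissible functional, hence a
      finite combination of states that extracts \<open>F i a\<close> from any expansion of \<alpha>
      f.\<close>
    define e where "e k \<phi> = (if cstar_state \<phi> then \<phi> (y k) else 0)" for k and \<phi> :: "'q \<Rightarrow> complex"
    define \<delta> where "\<delta> k = (if k = (i, a) then 1 else 0 :: complex)" for k
    have "(\<Sum>k\<in>K. \<delta> k * \<xi> k) = 0" if \<xi>: "\<And>\<phi>. (\<Sum>k\<in>K. \<xi> k * e k \<phi>) = 0" for \<xi>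
    proof -
      have "(\<Sum>k\<in>K. \<xi> k *\<^sub>C y k) = 0"
      proof (rule cstar_states_separate)
        fix \<phi> :: "'q \<Rightarrow> complex" assume \<phi>: "cstar_state \<phi>"
        show "\<phi> (\<Sum>k\<in>K. \<xi> k *\<^sub>C y k) = 0"
          using \<xi>[of \<phi>] \<phi> by (simp add: e_def cstar_state_sum[OF \<phi>] cstar_state_scaleC[OF \<phi>])
      qed
      then have "\<xi> k = 0" if "k \<in> K" for k using indK that by blast
      then show ?thesis by simp
    qed
    then obtain \<Phi> c where \<Phi>: "finite \<Phi>" "\<forall>k\<in>K. \<delta> k = (\<Sum>\<phi>\<in>\<Phi>. c \<phi> * e k \<phi>)"
      using annihilator_is_evaluation_combination[of K e \<delta>, OF K] by blast
    define \<omega> where "\<omega> q = (\<Sum>\<phi>\<in>\<Phi>. c \<phi> * (if cstar_state \<phi> then \<phi> q else 0))" for q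
    have \<omega>: "\<omega> (\<Sum>l\<in>M. d l *\<^sub>C v l) = (\<Sum>l\<in>M. d l * \<omega> (v l))" for M :: "'l set" and d v
      unfolding \<omega>_def sum_distrib_left
      by (subst sum.swap) (auto simp: cstar_state_sum cstar_state_scaleC sum_distrib_left mult_ac intro!: sum.cong)
    have "F i a x = (\<Sum>l\<in>L. \<omega> (z l) * g l x)" for x
    proof -
      have "\<omega> (\<alpha> f x) = (\<Sum>k\<in>K. FK k x * \<delta> k)"
        unfolding repK \<omega> using \<Phi>(2) by (intro sum.cong) (auto simp: \<omega>_def e_def)
      also have "\<dots> = F i a x"
        using K ia by (simp add: \<delta>_def if_distrib[of "\<lambda>x. _ * x"] FK_def K_def cong: if_cong)
      finally have "F i a x = \<omega> (\<Sum>l\<in>L. g l x *\<^sub>C z l)" using L(2) by simp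
      then show ?thesis unfolding \<omega> by (simp add: mult.commute)
    qed
    then show ?thesis by (intro exI[of _ "\<lambda>l. \<omega> (z l)"]) simp
  qed
  show ?thesis
    by (rule exI[of _ J], rule exI[of _ n], rule exI[of _ u], rule exI[of _ b], rule exI[of _ F],
        unfold decomposition_def, intro conjI allI impI ballI) (use fin pieces rep slice in blast)+
qed

end

section \<open>Conjugation of pieces, and unitary families\<close>

context algebraic_coaction
begin

text \<open>The coefficient vectors of the zero function are invariant under slices of u. If they
  vanish, unitarity of u recovers \<eta> = 0 from the slices; otherwise they are all vectors and the
  functions themselves vanish. So \<alpha> is injective on the span of a piece although injectivity
  of \<alpha> is not assumed.\<close>

lemma piece_injective:
  assumes P: "piece n u F" and zero: "\<And>x. \<alpha> (\<lambda>x. \<Sum>c<n. \<eta> c * F c x) x = 0"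
  shows "(\<Sum>c<n. \<eta> c * F c x) = 0"
proof -
  have irr: "irrep n u" and FA: "F c \<in> \<A>" and \<alpha>F: "\<alpha> (F c) x = (\<Sum>a<n. F a x *\<^sub>C u a c)" if "c < n" for c x
    using P that by (auto simp: piece_def)
  have irr: "irrep n u" using P by (simp add: piece_def)
  have expand: "\<phi> (\<alpha> (\<lambda>x. \<Sum>c<n. \<xi> c * F c x) x) = (\<Sum>a<n. (\<Sum>c<n. \<phi> (u a c) * \<xi> c) * F a x)"
    if \<phi>: "cstar_state \<phi>" for \<phi> \<xi> x
  proof -
    have "\<alpha> (\<lambda>x. \<Sum>c<n. \<xi> c * F c x) x = (\<Sum>c<n. \<xi> c *\<^sub>C \<alpha> (F c) x)"
      using FA continuous by (intro action_combination) auto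
    then have "\<phi> (\<alpha> (\<lambda>x. \<Sum>c<n. \<xi> c * F c x) x) = (\<Sum>c<n. \<Sum>a<n. \<phi> (u a c) * \<xi> c * F a x)"
      by (simp add: \<alpha>F cstar_state_sum[OF \<phi>] cstar_state_scaleC[OF \<phi>] sum_distrib_left mult_ac)
    then show ?thesis by (subst (asm) sum.swap) (simp add: sum_distrib_right)
  qed
  define N where "N = {\<xi>. \<forall>x. (\<Sum>c<n. \<xi> c * F c x) = 0}"
  have N: "csubspace N"
  proof (rule csubspaceI)
    show "(\<lambda>i. c * f i) \<in> N" if "f \<in> N" for c f
      using that by (simp add: N_def mult.assoc sum_distrib_left[symmetric])
  qed (auto simp: N_def distrib_right sum.distrib)
  have in_N: "(\<lambda>a. \<Sum>c<n. \<phi> (u a c) * \<xi> c) \<in> N" if \<phi>: "cstar_state \<phi>" and z: "\<And>x. \<alpha> (\<lambda>x. \<Sum>c<n. \<xi> c * F c x) x = 0" for \<phi> \<xi>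
    using expand[OF \<phi>, of \<xi>] unfolding z by (simp add: N_def cstar_state_zero[OF \<phi>])
  have "\<alpha> (\<lambda>x. 0) x = 0" for x using action_combination[of "{}"] by simp
  then have invariant: "(\<lambda>a. \<Sum>c<n. \<phi> (u a c) * \<xi> c) \<in> N" if "cstar_state \<phi>" "\<xi> \<in> N" for \<phi> \<xi>
    using in_N[OF that(1), of \<xi>] that(2) by (simp add: N_def)
  have "(\<forall>\<xi>\<in>N. \<forall>i<n. \<xi> i = 0) \<or> (\<forall>\<zeta>. \<exists>\<xi>\<in>N. \<forall>i<n. \<xi> i = \<zeta> i)"
  proof (rule irreducible_column_dichotomy[OF irr N])
    show "\<exists>\<eta>\<in>N. \<forall>a<n. \<eta> a = (\<Sum>c<n. \<phi> (u a c) * \<xi> c)" if "\<xi> \<in> N" "cstar_state \<phi>" for \<xi> \<phi>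
      using invariant[OF that(2,1)] by (rule bexI[rotated]) simp
  qed
  then show ?thesis
  proof
    assume 0: "\<forall>\<xi>\<in>N. \<forall>i<n. \<xi> i = 0"
    have "(\<Sum>c<n. \<phi> (u a c) * \<eta> c) = 0" if "a < n" "cstar_state \<phi>" for a \<phi>
      using bspec[OF 0 in_N[OF that(2) zero]] that(1) by simp
    then have "(\<Sum>c<n. \<eta> c *\<^sub>C u a c) = 0" if "a < n" for a
      using that by - (rule cstar_states_separate, simp add: cstar_state_sum cstar_state_scaleC mult.commute)
    then have "(\<Sum>a<n. star (u a d) * (\<Sum>c<n. \<eta> c *\<^sub>C u a c)) = 0" for d by simp
    moreover have "(\<Sum>a<n. star (u a d) * (\<Sum>c<n. \<eta> c *\<^sub>C u a c)) = \<eta> d *\<^sub>C 1" if "d < n" for d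
    proof -
      have "(\<Sum>a<n. star (u a d) * (\<Sum>c<n. \<eta> c *\<^sub>C u a c)) = (\<Sum>c<n. \<eta> c *\<^sub>C (\<Sum>a<n. star (u a d) * u a c))"
        unfolding scaleC_sum_right sum_distrib_left by (subst sum.swap) (simp add: mult_scaleC_right)
      also have "\<dots> = (\<Sum>c<n. \<eta> c *\<^sub>C (if d = c then 1 else 0))"
        using irr that by (intro sum.cong) (auto simp: irreducible_unitary_rep_def unitary_rep_def)
      finally show ?thesis using that by (simp add: if_distrib[of "\<lambda>x. _ *\<^sub>C x"] cong: if_cong)
    qed
    ultimately have "\<eta> d = 0" if "d < n" for d using that by (metis cstar.scale_eq_0_iff zero_neq_one)
    then show ?thesis by simp
  next
    assume all: "\<forall>\<zeta>. \<exists>\<xi>\<in>N. \<forall>i<n. \<xi> i = \<zeta> i"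
    obtain \<xi> where "\<xi> \<in> N" "\<forall>i<n. \<xi> i = \<eta> i" using all by blast
    then show ?thesis by (auto simp: N_def dest: spec[of _ x])
  qed
qed

type_synonym ('a, 'b) piece_list = "(nat \<times> (nat \<Rightarrow> nat \<Rightarrow> 'a) \<times> (nat \<Rightarrow> 'b \<Rightarrow> complex)) list"

definition pieces :: "('q, 'm) piece_list \<Rightarrow> bool" where
  "pieces Ls \<longleftrightarrow> (\<forall>(n, u, F)\<in>set Ls. piece n u F)"

definition entries :: "('q, 'm) piece_list \<Rightarrow> ('m \<Rightarrow> complex) set" where
  "entries Ls = (\<Union>(n, u, F)\<in>set Ls. F ` {..<n})"

lemma entries_append: "entries (Ls @ Ms) = entries Ls \<union> entries Ms"
  by (simp add: entries_def)

lemma cspan_combination: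
  fixes f :: "'k \<Rightarrow> 'm \<Rightarrow> complex"
  shows "(\<And>k. k \<in> K \<Longrightarrow> f k \<in> S) \<Longrightarrow> (\<lambda>x. \<Sum>k\<in>K. c k * f k x) \<in> cspan S"
  by (rule csubspace_sum[OF cstar_fun.subspace_span]) (rule cstar_fun.span_base)

text \<open>The matrix of adjoints star u_ij is not known to be unitary, so the conjugate function
  is decomposed afresh. The slice clause keeps the new functions inside the conjugates of the old
  span; there injectivity shows that the decomposition gives the conjugate function back.\<close>

lemma star_of_piece_entry:
  assumes P: "piece n u F" and c: "c < n"
  shows "\<exists>Ls. pieces Ls \<and> (\<lambda>x. cnj (F c x)) \<in> cspan (entries Ls) \<and>
    (\<forall>h\<in>entries Ls. (\<lambda>x. cnj (h x)) \<in> cspan (F ` {..<n}))"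
proof -
  have FA: "F a \<in> \<A>" and \<alpha>F: "\<alpha> (F a) x = (\<Sum>k<n. F k x *\<^sub>C u k a)" if "a < n" for a x
    using P that by (auto simp: piece_def)
  define f where "f x = cnj (F c x)" for x
  have fA: "f \<in> \<A>" using subalgebra_closed(4)[OF FA[OF c]] by (simp add: f_def[abs_def] star_fun_def star_complex_def)
  have \<alpha>f: "\<alpha> f x = (\<Sum>l<n. cnj (F l x) *\<^sub>C star (u l c))" for x
    unfolding f_def using action_star[of "F c" x] FA[OF c] continuous
    by (auto simp: \<alpha>F[OF c] star_sum star_scaleC)
  obtain J n' u' b F' where "decomposition f J n' u' b F'"
    using piece_decomposition[OF fA] by blast
  then have J: "finite (J :: nat set)" "\<forall>i\<in>J. piece (n' i) (u' i) (F' i) \<and> b i < n' i"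
    and rep: "\<forall>x. \<alpha> f x = (\<Sum>i\<in>J. \<Sum>a<n' i. F' i a x *\<^sub>C u' i a (b i))"
    and slice: "\<forall>L g z. finite (L :: nat set) \<longrightarrow> (\<forall>x. \<alpha> f x = (\<Sum>l\<in>L. g l x *\<^sub>C z l)) \<longrightarrow>
      (\<forall>i\<in>J. \<forall>a<n' i. \<exists>c. \<forall>x. F' i a x = (\<Sum>l\<in>L. c l * g l x))"
    unfolding decomposition_def by simp_all
  have "\<forall>i\<in>J. \<forall>a<n' i. \<exists>c. \<forall>x. F' i a x = (\<Sum>l<n. c l * cnj (F l x))"
    using slice[rule_format, of "{..<n}" "\<lambda>l x. cnj (F l x)" "\<lambda>l. star (u l c)"] \<alpha>f by simp
  then obtain C where C: "\<And>i a x. i \<in> J \<Longrightarrow> a < n' i \<Longrightarrow> F' i a x = (\<Sum>l<n. C i a l * cnj (F l x))" by metis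
  obtain js where js: "set js = J" using finite_list[OF J(1)] by blast
  define Ls where "Ls = map (\<lambda>i. (n' i, u' i, F' i)) js"
  have "pieces Ls" using J(2) js by (auto simp: pieces_def Ls_def)
  moreover have "(\<lambda>x. cnj (h x)) \<in> cspan (F ` {..<n})" if h: "h \<in> entries Ls" for h
  proof -
    obtain i a where ia: "i \<in> J" "a < n' i" "h = F' i a" using h js by (auto simp: entries_def Ls_def)
    have "(\<lambda>x. cnj (h x)) = (\<lambda>x. \<Sum>l<n. cnj (C i a l) * F l x)" by (simp add: ia(3) C[OF ia(1,2)])
    then show ?thesis using cspan_combination[of "{..<n}" F "F ` {..<n}"] by simp
  qed
  moreover have "(\<lambda>x. cnj (F c x)) \<in> cspan (entries Ls)"
  proof -
    \<comment> \<open>What a counit would return when applied to the second leg of \<alpha> f. The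
      pieces give \<alpha> f' = \<alpha> f, and the conjugate of f - f' lies in the span of the
      given piece.\<close>
    define f' where "f' x = (\<Sum>i\<in>J. 1 * F' i (b i) x)" for x
    have F'c: "F' i (b i) \<in> cts" if "i \<in> J" for i using J(2) that continuous by (auto simp: piece_def)
    have "\<alpha> f' x = (\<Sum>i\<in>J. 1 *\<^sub>C \<alpha> (F' i (b i)) x)" for x
      unfolding f'_def by (rule action_combination) (rule F'c)
    also have "\<dots> x = \<alpha> f x" for x
      using J(2) rep by (auto simp: piece_def intro!: sum.cong)
    finally have eq: "\<alpha> f' x = \<alpha> f x" for x .
    define \<eta> where "\<eta> l = (if l = c then 1 else 0) - (\<Sum>i\<in>J. cnj (C i (b i) l))" for l
    have f'eq: "f' x = (\<Sum>i\<in>J. \<Sum>l<n. C i (b i) l * cnj (F l x))" for x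
      unfolding f'_def using J(2) by (intro sum.cong) (auto simp: C)
    have diff: "cnj (f x - f' x) = (\<Sum>l<n. \<eta> l * F l x)" for x
    proof -
      have "(\<Sum>l<n. \<eta> l * F l x) = F c x - (\<Sum>l<n. (\<Sum>i\<in>J. cnj (C i (b i) l)) * F l x)"
        using c by (simp add: \<eta>_def left_diff_distrib sum_subtractf if_distrib[of "\<lambda>x. x * _"] cong: if_cong)
      also have "(\<Sum>l<n. (\<Sum>i\<in>J. cnj (C i (b i) l)) * F l x) = cnj (f' x)"
        unfolding f'eq by (simp add: sum_distrib_right) (rule sum.swap)
      finally show ?thesis by (simp add: f_def)
    qed
    have "f' \<in> cts" unfolding f'_def[abs_def] by (rule csubspace_sum[OF csubspace_cts F'c])
    then have cts': "f \<in> cts" "f' \<in> cts" using fA continuous by auto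
    have "\<alpha> (\<lambda>x. \<Sum>l<n. \<eta> l * F l x) x = 0" for x
    proof -
      define fs where "fs k = (if k then f else f')" for k
      have d: "(\<lambda>x. f x - f' x) = (\<lambda>x. \<Sum>k\<in>UNIV. (if k then 1 else - 1) * fs k x)"
        by (simp add: UNIV_bool fs_def)
      have "\<alpha> (\<lambda>x. f x - f' x) x = (\<Sum>k\<in>UNIV. (if k then 1 else - 1) *\<^sub>C \<alpha> (fs k) x)"
        unfolding d by (rule action_combination) (use cts' in \<open>auto simp: fs_def\<close>)
      then have 0: "\<alpha> (\<lambda>x. f x - f' x) x = 0" by (simp add: UNIV_bool fs_def eq)
      have "(\<lambda>x. f x - f' x) \<in> cts" using cts' by (auto simp: cts_def intro: continuous_intros)
      from action_star[OF this, of x] show ?thesis unfolding diff 0 by simp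
    qed
    then have "(\<Sum>l<n. \<eta> l * F l x) = 0" for x by (rule piece_injective[OF P])
    then have "f x = f' x" for x using diff[of x] by simp
    then have "(\<lambda>x. cnj (F c x)) = f'" by (auto simp: f_def)
    moreover have "F' i (b i) \<in> entries Ls" if "i \<in> J" for i
      using that js J(2) by (force simp: entries_def Ls_def)
    then have "f' \<in> cspan (entries Ls)" unfolding f'_def[abs_def] by (rule cspan_combination)
    ultimately show ?thesis by simp
  qed
  ultimately show ?thesis by blast
qed

text \<open>One round of adjoining suffices: conjugates of the adjoined functions fall back into the
  span of the original entries.\<close>

lemma star_closed_pieces:
  assumes Gs: "pieces Gs"
  shows "\<exists>Ls. pieces Ls \<and> entries Gs \<subseteq> entries Ls \<and> (\<forall>h\<in>entries Ls. (\<lambda>x. cnj (h x)) \<in> cspan (entries Ls))"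
proof -
  have "\<exists>Ls. pieces Ls \<and> (\<lambda>x. cnj (h x)) \<in> cspan (entries Ls) \<and>
      (\<forall>h'\<in>entries Ls. (\<lambda>x. cnj (h' x)) \<in> cspan (entries Gs))" if h: "h \<in> entries Gs" for h
  proof -
    obtain n u F c where P: "(n, u, F) \<in> set Gs" "c < n" "h = F c" using h by (auto simp: entries_def)
    then have "F ` {..<n} \<subseteq> entries Gs" by (auto simp: entries_def)
    then have "cspan (F ` {..<n}) \<subseteq> cspan (entries Gs)" by (rule cstar_fun.span_mono)
    moreover have "piece n u F" using Gs P by (auto simp: pieces_def)
    ultimately show ?thesis using star_of_piece_entry[of n u F c] P by blast
  qed
  then obtain L where L: "\<And>h. h \<in> entries Gs \<Longrightarrow> pieces (L h)"
    "\<And>h. h \<in> entries Gs \<Longrightarrow> (\<lambda>x. cnj (h x)) \<in> cspan (entries (L h))"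
    "\<And>h h'. h \<in> entries Gs \<Longrightarrow> h' \<in> entries (L h) \<Longrightarrow> (\<lambda>x. cnj (h' x)) \<in> cspan (entries Gs)" by metis
  have "finite (entries Gs)" by (auto simp: entries_def)
  then obtain hs where hs: "set hs = entries Gs" using finite_list by blast
  define Ls where "Ls = Gs @ concat (map L hs)"
  have "entries (concat (map L hs)) = (\<Union>h\<in>entries Gs. entries (L h))"
    unfolding hs[symmetric] by (auto simp: entries_def)
  then have E: "entries Ls = entries Gs \<union> (\<Union>h\<in>entries Gs. entries (L h))" by (simp add: Ls_def entries_append)
  have "(\<lambda>x. cnj (h x)) \<in> cspan (entries Ls)" if h: "h \<in> entries Ls" for h
  proof -
    have "(\<lambda>x. cnj (h x)) \<in> cspan (entries Gs) \<or> (\<exists>h'\<in>entries Gs. (\<lambda>x. cnj (h x)) \<in> cspan (entries (L h')))"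
      using h L unfolding E by blast
    moreover have "cspan (entries Gs) \<subseteq> cspan (entries Ls)" by (intro cstar_fun.span_mono) (simp add: E)
    moreover have "cspan (entries (L h')) \<subseteq> cspan (entries Ls)" if "h' \<in> entries Gs" for h'
      using that by (intro cstar_fun.span_mono) (auto simp: E)
    ultimately show ?thesis by blast
  qed
  moreover have "set Ls = set Gs \<union> (\<Union>h\<in>entries Gs. set (L h))" by (simp add: Ls_def hs)
  then have "pieces Ls" using Gs L(1) unfolding pieces_def by blast
  ultimately show ?thesis using E by blast
qed

text \<open>The functions may be linearly dependent, so the matrix u is data and not determined by
  them. This is why what follows is phrased with coefficient vectors.\<close>

definition unitary_family :: "'i set \<Rightarrow> ('i \<Rightarrow> 'm \<Rightarrow> complex) \<Rightarrow> ('i \<Rightarrow> 'i \<Rightarrow> 'q) \<Rightarrow> bool" where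
  "unitary_family I e u \<longleftrightarrow> finite I \<and> (\<forall>i\<in>I. e i \<in> \<A>) \<and>
    (\<forall>i\<in>I. \<forall>j\<in>I. (\<Sum>k\<in>I. star (u k i) * u k j) = (if i = j then 1 else 0)) \<and>
    (\<forall>i\<in>I. \<forall>j\<in>I. (\<Sum>k\<in>I. u i k * star (u j k)) = (if i = j then 1 else 0)) \<and>
    (\<forall>j\<in>I. \<forall>x. \<alpha> (e j) x = (\<Sum>i\<in>I. e i x *\<^sub>C u i j))"

lemma unitary_family_of_pieces:
  assumes Ls: "pieces Ls"
  shows "\<exists>(I :: (nat \<times> nat) set) e u. unitary_family I e u \<and> e ` I = entries Ls"
proof -
  define n where "n i = fst (Ls ! i)" for i
  define u where "u i = fst (snd (Ls ! i))" for i
  define F where "F i = snd (snd (Ls ! i))" for i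
  have P: "piece (n i) (u i) (F i)" if "i < length Ls" for i
    using Ls nth_mem[OF that] by (auto simp: pieces_def n_def u_def F_def case_prod_unfold)
  define I where "I = Sigma {..<length Ls} (\<lambda>i. {..<n i})"
  define e where "e k = F (fst k) (snd k)" for k
  define U where "U k l = (if fst k = fst l then u (fst k) (snd k) (snd l) else 0)" for k l
  have sumI: "(\<Sum>k\<in>I. g k) = (\<Sum>i<length Ls. \<Sum>a<n i. g (i, a))" for g :: "nat \<times> nat \<Rightarrow> 'z::comm_monoid_add"
    by (simp add: I_def sum.Sigma)
  have diag: "(\<Sum>k\<in>I. if fst k = i then g k else 0) = (\<Sum>a<n i. g (i, a))"
    if "i < length Ls" for i and g :: "nat \<times> nat \<Rightarrow> 'z::comm_monoid_add"
  proof -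
    have "(\<Sum>k\<in>I. if fst k = i then g k else 0) = (\<Sum>i'<length Ls. if i' = i then \<Sum>a<n i'. g (i', a) else 0)"
      unfolding sumI by (intro sum.cong) auto
    then show ?thesis using that by simp
  qed
  have uni: "unitary_rep t \<Delta> (n i) (u i)" if "i < length Ls" for i
    using P[OF that] by (simp add: piece_def irreducible_unitary_rep_def)
  have "unitary_family I e U"
    unfolding unitary_family_def
  proof (intro conjI ballI allI)
    show "finite I" by (simp add: I_def)
    show "e k \<in> \<A>" if "k \<in> I" for k using P that by (auto simp: I_def e_def piece_def)
  next
    fix k l assume kl: "k \<in> I" "l \<in> I"
    have ik: "fst k < length Ls" "snd k < n (fst k)" "fst l < length Ls" "snd l < n (fst l)" using kl by (auto simp: I_def)
    have "(\<Sum>m\<in>I. star (U m k) * U m l) =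
        (\<Sum>m\<in>I. if fst m = fst k then star (u (fst k) (snd m) (snd k)) * (if fst k = fst l then u (fst k) (snd m) (snd l) else 0) else 0)"
      by (intro sum.cong) (auto simp: U_def)
    also have "\<dots> = (if k = l then 1 else 0)"
      unfolding diag[OF ik(1)] using uni[OF ik(1)] ik
      by (cases "fst k = fst l") (auto simp: unitary_rep_def prod_eq_iff)
    finally show "(\<Sum>m\<in>I. star (U m k) * U m l) = (if k = l then 1 else 0)" .
    have "(\<Sum>m\<in>I. U k m * star (U l m)) =
        (\<Sum>m\<in>I. if fst m = fst k then u (fst k) (snd k) (snd m) * (if fst k = fst l then star (u (fst k) (snd l) (snd m)) else 0) else 0)"
      by (intro sum.cong) (auto simp: U_def)
    also have "\<dots> = (if k = l then 1 else 0)"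
      unfolding diag[OF ik(1)] using uni[OF ik(1)] ik
      by (cases "fst k = fst l") (auto simp: unitary_rep_def prod_eq_iff)
    finally show "(\<Sum>m\<in>I. U k m * star (U l m)) = (if k = l then 1 else 0)" .
  next
    fix k x assume k: "k \<in> I"
    then have ik: "fst k < length Ls" "snd k < n (fst k)" by (auto simp: I_def)
    have "(\<Sum>m\<in>I. e m x *\<^sub>C U m k) = (\<Sum>m\<in>I. if fst m = fst k then e m x *\<^sub>C u (fst k) (snd m) (snd k) else 0)"
      by (intro sum.cong) (auto simp: U_def)
    also have "\<dots> = \<alpha> (e k) x"
      unfolding diag[OF ik(1)] using P[OF ik(1)] ik by (simp add: e_def piece_def)
    finally show "\<alpha> (e k) x = (\<Sum>m\<in>I. e m x *\<^sub>C U m k)" by simp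
  qed
  moreover have "e ` I = entries Ls"
  proof -
    have "e ` I = (\<Union>i<length Ls. F i ` {..<n i})" by (force simp: e_def I_def)
    also have "\<dots> = (\<Union>P\<in>(\<lambda>i. Ls ! i) ` {..<length Ls}. snd (snd P) ` {..<fst P})"
      by (simp add: n_def F_def)
    also have "(\<lambda>i. Ls ! i) ` {..<length Ls} = set Ls" by (auto simp: set_conv_nth)
    finally have "e ` I = (\<Union>P\<in>set Ls. snd (snd P) ` {..<fst P})" .
    also have "\<dots> = entries Ls" by (simp add: entries_def case_prod_unfold)
    finally show ?thesis .
  qed
  ultimately show ?thesis by blast
qed

end

section \<open>Real orthogonal families\<close>

context algebraic_coaction
begin

lemma unitary_familyD:
  assumes "unitary_family I e u"
  shows "finite I" "i \<in> I \<Longrightarrow> e i \<in> \<A>" "i \<in> I \<Longrightarrow> e i \<in> cts"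
    "i \<in> I \<Longrightarrow> j \<in> I \<Longrightarrow> (\<Sum>k\<in>I. star (u k i) * u k j) = (if i = j then 1 else 0)"
    "i \<in> I \<Longrightarrow> j \<in> I \<Longrightarrow> (\<Sum>k\<in>I. u i k * star (u j k)) = (if i = j then 1 else 0)"
    "j \<in> I \<Longrightarrow> \<alpha> (e j) x = (\<Sum>i\<in>I. e i x *\<^sub>C u i j)"
  using assms continuous by (auto simp: unitary_family_def)

lemma action_product:
  assumes fam: "unitary_family I e u" and ij: "i \<in> I" "j \<in> I"
  shows "\<alpha> (\<lambda>x. e i x * e j x) x =
    (\<Sum>k\<in>I \<times> I. (e (fst k) x * e (snd k) x) *\<^sub>C (u (fst k) i * u (snd k) j))"
proof -
  note D = unitary_familyD[OF fam]
  have "\<alpha> (\<lambda>x. e i x * e j x) x = \<alpha> (e i) x * \<alpha> (e j) x" using D(3) ij by (intro action_mult) auto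
  also have "\<dots> = (\<Sum>k\<in>I. \<Sum>l\<in>I. (e k x * e l x) *\<^sub>C (u k i * u l j))"
    by (simp add: D(6) ij sum_product mult_scaleC_left mult_scaleC_right scaleC_scaleC mult.commute)
  finally show ?thesis by (simp add: sum.cartesian_product case_prod_unfold)
qed

text \<open>Inner products involve products of two functions, so the finite functional is built on
  the products e_i e_j, on which the tensor square of u acts. Closure under conjugation makes the
  conjugated weights invariant too, and their average has real weights.\<close>

lemma real_invariant_measure:
  assumes fam: "unitary_family I e u"
    and star: "\<And>i x. i \<in> I \<Longrightarrow> cnj (e i x) = (\<Sum>j\<in>I. D i j * e j x)"
  shows "\<exists>Y (c :: 'm \<Rightarrow> real). finite Y \<and>
    (\<forall>i\<in>I. \<forall>j\<in>I. (\<Sum>y\<in>Y. c y *\<^sub>R \<alpha> (\<lambda>x. e i x * e j x) y) = (\<Sum>y\<in>Y. of_real (c y) * (e i y * e j y)) *\<^sub>C 1) \<and>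
    (\<forall>\<zeta>. (\<forall>x. (\<Sum>i\<in>I. \<Sum>j\<in>I. \<zeta> i j *\<^sub>C \<alpha> (\<lambda>x. e i x * e j x) x) = (\<Sum>i\<in>I. \<Sum>j\<in>I. \<zeta> i j * (e i x * e j x)) *\<^sub>C 1) \<longrightarrow>
      (\<Sum>y\<in>Y. of_real (c y) * (\<Sum>i\<in>I. \<Sum>j\<in>I. \<zeta> i j * (e i y * e j y))) =
      (\<Sum>y\<in>Y0. \<Sum>i\<in>I. \<Sum>j\<in>I. \<zeta> i j * (e i y * e j y)))"
proof -
  note F = unitary_familyD[OF fam]
  define K where "K = I \<times> I"
  define m where "m k x = e (fst k) x * e (snd k) x" for k x
  define U where "U k l = u (fst k) (fst l) * u (snd k) (snd l)" for k l
  define D2 where "D2 k l = D (fst k) (fst l) * D (snd k) (snd l)" for k l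
  have K: "finite K" using F(1) by (simp add: K_def)
  have sumK: "(\<Sum>k\<in>K. g k) = (\<Sum>i\<in>I. \<Sum>j\<in>I. g (i, j))" for g :: "'a \<times> 'a \<Rightarrow> 'z::comm_monoid_add"
    by (simp add: K_def sum.cartesian_product)
  have \<alpha>m: "\<alpha> (m k) x = (\<Sum>l\<in>K. m l x *\<^sub>C U l k)" if "k \<in> K" for k x
    using action_product[OF fam, of "fst k" "snd k" x] that by (auto simp: m_def[abs_def] U_def K_def)
  have mc: "m k \<in> cts" if "k \<in> K" for k
    using F(3) that by (auto simp: m_def[abs_def] K_def cts_def intro!: continuous_intros)
  have UU: "(\<Sum>j\<in>K. U k j * star (U l j)) = (if k = l then 1 else 0)" if kl: "k \<in> K" "l \<in> K" for k l
  proof -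
    have I: "fst k \<in> I" "snd k \<in> I" "fst l \<in> I" "snd l \<in> I" using kl by (auto simp: K_def)
    have "(\<Sum>j\<in>K. U k j * star (U l j)) =
        (\<Sum>i\<in>I. u (fst k) i * (\<Sum>j\<in>I. u (snd k) j * star (u (snd l) j)) * star (u (fst l) i))"
      unfolding sumK by (simp add: U_def star_mult sum_distrib_left sum_distrib_right mult.assoc)
    also have "\<dots> = (if k = l then 1 else 0)"
      using F(5) I by (cases "snd k = snd l") (auto simp: prod_eq_iff)
    finally show ?thesis .
  qed
  have \<alpha>0: "\<alpha> (\<lambda>x. 0) x = 0" for x using action_combination[of "{}"] by simp
  have \<alpha>lin: "\<alpha> (\<lambda>x. \<Sum>k\<in>K. \<xi> k * m k x) x = (\<Sum>k\<in>K. \<xi> k *\<^sub>C (\<Sum>l\<in>K. m l x *\<^sub>C U l k))" for \<xi> x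
    using action_combination[of K m \<xi> x] mc by (simp add: \<alpha>m)
  have wd: "(\<Sum>j\<in>K. \<xi> j *\<^sub>C (\<Sum>i\<in>K. m i x *\<^sub>C U i j)) = 0" if "\<And>y. (\<Sum>j\<in>K. \<xi> j * m j y) = 0" for \<xi> x
    using \<alpha>lin[of \<xi> x] unfolding that \<alpha>0 by simp
  obtain Y c where Y: "finite Y"
    and inv: "\<And>j. j \<in> K \<Longrightarrow> (\<Sum>y\<in>Y. c y *\<^sub>C (\<Sum>i\<in>K. m i y *\<^sub>C U i j)) = (\<Sum>y\<in>Y. c y * m j y) *\<^sub>C 1"
    and agree: "\<And>\<zeta>. (\<And>x. (\<Sum>j\<in>K. \<zeta> j *\<^sub>C (\<Sum>i\<in>K. m i x *\<^sub>C U i j)) = (\<Sum>j\<in>K. \<zeta> j * m j x) *\<^sub>C 1) \<Longrightarrow>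
      (\<Sum>y\<in>Y. c y * (\<Sum>j\<in>K. \<zeta> j * m j y)) = (\<Sum>y\<in>Y0. \<Sum>j\<in>K. \<zeta> j * m j y)"
    using invariant_measure_exists[of K U m Y0, OF K UU wd] by blast
  have mstar: "cnj (m k x) = (\<Sum>l\<in>K. D2 k l * m l x)" if "k \<in> K" for k x
    using that star unfolding sumK
    by (auto simp: m_def K_def D2_def sum_product mult_ac intro!: sum.cong)
  have re: "of_real (Re z) = (1/2) * (z + cnj z)" for z by (simp add: complex_eq_iff)
  \<comment> \<open>The adjoint of the invariance identity, with conjugates of products rewritten as
    products through \<open>D2\<close>.\<close>
  have inv': "(\<Sum>y\<in>Y. cnj (c y) *\<^sub>C \<alpha> (m j) y) = (\<Sum>y\<in>Y. cnj (c y) * m j y) *\<^sub>C 1" if j: "j \<in> K" for j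
  proof -
    have s: "star (\<alpha> (m j) y) = (\<Sum>k\<in>K. D2 j k *\<^sub>C \<alpha> (m k) y)" for y
      using action_star[OF mc[OF j], of y] action_combination[of K m "D2 j" y] mc by (simp add: mstar[OF j])
    have "(\<Sum>y\<in>Y. c y *\<^sub>C star (\<alpha> (m j) y)) = (\<Sum>k\<in>K. D2 j k *\<^sub>C (\<Sum>y\<in>Y. c y *\<^sub>C \<alpha> (m k) y))"
      unfolding s scaleC_sum_right by (subst sum.swap) (simp add: scaleC_scaleC mult.commute)
    also have "\<dots> = (\<Sum>k\<in>K. D2 j k *\<^sub>C (\<Sum>y\<in>Y. c y * m k y) *\<^sub>C 1)"
      by (intro sum.cong refl) (simp add: inv \<alpha>m)
    also have "\<dots> = (\<Sum>k\<in>K. \<Sum>y\<in>Y. D2 j k * (c y * m k y)) *\<^sub>C 1"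
      by (simp add: scaleC_sum_left sum_distrib_left scaleC_sum_right)
    also have "(\<Sum>k\<in>K. \<Sum>y\<in>Y. D2 j k * (c y * m k y)) = (\<Sum>y\<in>Y. c y * cnj (m j y))"
      by (subst sum.swap) (simp add: mstar[OF j] sum_distrib_left mult.left_commute)
    finally have "star (\<Sum>y\<in>Y. c y *\<^sub>C star (\<alpha> (m j) y)) = star ((\<Sum>y\<in>Y. c y * cnj (m j y)) *\<^sub>C 1)" by simp
    then show ?thesis by (simp add: star_sum star_scaleC star_star)
  qed
  define r where "r y = Re (c y)" for y
  have "(\<Sum>y\<in>Y. r y *\<^sub>R \<alpha> (m j) y) = (\<Sum>y\<in>Y. of_real (r y) * m j y) *\<^sub>C 1" if j: "j \<in> K" for j
  proof -
    have "(\<Sum>y\<in>Y. r y *\<^sub>R \<alpha> (m j) y) =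
        (1/2) *\<^sub>C ((\<Sum>y\<in>Y. c y *\<^sub>C \<alpha> (m j) y) + (\<Sum>y\<in>Y. cnj (c y) *\<^sub>C \<alpha> (m j) y))"
      unfolding r_def scaleC_of_real[symmetric] re
      by (simp add: scaleC_sum_right sum.distrib scaleC_add_left scaleC_add_right scaleC_scaleC distrib_left)
    also have "\<dots> = ((1/2) * ((\<Sum>y\<in>Y. c y * m j y) + (\<Sum>y\<in>Y. cnj (c y) * m j y))) *\<^sub>C 1"
    proof -
      have "(\<Sum>y\<in>Y. c y *\<^sub>C \<alpha> (m j) y) = (\<Sum>y\<in>Y. c y * m j y) *\<^sub>C 1" using inv[OF j] by (simp add: \<alpha>m[OF j])
      then show ?thesis unfolding inv'[OF j] by (simp only: scaleC_add_left[symmetric] scaleC_scaleC)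
    qed
    also have "(1/2) * ((\<Sum>y\<in>Y. c y * m j y) + (\<Sum>y\<in>Y. cnj (c y) * m j y)) = (\<Sum>y\<in>Y. of_real (r y) * m j y)"
      unfolding r_def re by (simp add: sum_distrib_left sum.distrib distrib_left distrib_right mult_ac)
    finally show ?thesis .
  qed
  \<comment> \<open>Taking real parts of the weights preserves agreement with Y0 because the
    conjugate of an invariant function is invariant and again a combination of the products.\<close>
  moreover have "(\<Sum>y\<in>Y. of_real (r y) * w y) = (\<Sum>y\<in>Y0. w y)"
    if w: "\<And>x. w x = (\<Sum>k\<in>K. \<zeta> k * m k x)" and winv: "\<And>x. \<alpha> w x = w x *\<^sub>C 1" for w \<zeta>
  proof -
    have w': "w = (\<lambda>x. \<Sum>k\<in>K. \<zeta> k * m k x)" using w by (rule ext)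
    have 1: "(\<Sum>y\<in>Y. c y * w y) = (\<Sum>y\<in>Y0. w y)"
    proof -
      have "(\<Sum>j\<in>K. \<zeta> j *\<^sub>C (\<Sum>i\<in>K. m i x *\<^sub>C U i j)) = (\<Sum>j\<in>K. \<zeta> j * m j x) *\<^sub>C 1" for x
        using winv[of x] \<alpha>lin[of \<zeta> x] by (simp add: w')
      from agree[OF this] show ?thesis by (simp add: w)
    qed
    define \<zeta>' where "\<zeta>' l = (\<Sum>k\<in>K. cnj (\<zeta> k) * D2 k l)" for l
    have ws: "cnj (w x) = (\<Sum>l\<in>K. \<zeta>' l * m l x)" for x
    proof -
      have "cnj (w x) = (\<Sum>k\<in>K. \<Sum>l\<in>K. cnj (\<zeta> k) * (D2 k l * m l x))"
        by (simp add: w mstar sum_distrib_left)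
      then show ?thesis unfolding \<zeta>'_def sum_distrib_right by (subst (asm) sum.swap) (simp add: mult.assoc)
    qed
    have 2: "(\<Sum>y\<in>Y. c y * cnj (w y)) = (\<Sum>y\<in>Y0. cnj (w y))"
    proof -
      have "w \<in> cts" unfolding w' by (rule csubspace_sum[OF csubspace_cts mc])
      then have "\<alpha> (\<lambda>x. cnj (w x)) x = cnj (w x) *\<^sub>C 1" for x
        by (simp add: action_star winv star_scaleC)
      then have "(\<Sum>j\<in>K. \<zeta>' j *\<^sub>C (\<Sum>i\<in>K. m i x *\<^sub>C U i j)) = (\<Sum>j\<in>K. \<zeta>' j * m j x) *\<^sub>C 1" for x
        using \<alpha>lin[of \<zeta>' x] by (simp add: ws)
      from agree[OF this] show ?thesis by (simp add: ws)
    qed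
    have "cnj (\<Sum>y\<in>Y. c y * cnj (w y)) = cnj (\<Sum>y\<in>Y0. cnj (w y))" using 2 by simp
    then have 3: "(\<Sum>y\<in>Y. cnj (c y) * w y) = (\<Sum>y\<in>Y0. w y)" by simp
    have "(\<Sum>y\<in>Y. of_real (r y) * w y) = (1/2) * ((\<Sum>y\<in>Y. c y * w y) + (\<Sum>y\<in>Y. cnj (c y) * w y))"
      unfolding r_def re by (simp add: sum_distrib_left sum.distrib distrib_left distrib_right mult_ac)
    then show ?thesis unfolding 1 3 by simp
  qed
  ultimately have A: "\<And>j. j \<in> K \<Longrightarrow> (\<Sum>y\<in>Y. r y *\<^sub>R \<alpha> (m j) y) = (\<Sum>y\<in>Y. of_real (r y) * m j y) *\<^sub>C 1"
    and B: "\<And>w \<zeta>. (\<And>x. w x = (\<Sum>k\<in>K. \<zeta> k * m k x)) \<Longrightarrow> (\<And>x. \<alpha> w x = w x *\<^sub>C 1) \<Longrightarrow>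
      (\<Sum>y\<in>Y. of_real (r y) * w y) = (\<Sum>y\<in>Y0. w y)" by blast+
  show ?thesis
  proof (rule exI[of _ Y], rule exI[of _ r], intro conjI ballI allI impI)
    show "finite Y" by (rule Y)
    fix i j assume "i \<in> I" "j \<in> I"
    then show "(\<Sum>y\<in>Y. r y *\<^sub>R \<alpha> (\<lambda>x. e i x * e j x) y) = (\<Sum>y\<in>Y. of_real (r y) * (e i y * e j y)) *\<^sub>C 1"
      using A[of "(i, j)"] by (simp add: K_def m_def[abs_def])
  next
    fix \<zeta> assume inv: "\<forall>x. (\<Sum>i\<in>I. \<Sum>j\<in>I. \<zeta> i j *\<^sub>C \<alpha> (\<lambda>x. e i x * e j x) x) = (\<Sum>i\<in>I. \<Sum>j\<in>I. \<zeta> i j * (e i x * e j x)) *\<^sub>C 1"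
    define w where "w x = (\<Sum>k\<in>K. \<zeta> (fst k) (snd k) * m k x)" for x
    have weq: "w x = (\<Sum>i\<in>I. \<Sum>j\<in>I. \<zeta> i j * (e i x * e j x))" for x
      by (simp add: w_def sumK m_def)
    have "\<alpha> w x = w x *\<^sub>C 1" for x
    proof -
      have "\<alpha> w x = (\<Sum>k\<in>K. \<zeta> (fst k) (snd k) *\<^sub>C \<alpha> (m k) x)"
        unfolding w_def by (rule action_combination) (rule mc)
      also have "\<dots> = (\<Sum>i\<in>I. \<Sum>j\<in>I. \<zeta> i j *\<^sub>C \<alpha> (\<lambda>x. e i x * e j x) x)" by (simp add: sumK m_def[abs_def])
      finally show ?thesis using inv by (simp add: weq)
    qed
    from B[OF w_def this] show "(\<Sum>y\<in>Y. of_real (r y) * (\<Sum>i\<in>I. \<Sum>j\<in>I. \<zeta> i j * (e i y * e j y))) =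
      (\<Sum>y\<in>Y0. \<Sum>i\<in>I. \<Sum>j\<in>I. \<zeta> i j * (e i y * e j y))" by (simp add: weq)
  qed
qed

text \<open>Invariance makes the Gram matrix commute with u. Its trace against a matrix T of the
  commutant is the value of the functional on an invariant function, where it agrees with the sum
  over Y0; that sum is positive for projections T. Choosing Y0 as a determining set makes null
  vectors vanish as functions.\<close>

lemma positive_invariant_measure:
  assumes fam: "unitary_family I e u"
    and star: "\<And>i x. i \<in> I \<Longrightarrow> cnj (e i x) = (\<Sum>j\<in>I. D i j * e j x)"
  shows "\<exists>Y (c :: 'm \<Rightarrow> real). finite Y \<and>
    (\<forall>i\<in>I. \<forall>j\<in>I. (\<Sum>y\<in>Y. c y *\<^sub>R \<alpha> (\<lambda>x. e i x * e j x) y) = (\<Sum>y\<in>Y. of_real (c y) * (e i y * e j y)) *\<^sub>C 1) \<and>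
    (\<forall>\<xi>. (\<Sum>y\<in>Y. c y * (cmod (\<Sum>i\<in>I. \<xi> i * e i y))\<^sup>2) \<ge> 0) \<and>
    (\<forall>\<xi>. (\<Sum>y\<in>Y. c y * (cmod (\<Sum>i\<in>I. \<xi> i * e i y))\<^sup>2) = 0 \<longrightarrow> (\<forall>x. (\<Sum>i\<in>I. \<xi> i * e i x) = 0))"
proof -
  note F = unitary_familyD[OF fam]
  obtain Y0 where Y0: "finite Y0"
    "\<And>\<xi> x. (\<And>y. y \<in> Y0 \<Longrightarrow> (\<Sum>i\<in>I. \<xi> i * e i y) = 0) \<Longrightarrow> (\<Sum>i\<in>I. \<xi> i * e i x) = 0"
    using finite_determining_set[OF F(1), of e] by metis
  obtain Y and c :: "'m \<Rightarrow> real" where Y: "finite Y"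
    and inv: "\<forall>i\<in>I. \<forall>j\<in>I. (\<Sum>y\<in>Y. c y *\<^sub>R \<alpha> (\<lambda>x. e i x * e j x) y) = (\<Sum>y\<in>Y. of_real (c y) * (e i y * e j y)) *\<^sub>C 1"
    and agree: "\<forall>\<zeta>. (\<forall>x. (\<Sum>i\<in>I. \<Sum>j\<in>I. \<zeta> i j *\<^sub>C \<alpha> (\<lambda>x. e i x * e j x) x) = (\<Sum>i\<in>I. \<Sum>j\<in>I. \<zeta> i j * (e i x * e j x)) *\<^sub>C 1) \<longrightarrow>
      (\<Sum>y\<in>Y. of_real (c y) * (\<Sum>i\<in>I. \<Sum>j\<in>I. \<zeta> i j * (e i y * e j y))) =
      (\<Sum>y\<in>Y0. \<Sum>i\<in>I. \<Sum>j\<in>I. \<zeta> i j * (e i y * e j y))"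
    using real_invariant_measure[OF fam star, of Y0] by blast
  define H where "H j i = (\<Sum>y\<in>Y. of_real (c y) * (e i y * cnj (e j y)))" for i j
  have herm: "H j i = cnj (H i j)" for i j by (simp add: H_def mult.commute)
  have prod: "\<alpha> (\<lambda>x. e i x * e l x) y = \<alpha> (e i) y * \<alpha> (e l) y" if "i \<in> I" "l \<in> I" for i l y
    using F(3) that by (intro action_mult) auto
  have conj: "star (\<alpha> (e j) y) = (\<Sum>l\<in>I. D j l *\<^sub>C \<alpha> (e l) y)" if j: "j \<in> I" for j y
    using action_star[OF F(3)[OF j], of y] action_combination[of I e "D j" y] F(3) by (simp add: star[OF j])
  have Hinv: "(\<Sum>y\<in>Y. c y *\<^sub>R (star (\<alpha> (e j) y) * \<alpha> (e i) y)) = H j i *\<^sub>C 1" if ij: "i \<in> I" "j \<in> I" for i j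
  proof -
    have "(\<Sum>y\<in>Y. c y *\<^sub>R (star (\<alpha> (e j) y) * \<alpha> (e i) y)) = (\<Sum>y\<in>Y. \<Sum>l\<in>I. D j l *\<^sub>C c y *\<^sub>R \<alpha> (\<lambda>x. e l x * e i x) y)"
      by (intro sum.cong refl)
        (simp add: conj[OF ij(2)] prod ij sum_distrib_right mult_scaleC_left scaleC_of_real[symmetric] scaleC_sum_right scaleC_scaleC mult.commute)
    also have "\<dots> = (\<Sum>l\<in>I. D j l *\<^sub>C (\<Sum>y\<in>Y. c y *\<^sub>R \<alpha> (\<lambda>x. e l x * e i x) y))"
      by (subst sum.swap) (simp add: scaleC_sum_right)
    also have "\<dots> = (\<Sum>l\<in>I. D j l *\<^sub>C (\<Sum>y\<in>Y. of_real (c y) * (e l y * e i y)) *\<^sub>C 1)"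
      using inv ij by (intro sum.cong) auto
    also have "\<dots> = (\<Sum>l\<in>I. \<Sum>y\<in>Y. D j l * (of_real (c y) * (e l y * e i y))) *\<^sub>C 1"
      by (simp add: scaleC_sum_left sum_distrib_left scaleC_sum_right)
    also have "(\<Sum>l\<in>I. \<Sum>y\<in>Y. D j l * (of_real (c y) * (e l y * e i y))) = H j i"
      unfolding H_def by (subst sum.swap) (simp add: star[OF ij(2)] sum_distrib_left mult_ac)
    finally show ?thesis .
  qed
  \<comment> \<open>Invariance of the functional in matrix form, H = u^* H u; multiplying by u from
    the left and using u u^* = 1 gives the commutation.\<close>
  have twist: "H j i *\<^sub>C 1 = (\<Sum>k\<in>I. \<Sum>l\<in>I. H l k *\<^sub>C (star (u l j) * u k i))" if ij: "i \<in> I" "j \<in> I" for i j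
  proof -
    have "H j i *\<^sub>C 1 = (\<Sum>y\<in>Y. c y *\<^sub>R (star (\<alpha> (e j) y) * \<alpha> (e i) y))" by (rule Hinv[OF ij, symmetric])
    also have "\<dots> = (\<Sum>y\<in>Y. \<Sum>l\<in>I. \<Sum>k\<in>I. (of_real (c y) * (e k y * cnj (e l y))) *\<^sub>C (star (u l j) * u k i))"
      by (intro sum.cong refl)
        (simp add: F(6) ij star_sum star_scaleC sum_product mult_scaleC_left mult_scaleC_right
          scaleC_of_real[symmetric] scaleC_sum_right scaleC_scaleC mult_ac)
    also have "\<dots> = (\<Sum>l\<in>I. \<Sum>k\<in>I. \<Sum>y\<in>Y. (of_real (c y) * (e k y * cnj (e l y))) *\<^sub>C (star (u l j) * u k i))"
      by (subst sum.swap, rule sum.cong, rule refl, rule sum.swap)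
    also have "\<dots> = (\<Sum>l\<in>I. \<Sum>k\<in>I. H l k *\<^sub>C (star (u l j) * u k i))" by (simp add: H_def scaleC_sum_left)
    finally show ?thesis by (subst sum.swap)
  qed
  have comm: "(\<Sum>k\<in>I. H i k *\<^sub>C u k j) = (\<Sum>k\<in>I. H k j *\<^sub>C u i k)" if ij: "i \<in> I" "j \<in> I" for i j
  proof -
    have "(\<Sum>p\<in>I. H p j *\<^sub>C u i p) = (\<Sum>p\<in>I. u i p * (H p j *\<^sub>C 1))" by (simp add: mult_scaleC_right)
    also have "\<dots> = (\<Sum>p\<in>I. \<Sum>k\<in>I. \<Sum>l\<in>I. H l k *\<^sub>C (u i p * star (u l p) * u k j))"
      by (intro sum.cong refl) (simp add: twist ij sum_distrib_left mult_scaleC_right mult.assoc)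
    also have "\<dots> = (\<Sum>k\<in>I. \<Sum>l\<in>I. \<Sum>p\<in>I. H l k *\<^sub>C (u i p * star (u l p) * u k j))"
      by (subst sum.swap, rule sum.cong, rule refl, rule sum.swap)
    also have "\<dots> = (\<Sum>k\<in>I. \<Sum>l\<in>I. H l k *\<^sub>C ((if i = l then 1 else 0) * u k j))"
      by (intro sum.cong refl) (simp add: F(5)[symmetric] ij scaleC_sum_right sum_distrib_right)
    also have "\<dots> = (\<Sum>k\<in>I. H i k *\<^sub>C u k j)"
      using F(1) ij by (simp add: if_distrib[of "\<lambda>x. x * _"] if_distrib[of "\<lambda>x. _ *\<^sub>C x"] cong: if_cong)
    finally show ?thesis by simp
  qed
  have trace: "(\<Sum>i\<in>I. \<Sum>j\<in>I. T i j * H j i) = (\<Sum>y\<in>Y0. \<Sum>i\<in>I. \<Sum>j\<in>I. T i j * (e i y * cnj (e j y)))"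
    if T: "\<And>i j. i \<in> I \<Longrightarrow> j \<in> I \<Longrightarrow> (\<Sum>k\<in>I. T i k *\<^sub>C u k j) = (\<Sum>k\<in>I. T k j *\<^sub>C u i k)" for T
  proof -
    \<comment> \<open>The matrix D turns \<Sum>_ij T_ij e_i cnj e_j into a combination of products
      e_i e_l, to which \<open>agree\<close> applies. The function is invariant because T commutes
      with u and u u^* = 1.\<close>
    define \<zeta> where "\<zeta> i l = (\<Sum>j\<in>I. T i j * D j l)" for i l
    have w: "(\<Sum>i\<in>I. \<Sum>l\<in>I. \<zeta> i l * (e i x * e l x)) = (\<Sum>i\<in>I. \<Sum>j\<in>I. T i j * (e i x * cnj (e j x)))" for x
    proof (rule sum.cong[OF refl])
      fix i assume "i \<in> I"
      have "(\<Sum>l\<in>I. \<zeta> i l * (e i x * e l x)) = (\<Sum>l\<in>I. \<Sum>j\<in>I. T i j * (e i x * (D j l * e l x)))"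
        by (simp add: \<zeta>_def sum_distrib_left mult_ac)
      also have "\<dots> = (\<Sum>j\<in>I. T i j * (e i x * (\<Sum>l\<in>I. D j l * e l x)))"
        by (subst sum.swap) (simp add: sum_distrib_left)
      finally show "(\<Sum>l\<in>I. \<zeta> i l * (e i x * e l x)) = (\<Sum>j\<in>I. T i j * (e i x * cnj (e j x)))" by (simp add: star)
    qed
    have "(\<Sum>i\<in>I. \<Sum>l\<in>I. \<zeta> i l *\<^sub>C \<alpha> (\<lambda>x. e i x * e l x) x) = (\<Sum>i\<in>I. \<Sum>l\<in>I. \<zeta> i l * (e i x * e l x)) *\<^sub>C 1" for x
    proof -
      have "(\<Sum>i\<in>I. \<Sum>l\<in>I. \<zeta> i l *\<^sub>C \<alpha> (\<lambda>x. e i x * e l x) x) = (\<Sum>i\<in>I. \<Sum>j\<in>I. T i j *\<^sub>C (\<alpha> (e i) x * star (\<alpha> (e j) x)))"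
      proof (rule sum.cong[OF refl])
        fix i assume i: "i \<in> I"
        have "(\<Sum>l\<in>I. \<zeta> i l *\<^sub>C \<alpha> (\<lambda>x. e i x * e l x) x) = (\<Sum>l\<in>I. \<Sum>j\<in>I. T i j *\<^sub>C (\<alpha> (e i) x * (D j l *\<^sub>C \<alpha> (e l) x)))"
          by (intro sum.cong refl) (simp add: \<zeta>_def prod i scaleC_sum_left mult_scaleC_right scaleC_scaleC)
        also have "\<dots> = (\<Sum>j\<in>I. T i j *\<^sub>C (\<alpha> (e i) x * (\<Sum>l\<in>I. D j l *\<^sub>C \<alpha> (e l) x)))"
          by (subst sum.swap) (simp add: scaleC_sum_right sum_distrib_left)
        finally show "(\<Sum>l\<in>I. \<zeta> i l *\<^sub>C \<alpha> (\<lambda>x. e i x * e l x) x) = (\<Sum>j\<in>I. T i j *\<^sub>C (\<alpha> (e i) x * star (\<alpha> (e j) x)))"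
          by (simp add: conj)
      qed
      also have "\<dots> = (\<Sum>i\<in>I. \<Sum>j\<in>I. \<Sum>k\<in>I. \<Sum>l\<in>I. (e k x * cnj (e l x)) *\<^sub>C T i j *\<^sub>C (u k i * star (u l j)))"
        by (intro sum.cong refl)
          (simp add: F(6) star_sum star_scaleC sum_product mult_scaleC_left mult_scaleC_right scaleC_sum_right scaleC_scaleC mult_ac)
      also have "\<dots> = (\<Sum>i\<in>I. \<Sum>k\<in>I. \<Sum>l\<in>I. \<Sum>j\<in>I. (e k x * cnj (e l x)) *\<^sub>C T i j *\<^sub>C (u k i * star (u l j)))"
        by (rule sum.cong[OF refl], subst sum.swap, rule sum.cong, rule refl, rule sum.swap)
      also have "\<dots> = (\<Sum>k\<in>I. \<Sum>l\<in>I. \<Sum>i\<in>I. \<Sum>j\<in>I. (e k x * cnj (e l x)) *\<^sub>C T i j *\<^sub>C (u k i * star (u l j)))"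
        by (subst sum.swap, rule sum.cong, rule refl, rule sum.swap)
      also have "\<dots> = (\<Sum>k\<in>I. \<Sum>l\<in>I. (T k l * (e k x * cnj (e l x))) *\<^sub>C 1)"
      proof (intro sum.cong refl)
        fix k l assume kl: "k \<in> I" "l \<in> I"
        have "(\<Sum>i\<in>I. \<Sum>j\<in>I. T i j *\<^sub>C (u k i * star (u l j))) = (\<Sum>j\<in>I. (\<Sum>i\<in>I. T i j *\<^sub>C u k i) * star (u l j))"
          by (subst sum.swap) (simp add: sum_distrib_right mult_scaleC_left)
        also have "\<dots> = (\<Sum>j\<in>I. (\<Sum>i\<in>I. T k i *\<^sub>C u i j) * star (u l j))"
          by (intro sum.cong refl) (simp add: T kl)
        also have "\<dots> = (\<Sum>i\<in>I. T k i *\<^sub>C (\<Sum>j\<in>I. u i j * star (u l j)))"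
          unfolding sum_distrib_right scaleC_sum_right by (subst sum.swap) (simp add: mult_scaleC_left)
        also have "\<dots> = T k l *\<^sub>C 1"
          using F(1) kl by (simp add: F(5) if_distrib[of "\<lambda>x. _ *\<^sub>C x"] cong: if_cong)
        finally show "(\<Sum>i\<in>I. \<Sum>j\<in>I. (e k x * cnj (e l x)) *\<^sub>C T i j *\<^sub>C (u k i * star (u l j))) = (T k l * (e k x * cnj (e l x))) *\<^sub>C 1"
          unfolding scaleC_sum_right[symmetric] by (simp add: scaleC_scaleC mult.commute)
      qed
      finally show ?thesis unfolding w by (simp add: scaleC_sum_left)
    qed
    then have "(\<Sum>y\<in>Y. of_real (c y) * (\<Sum>i\<in>I. \<Sum>j\<in>I. T i j * (e i y * cnj (e j y)))) =
        (\<Sum>y\<in>Y0. \<Sum>i\<in>I. \<Sum>j\<in>I. T i j * (e i y * cnj (e j y)))"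
      using agree[rule_format, of \<zeta>] unfolding w by blast
    moreover have "(\<Sum>y\<in>Y. of_real (c y) * (\<Sum>i\<in>I. \<Sum>j\<in>I. T i j * (e i y * cnj (e j y)))) = (\<Sum>i\<in>I. \<Sum>j\<in>I. T i j * H j i)"
      unfolding H_def sum_distrib_left
      by (subst sum.swap, rule sum.cong, rule refl, subst sum.swap) (simp add: mult_ac)
    ultimately show ?thesis by simp
  qed
  have quad: "(\<Sum>y\<in>Y. c y * (cmod (\<Sum>i\<in>I. \<xi> i * e i y))\<^sup>2) = quad_form I H \<xi>" for \<xi>
  proof -
    have "complex_of_real (\<Sum>y\<in>Y. c y * (cmod (\<Sum>i\<in>I. \<xi> i * e i y))\<^sup>2) =
        (\<Sum>y\<in>Y. of_real (c y) * ((\<Sum>i\<in>I. \<xi> i * e i y) * cnj (\<Sum>i\<in>I. \<xi> i * e i y)))"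
      by (simp add: complex_norm_square del: of_real_power)
    also have "\<dots> = (\<Sum>y\<in>Y. \<Sum>i\<in>I. \<Sum>j\<in>I. cnj (\<xi> i) * (of_real (c y) * (e j y * cnj (e i y))) * \<xi> j)"
      by (subst mult.commute[of "\<Sum>i\<in>I. \<xi> i * e i _"]) (simp add: sum_product sum_distrib_left mult_ac)
    also have "\<dots> = (\<Sum>i\<in>I. \<Sum>j\<in>I. cnj (\<xi> i) * H i j * \<xi> j)"
      unfolding H_def sum_distrib_left sum_distrib_right
      by (subst sum.swap, rule sum.cong, rule refl, rule sum.swap)
    finally show ?thesis unfolding quad_form_def by (metis Re_complex_of_real)
  qed
  show ?thesis
  proof (rule exI[of _ Y], rule exI[of _ c], intro conjI allI impI)
    show "finite Y" by (rule Y)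
    show "\<forall>i\<in>I. \<forall>j\<in>I. (\<Sum>y\<in>Y. c y *\<^sub>R \<alpha> (\<lambda>x. e i x * e j x) y) = (\<Sum>y\<in>Y. of_real (c y) * (e i y * e j y)) *\<^sub>C 1"
      by (rule inv)
    show "0 \<le> (\<Sum>y\<in>Y. c y * (cmod (\<Sum>i\<in>I. \<xi> i * e i y))\<^sup>2)" for \<xi>
      unfolding quad by (rule positive_if_traces_positive(1)[OF F(1) herm comm trace Y0(1)])
    show "(\<Sum>i\<in>I. \<xi> i * e i x) = 0" if "(\<Sum>y\<in>Y. c y * (cmod (\<Sum>i\<in>I. \<xi> i * e i y))\<^sup>2) = 0" for \<xi> x
      by (rule Y0(2), rule positive_if_traces_positive(2)[OF F(1) herm comm trace Y0(1) that[unfolded quad]])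
  qed
qed

end

text \<open>Real scalars act on complex-valued functions here, so that real functions stay real. A
  dependent list does no harm: a vanishing remainder leaves the basis as it is.\<close>

lemma finite_gram_schmidt:
  fixes S :: "('m \<Rightarrow> complex) \<Rightarrow> ('m \<Rightarrow> complex) \<Rightarrow> real"
  assumes V: "(\<lambda>x. 0) \<in> V" "\<And>f g r. f \<in> V \<Longrightarrow> g \<in> V \<Longrightarrow> (\<lambda>x. f x + of_real r * g x) \<in> V"
    and add: "\<And>f g h r. S (\<lambda>x. f x + of_real r * g x) h = S f h + r * S g h"
    and sym: "\<And>f g. S f g = S g f"
    and pos: "\<And>f. f \<in> V \<Longrightarrow> f \<noteq> (\<lambda>x. 0) \<Longrightarrow> S f f > 0"
  shows "set gs \<subseteq> V \<Longrightarrow> \<exists>B. finite B \<and> B \<subseteq> V \<and> (\<forall>f\<in>B. \<forall>g\<in>B. S f g = (if f = g then 1 else 0)) \<and>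
    (\<forall>g\<in>set gs. \<forall>x. g x = (\<Sum>f\<in>B. of_real (S g f) * f x))"
proof (induction gs)
  case Nil
  then show ?case by (intro exI[of _ "{}"]) auto
next
  case (Cons g gs)
  have S0: "S (\<lambda>x. 0) h = 0" for h using add[of "\<lambda>x. 0" "- 1" "\<lambda>x. 0" h] by simp
  have comb: "(\<lambda>x. \<Sum>f\<in>B. of_real (k f) * f x) \<in> V" "S (\<lambda>x. \<Sum>f\<in>B. of_real (k f) * f x) h = (\<Sum>f\<in>B. k f * S f h)"
    if "finite B" "B \<subseteq> V" for B k h
    using that
  proof (induction B rule: finite_induct)
    case (insert f B)
    { case 1 then show ?case using V(2)[of "\<lambda>x. \<Sum>f\<in>B. of_real (k f) * f x" f "k f"] insert by (simp add: add.commute) }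
    { case 2 then show ?case using add[of "\<lambda>x. \<Sum>f\<in>B. of_real (k f) * f x" "k f" f h] insert by (simp add: add.commute) }
  qed (use V(1) S0 in auto)
  have "set gs \<subseteq> V" using Cons.prems by simp
  from Cons.IH[OF this] obtain B where B: "finite B" "B \<subseteq> V"
    and on': "\<forall>f\<in>B. \<forall>g\<in>B. S f g = (if f = g then 1 else 0)"
    and ex': "\<forall>g\<in>set gs. \<forall>x. g x = (\<Sum>f\<in>B. of_real (S g f) * f x)" by (elim exE conjE)
  have on: "S f g = (if f = g then 1 else 0)" if "f \<in> B" "g \<in> B" for f g using on' that by blast
  have ex: "g x = (\<Sum>f\<in>B. of_real (S g f) * f x)" if "g \<in> set gs" for g x using ex' that by blast
  define p where "p x = (\<Sum>f\<in>B. of_real (S g f) * f x)" for x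
  define r where "r x = g x + of_real (- 1) * p x" for x
  have pV: "p \<in> V" unfolding p_def using B by (rule comb)
  have rV: "r \<in> V" unfolding r_def using Cons.prems pV by (intro V(2)) auto
  have Sp: "S p f = S g f" if "f \<in> B" for f
  proof -
    have "S p f = (\<Sum>h\<in>B. S g h * S h f)" unfolding p_def by (rule comb(2)[OF B])
    then show ?thesis using B(1) that by (simp add: on if_distrib[of "\<lambda>x. _ * x"] cong: if_cong)
  qed
  have Sr: "S r f = 0" if "f \<in> B" for f
    using add[of g "- 1" p f] Sp[OF that] by (simp add: r_def[abs_def])
  show ?case
  proof (cases "r = (\<lambda>x. 0)")
    case True
    have "r x = 0" for x using True by simp
    then have "g x = p x" for x by (simp add: r_def)
    then have "g x = (\<Sum>f\<in>B. of_real (S g f) * f x)" for x by (simp add: p_def)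
    then show ?thesis using B on ex by (intro exI[of _ B]) auto
  next
    case False
    define s where "s = sqrt (S r r)"
    have s: "s > 0" "s * s = S r r" using pos[OF rV False] by (simp_all add: s_def)
    define f0 where "f0 x = 0 + of_real (1 / s) * r x" for x
    have f0V: "f0 \<in> V" unfolding f0_def by (rule V(2)[OF V(1) rV])
    have Sf0: "S f0 h = (1 / s) * S r h" for h
      unfolding f0_def add S0 by simp
    have f0f: "S f0 f = 0" if "f \<in> B" for f using Sr[OF that] by (simp add: Sf0)
    have ff0: "S f f0 = 0" if "f \<in> B" for f using f0f[OF that] sym[of f f0] by simp
    have f00: "S f0 f0 = 1" using s(1) sym[of r f0] by (simp add: Sf0 s(2)[symmetric])
    have notin: "f0 \<notin> B" using f0f f00 by force
    have on2: "S f h = (if f = h then 1 else 0)" if "f \<in> insert f0 B" "h \<in> insert f0 B" for f h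
      using that(1)
    proof
      assume f: "f = f0"
      show ?thesis using that(2) f0f f00 notin unfolding f by auto
    next
      assume f: "f \<in> B"
      show ?thesis using that(2) on[OF f] ff0[OF f] notin f by auto
    qed
    have Sgf0: "S g f0 = s"
    proof -
      have "S p f0 = (\<Sum>h\<in>B. S g h * S h f0)" unfolding p_def by (rule comb(2)[OF B])
      also have "\<dots> = 0" using ff0 by (intro sum.neutral) auto
      finally have "S r f0 = S g f0" unfolding r_def add by simp
      moreover have "S r f0 = s" using Sf0[of r] s(1) by (simp add: sym[of r f0] s(2)[symmetric])
      ultimately show ?thesis by simp
    qed
    have "g x = (\<Sum>f\<in>insert f0 B. of_real (S g f) * f x)" for x
      using B(1) notin s by (simp add: Sgf0 p_def[symmetric]) (simp add: f0_def r_def)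
    moreover have "h x = (\<Sum>f\<in>insert f0 B. of_real (S h f) * f x)" if h: "h \<in> set gs" for h x
    proof -
      have "S h f0 = S (\<lambda>x. \<Sum>f\<in>B. of_real (S h f) * f x) f0" using ex[OF h] by (metis ext)
      also have "\<dots> = (\<Sum>f\<in>B. S h f * S f f0)" by (rule comb(2)[OF B])
      also have "\<dots> = 0" using ff0 by (intro sum.neutral) auto
      finally show ?thesis using B(1) notin ex[OF h] by simp
    qed
    ultimately show ?thesis
      using B f0V on2 by (intro exI[of _ "insert f0 B"]) auto
  qed
qed

context algebraic_coaction
begin

text \<open>Real and imaginary parts of a conjugation-closed span are orthonormalised with respect
  to the invariant functional; its invariance then becomes orthogonality of the matrix of \<alpha>
  in the new basis.\<close>

lemma real_orthogonal_family:
  assumes Gs: "pieces Gs"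
  shows "\<exists>B q. finite B \<and> B \<subseteq> \<A> \<and> (\<forall>f\<in>B. \<forall>x. cnj (f x) = f x) \<and>
    (\<forall>f\<in>B. \<forall>x. \<alpha> f x = (\<Sum>h\<in>B. h x *\<^sub>C q h f)) \<and> (\<forall>f\<in>B. \<forall>h\<in>B. star (q h f) = q h f) \<and>
    (\<forall>f\<in>B. \<forall>g\<in>B. (\<Sum>h\<in>B. q h f * q h g) = (if f = g then 1 else 0)) \<and>
    (\<forall>f\<in>B. \<forall>g\<in>B. (\<Sum>h\<in>B. q f h * q g h) = (if f = g then 1 else 0)) \<and>
    (\<forall>g\<in>entries Gs. \<exists>c. \<forall>x. g x = (\<Sum>f\<in>B. c f * f x))"
proof -
  obtain Ls where Ls: "pieces Ls" "entries Gs \<subseteq> entries Ls"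
    and Lstar: "\<forall>h\<in>entries Ls. (\<lambda>x. cnj (h x)) \<in> cspan (entries Ls)"
    using star_closed_pieces[OF Gs] by blast
  obtain I :: "(nat \<times> nat) set" and e u where fam: "unitary_family I e u" and eI: "e ` I = entries Ls"
    using unitary_family_of_pieces[OF Ls(1)] by blast
  note F = unitary_familyD[OF fam]
  have "cspan (e ` I) \<subseteq> {f. \<exists>d. \<forall>x. f x = (\<Sum>j\<in>I. d j * e j x)}"
  proof (rule cstar_fun.span_minimal)
    show "e ` I \<subseteq> {f. \<exists>d. \<forall>x. f x = (\<Sum>j\<in>I. d j * e j x)}"
    proof clarify
      fix i assume "i \<in> I"
      then show "\<exists>d. \<forall>x. e i x = (\<Sum>j\<in>I. d j * e j x)"
        using F(1) by (intro exI[of _ "\<lambda>j. if j = i then 1 else 0"]) (simp add: if_distrib[of "\<lambda>x. x * _"] cong: if_cong)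
    qed
    show "csubspace {f. \<exists>d. \<forall>x. f x = (\<Sum>j\<in>I. d j * e j x)}"
    proof (rule csubspaceI)
      show "(\<lambda>i. 0) \<in> {f. \<exists>d. \<forall>x. f x = (\<Sum>j\<in>I. d j * e j x)}" by (intro CollectI exI[of _ "\<lambda>_. 0"]) simp
    next
      fix f g assume "f \<in> {f. \<exists>d. \<forall>x. f x = (\<Sum>j\<in>I. d j * e j x)}" "g \<in> {f. \<exists>d. \<forall>x. f x = (\<Sum>j\<in>I. d j * e j x)}"
      then obtain d d' where "\<forall>x. f x = (\<Sum>j\<in>I. d j * e j x)" "\<forall>x. g x = (\<Sum>j\<in>I. d' j * e j x)" by auto
      then show "(\<lambda>i. f i + g i) \<in> {f. \<exists>d. \<forall>x. f x = (\<Sum>j\<in>I. d j * e j x)}"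
        by (intro CollectI exI[of _ "\<lambda>j. d j + d' j"]) (simp add: distrib_right sum.distrib)
    next
      fix c f assume "f \<in> {f. \<exists>d. \<forall>x. f x = (\<Sum>j\<in>I. d j * e j x)}"
      then obtain d where "\<forall>x. f x = (\<Sum>j\<in>I. d j * e j x)" by auto
      then show "(\<lambda>i. c * f i) \<in> {f. \<exists>d. \<forall>x. f x = (\<Sum>j\<in>I. d j * e j x)}"
        by (intro CollectI exI[of _ "\<lambda>j. c * d j"]) (simp add: sum_distrib_left mult.assoc)
    qed
  qed
  then have span: "\<exists>d. \<forall>x. f x = (\<Sum>j\<in>I. d j * e j x)" if "f \<in> cspan (e ` I)" for f using that by blast
  have "\<forall>i\<in>I. \<exists>d. \<forall>x. cnj (e i x) = (\<Sum>j\<in>I. d j * e j x)"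
    using Lstar span unfolding eI[symmetric] by blast
  then obtain D where D: "\<And>i x. i \<in> I \<Longrightarrow> cnj (e i x) = (\<Sum>j\<in>I. D i j * e j x)" by metis
  obtain Y and c :: "'m \<Rightarrow> real" where Y: "finite Y"
    and inv: "\<forall>i\<in>I. \<forall>j\<in>I. (\<Sum>y\<in>Y. c y *\<^sub>R \<alpha> (\<lambda>x. e i x * e j x) y) = (\<Sum>y\<in>Y. of_real (c y) * (e i y * e j y)) *\<^sub>C 1"
    and nn: "\<forall>\<xi>. (\<Sum>y\<in>Y. c y * (cmod (\<Sum>i\<in>I. \<xi> i * e i y))\<^sup>2) \<ge> 0"
    and def: "\<forall>\<xi>. (\<Sum>y\<in>Y. c y * (cmod (\<Sum>i\<in>I. \<xi> i * e i y))\<^sup>2) = 0 \<longrightarrow> (\<forall>x. (\<Sum>i\<in>I. \<xi> i * e i x) = 0)"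
    using positive_invariant_measure[OF fam D] by blast
  define S where "S f g = (\<Sum>y\<in>Y. c y * (Re (f y) * Re (g y)))" for f g :: "'m \<Rightarrow> complex"
  define V where "V = {f. (\<forall>x. cnj (f x) = f x) \<and> (\<exists>d. \<forall>x. f x = (\<Sum>j\<in>I. d j * e j x))}"
  have V0: "(\<lambda>x. 0) \<in> V" by (auto simp: V_def intro!: exI[of _ "\<lambda>_. 0"])
  have Vadd: "(\<lambda>x. f x + of_real r * g x) \<in> V" if fg: "f \<in> V" "g \<in> V" for f g r
  proof -
    obtain d d' where "\<forall>x. f x = (\<Sum>j\<in>I. d j * e j x)" "\<forall>x. g x = (\<Sum>j\<in>I. d' j * e j x)"
      using fg by (auto simp: V_def)
    then have comb: "\<forall>x. f x + of_real r * g x = (\<Sum>j\<in>I. (d j + of_real r * d' j) * e j x)"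
      by (simp add: distrib_right sum.distrib sum_distrib_left mult.assoc)
    have real: "cnj (f x + of_real r * g x) = f x + of_real r * g x" for x
      using fg by (simp add: V_def)
    show ?thesis unfolding V_def
      by (rule CollectI, rule conjI, rule allI, rule real, rule exI, rule comb)
  qed
  have re: "f x = of_real (Re (f x))" if "f \<in> V" for f x
    using that by (simp add: V_def complex_eq_iff)
  have "\<exists>gs. set gs \<subseteq> V \<and> (\<forall>i\<in>I. (\<lambda>x. of_real (Re (e i x))) \<in> set gs \<and> (\<lambda>x. of_real (Im (e i x))) \<in> set gs)"
  proof -
    define R where "R = (\<lambda>i x. complex_of_real (Re (e i x))) ` I \<union> (\<lambda>i x. complex_of_real (Im (e i x))) ` I"
    obtain gs where gs: "set gs = R" using finite_list[of R] F(1) by (auto simp: R_def)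
    have re_i: "complex_of_real (Re (e i x)) = (\<Sum>j\<in>I. ((1/2) * ((if j = i then 1 else 0) + D i j)) * e j x)"
      and im_i: "complex_of_real (Im (e i x)) = (\<Sum>j\<in>I. ((1/(2*\<i>)) * ((if j = i then 1 else 0) - D i j)) * e j x)" if i: "i \<in> I" for i x
    proof -
      have e: "(\<Sum>j\<in>I. (if j = i then 1 else 0) * e j x) = e i x"
        using F(1) i by (simp add: if_distrib[of "\<lambda>x. x * _"] cong: if_cong)
      have "complex_of_real (Re (e i x)) = (1/2) * (e i x + cnj (e i x))" by (simp add: complex_eq_iff)
      also have "\<dots> = (1/2) * ((\<Sum>j\<in>I. (if j = i then 1 else 0) * e j x) + (\<Sum>j\<in>I. D i j * e j x))"
        unfolding e D[OF i] ..
      finally show "complex_of_real (Re (e i x)) = (\<Sum>j\<in>I. ((1/2) * ((if j = i then 1 else 0) + D i j)) * e j x)"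
        unfolding sum.distrib[symmetric] sum_distrib_left by (simp add: algebra_simps)
      have "complex_of_real (Im (e i x)) = (1/(2*\<i>)) * (e i x - cnj (e i x))" by (simp add: complex_eq_iff)
      also have "\<dots> = (1/(2*\<i>)) * ((\<Sum>j\<in>I. (if j = i then 1 else 0) * e j x) - (\<Sum>j\<in>I. D i j * e j x))"
        unfolding e D[OF i] ..
      finally show "complex_of_real (Im (e i x)) = (\<Sum>j\<in>I. ((1/(2*\<i>)) * ((if j = i then 1 else 0) - D i j)) * e j x)"
        unfolding sum_subtractf[symmetric] sum_distrib_left by (simp only: left_diff_distrib mult.assoc)
    qed
    have "R \<subseteq> V"
    proof
      fix f assume "f \<in> R"
      then consider i where "i \<in> I" "f = (\<lambda>x. complex_of_real (Re (e i x)))"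
        | i where "i \<in> I" "f = (\<lambda>x. complex_of_real (Im (e i x)))" by (auto simp: R_def)
      then show "f \<in> V"
      proof cases
        case 1
        show ?thesis unfolding V_def 1(2)
          by (rule CollectI, rule conjI, rule allI, rule complex_cnj_complex_of_real, rule exI, rule allI,
              rule re_i[OF 1(1)])
      next
        case 2
        show ?thesis unfolding V_def 2(2)
          by (rule CollectI, rule conjI, rule allI, rule complex_cnj_complex_of_real, rule exI, rule allI,
              rule im_i[OF 2(1)])
      qed
    qed
    then show ?thesis using gs by (intro exI[of _ gs]) (auto simp: R_def)
  qed
  then obtain gs where gs: "set gs \<subseteq> V"
    "\<And>i. i \<in> I \<Longrightarrow> (\<lambda>x. of_real (Re (e i x))) \<in> set gs" "\<And>i. i \<in> I \<Longrightarrow> (\<lambda>x. of_real (Im (e i x))) \<in> set gs" by metis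
  have Spos: "S f f > 0" if f: "f \<in> V" "f \<noteq> (\<lambda>x. 0)" for f
  proof -
    obtain d where d: "\<forall>x. f x = (\<Sum>j\<in>I. d j * e j x)" using f by (auto simp: V_def)
    have cm: "Re (f y) * Re (f y) = (cmod (f y))\<^sup>2" for y
      by (subst (3) re[OF f(1)]) (simp add: power2_eq_square)
    have "S f f = (\<Sum>y\<in>Y. c y * (cmod (f y))\<^sup>2)" unfolding S_def cm ..
    then have "S f f = (\<Sum>y\<in>Y. c y * (cmod (\<Sum>j\<in>I. d j * e j y))\<^sup>2)" unfolding d[rule_format] .
    moreover have "(\<Sum>y\<in>Y. c y * (cmod (\<Sum>j\<in>I. d j * e j y))\<^sup>2) \<noteq> 0"
    proof
      assume "(\<Sum>y\<in>Y. c y * (cmod (\<Sum>j\<in>I. d j * e j y))\<^sup>2) = 0"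
      then have "\<forall>x. (\<Sum>j\<in>I. d j * e j x) = 0" using def by blast
      then show False using f(2) d by auto
    qed
    ultimately show ?thesis using nn[rule_format, of d] by linarith
  qed
  have "\<exists>B. finite B \<and> B \<subseteq> V \<and> (\<forall>f\<in>B. \<forall>g\<in>B. S f g = (if f = g then 1 else 0)) \<and>
    (\<forall>g\<in>set gs. \<forall>x. g x = (\<Sum>f\<in>B. of_real (S g f) * f x))"
  proof (rule finite_gram_schmidt[OF V0 Vadd _ _ Spos gs(1)])
    show "S (\<lambda>x. f x + of_real r * g x) h = S f h + r * S g h" for f g h r
      by (simp add: S_def algebra_simps sum.distrib sum_distrib_left)
    show "S f g = S g f" for f g by (simp add: S_def mult.commute)
  qed
  then obtain B where B: "finite B" "B \<subseteq> V"
    and on': "\<forall>f\<in>B. \<forall>g\<in>B. S f g = (if f = g then 1 else 0)"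
    and ex': "\<forall>g\<in>set gs. \<forall>x. g x = (\<Sum>f\<in>B. of_real (S g f) * f x)" by (elim exE conjE)
  have on: "S f g = (if f = g then 1 else 0)" if "f \<in> B" "g \<in> B" for f g using on' that by blast
  have ex: "g x = (\<Sum>f\<in>B. of_real (S g f) * f x)" if "g \<in> set gs" for g x using ex' that by blast
  \<comment> \<open>Real and imaginary parts of \<open>e i\<close> have real coordinates in B;
    together they give complex coordinates of \<open>e i\<close> itself.\<close>
  define \<gamma> where "\<gamma> i f = of_real (S (\<lambda>x. of_real (Re (e i x))) f) + \<i> * of_real (S (\<lambda>x. of_real (Im (e i x))) f)" for i f
  have e\<gamma>: "e i x = (\<Sum>f\<in>B. \<gamma> i f * f x)" if i: "i \<in> I" for i x
  proof -
    have "e i x = of_real (Re (e i x)) + \<i> * of_real (Im (e i x))" by (simp add: complex_eq_iff)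
    also have "\<dots> = (\<Sum>f\<in>B. of_real (S (\<lambda>x. of_real (Re (e i x))) f) * f x) +
        \<i> * (\<Sum>f\<in>B. of_real (S (\<lambda>x. of_real (Im (e i x))) f) * f x)"
      by (rule arg_cong2[where f = "\<lambda>a b. a + \<i> * b", OF ex[OF gs(2)[OF i]] ex[OF gs(3)[OF i]]])
    also have "\<dots> = (\<Sum>f\<in>B. \<gamma> i f * f x)"
      unfolding \<gamma>_def distrib_right sum.distrib sum_distrib_left by (simp only: mult.assoc)
    finally show ?thesis .
  qed
  have "\<forall>f\<in>B. \<exists>d. \<forall>x. f x = (\<Sum>j\<in>I. d j * e j x)" using B(2) by (auto simp: V_def)
  then obtain d where d: "\<And>f x. f \<in> B \<Longrightarrow> f x = (\<Sum>j\<in>I. d f j * e j x)" by metis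
  have BA: "B \<subseteq> \<A>"
  proof
    fix f assume "f \<in> B"
    then have "f = (\<lambda>x. \<Sum>j\<in>I. d f j * e j x)" using d by blast
    then show "f \<in> \<A>" using subalgebra_combination[of I e "d f"] F(2) by simp
  qed
  have Bc: "f \<in> cts" if "f \<in> B" for f using that BA continuous by blast
  have Breal: "cnj (f x) = f x" if "f \<in> B" for f x using that B(2) by (auto simp: V_def)
  define q where "q h f = (\<Sum>k\<in>I. \<gamma> k h *\<^sub>C (\<Sum>i\<in>I. d f i *\<^sub>C u k i))" for h f
  have \<alpha>d: "\<alpha> f x = (\<Sum>i\<in>I. d f i *\<^sub>C \<alpha> (e i) x)" if "f \<in> B" for f x
  proof -
    have "f = (\<lambda>x. \<Sum>j\<in>I. d f j * e j x)" using d[OF that] by blast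
    then show ?thesis using action_combination[of I e "d f" x] F(3) by simp
  qed
  have \<alpha>q: "\<alpha> f x = (\<Sum>h\<in>B. h x *\<^sub>C q h f)" if f: "f \<in> B" for f x
  proof -
    have "\<alpha> f x = (\<Sum>i\<in>I. \<Sum>k\<in>I. d f i *\<^sub>C e k x *\<^sub>C u k i)" by (simp add: \<alpha>d[OF f] F(6) scaleC_sum_right)
    also have "\<dots> = (\<Sum>k\<in>I. e k x *\<^sub>C (\<Sum>i\<in>I. d f i *\<^sub>C u k i))"
      by (subst sum.swap) (simp add: scaleC_sum_right scaleC_scaleC mult.commute)
    also have "\<dots> = (\<Sum>k\<in>I. \<Sum>h\<in>B. h x *\<^sub>C \<gamma> k h *\<^sub>C (\<Sum>i\<in>I. d f i *\<^sub>C u k i))"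
      by (intro sum.cong refl) (simp add: e\<gamma> scaleC_sum_left scaleC_scaleC mult.commute)
    also have "\<dots> = (\<Sum>h\<in>B. h x *\<^sub>C q h f)"
      by (subst sum.swap) (simp add: q_def scaleC_sum_right)
    finally show ?thesis .
  qed
  \<comment> \<open>By orthonormality the weights c_y h(y) extract the coefficient of h from any
    combination of B, also one with coefficients in the algebra.\<close>
  have slice: "(\<Sum>y\<in>Y. c y *\<^sub>R h y *\<^sub>C (\<Sum>h'\<in>B. h' y *\<^sub>C z h')) = z h" if h: "h \<in> B"
    for h and z :: "('m \<Rightarrow> complex) \<Rightarrow> 'q"
  proof -
    have cc: "of_real (c y) * h y * h' y = of_real (c y * (Re (h y) * Re (h' y)))" if "h' \<in> B" for h' y
    proof -
      have "h \<in> V" "h' \<in> V" using B(2) h that by blast+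
      from re[OF this(1), of y] re[OF this(2), of y] show ?thesis by (metis mult.assoc of_real_mult)
    qed
    have "(\<Sum>y\<in>Y. c y *\<^sub>R h y *\<^sub>C (\<Sum>h'\<in>B. h' y *\<^sub>C z h')) = (\<Sum>y\<in>Y. \<Sum>h'\<in>B. (of_real (c y) * h y * h' y) *\<^sub>C z h')"
      by (simp add: scaleC_of_real[symmetric] scaleC_sum_right scaleC_scaleC mult.assoc)
    also have "\<dots> = (\<Sum>h'\<in>B. of_real (S h h') *\<^sub>C z h')"
      by (subst sum.swap) (simp add: cc S_def scaleC_sum_left del: of_real_mult)
    also have "\<dots> = z h" using h B(1) by (simp add: on if_distrib[of of_real] if_distrib[of "\<lambda>x. x *\<^sub>C _"] cong: if_cong)
    finally show ?thesis .
  qed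
  \<comment> \<open>The extracted coefficient is a real combination of values of \<alpha> f, and
    these are selfadjoint because f is real.\<close>
  have qstar: "star (q h f) = q h f" if hf: "h \<in> B" "f \<in> B" for h f
  proof -
    have q: "q h f = (\<Sum>y\<in>Y. c y *\<^sub>R h y *\<^sub>C \<alpha> f y)"
      using slice[OF hf(1), of "\<lambda>h. q h f"] by (simp add: \<alpha>q[OF hf(2)])
    have "star (\<alpha> f y) = \<alpha> f y" for y
      using action_star[OF Bc[OF hf(2)], of y] unfolding Breal[OF hf(2)] by (rule sym)
    then show ?thesis unfolding q by (simp add: star_sum star_scaleR star_scaleC Breal[OF hf(1)])
  qed
  \<comment> \<open>Both sides are values of the functional on \<alpha>(f g): expanding \<alpha> f
    and \<alpha> g in B gives the left side, invariance on the products e_i e_j the right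
    side.\<close>
  have left: "(\<Sum>h\<in>B. q h f * q h g) = (if f = g then 1 else 0)" if fg: "f \<in> B" "g \<in> B" for f g
  proof -
    have "(\<Sum>y\<in>Y. c y *\<^sub>R (\<alpha> f y * \<alpha> g y)) = (\<Sum>y\<in>Y. \<Sum>h\<in>B. (c y *\<^sub>R h y *\<^sub>C (\<Sum>h'\<in>B. h' y *\<^sub>C (q h f * q h' g))))"
      by (simp add: \<alpha>q fg sum_product scaleC_of_real[symmetric] scaleC_sum_right mult_scaleC_left mult_scaleC_right scaleC_scaleC mult_ac)
    also have "\<dots> = (\<Sum>h\<in>B. q h f * q h g)" by (subst sum.swap) (simp add: slice)
    finally have 1: "(\<Sum>h\<in>B. q h f * q h g) = (\<Sum>y\<in>Y. c y *\<^sub>R (\<alpha> f y * \<alpha> g y))" by simp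
    have "(\<Sum>y\<in>Y. c y *\<^sub>R (\<alpha> f y * \<alpha> g y)) =
        (\<Sum>y\<in>Y. \<Sum>i\<in>I. \<Sum>j\<in>I. (d f i * d g j) *\<^sub>C c y *\<^sub>R \<alpha> (\<lambda>x. e i x * e j x) y)"
    proof (rule sum.cong[OF refl])
      fix y
      have "\<alpha> (e i) y * \<alpha> (e j) y = \<alpha> (\<lambda>x. e i x * e j x) y" if "i \<in> I" "j \<in> I" for i j
        using F(3) that by (intro action_mult[symmetric]) auto
      then show "c y *\<^sub>R (\<alpha> f y * \<alpha> g y) = (\<Sum>i\<in>I. \<Sum>j\<in>I. (d f i * d g j) *\<^sub>C c y *\<^sub>R \<alpha> (\<lambda>x. e i x * e j x) y)"
        by (simp add: \<alpha>d fg sum_product scaleC_of_real[symmetric] scaleC_sum_right mult_scaleC_left mult_scaleC_right scaleC_scaleC mult_ac)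
    qed
    also have "\<dots> = (\<Sum>i\<in>I. \<Sum>j\<in>I. (d f i * d g j) *\<^sub>C (\<Sum>y\<in>Y. c y *\<^sub>R \<alpha> (\<lambda>x. e i x * e j x) y))"
      unfolding scaleC_sum_right by (subst sum.swap, rule sum.cong, rule refl, rule sum.swap)
    also have "\<dots> = (\<Sum>i\<in>I. \<Sum>j\<in>I. (d f i * d g j) *\<^sub>C (\<Sum>y\<in>Y. of_real (c y) * (e i y * e j y)) *\<^sub>C 1)"
      using inv by (intro sum.cong) auto
    also have "\<dots> = (\<Sum>i\<in>I. \<Sum>j\<in>I. \<Sum>y\<in>Y. (d f i * d g j) * (of_real (c y) * (e i y * e j y))) *\<^sub>C 1"
      by (simp add: scaleC_sum_left scaleC_scaleC sum_distrib_left scaleC_sum_right)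
    also have "(\<Sum>i\<in>I. \<Sum>j\<in>I. \<Sum>y\<in>Y. (d f i * d g j) * (of_real (c y) * (e i y * e j y))) = of_real (S f g)"
    proof -
      have "(\<Sum>i\<in>I. \<Sum>j\<in>I. \<Sum>y\<in>Y. (d f i * d g j) * (of_real (c y) * (e i y * e j y))) =
          (\<Sum>y\<in>Y. \<Sum>i\<in>I. \<Sum>j\<in>I. (d f i * d g j) * (of_real (c y) * (e i y * e j y)))"
        by (subst (2) sum.swap, subst sum.swap, rule refl)
      also have "\<dots> = (\<Sum>y\<in>Y. of_real (c y) * (f y * g y))"
      proof (rule sum.cong[OF refl])
        fix y
        have "(\<Sum>i\<in>I. \<Sum>j\<in>I. (d f i * d g j) * (of_real (c y) * (e i y * e j y))) =
            of_real (c y) * ((\<Sum>i\<in>I. d f i * e i y) * (\<Sum>j\<in>I. d g j * e j y))"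
          unfolding sum_product unfolding sum_distrib_left by (intro sum.cong refl) (simp only: mult_ac)
        then show "(\<Sum>i\<in>I. \<Sum>j\<in>I. (d f i * d g j) * (of_real (c y) * (e i y * e j y))) =
            of_real (c y) * (f y * g y)" by (simp only: d[OF fg(1), of y] d[OF fg(2), of y])
      qed
      also have "\<dots> = (\<Sum>y\<in>Y. of_real (c y * (Re (f y) * Re (g y))))"
      proof (rule sum.cong[OF refl])
        fix y
        have "f \<in> V" "g \<in> V" using B(2) fg by blast+
        from re[OF this(1), of y] re[OF this(2), of y] show "of_real (c y) * (f y * g y) = of_real (c y * (Re (f y) * Re (g y)))" by (metis of_real_mult)
      qed
      finally show ?thesis by (simp add: S_def)
    qed
    finally show ?thesis unfolding 1 using on[OF fg] by simp
  qed
  \<comment> \<open>The previous relation provides only a left inverse of q. A right inverse is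
    assembled from the adjoint of u, and a left and a right inverse coincide.\<close>
  define s where "s g f = (\<Sum>k\<in>I. d f k *\<^sub>C (\<Sum>j\<in>I. \<gamma> j g *\<^sub>C star (u k j)))" for g f
  have right: "(\<Sum>g\<in>B. q h g * s g f) = (if h = f then 1 else 0)" if hf: "h \<in> B" "f \<in> B" for h f
  proof -
    have \<alpha>e: "\<alpha> (e j) x = (\<Sum>g\<in>B. \<gamma> j g *\<^sub>C \<alpha> g x)" if j: "j \<in> I" for j x
    proof -
      have "e j = (\<lambda>x. \<Sum>g\<in>B. \<gamma> j g * g x)" using e\<gamma>[OF j] by blast
      then show ?thesis using action_combination[of B "\<lambda>g. g" "\<gamma> j" x] Bc by simp
    qed
    have ek: "(\<Sum>j\<in>I. \<alpha> (e j) x * star (u k j)) = e k x *\<^sub>C 1" if k: "k \<in> I" for k x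
    proof -
      have "(\<Sum>j\<in>I. \<alpha> (e j) x * star (u k j)) = (\<Sum>i\<in>I. e i x *\<^sub>C (\<Sum>j\<in>I. u i j * star (u k j)))"
        unfolding scaleC_sum_right by (subst sum.swap) (simp add: F(6) sum_distrib_right mult_scaleC_left)
      then show ?thesis using F(1) k by (simp add: F(5) if_distrib[of "\<lambda>x. _ *\<^sub>C x"] cong: if_cong)
    qed
    have fx: "f x *\<^sub>C 1 = (\<Sum>h\<in>B. h x *\<^sub>C (\<Sum>g\<in>B. q h g * s g f))" for x
    proof -
      have "f x *\<^sub>C 1 = (\<Sum>k\<in>I. d f k *\<^sub>C (\<Sum>j\<in>I. \<alpha> (e j) x * star (u k j)))"
        by (subst d[OF hf(2)]) (simp add: scaleC_sum_left ek scaleC_scaleC)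
      also have "\<dots> = (\<Sum>k\<in>I. \<Sum>j\<in>I. \<Sum>g\<in>B. \<alpha> g x * (d f k *\<^sub>C \<gamma> j g *\<^sub>C star (u k j)))"
        by (simp add: \<alpha>e sum_distrib_right scaleC_sum_right mult_scaleC_left mult_scaleC_right)
      also have "\<dots> = (\<Sum>g\<in>B. \<Sum>k\<in>I. \<Sum>j\<in>I. \<alpha> g x * (d f k *\<^sub>C \<gamma> j g *\<^sub>C star (u k j)))"
        by (subst (2) sum.swap, subst sum.swap, rule refl)
      also have "\<dots> = (\<Sum>g\<in>B. \<alpha> g x * s g f)" by (simp add: s_def scaleC_sum_right sum_distrib_left)
      also have "\<dots> = (\<Sum>g\<in>B. \<Sum>h\<in>B. h x *\<^sub>C (q h g * s g f))"
        by (simp add: \<alpha>q sum_distrib_right mult_scaleC_left)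
      also have "\<dots> = (\<Sum>h\<in>B. h x *\<^sub>C (\<Sum>g\<in>B. q h g * s g f))" by (subst sum.swap) (simp add: scaleC_sum_right)
      finally show ?thesis .
    qed
    have "f x *\<^sub>C (1 :: 'q) = (\<Sum>h\<in>B. h x *\<^sub>C (if h = f then 1 else 0))" for x
      using hf B(1) by (simp add: if_distrib[of "\<lambda>z. _ *\<^sub>C z"] cong: if_cong)
    then have "(\<Sum>y\<in>Y. c y *\<^sub>R h y *\<^sub>C (\<Sum>h\<in>B. h y *\<^sub>C (\<Sum>g\<in>B. q h g * s g f))) =
        (\<Sum>y\<in>Y. c y *\<^sub>R h y *\<^sub>C (\<Sum>h\<in>B. h y *\<^sub>C (if h = f then 1 else 0)))" by (simp only: fx[symmetric])
    then show ?thesis unfolding slice[OF hf(1)] .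
  qed
  have s_eq: "s g f = q f g" if gf: "g \<in> B" "f \<in> B" for g f
  proof -
    have "s g f = (\<Sum>g'\<in>B. (\<Sum>h\<in>B. q h g * q h g') * s g' f)"
      using B(1) gf by (simp add: left if_distrib[of "\<lambda>x. x * _"] cong: if_cong)
    also have "\<dots> = (\<Sum>h\<in>B. q h g * (\<Sum>g'\<in>B. q h g' * s g' f))"
      unfolding sum_distrib_left sum_distrib_right by (subst sum.swap) (simp add: mult.assoc)
    also have "\<dots> = q f g"
      using B(1) gf by (simp add: right if_distrib[of "\<lambda>x. _ * x"] cong: if_cong)
    finally show ?thesis .
  qed
  have right': "(\<Sum>h\<in>B. q f h * q g h) = (if f = g then 1 else 0)" if "f \<in> B" "g \<in> B" for f g
    using right[OF that] that by (simp add: s_eq)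
  have ent: "\<exists>c. \<forall>x. g x = (\<Sum>f\<in>B. c f * f x)" if "g \<in> entries Gs" for g
    using that Ls(2) e\<gamma> unfolding eI[symmetric] by blast
  show ?thesis
    by (rule exI[of _ B], rule exI[of _ q], intro conjI ballI allI)
      (use B(1) BA Breal \<alpha>q qstar left right' ent in \<open>auto\<close>)
qed

end

section \<open>Smooth functions on open sets\<close>

lemma frechet_derivative_cong_open:
  assumes "open S" "y \<in> S" "\<And>z. z \<in> S \<Longrightarrow> f z = g z"
  shows "frechet_derivative f (at y) = frechet_derivative g (at y)"
proof -
  have "(f has_derivative D) (at y) \<longleftrightarrow> (g has_derivative D) (at y)" for D
    using has_derivative_transform_within_open[of f D y UNIV S g]
      has_derivative_transform_within_open[of g D y UNIV S f] assms by auto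
  then show ?thesis by (simp add: frechet_derivative_def)
qed

lemma dir_deriv_cong_open:
  assumes S: "open S" "\<And>z. z \<in> S \<Longrightarrow> f z = g z"
  shows "y \<in> S \<Longrightarrow> dir_deriv vs f y = dir_deriv vs g y"
proof (induction vs arbitrary: y)
  case (Cons v vs)
  then show ?case using frechet_derivative_cong_open[OF S(1) Cons(2), of "dir_deriv vs f" "dir_deriv vs g"] by simp
qed (use S in simp)

lemma dir_deriv_append: "dir_deriv (vs @ ws) f = dir_deriv vs (dir_deriv ws f)"
  by (induction vs) auto

text \<open>Smoothness quantifies over lists of all lengths at once; bounding the length makes
  induction possible, since the product and chain rules at one order use all factors at the order
  below.\<close>

definition differentiable_upto ::
  "nat \<Rightarrow> 'e::real_normed_vector set \<Rightarrow> ('e \<Rightarrow> 'b::real_normed_vector) \<Rightarrow> bool" where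
  "differentiable_upto n S f \<longleftrightarrow> (\<forall>vs. length vs < n \<longrightarrow> (\<forall>y\<in>S. dir_deriv vs f differentiable (at y)))"

lemma smooth_on_iff_differentiable_upto: "smooth_on S f \<longleftrightarrow> (\<forall>n. differentiable_upto n S f)"
  unfolding smooth_on_def differentiable_upto_def by blast

lemma differentiable_upto_0 [simp]: "differentiable_upto 0 S f"
  by (simp add: differentiable_upto_def)

text \<open>The last entry of the list is the innermost derivative, so peeling it off reduces the
  order by passing from f to a derivative of f.\<close>

lemma differentiable_upto_Suc:
  "differentiable_upto (Suc n) S f \<longleftrightarrow> (\<forall>y\<in>S. f differentiable (at y)) \<and>
     (\<forall>v. differentiable_upto n S (\<lambda>y. frechet_derivative f (at y) v))" (is "_ \<longleftrightarrow> ?R")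
proof
  assume L: "differentiable_upto (Suc n) S f"
  have "dir_deriv [] f differentiable (at y)" if "y \<in> S" for y
    using L[unfolded differentiable_upto_def, rule_format, of "[]" y] that by simp
  moreover have "dir_deriv vs (dir_deriv [v] f) differentiable (at y)" if "length vs < n" "y \<in> S" for vs v y
    using L that unfolding differentiable_upto_def dir_deriv_append[symmetric] by simp
  ultimately show ?R by (simp add: differentiable_upto_def)
next
  assume R: ?R
  have "dir_deriv vs f differentiable (at y)" if "length vs < Suc n" "y \<in> S" for vs y
  proof (cases vs rule: rev_cases)
    case (snoc ws v)
    then show ?thesis using R that by (simp add: differentiable_upto_def dir_deriv_append)
  qed (use R that in simp)
  then show "differentiable_upto (Suc n) S f" by (simp add: differentiable_upto_def)
qed

lemma differentiable_upto_cong: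
  assumes S: "open S" "\<And>z. z \<in> S \<Longrightarrow> f z = g z" and f: "differentiable_upto n S f"
  shows "differentiable_upto n S g"
proof -
  have "dir_deriv vs g differentiable (at y)" if "length vs < n" "y \<in> S" for vs y
  proof -
    obtain D where "(dir_deriv vs f has_derivative D) (at y)"
      using f \<open>length vs < n\<close> \<open>y \<in> S\<close> by (auto simp: differentiable_upto_def differentiable_def)
    then have "(dir_deriv vs g has_derivative D) (at y)"
      using has_derivative_transform_within_open[of "dir_deriv vs f" D y UNIV S "dir_deriv vs g"]
        dir_deriv_cong_open[of S f g] S \<open>y \<in> S\<close> by simp
    then show ?thesis by (auto simp: differentiable_def)
  qed
  then show ?thesis by (simp add: differentiable_upto_def)
qed

lemma differentiable_upto_SucI:
  assumes "open S" "\<And>y. y \<in> S \<Longrightarrow> (f has_derivative D y) (at y)"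
    "\<And>v. differentiable_upto n S (\<lambda>y. D y v)"
  shows "differentiable_upto (Suc n) S f"
  unfolding differentiable_upto_Suc
proof (intro conjI ballI allI)
  show "f differentiable at y" if "y \<in> S" for y using assms(2) that by (auto simp: differentiable_def)
  fix v
  show "differentiable_upto n S (\<lambda>y. frechet_derivative f (at y) v)"
    by (rule differentiable_upto_cong[OF assms(1) _ assms(3)[of v]])
      (use frechet_derivative_at[OF assms(2)] in metis)
qed

lemma differentiable_upto_SucD:
  assumes "differentiable_upto (Suc n) S f"
  shows "\<And>y. y \<in> S \<Longrightarrow> (f has_derivative frechet_derivative f (at y)) (at y)"
    "\<And>v. differentiable_upto n S (\<lambda>y. frechet_derivative f (at y) v)" "differentiable_upto n S f"
proof -
  show "\<And>y. y \<in> S \<Longrightarrow> (f has_derivative frechet_derivative f (at y)) (at y)"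
    "\<And>v. differentiable_upto n S (\<lambda>y. frechet_derivative f (at y) v)"
    using assms by (simp_all add: differentiable_upto_Suc frechet_derivative_works[symmetric])
  show "differentiable_upto n S f" using assms by (simp add: differentiable_upto_def)
qed

lemma differentiable_upto_const: "differentiable_upto n S (\<lambda>y. a)"
proof (induction n arbitrary: a)
  case (Suc n)
  then show ?case by (simp add: differentiable_upto_Suc)
qed simp

lemma differentiable_upto_add:
  assumes S: "open S"
  shows "differentiable_upto n S f \<Longrightarrow> differentiable_upto n S g \<Longrightarrow> differentiable_upto n S (\<lambda>y. f y + g y)"
proof (induction n arbitrary: f g)
  case (Suc n)
  note f = differentiable_upto_SucD[OF Suc(2)] and g = differentiable_upto_SucD[OF Suc(3)]
  show ?case
    by (rule differentiable_upto_SucI[OF S has_derivative_add[OF f(1) g(1)] Suc(1)[OF f(2) g(2)]])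
qed simp

lemma differentiable_upto_linear:
  assumes S: "open S" and T: "bounded_linear T"
  shows "differentiable_upto n S f \<Longrightarrow> differentiable_upto n S (\<lambda>y. T (f y))"
proof (induction n arbitrary: f)
  case (Suc n)
  note f = differentiable_upto_SucD[OF Suc(2)]
  show ?case
    by (rule differentiable_upto_SucI[OF S bounded_linear.has_derivative[OF T f(1)] Suc(1)[OF f(2)]])
qed simp

lemma differentiable_upto_bilinear:
  assumes S: "open S" and T: "bounded_bilinear T"
  shows "differentiable_upto n S f \<Longrightarrow> differentiable_upto n S g \<Longrightarrow> differentiable_upto n S (\<lambda>y. T (f y) (g y))"
proof (induction n arbitrary: f g)
  case (Suc n)
  note f = differentiable_upto_SucD[OF Suc(2)] and g = differentiable_upto_SucD[OF Suc(3)]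
  show ?case
    by (rule differentiable_upto_SucI[OF S bounded_bilinear.FDERIV[OF T f(1) g(1)]
          differentiable_upto_add[OF S Suc(1)[OF f(3) g(2)] Suc(1)[OF f(2) g(3)]]])
qed simp

lemma differentiable_upto_sum:
  assumes S: "open S" and f: "\<And>i. i \<in> I \<Longrightarrow> differentiable_upto n S (f i)"
  shows "differentiable_upto n S (\<lambda>y. \<Sum>i\<in>I. f i y)"
  using f
proof (induction I rule: infinite_finite_induct)
  case (insert i I)
  then show ?case using differentiable_upto_add[OF S, of n "f i" "\<lambda>y. \<Sum>i\<in>I. f i y"] by simp
qed (simp_all add: differentiable_upto_const)

text \<open>The chain rule evaluates the derivative of f at a vector that itself moves. Expanding
  this vector in the basis of the intermediate space separates both dependencies into products to
  which the induction hypothesis applies.\<close>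

lemma differentiable_upto_compose:
  fixes f :: "'d::euclidean_space \<Rightarrow> 'b::real_normed_vector" and g :: "'e::real_normed_vector \<Rightarrow> 'd"
  assumes S: "open S" and gS: "g ` S \<subseteq> U"
  shows "differentiable_upto n U f \<Longrightarrow> differentiable_upto n S g \<Longrightarrow> differentiable_upto n S (\<lambda>y. f (g y))"
proof (induction n arbitrary: f)
  case (Suc n)
  note f = differentiable_upto_SucD[OF Suc(2)] and g = differentiable_upto_SucD[OF Suc(3)]
  have gU: "g y \<in> U" if "y \<in> S" for y using gS that by auto
  let ?D = "\<lambda>y v. \<Sum>b\<in>Basis. (frechet_derivative g (at y) v \<bullet> b) *\<^sub>R frechet_derivative f (at (g y)) b"
  show ?case
  proof (rule differentiable_upto_SucI[OF S, of _ ?D])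
    fix y assume y: "y \<in> S"
    have "linear (frechet_derivative f (at (g y)))" using f(1)[OF gU[OF y]] by (rule has_derivative_linear)
    then have f_lin: "frechet_derivative f (at (g y)) v = (\<Sum>b\<in>Basis. (v \<bullet> b) *\<^sub>R frechet_derivative f (at (g y)) b)" for v
      using arg_cong[OF euclidean_representation[of v], of "frechet_derivative f (at (g y))"]
      by (simp add: linear_sum linear_scale)
    show "((\<lambda>y. f (g y)) has_derivative ?D y) (at y)" unfolding f_lin[symmetric]
      using has_derivative_compose[OF g(1)[OF y] f(1)[OF gU[OF y]]] .
  next
    fix v
    show "differentiable_upto n S (\<lambda>y. ?D y v)"
      by (intro differentiable_upto_sum[OF S] differentiable_upto_bilinear[OF S bounded_bilinear_scaleR]
          differentiable_upto_linear[OF S bounded_linear_inner_left] g Suc.IH f)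
  qed
qed simp

lemma differentiable_upto_inverse:
  fixes f :: "'e::real_normed_vector \<Rightarrow> real"
  assumes S: "open S" and nz: "\<And>y. y \<in> S \<Longrightarrow> f y \<noteq> 0"
  shows "differentiable_upto n S f \<Longrightarrow> differentiable_upto n S (\<lambda>y. inverse (f y))"
proof (induction n)
  case (Suc n)
  note f = differentiable_upto_SucD[OF Suc(2)]
  note mult = differentiable_upto_bilinear[OF S bounded_bilinear_mult]
  have D: "((\<lambda>y. inverse (f y)) has_derivative (\<lambda>v. - (inverse (f y) * frechet_derivative f (at y) v * inverse (f y)))) (at y)"
    if "y \<in> S" for y using nz f(1) that by (auto intro: has_derivative_inverse)
  show ?case
    by (rule differentiable_upto_SucI[OF S D], assumption)
      (intro differentiable_upto_linear[OF S bounded_linear_minus[OF bounded_linear_ident]] mult Suc.IH f)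
qed simp

section \<open>Rules for smooth maps\<close>

lemma smooth_on_differentiable: "smooth_on S f \<Longrightarrow> y \<in> S \<Longrightarrow> f differentiable (at y)"
  unfolding smooth_on_def by (metis dir_deriv.simps(1))

lemma smooth_on_continuous:
  assumes "smooth_on S f" shows "continuous_on S f"
  using smooth_on_differentiable[OF assms]
  by (meson continuous_at_imp_continuous_on differentiable_imp_continuous_within)

lemma smooth_on_dir_deriv: "smooth_on S f \<Longrightarrow> smooth_on S (dir_deriv ws f)"
  unfolding smooth_on_def dir_deriv_append[symmetric] by blast

lemma smooth_on_frechet: "smooth_on S f \<Longrightarrow> smooth_on S (\<lambda>y. frechet_derivative f (at y) v)"
  using smooth_on_dir_deriv[of S f "[v]"] by simp

lemma smooth_on_subset: "smooth_on S f \<Longrightarrow> T \<subseteq> S \<Longrightarrow> smooth_on T f"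
  unfolding smooth_on_def by blast

lemma smooth_on_cong: "open S \<Longrightarrow> (\<And>z. z \<in> S \<Longrightarrow> f z = g z) \<Longrightarrow> smooth_on S f \<Longrightarrow> smooth_on S g"
  using differentiable_upto_cong unfolding smooth_on_iff_differentiable_upto by blast

lemma smooth_on_locally:
  assumes "\<And>y. y \<in> S \<Longrightarrow> \<exists>T. open T \<and> y \<in> T \<and> smooth_on T f"
  shows "smooth_on S f"
  using assms unfolding smooth_on_def by blast

lemma smooth_on_const: "smooth_on S (\<lambda>y. a)"
  by (simp add: smooth_on_iff_differentiable_upto differentiable_upto_const)

lemma smooth_on_add: "open S \<Longrightarrow> smooth_on S f \<Longrightarrow> smooth_on S g \<Longrightarrow> smooth_on S (\<lambda>y. f y + g y)"
  by (simp add: smooth_on_iff_differentiable_upto differentiable_upto_add)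

lemma smooth_on_linear: "open S \<Longrightarrow> bounded_linear T \<Longrightarrow> smooth_on S f \<Longrightarrow> smooth_on S (\<lambda>y. T (f y))"
  by (simp add: smooth_on_iff_differentiable_upto differentiable_upto_linear)

lemma smooth_on_diff: "open S \<Longrightarrow> smooth_on S f \<Longrightarrow> smooth_on S g \<Longrightarrow> smooth_on S (\<lambda>y. f y - g y)"
  using smooth_on_add[of S f "\<lambda>y. - g y"]
    smooth_on_linear[OF _ bounded_linear_minus[OF bounded_linear_ident], of S g] by simp

lemma smooth_on_bilinear:
  "open S \<Longrightarrow> bounded_bilinear T \<Longrightarrow> smooth_on S f \<Longrightarrow> smooth_on S g \<Longrightarrow> smooth_on S (\<lambda>y. T (f y) (g y))"
  by (simp add: smooth_on_iff_differentiable_upto differentiable_upto_bilinear)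

lemmas smooth_on_mult = smooth_on_bilinear[OF _ bounded_bilinear_mult]
  and smooth_on_scaleR = smooth_on_bilinear[OF _ bounded_bilinear_scaleR]

lemma smooth_on_sum:
  "open S \<Longrightarrow> (\<And>i. i \<in> I \<Longrightarrow> smooth_on S (f i)) \<Longrightarrow> smooth_on S (\<lambda>y. \<Sum>i\<in>I. f i y)"
  by (simp add: smooth_on_iff_differentiable_upto differentiable_upto_sum)

lemma smooth_on_compose:
  fixes f :: "'d::euclidean_space \<Rightarrow> 'b::real_normed_vector"
  shows "open S \<Longrightarrow> g ` S \<subseteq> U \<Longrightarrow> smooth_on U f \<Longrightarrow> smooth_on S g \<Longrightarrow> smooth_on S (\<lambda>y. f (g y))"
  by (simp add: smooth_on_iff_differentiable_upto differentiable_upto_compose[of S g U])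

lemma smooth_on_inverse:
  fixes f :: "'e::real_normed_vector \<Rightarrow> real"
  shows "open S \<Longrightarrow> (\<And>y. y \<in> S \<Longrightarrow> f y \<noteq> 0) \<Longrightarrow> smooth_on S f \<Longrightarrow> smooth_on S (\<lambda>y. inverse (f y))"
  by (simp add: smooth_on_iff_differentiable_upto differentiable_upto_inverse)

lemma smooth_on_ident: "smooth_on S (\<lambda>y. y)"
proof -
  have "differentiable_upto n S (\<lambda>y. y)" for n
    by (cases n) (simp_all add: differentiable_upto_Suc differentiable_upto_const)
  then show ?thesis by (simp add: smooth_on_iff_differentiable_upto)
qed

lemma dir_deriv_add:
  assumes S: "open S"
  shows "smooth_on S f \<Longrightarrow> smooth_on S g \<Longrightarrow> y \<in> S \<Longrightarrow>
    dir_deriv vs (\<lambda>y. f y + g y) y = dir_deriv vs f y + dir_deriv vs g y"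
proof (induction vs arbitrary: y)
  case (Cons v vs)
  have "(dir_deriv vs f has_derivative frechet_derivative (dir_deriv vs f) (at y)) (at y)"
    "(dir_deriv vs g has_derivative frechet_derivative (dir_deriv vs g) (at y)) (at y)"
    using Cons by (simp_all add: smooth_on_def frechet_derivative_works[symmetric])
  from frechet_derivative_at[OF has_derivative_add[OF this], THEN fun_cong, of v, symmetric]
  have "frechet_derivative (\<lambda>y. dir_deriv vs f y + dir_deriv vs g y) (at y) v =
      frechet_derivative (dir_deriv vs f) (at y) v + frechet_derivative (dir_deriv vs g) (at y) v"
  .
  moreover have "frechet_derivative (dir_deriv vs (\<lambda>y. f y + g y)) (at y) =
      frechet_derivative (\<lambda>y. dir_deriv vs f y + dir_deriv vs g y) (at y)"
    by (rule frechet_derivative_cong_open[OF S Cons.prems(3)]) (rule Cons.IH[OF Cons.prems(1,2)])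
  ultimately show ?case by simp
qed simp

section \<open>A smooth function that is flat at 0\<close>

definition exp_quotient :: "nat \<Rightarrow> real \<Rightarrow> real" where
  "exp_quotient k t = (if t \<le> 0 then 0 else exp (- inverse t) * inverse t ^ k)"

lemma power_over_fact_le_exp:
  fixes x :: real assumes "x \<ge> 0" shows "x ^ n / fact n \<le> exp x"
proof -
  have "(\<Sum>k\<in>{n}. inverse (fact k) *\<^sub>R x ^ k) \<le> (\<Sum>k. inverse (fact k) *\<^sub>R x ^ k)"
    by (rule sum_le_suminf) (use assms summable_exp_generic[of x] in auto)
  then show ?thesis by (simp add: exp_def divide_inverse mult.commute)
qed

text \<open>With x = 1 / t a single term of the exponential series gives x ^ (k + 2) \<le> (k + 2)!
  exp x. The two additional powers make the function quadratically small at 0, enough for a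
  vanishing derivative there.\<close>

lemma exp_quotient_bound: "\<bar>exp_quotient k t\<bar> \<le> fact (k + 2) * t\<^sup>2"
proof (cases "t \<le> 0")
  case False
  define x where "x = inverse t"
  have x: "x > 0" using False by (simp add: x_def)
  have "x ^ (k + 2) / fact (k + 2) \<le> exp x" using power_over_fact_le_exp[of x "k + 2"] x by simp
  then have "exp (- x) * x ^ (k + 2) \<le> fact (k + 2)"
    by (subst (asm) pos_divide_le_eq) (simp_all add: exp_minus divide_simps mult.commute del: fact_Suc power_Suc add_2_eq_Suc')
  then have "exp (- x) * x ^ (k + 2) * t\<^sup>2 \<le> fact (k + 2) * t\<^sup>2" by (rule mult_right_mono) simp
  moreover have "exp (- x) * x ^ (k + 2) * t\<^sup>2 = exp (- x) * x ^ k * (x * t)\<^sup>2"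
    unfolding power_add power_mult_distrib by (simp only: mult.assoc)
  moreover have "x * t = 1" using False by (simp add: x_def)
  ultimately have "exp (- x) * x ^ k \<le> fact (k + 2) * t\<^sup>2" by (simp only: one_power2 mult_1_right)
  then show ?thesis using False x by (simp add: exp_quotient_def x_def[symmetric])
qed (simp add: exp_quotient_def)

text \<open>The powers of 1 / t are carried along so that the family is closed under
  differentiation; smoothness of all members then follows by one induction on the order.\<close>

lemma exp_quotient_derivative:
  "(exp_quotient k has_real_derivative exp_quotient (k + 2) t - k * exp_quotient (k + 1) t) (at t)"
proof -
  consider "t < 0" | "t = 0" | "t > 0" by linarith
  then show ?thesis
  proof cases
    case 1
    have "((\<lambda>t. 0) has_real_derivative 0) (at t)" by simp
    then have "(exp_quotient k has_real_derivative 0) (at t)"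
      by (rule DERIV_cong_ev[THEN iffD1, rotated 3])
        (use 1 eventually_nhds_in_open[of "{..<0}" t] in \<open>auto elim!: eventually_mono simp: exp_quotient_def\<close>)
    then show ?thesis using 1 by (simp add: exp_quotient_def)
  next
    case 2
    have "((\<lambda>h. exp_quotient k h / h) \<longlongrightarrow> 0) (at 0)"
    proof (rule Lim_null_comparison)
      show "\<forall>\<^sub>F h in at 0. norm (exp_quotient k h / h) \<le> fact (k + 2) * \<bar>h\<bar>"
      proof (rule always_eventually, rule allI)
        fix h :: real
        have "\<bar>exp_quotient k h\<bar> \<le> fact (k + 2) * \<bar>h\<bar> * \<bar>h\<bar>"
          using exp_quotient_bound[of k h] by (simp add: power2_eq_square mult.assoc)
        then show "norm (exp_quotient k h / h) \<le> fact (k + 2) * \<bar>h\<bar>"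
          by (cases "h = 0") (simp_all add: divide_le_eq)
      qed
      show "((\<lambda>h. fact (k + 2) * \<bar>h\<bar>) \<longlongrightarrow> 0) (at (0::real))"
        by (rule tendsto_eq_intros refl | simp)+
    qed
    then show ?thesis using 2 by (simp add: DERIV_def exp_quotient_def)
  next
    case 3
    have "((\<lambda>t. exp (- inverse t) * inverse t ^ k) has_real_derivative
        exp_quotient (k + 2) t - k * exp_quotient (k + 1) t) (at t)"
      using 3 power_eq_if[of "inverse t" "k - 1"]
      by (cases k) (auto intro!: derivative_eq_intros simp: exp_quotient_def power2_eq_square algebra_simps split: if_splits)
    then show ?thesis
      by (rule DERIV_cong_ev[THEN iffD1, rotated 3])
        (use 3 eventually_nhds_in_open[of "{0<..}" t] in \<open>auto elim!: eventually_mono simp: exp_quotient_def\<close>)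
  qed
qed

lemma smooth_exp_quotient: "smooth_on UNIV (exp_quotient k)"
proof -
  have "differentiable_upto n UNIV (exp_quotient k)" for n
  proof (induction n arbitrary: k)
    case (Suc n)
    show ?case
    proof (rule differentiable_upto_SucI)
      show "(exp_quotient k has_derivative (*) (exp_quotient (k + 2) t - k * exp_quotient (k + 1) t)) (at t)" for t
        using exp_quotient_derivative by (simp add: has_field_derivative_def)
      have "differentiable_upto n UNIV (\<lambda>t. v *\<^sub>R exp_quotient (k + 2) t + (- v * k) *\<^sub>R exp_quotient (k + 1) t)" for v
        by (intro differentiable_upto_add differentiable_upto_linear[OF open_UNIV bounded_linear_scaleR_right]
            open_UNIV Suc.IH)
      then show "differentiable_upto n UNIV (\<lambda>t. (exp_quotient (k + 2) t - k * exp_quotient (k + 1) t) * v)" for v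
        by (simp add: algebra_simps)
    qed simp
  qed simp
  then show ?thesis by (simp add: smooth_on_iff_differentiable_upto)
qed

lemma smooth_on_norm_square:
  fixes a :: "'e::euclidean_space"
  shows "smooth_on UNIV (\<lambda>y. r - (norm (y - a))\<^sup>2)"
  unfolding power2_norm_eq_inner
  by (intro smooth_on_diff smooth_on_const open_UNIV smooth_on_bilinear[OF _ bounded_bilinear_inner] smooth_on_ident)

section \<open>Positive definite forms that vary smoothly\<close>

definition inner_form :: "('e::real_vector \<Rightarrow> 'e \<Rightarrow> real) \<Rightarrow> bool" where
  "inner_form h \<longleftrightarrow> bilinear h \<and> (\<forall>v w. h v w = h w v) \<and> (\<forall>v. v \<noteq> 0 \<longrightarrow> h v v > 0)"

lemma inner_formD:
  assumes "inner_form h"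
  shows "linear (h v)" "linear (\<lambda>v. h v w)" "h v w = h w v" "h v v = 0 \<longleftrightarrow> v = 0" "v \<noteq> 0 \<Longrightarrow> h v v > 0"
proof -
  show "linear (h v)" "linear (\<lambda>v. h v w)" "h v w = h w v" "v \<noteq> 0 \<Longrightarrow> h v v > 0"
    using assms by (auto simp: inner_form_def bilinear_def)
  show "h v v = 0 \<longleftrightarrow> v = 0"
    using assms by (cases "v = 0") (auto simp: inner_form_def bilinear_lzero order_less_imp_not_eq2)
qed

lemma smooth_on_bilinear_form:
  fixes f g :: "'e::euclidean_space \<Rightarrow> 'd::euclidean_space" and h :: "'e \<Rightarrow> 'd \<Rightarrow> 'd \<Rightarrow> real"
  assumes S: "open S" and h: "\<And>y. y \<in> S \<Longrightarrow> bilinear (h y)" and sm: "\<And>v w. smooth_on S (\<lambda>y. h y v w)"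
    and f: "smooth_on S f" and g: "smooth_on S g"
  shows "smooth_on S (\<lambda>y. h y (f y) (g y))"
proof (rule smooth_on_cong[OF S])
  show "smooth_on S (\<lambda>y. \<Sum>a\<in>Basis. \<Sum>b\<in>Basis. (f y \<bullet> a) * ((g y \<bullet> b) * h y a b))"
    by (intro smooth_on_sum S smooth_on_mult smooth_on_linear[OF _ bounded_linear_inner_left] f g sm)
  fix y assume "y \<in> S"
  then have l: "linear (\<lambda>v. h y v w)" "linear (h y v)" for v w using h by (auto simp: bilinear_def)
  have "h y (f y) (g y) = (\<Sum>a\<in>Basis. (f y \<bullet> a) * h y a (g y))"
    using arg_cong[OF euclidean_representation[of "f y"], of "\<lambda>v. h y v (g y)"]
    by (simp add: linear_sum[OF l(1)] linear_scale[OF l(1)])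
  also have "\<dots> = (\<Sum>a\<in>Basis. \<Sum>b\<in>Basis. (f y \<bullet> a) * ((g y \<bullet> b) * h y a b))"
  proof (rule sum.cong[OF refl])
    fix a
    have "h y a (g y) = (\<Sum>b\<in>Basis. (g y \<bullet> b) * h y a b)"
      using arg_cong[OF euclidean_representation[of "g y"], of "h y a"]
      by (simp add: linear_sum[OF l(2)] linear_scale[OF l(2)])
    then show "(f y \<bullet> a) * h y a (g y) = (\<Sum>b\<in>Basis. (f y \<bullet> a) * ((g y \<bullet> b) * h y a b))"
      by (simp only: sum_distrib_left)
  qed
  finally show "(\<Sum>a\<in>Basis. \<Sum>b\<in>Basis. (f y \<bullet> a) * ((g y \<bullet> b) * h y a b)) = h y (f y) (g y)" by (rule sym)
qed

text \<open>Gram--Schmidt without normalisation involves only sums, products and inverses of nonvanishing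
  functions, so it preserves smoothness.\<close>

lemma smooth_orthogonal_frame:
  fixes h :: "'e::euclidean_space \<Rightarrow> 'd::euclidean_space \<Rightarrow> 'd \<Rightarrow> real"
  assumes S: "open S" and h: "\<And>y. y \<in> S \<Longrightarrow> inner_form (h y)" and sm: "\<And>v w. smooth_on S (\<lambda>y. h y v w)"
    and D: "finite D" "D \<subseteq> Basis"
  shows "\<exists>u. \<forall>i\<in>D. smooth_on S (u i) \<and> (\<forall>y\<in>S. u i y \<in> span D \<and> u i y \<noteq> 0 \<and>
    (\<forall>j\<in>D. j \<noteq> i \<longrightarrow> h y (u i y) (u j y) = 0) \<and> i \<in> span ((\<lambda>i. u i y) ` D))"
  using D
proof (induction D rule: finite_induct)
  case (insert b D)
  then obtain u where u: "\<And>i. i \<in> D \<Longrightarrow> smooth_on S (u i)"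
    "\<And>i y. i \<in> D \<Longrightarrow> y \<in> S \<Longrightarrow> u i y \<in> span D" "\<And>i y. i \<in> D \<Longrightarrow> y \<in> S \<Longrightarrow> u i y \<noteq> 0"
    "\<And>i j y. i \<in> D \<Longrightarrow> j \<in> D \<Longrightarrow> y \<in> S \<Longrightarrow> j \<noteq> i \<Longrightarrow> h y (u i y) (u j y) = 0"
    "\<And>i y. i \<in> D \<Longrightarrow> y \<in> S \<Longrightarrow> i \<in> span ((\<lambda>i. u i y) ` D)" by auto
  define p where "p y = (\<Sum>i\<in>D. (h y b (u i y) * inverse (h y (u i y) (u i y))) *\<^sub>R u i y)" for y
  define w where "w = u(b := \<lambda>y. b - p y)"
  have wb: "w b = (\<lambda>y. b - p y)" and wD: "\<And>i. i \<in> D \<Longrightarrow> w i = u i" using insert by (auto simp: w_def)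
  have hb: "bilinear (h y)" if "y \<in> S" for y using h[OF that] by (simp add: inner_form_def)
  have pspan: "p y \<in> span D" if "y \<in> S" for y
    using u(2) that by (auto simp: p_def intro!: span_sum span_scale)
  \<comment> \<open>A new basis vector outside span D keeps the next frame vector nonzero at every
    point, so that its squared length may be inverted.\<close>
  have bnot: "b \<notin> span D"
  proof -
    have "b \<notin> span (Basis - {b})" using independent_Basis insert.prems by (auto simp: dependent_def)
    moreover have "span D \<subseteq> span (Basis - {b})" using insert by (intro span_mono) auto
    ultimately show ?thesis by blast
  qed
  have ortho: "h y (b - p y) (u j y) = 0" if "y \<in> S" "j \<in> D" for y j
  proof -
    note l = inner_formD(2)[OF h[OF that(1)], of "u j y"]
    have "h y (p y) (u j y) = (\<Sum>i\<in>D. (h y b (u i y) * inverse (h y (u i y) (u i y))) * h y (u i y) (u j y))"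
      unfolding p_def by (simp add: linear_sum[OF l] linear_scale[OF l])
    also have "\<dots> = (\<Sum>i\<in>D. if i = j then h y b (u j y) else 0)"
      using u(3,4) that inner_formD(4)[OF h[OF that(1)]] by (intro sum.cong refl) auto
    also have "\<dots> = h y b (u j y)" using insert that by simp
    finally show ?thesis by (simp add: linear_diff[OF l])
  qed
  show ?case
  proof (rule exI[of _ w], intro ballI conjI impI)
    fix i assume i: "i \<in> insert b D"
    show "smooth_on S (w i)"
    proof (cases "i = b")
      case True
      have "smooth_on S (\<lambda>y. b - p y)" unfolding p_def
        by (intro smooth_on_diff[OF S] smooth_on_const smooth_on_sum[OF S] smooth_on_scaleR[OF S]
            smooth_on_mult[OF S] smooth_on_inverse[OF S] smooth_on_bilinear_form[OF S hb sm] u)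
          (use u(3) inner_formD(4)[OF h] in auto)
      then show ?thesis by (simp add: True wb)
    qed (use i u(1) wD in auto)
    fix y assume y: "y \<in> S"
    have bD: "b - p y \<in> span (insert b D)"
      using pspan[OF y] span_mono[of D "insert b D"] by (intro span_diff) (auto intro: span_base)
    show "w i y \<in> span (insert b D)"
      using i u(2)[OF _ y] bD wb wD span_mono[OF subset_insertI, of D b] by auto
    have "b - p y \<noteq> 0" using pspan[OF y] bnot by auto
    then show "w i y \<noteq> 0" using i u(3)[OF _ y] wb wD by auto
    have im: "(\<lambda>i. u i y) ` D \<subseteq> (\<lambda>i. w i y) ` insert b D" using wD by auto
    have "p y \<in> span ((\<lambda>i. w i y) ` insert b D)"
      unfolding p_def using im by (intro span_sum span_scale span_base) auto
    moreover have "b - p y \<in> span ((\<lambda>i. w i y) ` insert b D)"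
      using wb by (intro span_base) auto
    ultimately have "b \<in> span ((\<lambda>i. w i y) ` insert b D)" using span_add by fastforce
    then show "i \<in> span ((\<lambda>i. w i y) ` insert b D)"
      using i u(5)[OF _ y] span_mono[OF im] by blast
    fix j assume "j \<in> insert b D" "j \<noteq> i"
    then show "h y (w i y) (w j y) = 0"
      using i u(4)[OF _ _ y] ortho[OF y] wb wD inner_formD(3)[OF h[OF y]] by auto
  qed
qed simp

text \<open>In an orthogonal frame the vector dual to b has coefficients (b \<bullet> u_i) / h(u_i,
  u_i). This gives its existence and its smooth dependence on the point at once.\<close>

lemma smooth_dual_frame:
  fixes h :: "'e::euclidean_space \<Rightarrow> 'd::euclidean_space \<Rightarrow> 'd \<Rightarrow> real"
  assumes S: "open S" and h: "\<And>y. y \<in> S \<Longrightarrow> inner_form (h y)" and sm: "\<And>v w. smooth_on S (\<lambda>y. h y v w)"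
  shows "\<exists>s. smooth_on S s \<and> (\<forall>y\<in>S. \<forall>v. h y (s y) v = b \<bullet> v)"
proof -
  obtain u where U: "\<forall>i\<in>Basis. smooth_on S (u i) \<and> (\<forall>y\<in>S. u i y \<in> span Basis \<and> u i y \<noteq> 0 \<and>
      (\<forall>j\<in>Basis. j \<noteq> i \<longrightarrow> h y (u i y) (u j y) = 0) \<and> i \<in> span ((\<lambda>i. u i y) ` Basis))"
    by (rule exE[OF smooth_orthogonal_frame[OF S h sm finite_Basis order_refl]])
  have u: "\<And>i. i \<in> Basis \<Longrightarrow> smooth_on S (u i)"
    "\<And>i y. i \<in> Basis \<Longrightarrow> y \<in> S \<Longrightarrow> u i y \<noteq> 0"
    "\<And>i j y. i \<in> Basis \<Longrightarrow> j \<in> Basis \<Longrightarrow> y \<in> S \<Longrightarrow> j \<noteq> i \<Longrightarrow> h y (u i y) (u j y) = 0"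
    "\<And>i y. i \<in> Basis \<Longrightarrow> y \<in> S \<Longrightarrow> i \<in> span ((\<lambda>i. u i y) ` Basis)"
    using U by auto
  have hb: "bilinear (h y)" if "y \<in> S" for y using h[OF that] by (simp add: inner_form_def)
  define s where "s y = (\<Sum>i\<in>Basis. ((b \<bullet> u i y) * inverse (h y (u i y) (u i y))) *\<^sub>R u i y)" for y
  have "smooth_on S s" unfolding s_def
    by (intro smooth_on_sum[OF S] smooth_on_scaleR[OF S] smooth_on_mult[OF S]
        smooth_on_linear[OF S bounded_linear_inner_right] smooth_on_inverse[OF S]
        smooth_on_bilinear_form[OF S hb sm] u)
      (use u(2) inner_formD(4)[OF h] in auto)
  moreover have "h y (s y) v = b \<bullet> v" if y: "y \<in> S" for y v
  proof -
    note l = inner_formD(1)[OF h[OF y]] inner_formD(2)[OF h[OF y]]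
    have "v \<in> span ((\<lambda>i. u i y) ` Basis)"
      using span_mono[of Basis "span ((\<lambda>i. u i y) ` Basis)"] u(4)[OF _ y] by (auto simp: span_span)
    then show ?thesis
    proof (rule span_induct)
      show "subspace {v. h y (s y) v = b \<bullet> v}"
        using l(1)[of "s y"] by (auto simp: subspace_def linear_0 linear_add linear_scale inner_add_right)
      fix v assume "v \<in> (\<lambda>i. u i y) ` Basis"
      then obtain j where j: "j \<in> Basis" "v = u j y" by auto
      have "h y (s y) (u j y) = (\<Sum>i\<in>Basis. ((b \<bullet> u i y) * inverse (h y (u i y) (u i y))) * h y (u i y) (u j y))"
        unfolding s_def by (simp add: linear_sum[OF l(2)] linear_scale[OF l(2)])
      also have "\<dots> = (\<Sum>i\<in>Basis. if i = j then b \<bullet> u j y else 0)"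
        using u(2,3) y j inner_formD(4)[OF h[OF y]] by (intro sum.cong refl) auto
      finally show "h y (s y) v = b \<bullet> v" using j by simp
    qed
  qed
  ultimately show ?thesis by blast
qed

lemma inner_form_eqI:
  assumes h: "inner_form h" and eq: "\<And>v. h w v = h w' v" shows "w = w'"
proof -
  have "h (w - w') (w - w') = 0" using eq by (simp add: linear_diff[OF inner_formD(2)[OF h]])
  then show ?thesis using inner_formD(4)[OF h] by auto
qed

lemma sharp_eqI:
  assumes h: "inner_form h" and w: "\<And>v. h w v = b \<bullet> v" shows "sharp h b = w"
  unfolding sharp_def by (rule the_equality) (use w inner_form_eqI[OF h] in auto)

text \<open>Existence of the vector described by \<open>THE\<close> is the case of a constant family
  of forms in the dual frame lemma.\<close>

lemma sharp_inner:
  fixes h :: "'e::euclidean_space \<Rightarrow> 'e \<Rightarrow> real"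
  assumes h: "inner_form h" shows "h (sharp h b) v = b \<bullet> v"
proof -
  obtain s :: "'e \<Rightarrow> 'e" where s: "\<forall>y\<in>UNIV. \<forall>v. h (s y) v = b \<bullet> v"
    using smooth_dual_frame[OF open_UNIV, of "\<lambda>y::'e. h"] h smooth_on_const by metis
  then have "sharp h b = s 0" by (intro sharp_eqI[OF h]) simp
  then show ?thesis using s by simp
qed

lemma smooth_on_sharp:
  fixes h :: "'e::euclidean_space \<Rightarrow> 'd::euclidean_space \<Rightarrow> 'd \<Rightarrow> real"
  assumes S: "open S" and h: "\<And>y. y \<in> S \<Longrightarrow> inner_form (h y)" and sm: "\<And>v w. smooth_on S (\<lambda>y. h y v w)"
  shows "smooth_on S (\<lambda>y. sharp (h y) b)"
proof -
  obtain s where s: "smooth_on S s" "\<And>y v. y \<in> S \<Longrightarrow> h y (s y) v = b \<bullet> v"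
    using smooth_dual_frame[OF S h sm] by metis
  show ?thesis by (rule smooth_on_cong[OF S _ s(1)]) (rule sharp_eqI[OF h s(2), symmetric])
qed

lemma sharp_expansion:
  fixes h :: "'e::euclidean_space \<Rightarrow> 'e \<Rightarrow> real"
  assumes h: "inner_form h" shows "v = (\<Sum>b\<in>Basis. h b v *\<^sub>R sharp h b)"
proof (rule inner_form_eqI[OF h])
  fix w
  note l = inner_formD(2)[OF h]
  have "h v w = h w v" by (rule inner_formD(3)[OF h])
  also have "\<dots> = (\<Sum>b\<in>Basis. (w \<bullet> b) * h b v)"
    using arg_cong[OF euclidean_representation[of w], of "\<lambda>w. h w v"]
    by (simp add: linear_sum[OF l] linear_scale[OF l])
  also have "\<dots> = h (\<Sum>b\<in>Basis. h b v *\<^sub>R sharp h b) w"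
    by (simp add: linear_sum[OF l] linear_scale[OF l] sharp_inner[OF h] inner_commute mult.commute)
  finally show "h v w = h (\<Sum>b\<in>Basis. h b v *\<^sub>R sharp h b) w" .
qed

section \<open>Smooth functions and one-forms on a manifold\<close>

locale smooth_manifold =
  fixes A :: "('m::t2_space, 'e::euclidean_space) chart set"
  assumes atlas: "smooth_atlas A"
begin

lemma chart_around: "\<exists>c\<in>A. x \<in> fst c"
  using atlas unfolding smooth_atlas_def by blast

lemma open_chart: "c \<in> A \<Longrightarrow> open (fst c)" "c \<in> A \<Longrightarrow> open (chart_image c)"
  using atlas unfolding smooth_atlas_def by blast+

lemma homeomorphism_chart: "c \<in> A \<Longrightarrow> homeomorphism (fst c) (chart_image c) (snd c) (chart_inv c)"
  using atlas unfolding smooth_atlas_def by blast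

lemma chart_inv_snd [simp]: "c \<in> A \<Longrightarrow> x \<in> fst c \<Longrightarrow> chart_inv c (snd c x) = x"
  using homeomorphism_chart by (auto simp: homeomorphism_def)

lemma snd_chart_inv [simp]: "c \<in> A \<Longrightarrow> y \<in> chart_image c \<Longrightarrow> snd c (chart_inv c y) = y"
  using homeomorphism_chart by (auto simp: homeomorphism_def)

lemma chart_inv_in [simp]: "c \<in> A \<Longrightarrow> y \<in> chart_image c \<Longrightarrow> chart_inv c y \<in> fst c"
  using homeomorphism_chart[of c] by (auto simp: homeomorphism_def)

lemma snd_in_chart_image [simp]: "x \<in> fst c \<Longrightarrow> snd c x \<in> chart_image c"
  by (simp add: chart_image_def)

lemma open_chart_coordinates:
  assumes c: "c \<in> A" and W: "open W" "W \<subseteq> fst c"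
  shows "open (snd c ` W)"
proof -
  have "openin (top_of_set (fst c)) W" using W by (auto simp: openin_open)
  then have "openin (top_of_set (chart_image c)) (snd c ` W)"
    by (rule homeomorphism_imp_open_map[OF homeomorphism_chart[OF c]])
  then show ?thesis using openin_open_trans open_chart(2)[OF c] by blast
qed

lemma continuous_on_chart: "c \<in> A \<Longrightarrow> continuous_on (fst c) (snd c)"
  using homeomorphism_chart by (auto simp: homeomorphism_def)

lemma smooth_transition:
  "c \<in> A \<Longrightarrow> c' \<in> A \<Longrightarrow> smooth_on (snd c ` (fst c \<inter> fst c')) (snd c' \<circ> chart_inv c)"
  using atlas unfolding smooth_atlas_def by blast

lemma has_derivative_transition:
  assumes "c \<in> A" "c' \<in> A" "x \<in> fst c" "x \<in> fst c'"
  shows "((\<lambda>y. snd c' (chart_inv c y)) has_derivative transition_deriv c c' x) (at (snd c x))"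
  using smooth_on_differentiable[OF smooth_transition[OF assms(1,2)], of "snd c x"] assms(3,4)
  by (simp add: transition_deriv_def frechet_derivative_works o_def)

lemma linear_transition:
  "c \<in> A \<Longrightarrow> c' \<in> A \<Longrightarrow> x \<in> fst c \<Longrightarrow> x \<in> fst c' \<Longrightarrow> linear (transition_deriv c c' x)"
  using has_derivative_transition has_derivative_linear by blast

text \<open>Compose with the transition map on the coordinate image of W; the open set W is kept
  arbitrary so that smoothness can be checked near a point in any convenient chart.\<close>

lemma smooth_on_chart_change:
  assumes c: "c \<in> A" "c' \<in> A" and W: "open W" "W \<subseteq> fst c" "W \<subseteq> fst c'"
    and F: "smooth_on (snd c ` W) (F \<circ> chart_inv c)"
  shows "smooth_on (snd c' ` W) (F \<circ> chart_inv c')"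
proof (rule smooth_on_cong)
  show op: "open (snd c' ` W)" by (rule open_chart_coordinates[OF c(2) W(1,3)])
  show "smooth_on (snd c' ` W) (\<lambda>y. (F \<circ> chart_inv c) ((snd c \<circ> chart_inv c') y))"
  proof (rule smooth_on_compose[OF op _ F])
    show "(snd c \<circ> chart_inv c') ` snd c' ` W \<subseteq> snd c ` W" using c W by (auto simp: subset_iff)
    show "smooth_on (snd c' ` W) (snd c \<circ> chart_inv c')"
      by (rule smooth_on_subset[OF smooth_transition[OF c(2,1)]]) (use W in auto)
  qed
  show "(F \<circ> chart_inv c) ((snd c \<circ> chart_inv c') z) = (F \<circ> chart_inv c') z" if "z \<in> snd c' ` W" for z
    using that c W by (auto simp: subset_iff)
qed

lemma smooth_functionsI:
  assumes "\<And>x. \<exists>c\<in>A. \<exists>W. open W \<and> x \<in> W \<and> W \<subseteq> fst c \<and> smooth_on (snd c ` W) (F \<circ> chart_inv c)"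
  shows "F \<in> smooth_functions A"
  unfolding smooth_functions_def
proof (intro CollectI ballI smooth_on_locally)
  fix c y assume c: "c \<in> A" and y: "y \<in> chart_image c"
  obtain c' W where c': "c' \<in> A" and W: "open W" "chart_inv c y \<in> W" "W \<subseteq> fst c'" "smooth_on (snd c' ` W) (F \<circ> chart_inv c')"
    using assms by blast
  let ?V = "W \<inter> fst c"
  have op: "open ?V" using W open_chart[OF c] by auto
  have "smooth_on (snd c ` ?V) (F \<circ> chart_inv c)"
    by (rule smooth_on_chart_change[OF c' c op _ _ smooth_on_subset[OF W(4)]]) (use W in auto)
  moreover have "open (snd c ` ?V)" by (rule open_chart_coordinates[OF c op]) simp
  moreover have "y \<in> snd c ` ?V" using W(2) c y by (intro image_eqI[of _ _ "chart_inv c y"]) auto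
  ultimately show "\<exists>T. open T \<and> y \<in> T \<and> smooth_on T (F \<circ> chart_inv c)" by blast
qed

lemma smooth_functionsD: "F \<in> smooth_functions A \<Longrightarrow> c \<in> A \<Longrightarrow> smooth_on (chart_image c) (F \<circ> chart_inv c)"
  by (simp add: smooth_functions_def)

lemma smooth_functions_cts: "smooth_functions A \<subseteq> cts"
proof
  fix F :: "'m \<Rightarrow> 'b::real_normed_vector" assume F: "F \<in> smooth_functions A"
  have "isCont F x" for x
  proof -
    obtain c where c: "c \<in> A" "x \<in> fst c" using chart_around by blast
    have "continuous_on (fst c) ((F \<circ> chart_inv c) \<circ> snd c)"
      by (rule continuous_on_compose[OF continuous_on_chart[OF c(1)]])
        (use smooth_on_continuous[OF smooth_functionsD[OF F c(1)]] in \<open>simp add: chart_image_def\<close>)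
    then have "continuous_on (fst c) F"
      by (rule continuous_on_cong[OF refl, THEN iffD1, rotated]) (use c in simp)
    then show ?thesis using c open_chart continuous_on_eq_continuous_at by blast
  qed
  then show "F \<in> cts" by (simp add: cts_def continuous_at_imp_continuous_on)
qed

lemma smooth_functions_const: "(\<lambda>x. a) \<in> smooth_functions A"
  by (simp add: smooth_functions_def o_def smooth_on_const)

lemma smooth_functions_add:
  "F \<in> smooth_functions A \<Longrightarrow> G \<in> smooth_functions A \<Longrightarrow> (\<lambda>x. F x + G x) \<in> smooth_functions A"
  using open_chart by (auto simp: smooth_functions_def o_def intro: smooth_on_add)

lemma smooth_functions_linear:
  "bounded_linear T \<Longrightarrow> F \<in> smooth_functions A \<Longrightarrow> (\<lambda>x. T (F x)) \<in> smooth_functions A"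
  using open_chart by (auto simp: smooth_functions_def o_def intro: smooth_on_linear)

lemma smooth_functions_sum:
  "(\<And>i. i \<in> I \<Longrightarrow> F i \<in> smooth_functions A) \<Longrightarrow> (\<lambda>x. \<Sum>i\<in>I. F i x) \<in> smooth_functions A"
  using open_chart by (auto simp: smooth_functions_def o_def intro!: smooth_on_sum)

lemma has_derivative_de_rham:
  assumes F: "F \<in> smooth_functions A" and c: "c \<in> A" "x \<in> fst c"
  shows "((\<lambda>y. F (chart_inv c y)) has_derivative de_rham A F c x) (at (snd c x))"
  using smooth_on_differentiable[OF smooth_functionsD[OF F c(1)], of "snd c x"] c
  by (simp add: de_rham_def frechet_derivative_works o_def)

lemma de_rham_eqI:
  assumes c: "c \<in> A" "x \<in> fst c" and D: "((\<lambda>y. F (chart_inv c y)) has_derivative D) (at (snd c x))"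
  shows "de_rham A F c x = D"
  using frechet_derivative_at[OF D] c by (simp add: de_rham_def o_def)

lemma de_rham_chart_change:
  assumes F: "F \<in> smooth_functions A" and c: "c \<in> A" "c' \<in> A" "x \<in> fst c" "x \<in> fst c'"
  shows "de_rham A F c x v = de_rham A F c' x (transition_deriv c c' x v)"
proof -
  have "((\<lambda>y. F (chart_inv c' y)) has_derivative de_rham A F c' x) (at (snd c' (chart_inv c (snd c x))))"
    using has_derivative_de_rham[OF F c(2,4)] c by simp
  from has_derivative_compose[OF has_derivative_transition[OF c] this]
  have "((\<lambda>y. F (chart_inv c' (snd c' (chart_inv c y)))) has_derivative
      (\<lambda>v. de_rham A F c' x (transition_deriv c c' x v))) (at (snd c x))" .
  moreover have "open (snd c ` (fst c \<inter> fst c'))"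
    by (rule open_chart_coordinates[OF c(1) open_Int[OF open_chart(1)[OF c(1)] open_chart(1)[OF c(2)]]]) simp
  ultimately have "((\<lambda>y. F (chart_inv c y)) has_derivative
      (\<lambda>v. de_rham A F c' x (transition_deriv c c' x v))) (at (snd c x))"
    by (rule has_derivative_transform_within_open) (use c in auto)
  from de_rham_eqI[OF c(1,3) this] show ?thesis by simp
qed

lemma de_rham_in_chart: "c \<in> A \<Longrightarrow> y \<in> chart_image c \<Longrightarrow>
    de_rham A F c (chart_inv c y) v = frechet_derivative (F \<circ> chart_inv c) (at y) v"
  by (simp add: de_rham_def)

lemma de_rham_one_forms:
  assumes F: "F \<in> smooth_functions A" shows "de_rham A F \<in> one_forms A"
  unfolding one_forms_def
proof (intro CollectI conjI ballI allI impI)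
  show "de_rham A F c x = (\<lambda>v. 0)" if "c \<notin> A \<or> x \<notin> fst c" for c x using that by (auto simp: de_rham_def)
  fix c assume c: "c \<in> A"
  show "linear (de_rham A F c x)" if "x \<in> fst c" for x
    by (rule has_derivative_linear[OF has_derivative_de_rham[OF F c that]])
  show "smooth_on (chart_image c) (\<lambda>y. de_rham A F c (chart_inv c y) v)" for v
    by (rule smooth_on_cong[OF open_chart(2)[OF c] _ smooth_on_frechet[OF smooth_functionsD[OF F c]]])
      (rule de_rham_in_chart[OF c, symmetric])
  fix c' x v assume "c' \<in> A" "x \<in> fst c \<inter> fst c'"
  then show "de_rham A F c x v = de_rham A F c' x (transition_deriv c c' x v)"
    using de_rham_chart_change[OF F c] by blast
qed

lemma de_rham_add:
  assumes "F \<in> smooth_functions A" "G \<in> smooth_functions A"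
  shows "de_rham A (\<lambda>x. F x + G x) = (\<lambda>c x v. de_rham A F c x v + de_rham A G c x v)"
proof (intro ext)
  fix c x v
  show "de_rham A (\<lambda>x. F x + G x) c x v = de_rham A F c x v + de_rham A G c x v"
  proof (cases "c \<in> A \<and> x \<in> fst c")
    case True
    then show ?thesis
      using de_rham_eqI[OF _ _ has_derivative_add[OF has_derivative_de_rham[OF assms(1)] has_derivative_de_rham[OF assms(2)]], of c x]
      by simp
  qed (auto simp: de_rham_def)
qed

lemma de_rham_linear:
  assumes T: "bounded_linear T" and F: "F \<in> smooth_functions A"
  shows "de_rham A (\<lambda>x. T (F x)) = (\<lambda>c x v. T (de_rham A F c x v))"
proof (intro ext)
  fix c x v
  show "de_rham A (\<lambda>x. T (F x)) c x v = T (de_rham A F c x v)"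
  proof (cases "c \<in> A \<and> x \<in> fst c")
    case True
    then show ?thesis
      using de_rham_eqI[OF _ _ bounded_linear.has_derivative[OF T has_derivative_de_rham[OF F]], of c x] by simp
  qed (auto simp: de_rham_def linear_0[OF bounded_linear.linear[OF T]])
qed

lemma de_rham_sum:
  assumes "finite I" "\<And>i. i \<in> I \<Longrightarrow> F i \<in> smooth_functions A"
  shows "de_rham A (\<lambda>x. \<Sum>i\<in>I. F i x) = (\<lambda>c x v. \<Sum>i\<in>I. de_rham A (F i) c x v)"
  using assms
proof (induction I rule: finite_induct)
  case empty
  show ?case by (auto simp: de_rham_def fun_eq_iff o_def)
next
  case (insert i I)
  then show ?case using de_rham_add[of "F i" "\<lambda>x. \<Sum>i\<in>I. F i x"] smooth_functions_sum[of I F] by simp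
qed

section \<open>Operations on one-forms\<close>

lemma one_formsD:
  assumes "\<omega> \<in> one_forms A"
  shows "c \<notin> A \<or> x \<notin> fst c \<Longrightarrow> \<omega> c x v = 0" "c \<in> A \<Longrightarrow> x \<in> fst c \<Longrightarrow> linear (\<omega> c x)"
    "c \<in> A \<Longrightarrow> smooth_on (chart_image c) (\<lambda>y. \<omega> c (chart_inv c y) v)"
    "c \<in> A \<Longrightarrow> c' \<in> A \<Longrightarrow> x \<in> fst c \<Longrightarrow> x \<in> fst c' \<Longrightarrow> \<omega> c x v = \<omega> c' x (transition_deriv c c' x v)"
proof -
  show "\<omega> c x v = 0" if "c \<notin> A \<or> x \<notin> fst c"
  proof -
    have "\<omega> c x = (\<lambda>v. 0)" using assms that unfolding one_forms_def by blast
    then show ?thesis by simp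
  qed
  show "c \<in> A \<Longrightarrow> x \<in> fst c \<Longrightarrow> linear (\<omega> c x)"
    "c \<in> A \<Longrightarrow> smooth_on (chart_image c) (\<lambda>y. \<omega> c (chart_inv c y) v)"
    "c \<in> A \<Longrightarrow> c' \<in> A \<Longrightarrow> x \<in> fst c \<Longrightarrow> x \<in> fst c' \<Longrightarrow> \<omega> c x v = \<omega> c' x (transition_deriv c c' x v)"
    using assms unfolding one_forms_def by blast+
qed

lemma one_formsI:
  assumes "\<And>c x v. c \<notin> A \<or> x \<notin> fst c \<Longrightarrow> \<omega> c x v = 0" "\<And>c x. c \<in> A \<Longrightarrow> x \<in> fst c \<Longrightarrow> linear (\<omega> c x)"
    "\<And>c v. c \<in> A \<Longrightarrow> smooth_on (chart_image c) (\<lambda>y. \<omega> c (chart_inv c y) v)"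
    "\<And>c c' x v. c \<in> A \<Longrightarrow> c' \<in> A \<Longrightarrow> x \<in> fst c \<Longrightarrow> x \<in> fst c' \<Longrightarrow> \<omega> c x v = \<omega> c' x (transition_deriv c c' x v)"
  shows "\<omega> \<in> one_forms A"
  unfolding one_forms_def using assms by (intro CollectI conjI ballI allI impI ext) blast+

lemma one_forms_add:
  assumes w: "\<omega> \<in> one_forms A" and e: "\<eta> \<in> one_forms A"
  shows "(\<lambda>c x v. \<omega> c x v + \<eta> c x v) \<in> one_forms A"
proof (rule one_formsI)
  show "\<omega> c x v + \<eta> c x v = 0" if "c \<notin> A \<or> x \<notin> fst c" for c x v
    using one_formsD(1)[OF w that] one_formsD(1)[OF e that] by simp
  show "linear (\<lambda>v. \<omega> c x v + \<eta> c x v)" if "c \<in> A" "x \<in> fst c" for c x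
    by (rule linear_compose_add[OF one_formsD(2)[OF w that] one_formsD(2)[OF e that]])
  show "smooth_on (chart_image c) (\<lambda>y. \<omega> c (chart_inv c y) v + \<eta> c (chart_inv c y) v)" if "c \<in> A" for c v
    by (rule smooth_on_add[OF open_chart(2)[OF that] one_formsD(3)[OF w that] one_formsD(3)[OF e that]])
  show "\<omega> c x v + \<eta> c x v = \<omega> c' x (transition_deriv c c' x v) + \<eta> c' x (transition_deriv c c' x v)"
    if "c \<in> A" "c' \<in> A" "x \<in> fst c" "x \<in> fst c'" for c c' x v
    using one_formsD(4)[OF w that] one_formsD(4)[OF e that] by simp
qed

lemma one_forms_zero: "(\<lambda>c x v. 0) \<in> one_forms A"
  by (rule one_formsI) (simp_all add: smooth_on_const linear_zero)

lemma one_forms_sum: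
  "(\<And>i. i \<in> I \<Longrightarrow> \<omega> i \<in> one_forms A) \<Longrightarrow> (\<lambda>c x v. \<Sum>i\<in>I. \<omega> i c x v) \<in> one_forms A"
  by (induction I rule: infinite_finite_induct) (simp_all add: one_forms_zero one_forms_add)

lemma one_forms_bilinear:
  assumes T: "bounded_bilinear T" and w: "\<omega> \<in> one_forms A" and F: "F \<in> smooth_functions A"
  shows "(\<lambda>c x v. T (\<omega> c x v) (F x)) \<in> one_forms A"
proof (rule one_formsI)
  interpret bounded_bilinear T by (rule T)
  show "T (\<omega> c x v) (F x) = 0" if "c \<notin> A \<or> x \<notin> fst c" for c x v
    using one_formsD(1)[OF w that] by (simp add: zero_left)
  show "linear (\<lambda>v. T (\<omega> c x v) (F x))" if "c \<in> A" "x \<in> fst c" for c x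
    using linear_compose[OF one_formsD(2)[OF w that] bounded_linear.linear[OF bounded_linear_left]]
    by (simp add: o_def)
  show "smooth_on (chart_image c) (\<lambda>y. T (\<omega> c (chart_inv c y) v) (F (chart_inv c y)))" if "c \<in> A" for c v
    by (rule smooth_on_bilinear[OF open_chart(2)[OF that] T one_formsD(3)[OF w that]])
      (use smooth_functionsD[OF F that] in \<open>simp add: o_def\<close>)
  show "T (\<omega> c x v) (F x) = T (\<omega> c' x (transition_deriv c c' x v)) (F x)"
    if "c \<in> A" "c' \<in> A" "x \<in> fst c" "x \<in> fst c'" for c c' x v
    using one_formsD(4)[OF w that] by simp
qed

lemmas one_forms_times = one_forms_bilinear[OF bounded_bilinear_mult]

end

text \<open>J is an invertible isometry and transports dual vectors up to the real matrix of J in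
  the standard basis. Only real scalars are moved, so the values of \<omega> and \<eta> may fail to
  commute. With J a transition derivative this is chart independence of the inner product.\<close>

lemma sharp_contraction_pullback:
  fixes \<omega> \<eta> :: "'e::euclidean_space \<Rightarrow> 'q::cstar_algebra" and J :: "'e \<Rightarrow> 'e"
  assumes h: "inner_form h" "inner_form h'" and J: "linear J" "\<And>v w. h v w = h' (J v) (J w)"
    and w: "linear \<omega>" and e: "linear \<eta>"
  shows "(\<Sum>b\<in>Basis. star (\<omega> (J (sharp h b))) * \<eta> (J b)) = (\<Sum>b\<in>Basis. star (\<omega> (sharp h' b)) * \<eta> b)"
proof -
  have inj: "inj J"
  proof (rule linear_injective_0[OF J(1), THEN iffD2], intro allI impI)
    fix v assume "J v = 0"
    then have "h v v = 0" using J(2)[of v v] inner_formD(4)[OF h(2), of 0] by simp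
    then show "v = 0" using inner_formD(4)[OF h(1)] by simp
  qed
  have surj: "surj J" by (rule linear_inj_imp_surj[OF J(1) inj])
  have sharp': "sharp h' b' = (\<Sum>b\<in>Basis. (J b \<bullet> b') *\<^sub>R J (sharp h b))" for b'
  proof (rule sharp_eqI[OF h(2)])
    fix u
    obtain w where u: "u = J w" using surj by (metis surjD)
    note l = inner_formD(2)[OF h(2)]
    have "h' (\<Sum>b\<in>Basis. (J b \<bullet> b') *\<^sub>R J (sharp h b)) u = (\<Sum>b\<in>Basis. (J b \<bullet> b') * (b \<bullet> w))"
      unfolding u by (simp add: linear_sum[OF l] linear_scale[OF l] J(2)[symmetric] sharp_inner[OF h(1)])
    also have "\<dots> = J (\<Sum>b\<in>Basis. (w \<bullet> b) *\<^sub>R b) \<bullet> b'"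
      by (simp add: linear_sum[OF J(1)] linear_scale[OF J(1)] inner_sum_left inner_sum_right inner_commute mult.commute)
    finally show "h' (\<Sum>b\<in>Basis. (J b \<bullet> b') *\<^sub>R J (sharp h b)) u = b' \<bullet> u"
      unfolding u euclidean_representation by (simp only: inner_commute)
  qed
  have exp: "\<eta> (J b) = (\<Sum>b'\<in>Basis. (J b \<bullet> b') *\<^sub>R \<eta> b')" for b
    using arg_cong[OF euclidean_representation[of "J b"], of \<eta>]
    by (simp add: linear_sum[OF e] linear_scale[OF e])
  have "(\<Sum>b\<in>Basis. star (\<omega> (J (sharp h b))) * \<eta> (J b)) =
      (\<Sum>b\<in>Basis. \<Sum>b'\<in>Basis. (J b \<bullet> b') *\<^sub>R (star (\<omega> (J (sharp h b))) * \<eta> b'))"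
    by (simp add: exp sum_distrib_left)
  also have "\<dots> = (\<Sum>b'\<in>Basis. star (\<omega> (sharp h' b')) * \<eta> b')"
    by (subst sum.swap)
      (simp add: sharp' linear_sum[OF w] linear_scale[OF w] star_sum star_scaleR sum_distrib_right)
  finally show ?thesis .
qed

locale metric_manifold = smooth_manifold A
  for A :: "('m::t2_space, 'e::euclidean_space) chart set" +
  fixes g :: "('m, 'e) metric_field"
  assumes metric: "riemannian_metric A g"
begin

lemma inner_form_metric: "c \<in> A \<Longrightarrow> x \<in> fst c \<Longrightarrow> inner_form (g c x)"
  using metric unfolding riemannian_metric_def inner_form_def by blast

text \<open>The definition selects a chart by \<open>SOME\<close> separately at each point; only a
  formula in a fixed chart can be differentiated or compared between neighbouring points.\<close>

lemma form_inner_chart: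
  fixes \<omega> \<eta> :: "('m, 'e, 'q::cstar_algebra) form"
  assumes w: "\<omega> \<in> one_forms A" and e: "\<eta> \<in> one_forms A" and c: "c \<in> A" "x \<in> fst c"
  shows "form_inner A g \<omega> \<eta> x = (\<Sum>b\<in>Basis. star (\<omega> c x (sharp (g c x) b)) * \<eta> c x b)"
proof -
  define c' where "c' = (SOME c. c \<in> A \<and> x \<in> fst c)"
  have c': "c' \<in> A" "x \<in> fst c'"
    using someI_ex[of "\<lambda>c. c \<in> A \<and> x \<in> fst c"] c unfolding c'_def by blast+
  have "form_inner A g \<omega> \<eta> x = (\<Sum>b\<in>Basis. star (\<omega> c' x (sharp (g c' x) b)) * \<eta> c' x b)"
    by (simp add: form_inner_def Let_def c'_def)
  also have "\<dots> = (\<Sum>b\<in>Basis. star (\<omega> c x (transition_deriv c' c x (sharp (g c' x) b))) *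
      \<eta> c x (transition_deriv c' c x b))"
    using one_formsD(4)[OF w c'(1) c(1) c'(2) c(2)] one_formsD(4)[OF e c'(1) c(1) c'(2) c(2)] by simp
  also have "\<dots> = (\<Sum>b\<in>Basis. star (\<omega> c x (sharp (g c x) b)) * \<eta> c x b)"
  proof (rule sharp_contraction_pullback)
    show "g c' x v w = g c x (transition_deriv c' c x v) (transition_deriv c' c x w)" for v w
      using metric c c' unfolding riemannian_metric_def by blast
  qed (use inner_form_metric linear_transition c c' one_formsD(2)[OF w c] one_formsD(2)[OF e c] in auto)
  finally show ?thesis .
qed

lemma form_inner_smooth:
  fixes \<omega> \<eta> :: "('m, 'e, 'q::cstar_algebra) form"
  assumes w: "\<omega> \<in> one_forms A" and e: "\<eta> \<in> one_forms A"
  shows "form_inner A g \<omega> \<eta> \<in> smooth_functions A"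
  unfolding smooth_functions_def
proof (intro CollectI ballI)
  fix c assume c: "c \<in> A"
  define s where "s b y = sharp (g c (chart_inv c y)) b" for b y
  note S = open_chart(2)[OF c]
  have sm: "smooth_on (chart_image c) (s b)" for b unfolding s_def
  proof (rule smooth_on_sharp[OF S])
    show "inner_form (g c (chart_inv c y))" if "y \<in> chart_image c" for y
      using that c by (intro inner_form_metric) auto
    show "smooth_on (chart_image c) (\<lambda>y. g c (chart_inv c y) v w)" for v w
      using metric c unfolding riemannian_metric_def by blast
  qed
  show "smooth_on (chart_image c) (form_inner A g \<omega> \<eta> \<circ> chart_inv c)"
  proof (rule smooth_on_cong[OF S])
    show "smooth_on (chart_image c) (\<lambda>y. \<Sum>b\<in>Basis.
        star (\<Sum>a\<in>Basis. (s b y \<bullet> a) *\<^sub>R \<omega> c (chart_inv c y) a) * \<eta> c (chart_inv c y) b)"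
      by (intro smooth_on_sum[OF S] smooth_on_mult[OF S] smooth_on_linear[OF S bounded_linear_star]
          smooth_on_scaleR[OF S] smooth_on_linear[OF S bounded_linear_inner_left] sm
          one_formsD(3)[OF w c] one_formsD(3)[OF e c])
    fix y assume y: "y \<in> chart_image c"
    have "linear (\<omega> c (chart_inv c y))" using one_formsD(2)[OF w c] c y by simp
    then have "(\<Sum>a\<in>Basis. (v \<bullet> a) *\<^sub>R \<omega> c (chart_inv c y) a) = \<omega> c (chart_inv c y) v" for v
      using arg_cong[OF euclidean_representation[of v], of "\<omega> c (chart_inv c y)"]
      by (simp add: linear_sum linear_scale)
    then show "(\<Sum>b\<in>Basis. star (\<Sum>a\<in>Basis. (s b y \<bullet> a) *\<^sub>R \<omega> c (chart_inv c y) a) * \<eta> c (chart_inv c y) b) =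
        (form_inner A g \<omega> \<eta> \<circ> chart_inv c) y"
      using form_inner_chart[OF w e c, of "chart_inv c y"] c y by (simp add: s_def)
  qed
qed

end

section \<open>Functions with a nonvanishing directional derivative\<close>

context smooth_manifold
begin

text \<open>A linear coordinate function in the direction v is cut off by a bump supported in the
  chart and extended by 0.\<close>

lemma smooth_bump:
  assumes c: "c \<in> A" and x0: "x0 \<in> fst c" and v: "v \<noteq> 0"
  shows "\<exists>G::'m \<Rightarrow> real. G \<in> smooth_functions A \<and> de_rham A G c x0 v \<noteq> 0"
proof -
  define a where "a = snd c x0"
  have a: "a \<in> chart_image c" using x0 by (simp add: a_def)
  obtain \<rho> where \<rho>: "\<rho> > 0" "cball a \<rho> \<subseteq> chart_image c"
    using open_contains_cball[THEN iffD1, OF open_chart(2)[OF c]] a by blast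
  define \<psi> where "\<psi> y = exp_quotient 0 (\<rho>\<^sup>2 - (norm (y - a))\<^sup>2)" for y
  define H where "H y = \<psi> y * ((y - a) \<bullet> v)" for y
  define G where "G x = (if x \<in> fst c then H (snd c x) else 0)" for x
  have sm\<psi>: "smooth_on UNIV \<psi>" unfolding \<psi>_def
    by (rule smooth_on_compose[OF open_UNIV subset_UNIV smooth_exp_quotient smooth_on_norm_square])
  have smH: "smooth_on UNIV H" unfolding H_def
    by (intro smooth_on_mult[OF open_UNIV] sm\<psi> smooth_on_linear[OF open_UNIV bounded_linear_inner_left]
        smooth_on_diff[OF open_UNIV] smooth_on_ident smooth_on_const)
  \<comment> \<open>The preimage of the ball is compact, hence closed in the Hausdorff space. So G
    vanishes on an open set which, together with the chart domain, covers the manifold.\<close>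
  define K where "K = chart_inv c ` cball a \<rho>"
  have "compact K" unfolding K_def
    using homeomorphism_chart[OF c] \<rho>(2)
    by (intro compact_continuous_image) (auto simp: homeomorphism_def intro: continuous_on_subset)
  then have K: "closed K" by (rule compact_imp_closed)
  have KG: "G x = 0" if "x \<notin> K" for x
  proof (cases "x \<in> fst c")
    case True
    then have "snd c x \<notin> cball a \<rho>" using that c unfolding K_def by (metis chart_inv_snd imageI)
    then have "\<rho> < norm (snd c x - a)" by (simp add: dist_norm norm_minus_commute)
    then have "\<rho>\<^sup>2 \<le> (norm (snd c x - a))\<^sup>2" using \<rho>(1) by (intro power_mono) auto
    then show ?thesis using True by (simp add: G_def H_def \<psi>_def exp_quotient_def)
  qed (simp add: G_def)
  have G: "G \<in> smooth_functions A"
  proof (rule smooth_functionsI)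
    fix x
    show "\<exists>c\<in>A. \<exists>W. open W \<and> x \<in> W \<and> W \<subseteq> fst c \<and> smooth_on (snd c ` W) (G \<circ> chart_inv c)"
    proof (cases "x \<in> fst c")
      case True
      have "smooth_on (snd c ` fst c) (G \<circ> chart_inv c)"
        by (rule smooth_on_cong[OF open_chart(2)[OF c, unfolded chart_image_def] _
              smooth_on_subset[OF smH subset_UNIV]]) (use c in \<open>auto simp: G_def\<close>)
      then show ?thesis using c True open_chart(1)[OF c] by blast
    next
      case False
      obtain c' where c': "c' \<in> A" "x \<in> fst c'" using chart_around by blast
      let ?W = "fst c' - K"
      have op: "open ?W" using open_chart(1)[OF c'(1)] K by (rule open_Diff)
      have "K \<subseteq> fst c" using \<rho>(2) c unfolding K_def by auto
      then have "x \<in> ?W" using False c' by auto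
      moreover have "smooth_on (snd c' ` ?W) (G \<circ> chart_inv c')"
        by (rule smooth_on_cong[OF open_chart_coordinates[OF c'(1) op] _ smooth_on_const[of _ 0]])
          (use KG c' in auto)
      ultimately show ?thesis using c' op by blast
    qed
  qed
  \<comment> \<open>The linear factor vanishes at the centre, so the derivative of \<psi> drops out
    of the product rule.\<close>
  have dH: "(H has_derivative (\<lambda>w. \<psi> a * (w \<bullet> v))) (at a)"
  proof -
    have "(\<psi> has_derivative frechet_derivative \<psi> (at a)) (at a)"
      using smooth_on_differentiable[OF sm\<psi>] by (simp add: frechet_derivative_works)
    then show ?thesis unfolding H_def by (auto intro!: derivative_eq_intros)
  qed
  have "((\<lambda>y. G (chart_inv c y)) has_derivative (\<lambda>w. \<psi> a * (w \<bullet> v))) (at (snd c x0))"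
    using has_derivative_transform_within_open[OF dH open_chart(2)[OF c] a, of "\<lambda>y. G (chart_inv c y)"] c
    by (simp add: G_def a_def)
  then have "de_rham A G c x0 v = \<psi> a * (v \<bullet> v)" using de_rham_eqI[OF c x0, of G] by simp
  moreover have "\<psi> a > 0" using \<rho>(1) by (simp add: \<psi>_def exp_quotient_def not_le)
  ultimately show ?thesis using G v by (intro exI[of _ G]) simp
qed

end

section \<open>Continuity for the natural topologies\<close>

lemma topspace_seminorm_topology: "topspace (seminorm_topology V P) = V"
  unfolding seminorm_topology_def topology_generated_by_topspace by auto

lemma openin_seminorm_ball:
  "p \<in> P \<Longrightarrow> F \<in> V \<Longrightarrow> e > 0 \<Longrightarrow> openin (seminorm_topology V P) {G\<in>V. p (G - F) < e}"
  unfolding seminorm_topology_def by (rule topology_generated_by_Basis) blast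

lemma openin_seminormI:
  assumes "U \<subseteq> V" "\<And>f. f \<in> U \<Longrightarrow> \<exists>p\<in>P. \<exists>e>0. p (f - f) < e \<and> (\<forall>h\<in>V. p (h - f) < e \<longrightarrow> h \<in> U)"
  shows "openin (seminorm_topology V P) U"
proof (subst openin_subopen, intro ballI)
  fix f assume f: "f \<in> U"
  obtain p e where p: "p \<in> P" "e > 0" "p (f - f) < e" "\<And>h. h \<in> V \<Longrightarrow> p (h - f) < e \<Longrightarrow> h \<in> U"
    using assms(2)[OF f] by blast
  show "\<exists>T. openin (seminorm_topology V P) T \<and> f \<in> T \<and> T \<subseteq> U"
    by (rule exI[of _ "{h\<in>V. p (h - f) < e}"]) (use p f assms(1) openin_seminorm_ball[of p P f V e] in auto)
qed

text \<open>The suprema that define the natural topologies behave like seminorms only on smooth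
  arguments, so just the triangle inequality on the carrier and the value at f - f are
  demanded.\<close>

lemma continuous_map_seminorm_topology:
  assumes T: "T \<in> V \<rightarrow> W"
    and tri: "\<And>q a b c. q \<in> Q \<Longrightarrow> a \<in> W \<Longrightarrow> b \<in> W \<Longrightarrow> c \<in> W \<Longrightarrow> q (a - c) \<le> q (a - b) + q (b - c)"
    and bound: "\<And>q. q \<in> Q \<Longrightarrow> \<exists>p\<in>P. \<forall>f\<in>V. \<forall>h\<in>V. p (f - f) \<le> 0 \<and> q (T f - T h) \<le> p (f - h)"
  shows "continuous_map (seminorm_topology V P) (seminorm_topology W Q) T"
proof (subst (2) seminorm_topology_def, rule continuous_on_generated_topo)
  show "T ` topspace (seminorm_topology V P) \<subseteq> \<Union> (insert W {{G\<in>W. q (G - F) < e} |q F e. q \<in> Q \<and> F \<in> W \<and> e > 0})"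
    using T by (auto simp: topspace_seminorm_topology)
  fix U assume "U \<in> insert W {{G\<in>W. q (G - F) < e} |q F e. q \<in> Q \<and> F \<in> W \<and> e > 0}"
  then consider "U = W" | q F e where "U = {G\<in>W. q (G - F) < e}" "q \<in> Q" "F \<in> W" "e > 0" by blast
  then show "openin (seminorm_topology V P) (T -` U \<inter> topspace (seminorm_topology V P))"
  proof cases
    case 1
    then have "T -` U \<inter> topspace (seminorm_topology V P) = topspace (seminorm_topology V P)"
      using T by (auto simp: topspace_seminorm_topology)
    then show ?thesis by simp
  next
    case 2
    obtain p where p: "p \<in> P" "\<And>f. f \<in> V \<Longrightarrow> p (f - f) \<le> 0"
      "\<And>f h. f \<in> V \<Longrightarrow> h \<in> V \<Longrightarrow> q (T f - T h) \<le> p (f - h)"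
      using bound[OF 2(2)] by blast
    show ?thesis
    proof (rule openin_seminormI)
      fix f assume "f \<in> T -` U \<inter> topspace (seminorm_topology V P)"
      then have f: "f \<in> V" "q (T f - F) < e" using 2 by (auto simp: topspace_seminorm_topology)
      show "\<exists>p\<in>P. \<exists>e>0. p (f - f) < e \<and> (\<forall>h\<in>V. p (h - f) < e \<longrightarrow> h \<in> T -` U \<inter> topspace (seminorm_topology V P))"
      proof (intro bexI[OF _ p(1)] exI[of _ "e - q (T f - F)"] conjI ballI impI)
        fix h assume h: "h \<in> V" "p (h - f) < e - q (T f - F)"
        have TW: "T h \<in> W" "T f \<in> W" using T h f by auto
        have "q (T h - F) < e"
          using p(3)[OF h(1) f(1)] h(2) tri[OF 2(2) TW 2(3)] by linarith
        then show "h \<in> T -` U \<inter> topspace (seminorm_topology V P)"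
          using h TW 2 by (auto simp: topspace_seminorm_topology)
      qed (use f p(2)[OF f(1)] in auto)
    qed (auto simp: topspace_seminorm_topology)
  qed
qed

lemma continuous_map_seminorm_euclidean:
  fixes T :: "'v::minus \<Rightarrow> 'b::real_normed_vector"
  assumes p: "p \<in> P" "\<And>f. f \<in> V \<Longrightarrow> p (f - f) \<le> 0" "\<And>f h. f \<in> V \<Longrightarrow> h \<in> V \<Longrightarrow> norm (T f - T h) \<le> p (f - h)"
  shows "continuous_map (seminorm_topology V P) euclidean T"
  unfolding continuous_map_def
proof (intro conjI allI impI)
  fix U :: "'b set" assume "openin euclidean U"
  then have U: "open U" by simp
  show "openin (seminorm_topology V P) {x \<in> topspace (seminorm_topology V P). T x \<in> U}"
  proof (rule openin_seminormI)
    fix f assume "f \<in> {x \<in> topspace (seminorm_topology V P). T x \<in> U}"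
    then have f: "f \<in> V" "T f \<in> U" by (auto simp: topspace_seminorm_topology)
    obtain e where e: "e > 0" "ball (T f) e \<subseteq> U" using U f(2) openE by blast
    show "\<exists>p\<in>P. \<exists>e>0. p (f - f) < e \<and>
        (\<forall>h\<in>V. p (h - f) < e \<longrightarrow> h \<in> {x \<in> topspace (seminorm_topology V P). T x \<in> U})"
    proof (intro bexI[OF _ p(1)] exI[of _ e] conjI ballI impI)
      fix h assume h: "h \<in> V" "p (h - f) < e"
      then have "T h \<in> ball (T f) e" using p(3)[OF h(1) f(1)] by (simp add: dist_norm norm_minus_commute)
      then show "h \<in> {x \<in> topspace (seminorm_topology V P). T x \<in> U}"
        using e h by (auto simp: topspace_seminorm_topology)
    qed (use e p(2)[OF f(1)] in auto)
  qed (auto simp: topspace_seminorm_topology)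
qed simp

lemma dense_in_kernel:
  fixes T :: "'v \<Rightarrow> 'b::real_normed_vector"
  assumes T: "continuous_map X euclidean T" and S: "dense_in X S" and z: "\<And>s. s \<in> S \<Longrightarrow> T s = 0"
    and x: "x \<in> topspace X"
  shows "T x = 0"
proof -
  have "closedin X {x \<in> topspace X. T x \<in> {0}}"
    by (rule closedin_continuous_map_preimage[OF T]) simp
  moreover have "S \<subseteq> {x \<in> topspace X. T x \<in> {0}}" using S z by (auto simp: dense_in_def)
  ultimately have "X closure_of S \<subseteq> {x \<in> topspace X. T x \<in> {0}}" by (rule closure_of_minimal[rotated])
  then show ?thesis using S x by (auto simp: dense_in_def)
qed

section \<open>Continuity of the differential and density of the differentials\<close>

context smooth_manifold
begin

lemma bdd_above_dir_deriv:
  assumes c: "c \<in> A" and K: "compact K" "K \<subseteq> fst c" and sm: "smooth_on (chart_image c) \<phi>"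
  shows "bdd_above ((\<lambda>x. norm (dir_deriv vs \<phi> (snd c x))) ` K)"
proof -
  have "continuous_on (snd c ` K) (dir_deriv vs \<phi>)"
    by (rule continuous_on_subset[OF smooth_on_continuous[OF smooth_on_dir_deriv[OF sm, of vs]]])
      (use K(2) in \<open>auto simp: chart_image_def\<close>)
  then have "continuous_on K (\<lambda>x. dir_deriv vs \<phi> (snd c x))"
    using continuous_on_compose[of K "snd c" "dir_deriv vs \<phi>"] continuous_on_subset[OF continuous_on_chart[OF c] K(2)]
    by (simp add: o_def)
  then have "compact ((\<lambda>x. norm (dir_deriv vs \<phi> (snd c x))) ` K)"
    by (intro compact_continuous_image continuous_on_norm K(1))
  then show ?thesis by (intro bounded_imp_bdd_above compact_imp_bounded)
qed

lemma dir_deriv_seminorm_triangle: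
  assumes c: "c \<in> A" and K: "compact K" "K \<subseteq> fst c" "K \<noteq> {}"
    and sm: "smooth_on (chart_image c) \<phi>" "smooth_on (chart_image c) \<psi>"
  shows "(SUP x\<in>K. norm (dir_deriv vs (\<lambda>y. \<phi> y + \<psi> y) (snd c x))) \<le>
    (SUP x\<in>K. norm (dir_deriv vs \<phi> (snd c x))) + (SUP x\<in>K. norm (dir_deriv vs \<psi> (snd c x)))"
proof (rule cSUP_least[OF K(3)])
  fix x assume x: "x \<in> K"
  then have "norm (dir_deriv vs (\<lambda>y. \<phi> y + \<psi> y) (snd c x)) =
      norm (dir_deriv vs \<phi> (snd c x) + dir_deriv vs \<psi> (snd c x))"
    using dir_deriv_add[OF open_chart(2)[OF c] sm] K(2) by auto
  moreover have "norm (dir_deriv vs \<phi> (snd c x)) \<le> (SUP x\<in>K. norm (dir_deriv vs \<phi> (snd c x)))"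
    by (rule cSUP_upper[OF x bdd_above_dir_deriv[OF c K(1,2) sm(1)]])
  moreover have "norm (dir_deriv vs \<psi> (snd c x)) \<le> (SUP x\<in>K. norm (dir_deriv vs \<psi> (snd c x)))"
    by (rule cSUP_upper[OF x bdd_above_dir_deriv[OF c K(1,2) sm(2)]])
  ultimately show "norm (dir_deriv vs (\<lambda>y. \<phi> y + \<psi> y) (snd c x)) \<le>
      (SUP x\<in>K. norm (dir_deriv vs \<phi> (snd c x))) + (SUP x\<in>K. norm (dir_deriv vs \<psi> (snd c x)))"
    using norm_triangle_ineq[of "dir_deriv vs \<phi> (snd c x)" "dir_deriv vs \<psi> (snd c x)"] by linarith
qed

lemma dir_deriv_zero: "dir_deriv vs (\<lambda>y. 0) = (\<lambda>y. 0)"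
  by (induction vs) simp_all

lemma topspace_smooth_topology: "topspace (smooth_topology A) = smooth_functions A"
  by (simp add: smooth_topology_def topspace_seminorm_topology)

lemma de_rham_diff:
  assumes "F \<in> smooth_functions A" "G \<in> smooth_functions A"
  shows "de_rham A (\<lambda>x. F x - G x) = (\<lambda>c x v. de_rham A F c x v - de_rham A G c x v)"
  using de_rham_add[OF assms(1) smooth_functions_linear[OF bounded_linear_minus[OF bounded_linear_ident] assms(2)]]
    de_rham_linear[OF bounded_linear_minus[OF bounded_linear_ident] assms(2)] by simp

text \<open>A derivative of the component along v of dF is a derivative of F with v as innermost
  direction. Each seminorm of the target thus equals one of the source, with v appended to the
  list.\<close>

lemma continuous_map_de_rham:
  "continuous_map (smooth_topology A) (form_topology A)
     (de_rham A :: ('m \<Rightarrow> 'q::real_normed_vector) \<Rightarrow> ('m, 'e, 'q) form)"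
  unfolding smooth_topology_def form_topology_def
proof (rule continuous_map_seminorm_topology)
  show "de_rham A \<in> smooth_functions A \<rightarrow> (one_forms A :: ('m, 'e, 'q) form set)"
    using de_rham_one_forms by auto
next
  fix q :: "('m, 'e, 'q) form \<Rightarrow> real" and \<omega> \<eta> \<zeta> :: "('m, 'e, 'q) form"
  assume "q \<in> {\<lambda>\<omega>. SUP x\<in>K. norm (dir_deriv vs (\<lambda>y. \<omega> c (chart_inv c y) v) (snd c x)) |c K vs v.
      c \<in> A \<and> compact K \<and> K \<noteq> {} \<and> K \<subseteq> fst c}" and forms: "\<omega> \<in> one_forms A" "\<eta> \<in> one_forms A" "\<zeta> \<in> one_forms A"
  then obtain c K vs v where q: "q = (\<lambda>\<omega>. SUP x\<in>K. norm (dir_deriv vs (\<lambda>y. \<omega> c (chart_inv c y) v) (snd c x)))"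
    and c: "c \<in> A" and K: "compact K" "K \<noteq> {}" "K \<subseteq> fst c" by blast
  note sm = one_formsD(3)[OF forms(1) c, of v] one_formsD(3)[OF forms(2) c, of v] one_formsD(3)[OF forms(3) c, of v]
  note S = open_chart(2)[OF c]
  show "q (\<omega> - \<zeta>) \<le> q (\<omega> - \<eta>) + q (\<eta> - \<zeta>)"
    using dir_deriv_seminorm_triangle[OF c K(1,3,2) smooth_on_diff[OF S sm(1,2)] smooth_on_diff[OF S sm(2,3)], of vs]
    by (simp add: q)
next
  fix q :: "('m, 'e, 'q) form \<Rightarrow> real"
  assume "q \<in> {\<lambda>\<omega>. SUP x\<in>K. norm (dir_deriv vs (\<lambda>y. \<omega> c (chart_inv c y) v) (snd c x)) |c K vs v.
      c \<in> A \<and> compact K \<and> K \<noteq> {} \<and> K \<subseteq> fst c}"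
  then obtain c K vs v where q: "q = (\<lambda>\<omega>. SUP x\<in>K. norm (dir_deriv vs (\<lambda>y. \<omega> c (chart_inv c y) v) (snd c x)))"
    and c: "c \<in> A" and K: "compact K" "K \<noteq> {}" "K \<subseteq> fst c" by blast
  define p where "p = (\<lambda>F::'m \<Rightarrow> 'q. SUP x\<in>K. norm (dir_deriv (vs @ [v]) (F \<circ> chart_inv c) (snd c x)))"
  have "q (de_rham A F - de_rham A G) = p (F - G)"
    if FG: "F \<in> smooth_functions A" "G \<in> smooth_functions A" for F G
  proof -
    have "dir_deriv vs (\<lambda>y. de_rham A F c (chart_inv c y) v - de_rham A G c (chart_inv c y) v) (snd c x) =
        dir_deriv vs (dir_deriv [v] ((F - G) \<circ> chart_inv c)) (snd c x)" if "x \<in> K" for x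
    proof (rule dir_deriv_cong_open[OF open_chart(2)[OF c]])
      show "de_rham A F c (chart_inv c y) v - de_rham A G c (chart_inv c y) v = dir_deriv [v] ((F - G) \<circ> chart_inv c) y"
        if "y \<in> chart_image c" for y
        using de_rham_in_chart[OF c that, of "F - G" v] fun_cong[OF fun_cong[OF fun_cong[OF de_rham_diff[OF FG]]], of c "chart_inv c y" v]
        by (simp add: fun_diff_def)
      show "snd c x \<in> chart_image c" using that K by auto
    qed
    then show ?thesis unfolding q p_def dir_deriv_append by (simp cong: SUP_cong)
  qed
  moreover have "p (F - F) \<le> 0" for F
    using K(2) by (simp add: p_def o_def dir_deriv_zero)
  moreover have "p \<in> {\<lambda>F. SUP x\<in>K. norm (dir_deriv vs (F \<circ> chart_inv c) (snd c x)) |c K vs.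
      c \<in> A \<and> compact K \<and> K \<noteq> {} \<and> K \<subseteq> fst c}" unfolding p_def using c K by blast
  ultimately show "\<exists>p\<in>{\<lambda>F. SUP x\<in>K. norm (dir_deriv vs (F \<circ> chart_inv c) (snd c x)) |c K vs.
      c \<in> A \<and> compact K \<and> K \<noteq> {} \<and> K \<subseteq> fst c}. \<forall>f\<in>smooth_functions A. \<forall>h\<in>smooth_functions A.
      p (f - f) \<le> 0 \<and> q (de_rham A f - de_rham A h) \<le> p (f - h)"
    by (intro bexI[of _ p]) auto
qed

text \<open>The evaluation is bounded by the seminorm for the compact set {x} and the empty list of
  directions.\<close>

lemma continuous_map_form_evaluation:
  assumes c: "c \<in> A" "x \<in> fst c"
  shows "continuous_map (form_topology A) euclidean (\<lambda>\<omega> :: ('m, 'e, 'q::real_normed_vector) form. \<omega> c x v)"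
proof -
  let ?p = "\<lambda>\<omega> :: ('m, 'e, 'q) form. SUP x\<in>{x}. norm (dir_deriv [] (\<lambda>y. \<omega> c (chart_inv c y) v) (snd c x))"
  show ?thesis unfolding form_topology_def
  proof (rule continuous_map_seminorm_euclidean[of ?p])
    show "?p \<in> {\<lambda>\<omega>. SUP x\<in>K. norm (dir_deriv vs (\<lambda>y. \<omega> c (chart_inv c y) v) (snd c x)) |c K vs v.
        c \<in> A \<and> compact K \<and> K \<noteq> {} \<and> K \<subseteq> fst c}"
      by (intro CollectI exI[of _ c] exI[of _ "{x}"] exI[of _ "[]"] exI[of _ v]) (use c in auto)
  qed (use c in auto)
qed

text \<open>If v were killed by d(\<alpha> f) for all f in the dense algebra, continuity of \<Gamma>
  would extend this to all smooth f, multiplication by constants to the span in the density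
  condition, and density to every smooth function with values in \<open>'q\<close>. A bump function
  times 1 contradicts this.\<close>

lemma differentials_separate:
  fixes \<alpha> :: "('m \<Rightarrow> complex) \<Rightarrow> 'm \<Rightarrow> 'q::cstar_algebra"
    and \<Gamma> :: "('m, 'e, complex) form \<Rightarrow> ('m, 'e, 'q) form"
  assumes \<alpha>: "\<alpha> \<in> smooth_functions A \<rightarrow> smooth_functions A"
    and podles: "dense_in (smooth_topology A) (cspan {\<alpha> f * (\<lambda>_. q) | f q. f \<in> smooth_functions A})"
    and dense: "dense_in (smooth_topology A) \<A>"
    and \<Gamma>: "continuous_map (form_topology A) (form_topology A) \<Gamma>"
    and differential: "\<And>f. f \<in> smooth_functions A \<Longrightarrow> \<Gamma> (de_rham A f) = de_rham A (\<alpha> f)"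
    and c: "c \<in> A" "x \<in> fst c" and v: "v \<noteq> 0"
  shows "\<exists>f\<in>\<A>. de_rham A (\<alpha> f) c x v \<noteq> 0"
proof (rule ccontr)
  assume "\<not> ?thesis"
  then have z: "\<Gamma> (de_rham A f) c x v = 0" if "f \<in> \<A>" for f
    using that dense differential by (auto simp: dense_in_def topspace_smooth_topology)
  have "continuous_map (smooth_topology A) euclidean ((\<lambda>\<omega>. \<omega> c x v) \<circ> (\<Gamma> \<circ> de_rham A))"
    by (intro continuous_map_compose[OF _ continuous_map_form_evaluation[OF c]]
        continuous_map_compose[OF continuous_map_de_rham \<Gamma>])
  then have "((\<lambda>\<omega>. \<omega> c x v) \<circ> (\<Gamma> \<circ> de_rham A)) f = 0" if "f \<in> smooth_functions A" for f
    by (rule dense_in_kernel[OF _ dense]) (use z that in \<open>simp_all add: topspace_smooth_topology\<close>)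
  then have \<alpha>z: "de_rham A (\<alpha> f) c x v = 0" if "f \<in> smooth_functions A" for f
    using differential that by simp
  let ?V = "{G :: 'm \<Rightarrow> 'q. G \<in> smooth_functions A \<and> de_rham A G c x v = 0}"
  have "cspan {\<alpha> f * (\<lambda>_. q) | f q. f \<in> smooth_functions A} \<subseteq> ?V"
  proof (rule cstar_fun.span_minimal)
    show "{\<alpha> f * (\<lambda>_. q) | f q. f \<in> smooth_functions A} \<subseteq> ?V"
    proof clarify
      fix f :: "'m \<Rightarrow> complex" and q :: 'q assume f: "f \<in> smooth_functions A"
      then have af: "\<alpha> f \<in> smooth_functions A" using \<alpha> by auto
      have e: "\<alpha> f * (\<lambda>_. q) = (\<lambda>x. \<alpha> f x * q)" by auto
      show "\<alpha> f * (\<lambda>_. q) \<in> smooth_functions A \<and> de_rham A (\<alpha> f * (\<lambda>_. q)) c x v = 0"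
        unfolding e using smooth_functions_linear[OF bounded_linear_mult_left af]
          de_rham_linear[OF bounded_linear_mult_left af, of q] \<alpha>z[OF f] by simp
    qed
    show "cstar_fun.subspace ?V"
    proof (rule cstar_fun.subspaceI)
      show "0 \<in> ?V" by (auto simp: smooth_functions_const de_rham_def o_def zero_fun_def)
    next
      fix F G assume "F \<in> ?V" "G \<in> ?V"
      then show "F + G \<in> ?V" by (auto simp: smooth_functions_add de_rham_add plus_fun_def)
    next
      fix a F assume "F \<in> ?V"
      then show "a *\<^sub>C F \<in> ?V"
        using smooth_functions_linear[OF bounded_linear_scaleC_right, of F a]
          de_rham_linear[OF bounded_linear_scaleC_right, of F a] by (auto simp: scaleC_fun_def)
    qed
  qed
  then have kill: "de_rham A G c x v = 0" if "G \<in> smooth_functions A" for G :: "'m \<Rightarrow> 'q"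
    using dense_in_kernel[OF continuous_map_compose[OF continuous_map_de_rham continuous_map_form_evaluation[OF c]] podles] that
    by (auto simp: topspace_smooth_topology)
  obtain G :: "'m \<Rightarrow> real" where G: "G \<in> smooth_functions A" "de_rham A G c x v \<noteq> 0"
    using smooth_bump[OF c v] by blast
  have "de_rham A (\<lambda>x. G x *\<^sub>R (1 :: 'q)) c x v = 0"
    by (rule kill[OF smooth_functions_linear[OF bounded_linear_scaleR_left G(1)]])
  then show False using G(2) de_rham_linear[OF bounded_linear_scaleR_left G(1), of "1 :: 'q"] by simp
qed

end

section \<open>Finitely many differentials separate tangent vectors\<close>

context metric_manifold
begin

text \<open>The metric read in two charts makes the transition derivative an isometry, which gives
  injectivity without inverting the coordinate change.\<close>

lemma transition_nonzero:
  assumes c: "c \<in> A" "c' \<in> A" "x \<in> fst c" "x \<in> fst c'" and v: "v \<noteq> 0"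
  shows "transition_deriv c c' x v \<noteq> 0"
proof
  assume "transition_deriv c c' x v = 0"
  moreover have "g c x v v = g c' x (transition_deriv c c' x v) (transition_deriv c c' x v)"
    using metric c unfolding riemannian_metric_def by blast
  ultimately have "g c x v v = 0" using inner_formD(4)[OF inner_form_metric[OF c(2,4)], of 0] by simp
  then show False using inner_formD(5)[OF inner_form_metric[OF c(1,3)] v] by simp
qed

lemma continuous_on_de_rham:
  assumes F: "F \<in> smooth_functions A" and c: "c \<in> A"
  shows "continuous_on (fst c \<times> UNIV) (\<lambda>(x, w). de_rham A F c x w)"
proof -
  have "continuous_on (fst c) (\<lambda>x. de_rham A F c x b)" for b
  proof -
    have "continuous_on (fst c) (\<lambda>x. de_rham A F c (chart_inv c (snd c x)) b)"
      using continuous_on_compose[OF continuous_on_chart[OF c], of "\<lambda>y. de_rham A F c (chart_inv c y) b"]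
        smooth_on_continuous[OF one_formsD(3)[OF de_rham_one_forms[OF F] c, of b]]
      by (simp add: o_def chart_image_def)
    then show ?thesis by (rule continuous_on_cong[OF refl, THEN iffD1, rotated]) (use c in simp)
  qed
  then have comp: "continuous_on (fst c \<times> UNIV) (\<lambda>p :: 'm \<times> 'e. de_rham A F c (fst p) b)" for b
    using continuous_on_compose[OF continuous_on_fst[OF continuous_on_id], of "fst c \<times> UNIV" "\<lambda>x. de_rham A F c x b"]
    by (simp add: o_def)
  have "continuous_on (fst c \<times> UNIV) (\<lambda>p. \<Sum>b\<in>Basis. (snd p \<bullet> b) *\<^sub>R de_rham A F c (fst p) b)"
    by (intro continuous_intros comp)
  then show ?thesis
  proof (rule continuous_on_cong[OF refl, THEN iffD1, rotated])
    fix p :: "'m \<times> 'e" assume "p \<in> fst c \<times> UNIV"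
    then have l: "linear (de_rham A F c (fst p))"
      using one_formsD(2)[OF de_rham_one_forms[OF F] c] by auto
    show "(\<Sum>b\<in>Basis. (snd p \<bullet> b) *\<^sub>R de_rham A F c (fst p) b) = (case p of (x, w) \<Rightarrow> de_rham A F c x w)"
      using arg_cong[OF euclidean_representation[of "snd p"], of "de_rham A F c (fst p)"]
      by (simp add: linear_sum[OF l] linear_scale[OF l] case_prod_beta)
  qed
qed

text \<open>Compactness is used twice: of the unit sphere over one point, where the tube lemma
  extends the choice to a neighbourhood, and of the manifold.\<close>

lemma finite_separating_family:
  fixes \<H> :: "('m \<Rightarrow> 'q::real_normed_vector) set"
  assumes compact: "compact (UNIV :: 'm set)" and \<H>: "\<H> \<subseteq> smooth_functions A"
    and sep: "\<And>c x v. c \<in> A \<Longrightarrow> x \<in> fst c \<Longrightarrow> v \<noteq> 0 \<Longrightarrow> \<exists>h\<in>\<H>. de_rham A h c x v \<noteq> 0"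
  shows "\<exists>H\<subseteq>\<H>. finite H \<and> (\<forall>c\<in>A. \<forall>x\<in>fst c. \<forall>v. v \<noteq> 0 \<longrightarrow> (\<exists>h\<in>H. de_rham A h c x v \<noteq> 0))"
proof -
  have "\<exists>H U. H \<subseteq> \<H> \<and> finite H \<and> open U \<and> x0 \<in> U \<and>
      (\<forall>x\<in>U. \<forall>c\<in>A. x \<in> fst c \<longrightarrow> (\<forall>v. v \<noteq> 0 \<longrightarrow> (\<exists>h\<in>H. de_rham A h c x v \<noteq> 0)))" for x0
  proof -
    obtain c0 where c0: "c0 \<in> A" "x0 \<in> fst c0" using chart_around by blast
    define S :: "'e set" where "S = sphere 0 1"
    \<comment> \<open>Joint openness in the point and the vector is what lets the tube lemma work;
      it comes from expanding the covector in the standard basis.\<close>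
    define O' where "O' h = (fst c0 \<times> UNIV) \<inter> (\<lambda>(x, w). de_rham A h c0 x w) -` (- {0})" for h :: "'m \<Rightarrow> 'q"
    have op: "open (O' h)" if "h \<in> \<H>" for h
      unfolding O'_def using \<H> that c0
      by (intro continuous_open_preimage continuous_on_de_rham open_Times open_chart) auto
    have cov: "{x0} \<times> S \<subseteq> (\<Union>h\<in>\<H>. O' h)"
    proof clarify
      fix w :: 'e assume "w \<in> S"
      then have "w \<noteq> 0" by (auto simp: S_def)
      from sep[OF c0 this] show "(x0, w) \<in> (\<Union>h\<in>\<H>. O' h)" using c0 by (auto simp: O'_def)
    qed
    have "compact ({x0} \<times> S)" by (simp add: S_def compact_Times)
    then obtain H where H: "H \<subseteq> \<H>" "finite H" "{x0} \<times> S \<subseteq> (\<Union>h\<in>H. O' h)"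
      using compactE_image[OF _ op cov] by metis
    have "open (\<Union>h\<in>H. O' h)" using op H(1) by blast
    then obtain X where X: "x0 \<in> X" "open X" "X \<times> S \<subseteq> (\<Union>h\<in>H. O' h)"
      using Elementary_Topology.tube_lemma[of S "\<Union>h\<in>H. O' h" x0] H(3) by (auto simp: S_def)
    have "\<exists>h\<in>H. de_rham A h c x v \<noteq> 0" if x: "x \<in> X \<inter> fst c0" and c: "c \<in> A" "x \<in> fst c" and v: "v \<noteq> 0" for x c v
    proof -
      \<comment> \<open>The vector is moved to the fixed chart c0; there it may be rescaled to the
        unit sphere, since the covector is linear.\<close>
      define w where "w = transition_deriv c c0 x v"
      have w: "w \<noteq> 0" unfolding w_def using transition_nonzero[OF c(1) c0(1) c(2) _ v] x by auto
      then have "(x, w /\<^sub>R norm w) \<in> X \<times> S" using x by (auto simp: S_def)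
      then obtain h where h: "h \<in> H" "(x, w /\<^sub>R norm w) \<in> O' h" using X(3) by blast
      then have nz: "de_rham A h c0 x (w /\<^sub>R norm w) \<noteq> 0" by (simp add: O'_def)
      have form: "de_rham A h \<in> one_forms A" using h(1) H(1) \<H> by (intro de_rham_one_forms) auto
      have "linear (de_rham A h c0 x)" using one_formsD(2)[OF form c0(1)] x by auto
      then have "de_rham A h c0 x w \<noteq> 0" using nz by (auto simp: linear_scale)
      then have "de_rham A h c x v \<noteq> 0"
        using one_formsD(4)[OF form c(1) c0(1) c(2)] x by (auto simp: w_def)
      then show ?thesis using h(1) by blast
    qed
    then show ?thesis
      using H(1,2) X(1,2) c0 open_chart(1)[OF c0(1)]
      by (intro exI[of _ H] exI[of _ "X \<inter> fst c0"]) blast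
  qed
  then obtain H U where HU: "\<And>x. H x \<subseteq> \<H>" "\<And>x. finite (H x)" "\<And>x. open (U x)" "\<And>x. x \<in> U x"
    "\<And>x0 x c v. x \<in> U x0 \<Longrightarrow> c \<in> A \<Longrightarrow> x \<in> fst c \<Longrightarrow> v \<noteq> 0 \<Longrightarrow> \<exists>h\<in>H x0. de_rham A h c x v \<noteq> 0"
    by metis
  have "UNIV \<subseteq> (\<Union>x\<in>UNIV. U x)" using HU(4) by blast
  then obtain D where "D \<subseteq> UNIV" and D: "finite D" "UNIV \<subseteq> (\<Union>x\<in>D. U x)"
    by (rule compactE_image[OF compact HU(3)])
  show ?thesis
  proof (intro exI[of _ "\<Union>x\<in>D. H x"] conjI ballI allI impI)
    fix c x and v :: 'e assume cx: "c \<in> A" "x \<in> fst c" "v \<noteq> 0"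
    obtain x0 where "x0 \<in> D" "x \<in> U x0" using D(2) by blast
    then show "\<exists>h\<in>\<Union>x\<in>D. H x. de_rham A h c x v \<noteq> 0" using HU(5)[OF _ cx] by blast
  qed (use HU(1,2) D(1) in auto)
qed

end

context algebraic_coaction
begin

lemma finite_subset_of_pieces:
  assumes "finite H" "\<And>h. h \<in> H \<Longrightarrow> \<exists>Gs. pieces Gs \<and> h \<in> entries Gs"
  shows "\<exists>Gs. pieces Gs \<and> H \<subseteq> entries Gs"
  using assms
proof (induction H rule: finite_induct)
  case empty
  show ?case by (intro exI[of _ "[]"]) (simp add: pieces_def)
next
  case (insert h H)
  then obtain Gs Gs' where "pieces Gs" "H \<subseteq> entries Gs" "pieces Gs'" "h \<in> entries Gs'" by blast
  then show ?case by (intro exI[of _ "Gs @ Gs'"]) (auto simp: pieces_def entries_append)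
qed

lemma pieces_subset: "pieces Gs \<Longrightarrow> entries Gs \<subseteq> \<A>"
  by (fastforce simp: pieces_def entries_def piece_def)

end

section \<open>The metric defined by an orthogonal family\<close>

text \<open>No cyclicity of the trace is involved: star Z_ij = Z_ji by selfadjointness, and \<Sum>_i
  Z_ji Z_ij = Z_jj by idempotence, so the sum of squares is the difference of the traces.\<close>

lemma comparable_projections_eqI:
  fixes P Q :: "'i \<Rightarrow> 'i \<Rightarrow> 'a::cstar_algebra"
  assumes I: "finite I"
    and PP: "\<And>i k. i \<in> I \<Longrightarrow> k \<in> I \<Longrightarrow> (\<Sum>j\<in>I. P i j * P j k) = P i k"
    and PQ: "\<And>i k. i \<in> I \<Longrightarrow> k \<in> I \<Longrightarrow> (\<Sum>j\<in>I. P i j * Q j k) = Q i k"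
    and QP: "\<And>i k. i \<in> I \<Longrightarrow> k \<in> I \<Longrightarrow> (\<Sum>j\<in>I. Q i j * P j k) = Q i k"
    and QQ: "\<And>i k. i \<in> I \<Longrightarrow> k \<in> I \<Longrightarrow> (\<Sum>j\<in>I. Q i j * Q j k) = Q i k"
    and P: "\<And>i j. i \<in> I \<Longrightarrow> j \<in> I \<Longrightarrow> star (P i j) = P j i"
    and Q: "\<And>i j. i \<in> I \<Longrightarrow> j \<in> I \<Longrightarrow> star (Q i j) = Q j i"
    and trace: "(\<Sum>i\<in>I. P i i) = (\<Sum>i\<in>I. Q i i)"
    and ij: "i \<in> I" "j \<in> I"
  shows "P i j = Q i j"
proof -
  define Z where "Z i j = P i j - Q i j" for i j
  have ZZ: "(\<Sum>j\<in>I. Z i j * Z j k) = Z i k" if "i \<in> I" "k \<in> I" for i k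
  proof -
    have "(\<Sum>j\<in>I. Z i j * Z j k) =
        (\<Sum>j\<in>I. P i j * P j k) - (\<Sum>j\<in>I. P i j * Q j k) - ((\<Sum>j\<in>I. Q i j * P j k) - (\<Sum>j\<in>I. Q i j * Q j k))"
      by (simp add: Z_def algebra_simps sum_subtractf sum.distrib)
    then show ?thesis using that by (simp add: PP PQ QP QQ Z_def)
  qed
  have "(\<Sum>p\<in>I \<times> I. star (Z (fst p) (snd p)) * Z (fst p) (snd p)) = (\<Sum>i\<in>I. \<Sum>j\<in>I. Z j i * Z i j)"
    unfolding sum.cartesian_product by (rule sum.cong) (auto simp: Z_def star_diff P Q)
  also have "\<dots> = (\<Sum>j\<in>I. Z j j)" by (subst sum.swap) (simp add: ZZ)
  also have "\<dots> = 0" using trace by (simp add: Z_def sum_subtractf)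
  finally have "Z (fst (i, j)) (snd (i, j)) = 0"
    by (rule sum_star_mult_eq_0D[of "I \<times> I", rotated]) (use I ij in auto)
  then show ?thesis by (simp add: Z_def)
qed

text \<open>Linear algebra in one tangent space: \<open>D i\<close> is the differential of f_i at a
  point, and \<open>h\<close> the metric that these differentials define.\<close>

locale covector_frame =
  fixes B :: "'i set" and D :: "'i \<Rightarrow> 'e::euclidean_space \<Rightarrow> real" and h :: "'e \<Rightarrow> 'e \<Rightarrow> real"
  assumes finite_frame: "finite B" and linear_covector: "\<And>i. i \<in> B \<Longrightarrow> linear (D i)"
    and form: "inner_form h" and form_eq: "\<And>v w. h v w = (\<Sum>i\<in>B. D i v * D i w)"
begin

definition gram :: "'i \<Rightarrow> 'i \<Rightarrow> real" where
  "gram i j = (\<Sum>b\<in>Basis. D i (sharp h b) * D j b)"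

text \<open>The gradient of the j-th function. The Gram matrix then consists of values of covectors
  on gradients, and gram identities follow by inserting gradients for w.\<close>

definition dual_vector :: "'i \<Rightarrow> 'e" where
  "dual_vector j = (\<Sum>b\<in>Basis. D j b *\<^sub>R sharp h b)"

lemma resolution: "(\<Sum>i\<in>B. D i (sharp h b) * D i w) = w \<bullet> b"
  using form_eq[of "sharp h b" w] sharp_inner[OF form, of b w] by (simp add: inner_commute)

lemma covector_dual_vector: "i \<in> B \<Longrightarrow> D i (dual_vector j) = gram i j"
  by (simp add: dual_vector_def gram_def linear_sum[OF linear_covector] linear_scale[OF linear_covector] mult.commute)

lemma form_dual_vector:
  assumes "j \<in> B" shows "h (dual_vector j) v = D j v"
proof -
  have "h (dual_vector j) v = (\<Sum>b\<in>Basis. D j b * (b \<bullet> v))"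
    by (simp add: dual_vector_def linear_sum[OF inner_formD(2)[OF form]] linear_scale[OF inner_formD(2)[OF form]] sharp_inner[OF form])
  also have "\<dots> = D j (\<Sum>b\<in>Basis. (v \<bullet> b) *\<^sub>R b)"
    by (simp add: linear_sum[OF linear_covector[OF assms]] linear_scale[OF linear_covector[OF assms]] inner_commute mult.commute)
  finally show ?thesis by (simp add: euclidean_representation)
qed

lemma gram_sym: "i \<in> B \<Longrightarrow> j \<in> B \<Longrightarrow> gram i j = gram j i"
  using form_dual_vector[of i "dual_vector j"] form_dual_vector[of j "dual_vector i"]
    inner_formD(3)[OF form, of "dual_vector i" "dual_vector j"] covector_dual_vector by simp

text \<open>As h is the sum of the squares of the \<open>D i\<close>, these form a Parseval frame of
  the dual space. The Gram matrix therefore is the projection onto the vectors of the form (D_i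
  w)_i.\<close>

lemma gram_reproduce:
  assumes "i \<in> B" shows "(\<Sum>j\<in>B. gram i j * D j w) = D i w"
proof -
  note l = linear_sum[OF linear_covector[OF assms]] linear_scale[OF linear_covector[OF assms]]
  have "(\<Sum>j\<in>B. gram i j * D j w) = (\<Sum>b\<in>Basis. D i (sharp h b) * (\<Sum>j\<in>B. D j b * D j w))"
    unfolding gram_def sum_distrib_left sum_distrib_right by (subst sum.swap) (simp add: mult.assoc)
  also have "\<dots> = (\<Sum>b\<in>Basis. h b w * D i (sharp h b))" by (simp add: form_eq mult.commute)
  also have "\<dots> = D i (\<Sum>b\<in>Basis. h b w *\<^sub>R sharp h b)" by (simp add: l)
  also have "\<dots> = D i w" using sharp_expansion[OF form, of w] by simp
  finally show ?thesis .
qed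

lemma gram_idempotent: "i \<in> B \<Longrightarrow> (\<Sum>j\<in>B. gram i j * gram j k) = gram i k"
  using gram_reproduce[of i "dual_vector k"] covector_dual_vector by simp

text \<open>Summing over the frame turns \<open>sharp h b\<close> paired with b into b \<bullet> b,
  so each basis vector contributes 1.\<close>

lemma gram_trace: "(\<Sum>i\<in>B. gram i i) = DIM('e)"
proof -
  have "(\<Sum>i\<in>B. gram i i) = (\<Sum>b\<in>Basis. \<Sum>i\<in>B. D i (sharp h b) * D i b)"
    unfolding gram_def by (rule sum.swap)
  then show ?thesis by (simp add: resolution inner_same_Basis)
qed

end

section \<open>The metric of an orthogonal family and its invariance\<close>

locale framed_action = smooth_manifold A + algebraic_coaction t \<Delta> \<alpha> \<A>
  for A :: "('m::t2_space, 'e::euclidean_space) chart set"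
    and t :: "'q::cstar_algebra \<Rightarrow> 'q \<Rightarrow> 'qq::cstar_algebra" and \<Delta> :: "'q \<Rightarrow> 'qq"
    and \<alpha> :: "('m \<Rightarrow> complex) \<Rightarrow> ('m \<Rightarrow> 'q)" and \<A> :: "('m \<Rightarrow> complex) set" +
  fixes \<Gamma> :: "('m, 'e, complex) form \<Rightarrow> ('m, 'e, 'q) form"
    and B :: "('m \<Rightarrow> complex) set" and q :: "('m \<Rightarrow> complex) \<Rightarrow> ('m \<Rightarrow> complex) \<Rightarrow> 'q"
  assumes smooth_action: "\<alpha> \<in> smooth_functions A \<rightarrow> smooth_functions A"
    and \<Gamma>_linear: "clinear_on (one_forms A) \<Gamma>"
    and \<Gamma>_forms: "\<Gamma> \<in> one_forms A \<rightarrow> one_forms A"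
    and \<Gamma>_times: "\<And>\<omega> f. \<omega> \<in> one_forms A \<Longrightarrow> f \<in> smooth_functions A \<Longrightarrow>
      \<Gamma> (form_times \<omega> f) = form_times (\<Gamma> \<omega>) (\<alpha> f) \<and> \<Gamma> (form_times \<omega> f) = times_form (\<alpha> f) (\<Gamma> \<omega>)"
    and differential: "\<And>f. f \<in> smooth_functions A \<Longrightarrow> \<Gamma> (de_rham A f) = de_rham A (\<alpha> f)"
    and finite_B: "finite B" and smooth_B: "B \<subseteq> smooth_functions A"
    and real_B: "\<And>f x. f \<in> B \<Longrightarrow> cnj (f x) = f x"
    and action_B: "\<And>f x. f \<in> B \<Longrightarrow> \<alpha> f x = (\<Sum>h\<in>B. h x *\<^sub>C q h f)"
    and star_q: "\<And>f h. f \<in> B \<Longrightarrow> h \<in> B \<Longrightarrow> star (q h f) = q h f"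
    and orthogonal_q: "\<And>f h. f \<in> B \<Longrightarrow> h \<in> B \<Longrightarrow> (\<Sum>k\<in>B. q f k * q h k) = (if f = h then 1 else 0)"
    and separating: "\<And>c x v. c \<in> A \<Longrightarrow> x \<in> fst c \<Longrightarrow> v \<noteq> 0 \<Longrightarrow> \<exists>f\<in>B. de_rham A f c x v \<noteq> 0"
begin

lemma B_forms: "f \<in> B \<Longrightarrow> de_rham A f \<in> one_forms A"
  using smooth_B by (auto intro: de_rham_one_forms)

definition covector :: "('m, 'e) chart \<Rightarrow> 'm \<Rightarrow> ('m \<Rightarrow> complex) \<Rightarrow> 'e \<Rightarrow> real" where
  "covector c x f v = Re (de_rham A f c x v)"

lemma de_rham_covector:
  assumes "f \<in> B" shows "de_rham A f c x v = of_real (covector c x f v)"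
proof -
  have "f \<in> smooth_functions A" using smooth_B assms by blast
  from de_rham_linear[OF bounded_linear_cnj this, unfolded real_B[OF assms]]
  have "cnj (de_rham A f c x v) = de_rham A f c x v" by (metis (no_types))
  then show ?thesis by (simp add: covector_def complex_eq_iff)
qed

lemma linear_covector: "f \<in> B \<Longrightarrow> c \<in> A \<Longrightarrow> x \<in> fst c \<Longrightarrow> linear (covector c x f)"
  using linear_compose[OF one_formsD(2)[OF B_forms] bounded_linear.linear[OF bounded_linear_Re], of f c x]
  by (simp add: covector_def[abs_def] o_def)

definition frame_metric :: "('m, 'e) metric_field" where
  "frame_metric c x v w = (\<Sum>f\<in>B. covector c x f v * covector c x f w)"

lemma riemannian_frame_metric: "riemannian_metric A frame_metric"
  unfolding riemannian_metric_def
proof (intro conjI ballI allI impI)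
  fix c assume c: "c \<in> A"
  show "smooth_on (chart_image c) (\<lambda>y. frame_metric c (chart_inv c y) v w)" for v w
    unfolding frame_metric_def covector_def
    by (intro smooth_on_sum smooth_on_mult smooth_on_linear[OF _ bounded_linear_Re]
        one_formsD(3)[OF B_forms] open_chart(2)[OF c] c)
  show "frame_metric c x v w = frame_metric c' x (transition_deriv c c' x v) (transition_deriv c c' x w)"
    if "c' \<in> A" "x \<in> fst c \<inter> fst c'" for c' x v w
    unfolding frame_metric_def covector_def
    using one_formsD(4)[OF B_forms c that(1), of _ x] that by simp
  fix x assume x: "x \<in> fst c"
  show "bilinear (frame_metric c x)"
    unfolding bilinear_def frame_metric_def
    using linear_covector[OF _ c x]
    by (auto intro!: linearI simp: linear_add linear_scale algebra_simps sum.distrib sum_distrib_left)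
  show "frame_metric c x v w = frame_metric c x w v" for v w
    by (simp add: frame_metric_def mult.commute)
  show "frame_metric c x v v > 0" if v: "v \<noteq> 0" for v
  proof -
    obtain f where f: "f \<in> B" "covector c x f v \<noteq> 0"
      using separating[OF c x v] de_rham_covector by auto
    show ?thesis unfolding frame_metric_def
      by (rule sum_pos2[OF finite_B f(1)]) (use f in \<open>auto simp: zero_less_mult_iff not_less order_less_le\<close>)
  qed
qed

sublocale metric_manifold A frame_metric
  by unfold_locales (rule riemannian_frame_metric)

lemma covector_frame: "c \<in> A \<Longrightarrow> x \<in> fst c \<Longrightarrow> covector_frame B (covector c x) (frame_metric c x)"
  by (rule covector_frame.intro) (simp_all add: finite_B linear_covector inner_form_metric, simp add: frame_metric_def)

definition coefficient :: "('m \<Rightarrow> complex) \<Rightarrow> ('m \<Rightarrow> complex) \<Rightarrow> 'm \<Rightarrow> complex" where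
  "coefficient i f = form_inner A frame_metric (de_rham A i) (de_rham A f)"

lemma coefficient_smooth: "i \<in> B \<Longrightarrow> f \<in> smooth_functions A \<Longrightarrow> coefficient i f \<in> smooth_functions A"
  unfolding coefficient_def by (intro form_inner_smooth B_forms de_rham_one_forms)

lemma coefficient_cts: "i \<in> B \<Longrightarrow> f \<in> smooth_functions A \<Longrightarrow> coefficient i f \<in> cts"
  using coefficient_smooth smooth_functions_cts by blast

lemma coefficient_chart:
  assumes "i \<in> B" "f \<in> smooth_functions A" "c \<in> A" "x \<in> fst c"
  shows "coefficient i f x = (\<Sum>b\<in>Basis. of_real (covector c x i (sharp (frame_metric c x) b)) * de_rham A f c x b)"
  unfolding coefficient_def form_inner_chart[OF B_forms[OF assms(1)] de_rham_one_forms[OF assms(2)] assms(3,4)]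
  by (simp add: de_rham_covector[OF assms(1)])

lemma coefficient_gram:
  assumes "i \<in> B" "j \<in> B" "c \<in> A" "x \<in> fst c"
  shows "coefficient i j x = of_real (covector_frame.gram (covector c x) (frame_metric c x) i j)"
  using coefficient_chart[OF assms(1) _ assms(3,4), of j] assms(2) smooth_B
    covector_frame.gram_def[OF covector_frame[OF assms(3,4)], of i j]
  by (auto simp: de_rham_covector)

text \<open>The Parseval property, applied at each point with the coefficients \<langle>df_i,
  df\<rangle>. These are globally smooth functions, so the module rule for \<Gamma> can be used on
  the expansion.\<close>

lemma de_rham_expansion:
  assumes f: "f \<in> smooth_functions A"
  shows "de_rham A f = (\<lambda>c x v. \<Sum>i\<in>B. de_rham A i c x v * coefficient i f x)"
proof (intro ext)
  fix c x v
  show "de_rham A f c x v = (\<Sum>i\<in>B. de_rham A i c x v * coefficient i f x)"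
  proof (cases "c \<in> A \<and> x \<in> fst c")
    case True
    then interpret F: covector_frame B "covector c x" "frame_metric c x" by (intro covector_frame) auto
    let ?s = "sharp (frame_metric c x)"
    have l: "linear (de_rham A f c x)" using one_formsD(2)[OF de_rham_one_forms[OF f]] True by blast
    have "(\<Sum>i\<in>B. de_rham A i c x v * coefficient i f x) =
        (\<Sum>i\<in>B. \<Sum>b\<in>Basis. of_real (covector c x i (?s b) * covector c x i v) * de_rham A f c x b)"
      using True by (simp add: coefficient_chart[OF _ f, of _ c x] de_rham_covector sum_distrib_left mult_ac)
    also have "\<dots> = (\<Sum>b\<in>Basis. of_real (\<Sum>i\<in>B. covector c x i (?s b) * covector c x i v) * de_rham A f c x b)"
      by (subst sum.swap) (simp add: sum_distrib_right)
    also have "\<dots> = (\<Sum>b\<in>Basis. (v \<bullet> b) *\<^sub>R de_rham A f c x b)"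
      by (simp only: F.resolution scaleR_conv_of_real)
    also have "\<dots> = de_rham A f c x v"
      using arg_cong[OF euclidean_representation[of v], of "de_rham A f c x"]
      by (simp add: linear_sum[OF l] linear_scale[OF l])
    finally show ?thesis by simp
  next
    case False
    then show ?thesis by (auto simp: de_rham_def)
  qed
qed

lemma \<Gamma>_zero: "\<Gamma> (\<lambda>c x v. 0) = (\<lambda>c x v. 0)"
proof -
  have z: "(\<lambda>c x v. 0 :: complex) \<in> one_forms A" by (rule one_forms_zero)
  then have "\<Gamma> (0 *\<^sub>C (\<lambda>c x v. 0)) = 0 *\<^sub>C \<Gamma> (\<lambda>c x v. 0)" using \<Gamma>_linear unfolding clinear_on_def by blast
  then show ?thesis by (simp add: scaleC_fun_def)
qed

lemma \<Gamma>_sum: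
  assumes "finite I" "\<And>i. i \<in> I \<Longrightarrow> \<omega> i \<in> one_forms A"
  shows "\<Gamma> (\<lambda>c x v. \<Sum>i\<in>I. \<omega> i c x v) = (\<lambda>c x v. \<Sum>i\<in>I. \<Gamma> (\<omega> i) c x v)"
  using assms
proof (induction I rule: finite_induct)
  case (insert i I)
  have "\<Gamma> (\<omega> i + (\<lambda>c x v. \<Sum>i\<in>I. \<omega> i c x v)) = \<Gamma> (\<omega> i) + \<Gamma> (\<lambda>c x v. \<Sum>i\<in>I. \<omega> i c x v)"
    using \<Gamma>_linear insert.prems one_forms_sum[of I \<omega>] unfolding clinear_on_def by blast
  then show ?case using insert by (simp add: plus_fun_def)
qed (simp add: \<Gamma>_zero)

text \<open>The module rule is available on both sides, so the factor \<alpha>(\<langle>df_i,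
  df\<rangle>) may stand on either side of \<Gamma>(df_i), although values in the algebra do not
  commute in general.\<close>

lemma \<Gamma>_expansion:
  assumes f: "f \<in> smooth_functions A"
  shows "\<Gamma> (de_rham A f) c x v = (\<Sum>i\<in>B. \<Gamma> (de_rham A i) c x v * \<alpha> (coefficient i f) x)"
    "\<Gamma> (de_rham A f) c x v = (\<Sum>i\<in>B. \<alpha> (coefficient i f) x * \<Gamma> (de_rham A i) c x v)"
proof -
  have forms: "form_times (de_rham A i) (coefficient i f) \<in> one_forms A" if "i \<in> B" for i
    unfolding form_times_def by (rule one_forms_times[OF B_forms[OF that] coefficient_smooth[OF that f]])
  have "\<Gamma> (de_rham A f) = (\<lambda>c x v. \<Sum>i\<in>B. \<Gamma> (form_times (de_rham A i) (coefficient i f)) c x v)"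
    using \<Gamma>_sum[OF finite_B forms] de_rham_expansion[OF f] by (simp add: form_times_def)
  then have e: "\<Gamma> (de_rham A f) c x v = (\<Sum>i\<in>B. \<Gamma> (form_times (de_rham A i) (coefficient i f)) c x v)" by simp
  have "\<Gamma> (form_times (de_rham A i) (coefficient i f)) c x v = \<Gamma> (de_rham A i) c x v * \<alpha> (coefficient i f) x"
    "\<Gamma> (form_times (de_rham A i) (coefficient i f)) c x v = \<alpha> (coefficient i f) x * \<Gamma> (de_rham A i) c x v" if "i \<in> B" for i
    using \<Gamma>_times[OF B_forms[OF that] coefficient_smooth[OF that f]] by (metis form_times_def, metis times_form_def)
  then show "\<Gamma> (de_rham A f) c x v = (\<Sum>i\<in>B. \<Gamma> (de_rham A i) c x v * \<alpha> (coefficient i f) x)"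
    "\<Gamma> (de_rham A f) c x v = (\<Sum>i\<in>B. \<alpha> (coefficient i f) x * \<Gamma> (de_rham A i) c x v)"
    unfolding e by (simp_all cong: sum.cong)
qed

lemma \<Gamma>_frame:
  assumes j: "j \<in> B"
  shows "\<Gamma> (de_rham A j) c x v = (\<Sum>h\<in>B. covector c x h v *\<^sub>R q h j)"
proof -
  have sm: "h \<in> smooth_functions A" if "h \<in> B" for h using smooth_B that by blast
  have "\<alpha> j = (\<lambda>x. \<Sum>h\<in>B. h x *\<^sub>C q h j)" using action_B[OF j] by blast
  then have "\<Gamma> (de_rham A j) = de_rham A (\<lambda>x. \<Sum>h\<in>B. h x *\<^sub>C q h j)" using differential[OF sm[OF j]] by simp
  also have "\<dots> = (\<lambda>c x v. \<Sum>h\<in>B. de_rham A (\<lambda>x. h x *\<^sub>C q h j) c x v)"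
    by (rule de_rham_sum[OF finite_B smooth_functions_linear[OF bounded_linear_scaleC_left sm]])
  finally have "\<Gamma> (de_rham A j) c x v = (\<Sum>h\<in>B. de_rham A (\<lambda>x. h x *\<^sub>C q h j) c x v)" by simp
  also have "\<dots> = (\<Sum>h\<in>B. covector c x h v *\<^sub>R q h j)"
  proof (rule sum.cong[OF refl])
    fix h assume h: "h \<in> B"
    show "de_rham A (\<lambda>x. h x *\<^sub>C q h j) c x v = covector c x h v *\<^sub>R q h j"
      using fun_cong[OF fun_cong[OF fun_cong[OF de_rham_linear[OF bounded_linear_scaleC_left sm[OF h]]]], of "q h j" c x v]
      by (simp add: de_rham_covector[OF h] scaleC_of_real)
  qed
  finally show ?thesis .
qed

text \<open>The chart enters on the right only, as a way to evaluate \<langle>\<Gamma>(df_i),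
  \<Gamma>(df_j)\<rangle> at x. The left side applies \<alpha> to a function on the whole manifold,
  so identities for it have to hold at all points and not just at x.\<close>

lemma action_gram:
  assumes i: "i \<in> B" and j: "j \<in> B" and c: "c \<in> A" "x \<in> fst c"
  shows "\<alpha> (coefficient i j) x =
    (\<Sum>b\<in>Basis. star (\<Gamma> (de_rham A i) c x (sharp (frame_metric c x) b)) * \<Gamma> (de_rham A j) c x b)"
proof -
  interpret F: covector_frame B "covector c x" "frame_metric c x" by (rule covector_frame[OF c])
  let ?s = "sharp (frame_metric c x)"
  define P where "P i j = \<alpha> (coefficient i j) x" for i j
  define Y where "Y i v = \<Gamma> (de_rham A i) c x v" for i v
  define Q where "Q i j = (\<Sum>b\<in>Basis. star (Y i (?s b)) * Y j b)" for i j
  have sm: "h \<in> smooth_functions A" if "h \<in> B" for h using smooth_B that by blast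
  have cf: "coefficient i j \<in> cts" if "i \<in> B" "j \<in> B" for i j using coefficient_cts that sm by blast
  \<comment> \<open>The Gram identities are pointwise and each point has its own chart. They are
    collected here as statements on functions, to which the homomorphism \<alpha> can be
    applied.\<close>
  have gram_at: "\<exists>G. (\<forall>i\<in>B. \<forall>j\<in>B. coefficient i j y = of_real (G i j) \<and> G i j = G j i \<and>
      (\<forall>k\<in>B. (\<Sum>j\<in>B. G i j * G j k) = G i k)) \<and> (\<Sum>i\<in>B. G i i) = DIM('e)" for y
  proof -
    obtain c' where c': "c' \<in> A" "y \<in> fst c'" using chart_around by blast
    interpret F': covector_frame B "covector c' y" "frame_metric c' y" by (rule covector_frame[OF c'])
    show ?thesis
      by (rule exI[of _ F'.gram])
        (use coefficient_gram[OF _ _ c'] F'.gram_sym F'.gram_idempotent F'.gram_trace in blast)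
  qed
  have sym: "coefficient i j = coefficient j i" and real: "cnj (coefficient i j y) = coefficient i j y"
    and idem: "(\<Sum>j\<in>B. coefficient i j y * coefficient j k y) = coefficient i k y"
    if "i \<in> B" "j \<in> B" "k \<in> B" for i j k y
  proof -
    show "coefficient i j = coefficient j i"
    proof
      fix y
      obtain G where "\<forall>i\<in>B. \<forall>j\<in>B. coefficient i j y = of_real (G i j) \<and> G i j = G j i" using gram_at[of y] by blast
      then show "coefficient i j y = coefficient j i y" using that by simp
    qed
    obtain G where G: "\<forall>i\<in>B. \<forall>j\<in>B. coefficient i j y = of_real (G i j) \<and> G i j = G j i \<and>
      (\<forall>k\<in>B. (\<Sum>j\<in>B. G i j * G j k) = G i k)" using gram_at[of y] by blast
    then have Gc: "\<And>a b. a \<in> B \<Longrightarrow> b \<in> B \<Longrightarrow> coefficient a b y = of_real (G a b)"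
      and Gi: "(\<Sum>j\<in>B. G i j * G j k) = G i k" using that by blast+
    show "cnj (coefficient i j y) = coefficient i j y" using Gc that by simp
    have "(\<Sum>j\<in>B. coefficient i j y * coefficient j k y) = of_real (\<Sum>j\<in>B. G i j * G j k)"
      using that by (simp add: Gc)
    also have "\<dots> = coefficient i k y" using that by (simp add: Gi Gc)
    finally show "(\<Sum>j\<in>B. coefficient i j y * coefficient j k y) = coefficient i k y" .
  qed
  have trace: "(\<Sum>i\<in>B. coefficient i i y) = of_nat DIM('e)" for y
  proof -
    obtain G where G: "\<forall>i\<in>B. \<forall>j\<in>B. coefficient i j y = of_real (G i j)" "(\<Sum>i\<in>B. G i i) = DIM('e)"
      using gram_at[of y] by blast
    have "(\<Sum>i\<in>B. coefficient i i y) = of_real (\<Sum>i\<in>B. G i i)" using G(1) by simp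
    then show ?thesis by (simp add: G(2))
  qed
  have YQ: "Y j v = (\<Sum>h\<in>B. covector c x h v *\<^sub>R q h j)" if "j \<in> B" for j v
    using \<Gamma>_frame[OF that] by (simp add: Y_def)
  have Q_gram: "Q i j = (\<Sum>k\<in>B. \<Sum>l\<in>B. F.gram k l *\<^sub>R (q k i * q l j))" if "i \<in> B" "j \<in> B" for i j
  proof -
    have "Q i j = (\<Sum>b\<in>Basis. \<Sum>k\<in>B. \<Sum>l\<in>B. (covector c x k (?s b) * covector c x l b) *\<^sub>R (q k i * q l j))"
      unfolding Q_def using that
      by (simp add: YQ star_sum star_scaleR star_q sum_product mult.commute)
    also have "\<dots> = (\<Sum>k\<in>B. \<Sum>l\<in>B. \<Sum>b\<in>Basis. (covector c x k (?s b) * covector c x l b) *\<^sub>R (q k i * q l j))"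
      by (subst sum.swap, rule sum.cong[OF refl], rule sum.swap)
    finally show ?thesis by (simp add: F.gram_def scaleR_sum_left)
  qed
  have P_star: "star (P i j) = P i j" "P i j = P j i" if "i \<in> B" "j \<in> B" for i j
    unfolding P_def
    by (rule action_star[OF cf[OF that], of x, unfolded real[OF that that(1)], symmetric])
      (rule arg_cong[OF sym[OF that that(1)], of "\<lambda>f. \<alpha> f x"])
  have PY: "(\<Sum>j\<in>B. P j i * Y j v) = Y i v" "(\<Sum>j\<in>B. Y j v * P j i) = Y i v" if "i \<in> B" for i v
    using \<Gamma>_expansion[OF sm[OF that], of c x v] by (simp_all add: P_def Y_def)
  have star_Q: "star (Q i j) = Q j i" if "i \<in> B" "j \<in> B" for i j
    unfolding Q_gram[OF that] Q_gram[OF that(2,1)] star_sum star_scaleR star_mult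
    by (subst sum.swap) (use that in \<open>auto simp: star_q F.gram_sym intro!: sum.cong\<close>)
  have "P i j = Q i j"
  proof (rule comparable_projections_eqI[OF finite_B _ _ _ _ _ _ _ i j])
    fix i k assume ik: "i \<in> B" "k \<in> B"
    show "(\<Sum>j\<in>B. P i j * P j k) = P i k"
    proof -
      have "(\<Sum>j\<in>B. P i j * P j k) = (\<Sum>j\<in>B. 1 *\<^sub>C \<alpha> (\<lambda>y. coefficient i j y * coefficient j k y) x)"
        using ik by (intro sum.cong refl) (simp add: P_def action_mult cf)
      also have "\<dots> = \<alpha> (\<lambda>y. \<Sum>j\<in>B. 1 * (coefficient i j y * coefficient j k y)) x"
        by (rule action_combination[symmetric])
          (use cf ik in \<open>auto simp: cts_def intro!: continuous_intros\<close>)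
      also have "(\<lambda>y. \<Sum>j\<in>B. 1 * (coefficient i j y * coefficient j k y)) = coefficient i k"
        using idem[OF ik(1) ik(1) ik(2)] by auto
      finally show ?thesis by (simp add: P_def)
    qed
    show "(\<Sum>j\<in>B. P i j * Q j k) = Q i k"
    proof -
      \<comment> \<open>The adjoint of \<Sum>_j Y_j P_ji = Y_i: P acts from the left on the
        adjoints, which is where they stand in Q.\<close>
      have PsY: "(\<Sum>j\<in>B. P i j * star (Y j v)) = star (Y i v)" for v
      proof -
        have "star (\<Sum>j\<in>B. Y j v * P j i) = (\<Sum>j\<in>B. P i j * star (Y j v))"
          unfolding star_sum star_mult using P_star ik by (intro sum.cong refl) metis
        then show ?thesis using PY(2)[OF ik(1)] by simp
      qed
      have "(\<Sum>j\<in>B. P i j * Q j k) = (\<Sum>b\<in>Basis. (\<Sum>j\<in>B. P i j * star (Y j (?s b))) * Y k b)"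
        unfolding Q_def sum_distrib_left sum_distrib_right by (subst sum.swap) (simp add: mult.assoc)
      then show ?thesis by (simp add: PsY Q_def)
    qed
    show "(\<Sum>j\<in>B. Q i j * P j k) = Q i k"
    proof -
      have "(\<Sum>j\<in>B. Q i j * P j k) = (\<Sum>b\<in>Basis. star (Y i (?s b)) * (\<Sum>j\<in>B. Y j b * P j k))"
        unfolding Q_def sum_distrib_left sum_distrib_right by (subst sum.swap) (simp add: mult.assoc)
      then show ?thesis by (simp add: PY(2)[OF ik(2)] Q_def)
    qed
    show "(\<Sum>j\<in>B. Q i j * Q j k) = Q i k"
    proof -
      \<comment> \<open>The inner factors are adjacent and share the index r, so row orthogonality
        contracts them to a Kronecker delta without any commutation. The square of Q then carries
        the square of the Gram matrix.\<close>
      have q: "(\<Sum>r\<in>B. (q a i * q l r) * (q m r * q n k)) = (if l = m then q a i * q n k else 0)"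
        if "l \<in> B" "m \<in> B" for a l m n
      proof -
        have "(\<Sum>r\<in>B. (q a i * q l r) * (q m r * q n k)) = q a i * (\<Sum>r\<in>B. q l r * q m r) * q n k"
          by (simp add: sum_distrib_left sum_distrib_right mult.assoc)
        then show ?thesis using orthogonal_q[OF that] by simp
      qed
      have "(\<Sum>r\<in>B. Q i r * Q r k) = (\<Sum>r\<in>B. \<Sum>a\<in>B. \<Sum>l\<in>B. \<Sum>m\<in>B. \<Sum>n\<in>B.
          (F.gram a l * F.gram m n) *\<^sub>R ((q a i * q l r) * (q m r * q n k)))"
      proof (rule sum.cong[OF refl])
        fix r assume r: "r \<in> B"
        show "Q i r * Q r k = (\<Sum>a\<in>B. \<Sum>l\<in>B. \<Sum>m\<in>B. \<Sum>n\<in>B.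
            (F.gram a l * F.gram m n) *\<^sub>R ((q a i * q l r) * (q m r * q n k)))"
          unfolding Q_gram[OF ik(1) r] Q_gram[OF r ik(2)] sum_distrib_right
          unfolding sum_distrib_left mult_scaleR_left mult_scaleR_right scaleR_scaleR
          by (intro sum.cong refl) (simp only: mult.commute)
      qed
      also have "\<dots> = (\<Sum>a\<in>B. \<Sum>l\<in>B. \<Sum>m\<in>B. \<Sum>n\<in>B. \<Sum>r\<in>B.
          (F.gram a l * F.gram m n) *\<^sub>R ((q a i * q l r) * (q m r * q n k)))"
        by (subst sum.swap, rule sum.cong[OF refl], subst sum.swap, rule sum.cong[OF refl],
            subst sum.swap, rule sum.cong[OF refl], rule sum.swap)
      also have "\<dots> = (\<Sum>a\<in>B. \<Sum>l\<in>B. \<Sum>m\<in>B. \<Sum>n\<in>B.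
          if l = m then (F.gram a l * F.gram m n) *\<^sub>R (q a i * q n k) else 0)"
        unfolding scaleR_sum_right[symmetric] by (intro sum.cong refl) (simp add: q)
      also have "\<dots> = (\<Sum>a\<in>B. \<Sum>l\<in>B. \<Sum>n\<in>B. (F.gram a l * F.gram l n) *\<^sub>R (q a i * q n k))"
      proof (rule sum.cong[OF refl], rule sum.cong[OF refl])
        fix a l assume "l \<in> B"
        have "(\<Sum>m\<in>B. \<Sum>n\<in>B. if l = m then (F.gram a l * F.gram m n) *\<^sub>R (q a i * q n k) else 0) =
            (\<Sum>m\<in>B. if l = m then \<Sum>n\<in>B. (F.gram a l * F.gram m n) *\<^sub>R (q a i * q n k) else 0)"
          by (intro sum.cong refl) auto
        then show "(\<Sum>m\<in>B. \<Sum>n\<in>B. if l = m then (F.gram a l * F.gram m n) *\<^sub>R (q a i * q n k) else 0) =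
            (\<Sum>n\<in>B. (F.gram a l * F.gram l n) *\<^sub>R (q a i * q n k))"
          using \<open>l \<in> B\<close> finite_B by simp
      qed
      also have "\<dots> = (\<Sum>a\<in>B. \<Sum>n\<in>B. (\<Sum>l\<in>B. F.gram a l * F.gram l n) *\<^sub>R (q a i * q n k))"
        unfolding scaleR_sum_left by (rule sum.cong[OF refl], rule sum.swap)
      also have "\<dots> = Q i k" using ik by (simp add: Q_gram F.gram_idempotent)
      finally show ?thesis .
    qed
    show "star (P i k) = P k i" using P_star ik by simp
    show "star (Q i k) = Q k i" by (rule star_Q[OF ik])
  next
    have "(\<Sum>i\<in>B. P i i) = (\<Sum>i\<in>B. 1 *\<^sub>C \<alpha> (coefficient i i) x)" by (simp add: P_def)
    also have "\<dots> = \<alpha> (\<lambda>y. \<Sum>i\<in>B. 1 * coefficient i i y) x"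
      by (rule action_combination[symmetric]) (use cf in auto)
    \<comment> \<open>The trace of the Gram matrix is the constant dimension. It is written as a
      one-term combination so that linearity of \<alpha> and \<alpha> 1 = 1 finish the
      computation.\<close>
    also have "(\<lambda>y. \<Sum>i\<in>B. 1 * coefficient i i y) = (\<lambda>y. \<Sum>i\<in>{()}. of_nat DIM('e) * 1)" using trace by auto
    also have "\<alpha> (\<lambda>y. \<Sum>i\<in>{()}. of_nat DIM('e) * 1) x = of_nat DIM('e) *\<^sub>C \<alpha> (\<lambda>y. 1) x"
      using action_combination[of "{()}" "\<lambda>_ _. 1" "\<lambda>_. of_nat DIM('e)" x] by (simp add: cts_def)
    also have "\<alpha> (\<lambda>y. 1) x = 1"
      using hom by (simp add: unital_star_hom_on_def one_fun_def)
    finally have "(\<Sum>i\<in>B. P i i) = of_nat DIM('e) *\<^sub>C 1" .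
    moreover have "(\<Sum>i\<in>B. Q i i) = of_nat DIM('e) *\<^sub>C 1"
    proof -
      \<comment> \<open>In q_ki q_li the sum over i is again row orthogonality, so only the diagonal
        of the Gram matrix survives.\<close>
      have "(\<Sum>i\<in>B. Q i i) = (\<Sum>k\<in>B. \<Sum>l\<in>B. \<Sum>i\<in>B. F.gram k l *\<^sub>R (q k i * q l i))"
        using Q_gram by simp (subst sum.swap, rule sum.cong[OF refl], rule sum.swap)
      also have "\<dots> = (\<Sum>k\<in>B. \<Sum>l\<in>B. if k = l then F.gram k l *\<^sub>R 1 else 0)"
        unfolding scaleR_sum_right[symmetric] by (intro sum.cong refl) (simp add: orthogonal_q)
      also have "\<dots> = (\<Sum>k\<in>B. F.gram k k) *\<^sub>R 1"
        using finite_B by (simp add: scaleR_sum_left)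
      also have "\<dots> = of_nat DIM('e) *\<^sub>C 1"
        using scaleC_of_real[of "real DIM('e)" "1 :: 'q"] F.gram_trace by simp
      finally show ?thesis .
    qed
    ultimately show "(\<Sum>i\<in>B. P i i) = (\<Sum>i\<in>B. Q i i)" by simp
  qed
  then show ?thesis by (simp add: P_def Q_def Y_def)
qed

text \<open>Expanding df and dh puts the adjoint of \<alpha>(\<langle>df_i, df\<rangle>) to the left
  and \<alpha>(\<langle>df_j, dh\<rangle>) to the right of \<langle>\<Gamma>(df_i),
  \<Gamma>(df_j)\<rangle>. The middle factor is known from \<open>action_gram\<close>, and \<alpha>
  reassembles the three factors in this same order.\<close>

lemma frame_metric_preserved:
  assumes f: "f \<in> smooth_functions A" and h: "h \<in> smooth_functions A"
  shows "form_inner A frame_metric (\<Gamma> (de_rham A f)) (\<Gamma> (de_rham A h)) =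
    \<alpha> (form_inner A frame_metric (de_rham A f) (de_rham A h))"
proof
  fix x
  obtain c where c: "c \<in> A" "x \<in> fst c" using chart_around by blast
  have sm: "h \<in> smooth_functions A" if "h \<in> B" for h using smooth_B that by blast
  have expand: "form_inner A frame_metric (de_rham A f) (de_rham A h) y =
      (\<Sum>i\<in>B. \<Sum>j\<in>B. cnj (coefficient i f y) * (coefficient i j y * coefficient j h y))" for y
  proof -
    obtain c where c: "c \<in> A" "y \<in> fst c" using chart_around by blast
    let ?s = "sharp (frame_metric c y)"
    have "form_inner A frame_metric (de_rham A f) (de_rham A h) y =
        (\<Sum>b\<in>Basis. cnj (de_rham A f c y (?s b)) * de_rham A h c y b)"
      unfolding form_inner_chart[OF de_rham_one_forms[OF f] de_rham_one_forms[OF h] c] by (simp add: star_complex_def)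
    also have "\<dots> = (\<Sum>b\<in>Basis. \<Sum>i\<in>B. cnj (coefficient i f y) * (of_real (covector c y i (?s b)) * de_rham A h c y b))"
      by (subst de_rham_expansion[OF f]) (simp add: de_rham_covector sum_distrib_right sum_distrib_left mult_ac)
    also have "\<dots> = (\<Sum>i\<in>B. cnj (coefficient i f y) * (\<Sum>b\<in>Basis. of_real (covector c y i (?s b)) * de_rham A h c y b))"
      unfolding sum_distrib_left by (rule sum.swap)
    also have "\<dots> = (\<Sum>i\<in>B. cnj (coefficient i f y) * (\<Sum>b\<in>Basis. \<Sum>j\<in>B. of_real (covector c y i (?s b)) * (de_rham A j c y b * coefficient j h y)))"
      by (subst de_rham_expansion[OF h]) (simp add: sum_distrib_left)
    also have "\<dots> = (\<Sum>i\<in>B. cnj (coefficient i f y) * (\<Sum>j\<in>B. coefficient i j y * coefficient j h y))"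
    proof (intro sum.cong refl arg_cong2[where f = "(*)"])
      fix i assume i: "i \<in> B"
      have "(\<Sum>b\<in>Basis. \<Sum>j\<in>B. of_real (covector c y i (?s b)) * (de_rham A j c y b * coefficient j h y)) =
          (\<Sum>j\<in>B. (\<Sum>b\<in>Basis. of_real (covector c y i (?s b)) * de_rham A j c y b) * coefficient j h y)"
        unfolding sum_distrib_right mult.assoc by (rule sum.swap)
      also have "\<dots> = (\<Sum>j\<in>B. coefficient i j y * coefficient j h y)"
        using coefficient_chart[OF i sm c] by simp
      finally show "(\<Sum>b\<in>Basis. \<Sum>j\<in>B. of_real (covector c y i (?s b)) * (de_rham A j c y b * coefficient j h y)) =
          (\<Sum>j\<in>B. coefficient i j y * coefficient j h y)" .
    qed
    finally show ?thesis by (simp only: sum_distrib_left)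
  qed
  let ?s = "sharp (frame_metric c x)"
  have forms: "\<Gamma> (de_rham A f) \<in> one_forms A" "\<Gamma> (de_rham A h) \<in> one_forms A"
    using \<Gamma>_forms de_rham_one_forms f h by auto
  have "form_inner A frame_metric (\<Gamma> (de_rham A f)) (\<Gamma> (de_rham A h)) x =
      (\<Sum>b\<in>Basis. star (\<Gamma> (de_rham A f) c x (?s b)) * \<Gamma> (de_rham A h) c x b)"
    by (rule form_inner_chart[OF forms c])
  also have "\<dots> = (\<Sum>b\<in>Basis. (\<Sum>i\<in>B. star (\<alpha> (coefficient i f) x) * star (\<Gamma> (de_rham A i) c x (?s b))) *
      (\<Sum>j\<in>B. \<Gamma> (de_rham A j) c x b * \<alpha> (coefficient j h) x))"
    unfolding \<Gamma>_expansion(1)[OF f] \<Gamma>_expansion(1)[OF h] star_sum star_mult ..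
  also have "\<dots> = (\<Sum>b\<in>Basis. \<Sum>i\<in>B. \<Sum>j\<in>B. star (\<alpha> (coefficient i f) x) *
      (star (\<Gamma> (de_rham A i) c x (?s b)) * \<Gamma> (de_rham A j) c x b) * \<alpha> (coefficient j h) x)"
    unfolding sum_product mult.assoc ..
  also have "\<dots> = (\<Sum>i\<in>B. \<Sum>j\<in>B. \<Sum>b\<in>Basis. star (\<alpha> (coefficient i f) x) *
      (star (\<Gamma> (de_rham A i) c x (?s b)) * \<Gamma> (de_rham A j) c x b) * \<alpha> (coefficient j h) x)"
    by (subst sum.swap, rule sum.cong[OF refl], rule sum.swap)
  also have "\<dots> = (\<Sum>i\<in>B. \<Sum>j\<in>B. star (\<alpha> (coefficient i f) x) * \<alpha> (coefficient i j) x * \<alpha> (coefficient j h) x)"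
    by (intro sum.cong refl) (simp add: action_gram[OF _ _ c] sum_distrib_left sum_distrib_right)
  also have "\<dots> = (\<Sum>i\<in>B. \<Sum>j\<in>B. \<alpha> (\<lambda>y. cnj (coefficient i f y) * (coefficient i j y * coefficient j h y)) x)"
  proof (intro sum.cong refl)
    fix i j assume ij: "i \<in> B" "j \<in> B"
    have cts: "coefficient i f \<in> cts" "coefficient i j \<in> cts" "coefficient j h \<in> cts"
      using ij f h sm coefficient_cts by blast+
    then have "(\<lambda>y. cnj (coefficient i f y)) \<in> cts" "(\<lambda>y. coefficient i j y * coefficient j h y) \<in> cts"
      by (auto simp: cts_def intro: continuous_intros)
    from action_mult[OF this, of x] show "star (\<alpha> (coefficient i f) x) * \<alpha> (coefficient i j) x * \<alpha> (coefficient j h) x =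
        \<alpha> (\<lambda>y. cnj (coefficient i f y) * (coefficient i j y * coefficient j h y)) x"
      by (simp add: action_mult cts action_star mult.assoc)
  qed
  also have "\<dots> = (\<Sum>p\<in>B \<times> B. 1 *\<^sub>C \<alpha> (\<lambda>y. cnj (coefficient (fst p) f y) * (coefficient (fst p) (snd p) y * coefficient (snd p) h y)) x)"
    by (simp add: sum.cartesian_product case_prod_beta)
  also have "\<dots> = \<alpha> (\<lambda>y. \<Sum>p\<in>B \<times> B. 1 * (cnj (coefficient (fst p) f y) * (coefficient (fst p) (snd p) y * coefficient (snd p) h y))) x"
  proof (rule action_combination[symmetric])
    fix p assume "p \<in> B \<times> B"
    then have "coefficient (fst p) f \<in> cts" "coefficient (fst p) (snd p) \<in> cts" "coefficient (snd p) h \<in> cts"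
      using f h sm coefficient_cts by auto
    then show "(\<lambda>y. cnj (coefficient (fst p) f y) * (coefficient (fst p) (snd p) y * coefficient (snd p) h y)) \<in> cts"
      by (auto simp: cts_def intro!: continuous_intros)
  qed
  also have "(\<lambda>y. \<Sum>p\<in>B \<times> B. 1 * (cnj (coefficient (fst p) f y) * (coefficient (fst p) (snd p) y * coefficient (snd p) h y))) =
      form_inner A frame_metric (de_rham A f) (de_rham A h)"
    by (rule ext) (simp add: expand sum.cartesian_product case_prod_beta)
  finally show "form_inner A frame_metric (\<Gamma> (de_rham A f)) (\<Gamma> (de_rham A h)) x =
      \<alpha> (form_inner A frame_metric (de_rham A f) (de_rham A h)) x" .
qed

end

section \<open>Choice of finitely many pieces and construction of the invariant metric\<close>

theorem theorem3p1:
  fixes A :: "('m::t2_space, 'e::euclidean_space) chart set"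
    and g :: "('m, 'e) metric_field"
    and t :: "'q::cstar_algebra \<Rightarrow> 'q \<Rightarrow> 'qq::cstar_algebra"
    and tL :: "'qq \<Rightarrow> 'q \<Rightarrow> 'qqq::cstar_algebra"
    and tR :: "'q \<Rightarrow> 'qq \<Rightarrow> 'qqq"
    and \<Delta> :: "'q \<Rightarrow> 'qq"
    and \<alpha> :: "('m \<Rightarrow> complex) \<Rightarrow> ('m \<Rightarrow> 'q)"
    and \<A> :: "('m \<Rightarrow> complex) set"
    and \<Gamma> :: "('m, 'e, complex) form \<Rightarrow> ('m, 'e, 'q) form"
  assumes manifold: "compact_manifold A"
    and metric: "riemannian_metric A g"
    and cqg: "compact_quantum_group t tL tR \<Delta>"
    and action: "smooth_action t \<Delta> A \<alpha>"
    and subalgebra: "unital_star_subalgebra \<A>" "\<A> \<subseteq> smooth_functions A"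
    and dense: "dense_in (smooth_topology A) \<A>"
    and algebraic: "\<And>f. f \<in> \<A> \<Longrightarrow> \<alpha> f \<in> cspan {fun_tensor a q | a q. a \<in> \<A> \<and> q \<in> hopf_core t \<Delta>}"
    and inner_algebraic: "\<And>f h. f \<in> \<A> \<Longrightarrow> h \<in> \<A> \<Longrightarrow>
      form_inner A g (\<Gamma> (de_rham A f)) (\<Gamma> (de_rham A h))
        \<in> cspan {fun_tensor a q | a q. a \<in> \<A> \<and> q \<in> hopf_core t \<Delta>}"
    and representation: "form_representation t \<Delta> A \<alpha> \<Gamma>"
    and differential: "\<And>f. f \<in> smooth_functions A \<Longrightarrow> \<Gamma> (de_rham A f) = de_rham A (\<alpha> f)"
  shows "\<exists>g'. riemannian_metric A g' \<and>
    (\<forall>f\<in>smooth_functions A. \<forall>h\<in>smooth_functions A.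
       form_inner A g' (\<Gamma> (de_rham A f)) (\<Gamma> (de_rham A h)) =
       \<alpha> (form_inner A g' (de_rham A f) (de_rham A h)))"
proof -
  have compact: "compact (UNIV :: 'm set)" using manifold by (simp add: compact_manifold_def)
  interpret M: metric_manifold A g
    using manifold metric by unfold_locales (simp_all add: compact_manifold_def)
  have cqg_act: "cqg_action t \<Delta> \<alpha>" and \<alpha>_smooth: "\<alpha> \<in> smooth_functions A \<rightarrow> smooth_functions A"
    and podles: "dense_in (smooth_topology A) (cspan {\<alpha> f * (\<lambda>_. q) | f q. f \<in> smooth_functions A})"
    using action unfolding smooth_action_def by blast+
  interpret C: algebraic_coaction t \<Delta> \<alpha> \<A>
  proof
    show "minimal_tensor t" "clinear_on UNIV \<Delta>"
      using cqg by (simp_all add: compact_quantum_group_def unital_star_hom_on_def)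
    show "unital_star_hom_on cts cts \<alpha>" using cqg_act by (simp add: cqg_action_def)
    show "\<exists>E. unital_star_hom_on cts cts E \<and> (\<forall>f\<in>cts. \<forall>q. E (fun_tensor f q) = (\<lambda>x. t (\<alpha> f x) q)) \<and>
        (\<forall>f\<in>cts. E (\<alpha> f) = \<Delta> \<circ> \<alpha> f)" using cqg_act unfolding cqg_action_def by blast
    show "\<A> \<subseteq> cts" using subalgebra(2) M.smooth_functions_cts by blast
  qed (use subalgebra(1) algebraic in auto)
  have \<Gamma>: "\<Gamma> \<in> one_forms A \<rightarrow> one_forms A" "clinear_on (one_forms A) \<Gamma>"
    "continuous_map (form_topology A) (form_topology A) \<Gamma>"
    and \<Gamma>_times: "\<And>\<omega> f. \<omega> \<in> one_forms A \<Longrightarrow> f \<in> smooth_functions A \<Longrightarrow>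
      \<Gamma> (form_times \<omega> f) = form_times (\<Gamma> \<omega>) (\<alpha> f) \<and> \<Gamma> (form_times \<omega> f) = times_form (\<alpha> f) (\<Gamma> \<omega>)"
    using representation unfolding form_representation_def by blast+
  \<comment> \<open>All functions that occur in some piece; any finite number of them fits into one
    orthogonal family.\<close>
  define \<H> where "\<H> = {h. \<exists>Gs. C.pieces Gs \<and> h \<in> C.entries Gs}"
  have \<H>_smooth: "\<H> \<subseteq> smooth_functions A" using C.pieces_subset subalgebra(2) unfolding \<H>_def by blast
  have sep: "\<exists>h\<in>\<H>. de_rham A h c x v \<noteq> 0" if cx: "c \<in> A" "x \<in> fst c" "v \<noteq> 0" for c x v
  proof (rule ccontr)
    assume none: "\<not> (\<exists>h\<in>\<H>. de_rham A h c x v \<noteq> 0)"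
    \<comment> \<open>Here \<alpha> f is a finite sum of members of \<H> with constant coefficients
      in the algebra, so if all their differentials killed v, so would that of \<alpha> f.\<close>
    obtain f where f: "f \<in> \<A>" "de_rham A (\<alpha> f) c x v \<noteq> 0"
      using M.differentials_separate[OF \<alpha>_smooth podles dense \<Gamma>(3) differential cx] by blast
    obtain J n u b F where dec: "C.decomposition f J n u b F" using C.piece_decomposition[OF f(1)] by blast
    have J: "finite J" and rep: "\<alpha> f = (\<lambda>x. \<Sum>i\<in>J. \<Sum>a<n i. F i a x *\<^sub>C u i a (b i))"
      and pc: "\<And>i. i \<in> J \<Longrightarrow> C.piece (n i) (u i) (F i)"
      using dec unfolding C.decomposition_def by auto
    have F\<H>: "F i a \<in> \<H>" if "i \<in> J" "a < n i" for i a
      unfolding \<H>_def C.pieces_def C.entries_def using pc[OF that(1)] that(2)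
      by (intro CollectI exI[of _ "[(n i, u i, F i)]"]) auto
    have sm: "(\<lambda>x. F i a x *\<^sub>C u i a (b i)) \<in> smooth_functions A" if "i \<in> J" "a \<in> {..<n i}" for i a
      using M.smooth_functions_linear[OF bounded_linear_scaleC_left] F\<H> \<H>_smooth that by blast
    have zero: "de_rham A (\<lambda>x. F i a x *\<^sub>C u i a (b i)) c x v = 0" if "i \<in> J" "a \<in> {..<n i}" for i a
    proof -
      have "F i a \<in> \<H>" using F\<H> that by auto
      then show ?thesis using none M.de_rham_linear[OF bounded_linear_scaleC_left, of "F i a" "u i a (b i)"] \<H>_smooth by auto
    qed
    have "de_rham A (\<alpha> f) c x v = (\<Sum>i\<in>J. de_rham A (\<lambda>x. \<Sum>a<n i. F i a x *\<^sub>C u i a (b i)) c x v)"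
      unfolding rep by (subst M.de_rham_sum[OF J M.smooth_functions_sum[OF sm]]) simp_all
    also have "\<dots> = 0"
    proof (rule sum.neutral, rule ballI)
      fix i assume i: "i \<in> J"
      show "de_rham A (\<lambda>x. \<Sum>a<n i. F i a x *\<^sub>C u i a (b i)) c x v = 0"
        by (subst M.de_rham_sum[OF finite_lessThan sm[OF i]]) (simp_all add: zero[OF i])
    qed
    finally show False using f(2) by blast
  qed
  obtain H where H: "H \<subseteq> \<H>" "finite H"
    and sepH: "\<forall>c\<in>A. \<forall>x\<in>fst c. \<forall>v. v \<noteq> 0 \<longrightarrow> (\<exists>h\<in>H. de_rham A h c x v \<noteq> 0)"
    using M.finite_separating_family[OF compact \<H>_smooth sep] by blast
  obtain Gs where Gs: "C.pieces Gs" "H \<subseteq> C.entries Gs"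
    using C.finite_subset_of_pieces[OF H(2)] H(1) unfolding \<H>_def by blast
  obtain B q where B: "finite B" "B \<subseteq> \<A>" and real: "\<forall>f\<in>B. \<forall>x. cnj (f x) = f x"
    and act: "\<forall>f\<in>B. \<forall>x. \<alpha> f x = (\<Sum>h\<in>B. h x *\<^sub>C q h f)"
    and star_q: "\<forall>f\<in>B. \<forall>h\<in>B. star (q h f) = q h f"
    and "\<forall>f\<in>B. \<forall>g\<in>B. (\<Sum>h\<in>B. q h f * q h g) = (if f = g then 1 else 0)"
    and ortho: "\<forall>f\<in>B. \<forall>g\<in>B. (\<Sum>h\<in>B. q f h * q g h) = (if f = g then 1 else 0)"
    and comb: "\<forall>g\<in>C.entries Gs. \<exists>c. \<forall>x. g x = (\<Sum>f\<in>B. c f * f x)"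
    using C.real_orthogonal_family[OF Gs(1)] by (elim exE conjE)
  have B_smooth: "B \<subseteq> smooth_functions A" using B(2) subalgebra(2) by blast
  \<comment> \<open>Every member of H is a complex combination of B, so a tangent vector killed by
    the differentials of B is killed by those of H.\<close>
  have sepB: "\<exists>f\<in>B. de_rham A f c x v \<noteq> 0" if cx: "c \<in> A" "x \<in> fst c" "v \<noteq> 0" for c x v
  proof (rule ccontr)
    assume none: "\<not> (\<exists>f\<in>B. de_rham A f c x v \<noteq> 0)"
    obtain h where h: "h \<in> H" "de_rham A h c x v \<noteq> 0" using sepH cx by blast
    obtain d where "\<forall>x. h x = (\<Sum>f\<in>B. d f * f x)" using comb h(1) Gs(2) by blast
    then have hd: "h = (\<lambda>x. \<Sum>f\<in>B. d f * f x)" by blast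
    have sm: "(\<lambda>x. d f * f x) \<in> smooth_functions A" if "f \<in> B" for f
      using M.smooth_functions_linear[OF bounded_linear_mult_right] B_smooth that by blast
    have "de_rham A h c x v = (\<Sum>f\<in>B. de_rham A (\<lambda>x. d f * f x) c x v)"
      unfolding hd by (subst M.de_rham_sum[OF B(1) sm]) simp_all
    also have "\<dots> = 0"
    proof (rule sum.neutral, rule ballI)
      fix f assume f: "f \<in> B"
      then show "de_rham A (\<lambda>x. d f * f x) c x v = 0"
        using none M.de_rham_linear[OF bounded_linear_mult_right, of f "d f"] B_smooth by auto
    qed
    finally show False using h(2) by blast
  qed
  interpret P: framed_action A t \<Delta> \<alpha> \<A> \<Gamma> B q
    by unfold_locales
      (use \<alpha>_smooth \<Gamma> \<Gamma>_times differential B(1) B_smooth real act star_q ortho sepB in blast)+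
  show ?thesis
    using P.riemannian_frame_metric P.frame_metric_preserved by blast
qed

end
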